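(* Let $k$ be an algebraically closed field, and let $C\subset\mathbf P^2$ be a (reduced) plane curve of degree $d$ over $k$. Assume $d$ is not a multiple of the characteristic of $k$. Let $m$ be the least degree of a nonzero polynomial vector field $\phi$ annihilating the polynomial defining $C$, and fix such a $\phi$ of degree $m$. Then $m\le d-1$ and $$(d-1)(d-m-1)\le\tau(C).$$ If the foliation defined by $\phi$ has only finitely many singularities on $C$, then also $$\tau(C)\le(d-1)(d-m-1)+m^2.$$
   Context: Let $x,y,z$ be homogeneous coordinates on $X:=\mathbf P^2$, and let $C$ be given by $u=0$ where $u\in k[x,y,z]$ is homogeneous of degree $d$ (squarefree, as $C$ is reduced). A polynomial vector field of degree $m$ is $\phi=f\frac{\partial}{\partial x}+g\frac{\partial}{\partial y}+h\frac{\partial}{\partial z}$ with $f,g,h\in k[x,y,z]$ homogeneous of degree $m$; it is nonzero if $(f,g,h)\ne0$, and it annihilates $u$ if $\phi u=0$. The foliation defined by $\phi$ is the map $\eta\colon\Omega^1_X\to\mathcal O_X(m-1)$ obtained by restricting the map $(f,g,h)\colon\mathcal O_X(-1)^3\to\mathcal O_X(m-1)$ to $\Omega^1_X$, viewed as the kernel of $(x,y,z)\colon\mathcal O_X(-1)^3\to\mathcal O_X$ via the Euler sequence (under the hypotheses, $\eta\neq 0$). Its singularities are the points of the closed subscheme $S\subseteq X$ whose ideal is the image of the induced map $\Omega^1_X\otimes\mathcal O_X(1-m)\to\mathcal O_X$. For a closed point $P\in C$, the Tjurina number is $\tau(C,P):=\ell(\mathrm{Ext}^1_{\mathcal O_{C,P}}(\Omega^1_{C,P},\mathcal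 O_{C,P}))$, where $\ell$ denotes length; it vanishes at smooth points, and $\tau(C):=\sum_{P\in C}\tau(C,P)$. *)

theory Defs
  imports
    "HOL-Library.Poly_Mapping"
    "HOL-Library.Numeral_Type"
    "HOL-Library.Extended_Nat"
    "HOL-Computational_Algebra.Computational_Algebra"
    "HOL-Algebra.Module"
    "HOL-Algebra.QuotRing"
begin

section \<open>Modules: quotients, \<open>Hom\<close>, \<open>Ext\<^sup>1\<close>, length\<close>

text \<open>
  The record of modules extends the record of rings, so every module carries the fields
  \<open>mult\<close> and \<open>one\<close>; they play no role in the locale \<^locale>\<open>module\<close> and are left undefined here.
\<close>

definition regular_module :: "('a, 'r) ring_scheme \<Rightarrow> ('a, 'a) module" where
  "regular_module R = \<lparr>carrier = carrier R, mult = mult R, one = one R,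
     zero = zero R, add = add R, smult = mult R\<rparr>"

definition quotient_module :: "('a, 'r) ring_scheme \<Rightarrow> ('a, 'b, 's) module_scheme \<Rightarrow> 'b set
    \<Rightarrow> ('a, 'b set) module" where
  "quotient_module R M N = \<lparr>carrier = a_rcosets\<^bsub>M\<^esub> N, mult = undefined, one = undefined,
     zero = N, add = set_add M,
     smult = (\<lambda>r X. \<Union>x\<in>X. N +>\<^bsub>M\<^esub> (r \<odot>\<^bsub>M\<^esub> x))\<rparr>"

definition module_span :: "('a, 'r) ring_scheme \<Rightarrow> ('a, 'b) module \<Rightarrow> 'b set \<Rightarrow> 'b set" where
  "module_span R M X = \<Inter>{N. submodule N R M \<and> X \<subseteq> N}"

definition free_module :: "('a, 'r) ring_scheme \<Rightarrow> 's set \<Rightarrow> ('a, 's \<Rightarrow> 'a) module" where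
  "free_module R S =
    \<lparr>carrier = {v. (\<forall>s\<in>S. v s \<in> carrier R) \<and> (\<forall>s. s \<notin> S \<longrightarrow> v s = \<zero>\<^bsub>R\<^esub>) \<and> finite {s. v s \<noteq> \<zero>\<^bsub>R\<^esub>}},
     mult = undefined, one = undefined,
     zero = (\<lambda>s. \<zero>\<^bsub>R\<^esub>), add = (\<lambda>v w s. v s \<oplus>\<^bsub>R\<^esub> w s), smult = (\<lambda>r v s. r \<otimes>\<^bsub>R\<^esub> v s)\<rparr>"

definition free_gen :: "('a, 'r) ring_scheme \<Rightarrow> 's \<Rightarrow> 's \<Rightarrow> 'a" where
  "free_gen R s = (\<lambda>t. if t = s then \<one>\<^bsub>R\<^esub> else \<zero>\<^bsub>R\<^esub>)"

text \<open>Homomorphisms are made extensional, so that equality on the carrier is equality.\<close>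

definition hom_module :: "('a, 'r) ring_scheme \<Rightarrow> ('a, 'b, 's) module_scheme
    \<Rightarrow> ('a, 'c, 't) module_scheme \<Rightarrow> ('a, 'b \<Rightarrow> 'c) module" where
  "hom_module R M N =
    \<lparr>carrier = {f \<in> carrier M \<rightarrow>\<^sub>E carrier N.
        (\<forall>x\<in>carrier M. \<forall>y\<in>carrier M. f (x \<oplus>\<^bsub>M\<^esub> y) = f x \<oplus>\<^bsub>N\<^esub> f y) \<and>
        (\<forall>r\<in>carrier R. \<forall>x\<in>carrier M. f (r \<odot>\<^bsub>M\<^esub> x) = r \<odot>\<^bsub>N\<^esub> f x)},
     mult = undefined, one = undefined,
     zero = (\<lambda>x\<in>carrier M. \<zero>\<^bsub>N\<^esub>),
     add = (\<lambda>f g. \<lambda>x\<in>carrier M. f x \<oplus>\<^bsub>N\<^esub> g x),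
     smult = (\<lambda>r f. \<lambda>x\<in>carrier M. r \<odot>\<^bsub>N\<^esub> f x)\<rparr>"

text \<open>
  \<open>Ext\<^sup>1\<close> is computed from the canonical presentation \<open>0 \<rightarrow> K \<rightarrow> F \<rightarrow> M \<rightarrow> 0\<close>, where \<open>F\<close> is the free
  module on the elements of \<open>M\<close>. As \<open>Ext\<^sup>1(F, N) = 0\<close>, the long exact sequence identifies
  \<open>Ext\<^sup>1(M, N)\<close> with the cokernel of the restriction map \<open>Hom(F, N) \<rightarrow> Hom(K, N)\<close>.
\<close>

definition free_cover_kernel :: "('a, 'r) ring_scheme \<Rightarrow> ('a, 'b, 's) module_scheme
    \<Rightarrow> ('b \<Rightarrow> 'a) set" where
  "free_cover_kernel R M = {v \<in> carrier (free_module R (carrier M)).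
     finsum M (\<lambda>x. v x \<odot>\<^bsub>M\<^esub> x) {x \<in> carrier M. v x \<noteq> \<zero>\<^bsub>R\<^esub>} = \<zero>\<^bsub>M\<^esub>}"

definition Ext1 :: "('a, 'r) ring_scheme \<Rightarrow> ('a, 'b, 's) module_scheme
    \<Rightarrow> ('a, 'c, 't) module_scheme \<Rightarrow> ('a, (('b \<Rightarrow> 'a) \<Rightarrow> 'c) set) module" where
  "Ext1 R M N =
    (let F = free_module R (carrier M); K = free_cover_kernel R M
     in quotient_module R (hom_module R (F\<lparr>carrier := K\<rparr>) N)
          ((\<lambda>f. restrict f K) ` carrier (hom_module R F N)))"

text \<open>The supremum of the lengths \<open>n\<close> of chains \<open>c 0 \<subset> \<dots> \<subset> c n\<close> of submodules.\<close>

definition module_length :: "('a, 'r) ring_scheme \<Rightarrow> ('a, 'b) module \<Rightarrow> enat" where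
  "module_length R M = (SUP n \<in> {n. \<exists>c :: nat \<Rightarrow> 'b set.
      (\<forall>i\<le>n. submodule (c i) R M) \<and> (\<forall>i<n. c i \<subset> c (Suc i))}. enat n)"

text \<open>
  The module of Kaehler differentials of an algebra \<open>A\<close> over \<open>'k\<close> with structure map \<open>\<iota>\<close>: generated by
  symbols \<open>d a\<close>, subject to additivity, the Leibniz rule and the vanishing of \<open>d\<close> on \<open>'k\<close>.
\<close>

definition kaehler_relations :: "('a, 'r) ring_scheme \<Rightarrow> ('k \<Rightarrow> 'a) \<Rightarrow> ('a \<Rightarrow> 'a) set" where
  "kaehler_relations A \<iota> = (let F = free_module A (carrier A); D = free_gen A in
     {D (a \<oplus>\<^bsub>A\<^esub> b) \<ominus>\<^bsub>F\<^esub> (D a \<oplus>\<^bsub>F\<^esub> D b) | a b. a \<in> carrier A \<and> b \<in> carrier A} \<union>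
     {D (a \<otimes>\<^bsub>A\<^esub> b) \<ominus>\<^bsub>F\<^esub> (a \<odot>\<^bsub>F\<^esub> D b \<oplus>\<^bsub>F\<^esub> b \<odot>\<^bsub>F\<^esub> D a) | a b. a \<in> carrier A \<and> b \<in> carrier A} \<union>
     {D (\<iota> c) | c. True})"

definition kaehler_module :: "('a, 'r) ring_scheme \<Rightarrow> ('k \<Rightarrow> 'a) \<Rightarrow> ('a, ('a \<Rightarrow> 'a) set) module" where
  "kaehler_module A \<iota> = (let F = free_module A (carrier A)
     in quotient_module A F (module_span A F (kaehler_relations A \<iota>)))"


section \<open>Polynomials in three variables and the projective plane\<close>

text \<open>The type \<open>3\<close> of indices has the elements \<open>0, 1, 2\<close>, for the coordinates \<open>x, y, z\<close>.\<close>

type_synonym 'k poly3 = "(3 \<Rightarrow>\<^sub>0 nat) \<Rightarrow>\<^sub>0 'k"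

definition const3 :: "'k \<Rightarrow> 'k::zero poly3" where
  "const3 c = Poly_Mapping.single 0 c"

definition var3 :: "3 \<Rightarrow> 'k::zero_neq_one poly3" where
  "var3 i = Poly_Mapping.single (Poly_Mapping.single i 1) 1"

definition eval3 :: "'k::comm_semiring_1 poly3 \<Rightarrow> (3 \<Rightarrow> 'k) \<Rightarrow> 'k" where
  "eval3 p v = (\<Sum>t\<in>Poly_Mapping.keys p.
     Poly_Mapping.lookup p t * (\<Prod>i\<in>UNIV. v i ^ Poly_Mapping.lookup t i))"

definition partial3 :: "3 \<Rightarrow> 'k::comm_semiring_1 poly3 \<Rightarrow> 'k poly3" where
  "partial3 i p = (\<Sum>t\<in>Poly_Mapping.keys p. Poly_Mapping.single (t - Poly_Mapping.single i 1)
     (of_nat (Poly_Mapping.lookup t i) * Poly_Mapping.lookup p t))"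

text \<open>The zero polynomial is homogeneous of every degree.\<close>

definition homogeneous3 :: "nat \<Rightarrow> 'k::zero poly3 \<Rightarrow> bool" where
  "homogeneous3 n p \<longleftrightarrow>
     (\<forall>t\<in>Poly_Mapping.keys p. (\<Sum>i\<in>UNIV. Poly_Mapping.lookup t i) = n)"

text \<open>
  A point of the plane is the set of all its homogeneous coordinate vectors. Over an algebraically
  closed field these are the closed points of the scheme \<open>\<bbbP>\<^sup>2\<close>.
\<close>

definition proj_plane :: "(3 \<Rightarrow> 'k::field) set set" where
  "proj_plane = {{\<lambda>i. c * v i | c. c \<noteq> 0} | v. v \<noteq> (\<lambda>i. 0)}"

definition curve_points :: "'k::field poly3 \<Rightarrow> (3 \<Rightarrow> 'k) set set" where
  "curve_points u = {P \<in> proj_plane. \<forall>v\<in>P. eval3 u v = 0}"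

text \<open>
  The stalk of \<open>\<O>(n)\<close> at \<open>P\<close>, as the set of fractions \<open>a / b\<close> of homogeneous
  polynomials with \<open>deg a - deg b = n\<close> and \<open>b(P) \<noteq> 0\<close>.
\<close>

definition stalk_O :: "(3 \<Rightarrow> 'k::field) set \<Rightarrow> int \<Rightarrow> 'k poly3 fract set" where
  "stalk_O P n = {Fract a b | a b i j. homogeneous3 i a \<and> homogeneous3 j b \<and>
     (\<forall>v\<in>P. eval3 b v \<noteq> 0) \<and> int i = int j + n}"

definition plane_local_ring :: "(3 \<Rightarrow> 'k::field) set \<Rightarrow> 'k poly3 fract ring" where
  "plane_local_ring P = \<lparr>carrier = stalk_O P 0, mult = (*), one = 1, zero = 0, add = (+)\<rparr>"

text \<open>The stalk at \<open>P\<close> of the ideal sheaf of the curve \<open>u = 0\<close>.\<close>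

definition curve_ideal :: "'k::field poly3 \<Rightarrow> (3 \<Rightarrow> 'k) set \<Rightarrow> 'k poly3 fract set" where
  "curve_ideal u P = {Fract (u * a) b | a b n. homogeneous3 n (u * a) \<and> homogeneous3 n b \<and>
     (\<forall>v\<in>P. eval3 b v \<noteq> 0)}"

definition curve_local_ring :: "'k::field poly3 \<Rightarrow> (3 \<Rightarrow> 'k) set \<Rightarrow> 'k poly3 fract set ring" where
  "curve_local_ring u P = plane_local_ring P Quot curve_ideal u P"

definition curve_structure_map ::
    "'k::field poly3 \<Rightarrow> (3 \<Rightarrow> 'k) set \<Rightarrow> 'k \<Rightarrow> 'k poly3 fract set" where
  "curve_structure_map u P c = curve_ideal u P +>\<^bsub>plane_local_ring P\<^esub> Fract (const3 c) 1"


section \<open>Tjurina numbers\<close>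

definition tjurina_at :: "'k::field poly3 \<Rightarrow> (3 \<Rightarrow> 'k) set \<Rightarrow> enat" where
  "tjurina_at u P = (let A = curve_local_ring u P in
     module_length A (Ext1 A (kaehler_module A (curve_structure_map u P)) (regular_module A)))"

text \<open>
  The sum over all points of the curve, as a supremum of finite partial sums: \<^const>\<open>sum\<close> would be
  0 on the infinite index set.
\<close>

definition tjurina :: "'k::field poly3 \<Rightarrow> enat" where
  "tjurina u = (SUP F \<in> {F. finite F \<and> F \<subseteq> curve_points u}. \<Sum>P\<in>F. tjurina_at u P)"


section \<open>Vector fields and foliations\<close>

text \<open>The triple \<open>(f, g, h)\<close> of coefficients is a function \<open>\<phi>\<close> on the index type \<open>3\<close>.\<close>

definition vector_field :: "nat \<Rightarrow> (3 \<Rightarrow> 'k::field poly3) \<Rightarrow> bool" where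
  "vector_field m \<phi> \<longleftrightarrow> (\<forall>i. homogeneous3 m (\<phi> i))"

definition apply_field :: "(3 \<Rightarrow> 'k::field poly3) \<Rightarrow> 'k poly3 \<Rightarrow> 'k poly3" where
  "apply_field \<phi> u = (\<Sum>i\<in>UNIV. \<phi> i * partial3 i u)"

definition annihilating_field :: "'k::field poly3 \<Rightarrow> nat \<Rightarrow> (3 \<Rightarrow> 'k poly3) \<Rightarrow> bool" where
  "annihilating_field u m \<phi> \<longleftrightarrow> vector_field m \<phi> \<and> \<phi> \<noteq> (\<lambda>i. 0) \<and> apply_field \<phi> u = 0"

text \<open>The stalk of \<open>\<Omega>\<^sup>1\<close> of the plane at \<open>P\<close>, by the Euler sequence.\<close>

definition stalk_Omega :: "(3 \<Rightarrow> 'k::field) set \<Rightarrow> (3 \<Rightarrow> 'k poly3 fract) set" where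
  "stalk_Omega P = {\<omega>. (\<forall>i. \<omega> i \<in> stalk_O P (-1)) \<and> (\<Sum>i\<in>UNIV. Fract (var3 i) 1 * \<omega> i) = 0}"

definition foliation_map :: "(3 \<Rightarrow> 'k::field poly3) \<Rightarrow> (3 \<Rightarrow> 'k poly3 fract) \<Rightarrow> 'k poly3 fract" where
  "foliation_map \<phi> \<omega> = (\<Sum>i\<in>UNIV. Fract (\<phi> i) 1 * \<omega> i)"

text \<open>
  The stalk at \<open>P\<close> of the image of \<open>\<Omega>\<^sup>1 \<otimes> \<O>(1 - m) \<rightarrow> \<O>\<close>. Since the stalk of
  \<open>\<O>(1 - m)\<close> is free of rank 1, every element of the tensor product is a pure tensor.
\<close>

definition singular_ideal :: "nat \<Rightarrow> (3 \<Rightarrow> 'k::field poly3) \<Rightarrow> (3 \<Rightarrow> 'k) set \<Rightarrow> 'k poly3 fract set" where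
  "singular_ideal m \<phi> P =
     {foliation_map \<phi> \<omega> * s | \<omega> s. \<omega> \<in> stalk_Omega P \<and> s \<in> stalk_O P (1 - int m)}"

definition foliation_singularities :: "nat \<Rightarrow> (3 \<Rightarrow> 'k::field poly3) \<Rightarrow> (3 \<Rightarrow> 'k) set set" where
  "foliation_singularities m \<phi> = {P \<in> proj_plane. singular_ideal m \<phi> P \<noteq> stalk_O P 0}"

end

theory Submission
  imports Defs "Berlekamp_Zassenhaus.Unique_Factorization_Poly" "HOL-Library.Function_Algebras"
begin

text \<open>
  At a point \<open>P\<close> of the curve the Kaehler differentials have the resolution
  \<open>0 \<rightarrow> A \<rightarrow> A\<^sup>2 \<rightarrow> \<Omega> \<rightarrow> 0\<close> given by the gradient of a local equation, so \<open>Ext\<^sup>1\<close> is the quotient of the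
  local ring of the plane by the stalk of the ideal \<open>J\<close> generated by the partial derivatives of \<open>u\<close>;
  this ideal contains \<open>u\<close> by the Euler identity, as \<open>d\<close> is invertible. Refining \<open>J\<close> by successively
  adjoining elements \<open>a\<close> for which \<open>(I : a)\<close> is the ideal of a point, one reaches an ideal containing
  all forms of high degree, and the number \<open>t\<close> of steps is both \<open>\<tau>(C)\<close> and the codimension of \<open>J\<close> in
  high degrees.

  Counting dimensions, the codimension is determined by the Hilbert function of the syzygies of
  the gradient. The cross product of a syzygy with \<open>\<phi>\<close> is a multiple of the gradient, which identifies the
  syzygies modulo multiples of \<open>\<phi>\<close> with an ideal, shifted by \<open>d - 1 - m\<close>. This ideal contains
  the components of \<open>\<phi>\<close>, and these have no common factor because the degree of \<open>\<phi>\<close> is minimal. Two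
  generic combinations of them form a complete intersection, so the codimension of the ideal lies between
  \<open>0\<close> and \<open>m\<^sup>2\<close>.
\<close>

section \<open>Polynomials in three variables\<close>

text \<open>The theorem compares a global codimension with a sum of local lengths. One filtration
  serves both counts: adjoining an eigenvector raises the dimension by exactly one in every high
  degree, and it changes the stalk at exactly one point, where the new quotient is simple. Such a
  filtration is available only once J is known to have finite codimension. The upper bound of the
  syzygy count supplies this, so it serves as the termination bound and again as the final estimate.

  The constants come from one identity. With e = d - 1 and h(n) the number of monomials of degree n,
  h(n+e) + h(n-m) + h(n+m-e) - 3 h(n) = e(e-m) + m^2. Hence codim J = e(e-m) + m^2 - c, where c is
  the codimension of the ideal of multipliers, and c lies between 0 and the Bezout number m^2.

  Invertibility of d enters through the Euler identity: it puts u into J and makes every common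
  factor of the partial derivatives divide u. In positive characteristic the obstacle is a prime
  polynomial with vanishing partial derivatives; it would be a p-th power, because k has p-th
  roots.\<close>

abbreviation lk :: "('a \<Rightarrow>\<^sub>0 'b::zero) \<Rightarrow> 'a \<Rightarrow> 'b" where "lk \<equiv> Poly_Mapping.lookup"
abbreviation ks :: "('a \<Rightarrow>\<^sub>0 'b::zero) \<Rightarrow> 'a set" where "ks \<equiv> Poly_Mapping.keys"
abbreviation mon :: "(3 \<Rightarrow>\<^sub>0 nat) \<Rightarrow> 'k::zero \<Rightarrow> 'k poly3" where "mon \<equiv> Poly_Mapping.single"
abbreviation unit_exp :: "3 \<Rightarrow> 3 \<Rightarrow>\<^sub>0 nat" where "unit_exp i \<equiv> Poly_Mapping.single i 1"

definition tdeg :: "(3 \<Rightarrow>\<^sub>0 nat) \<Rightarrow> nat" where "tdeg t = (\<Sum>i\<in>UNIV. lk t i)"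

lemma tdeg_0 [simp]: "tdeg 0 = 0"
  by (simp add: tdeg_def)

lemma tdeg_add: "tdeg (s + t) = tdeg s + tdeg t"
  by (simp add: tdeg_def lookup_add sum.distrib)

lemma tdeg_single [simp]: "tdeg (Poly_Mapping.single i n) = n"
  by (simp add: tdeg_def lookup_single when_def)

lemma tdeg_eq_0_iff: "tdeg t = 0 \<longleftrightarrow> t = 0"
  by (auto simp: tdeg_def intro!: poly_mapping_eqI)

lemma UNIV_3_eq: "(UNIV :: 3 set) = {0, 1, 2}"
proof -
  have "(0::3) \<noteq> 1" "(0::3) \<noteq> 2" "(1::3) \<noteq> 2"
    by simp_all
  then have "card {0, 1, 2 :: 3} = CARD(3)"
    by (simp del: zero_neq_one)
  then show ?thesis
    using card_subset_eq[of UNIV "{0, 1, 2 :: 3}"] by simp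
qed

lemma exhaust_index3: "(i::3) = 0 \<or> i = 1 \<or> i = 2"
proof -
  have "i \<in> UNIV"
    by (rule UNIV_I)
  then show ?thesis
    by (simp only: UNIV_3_eq insert_iff empty_iff simp_thms)
qed

lemma sum_UNIV_3: "(\<Sum>i\<in>UNIV. f (i::3)) = f 0 + f 1 + (f 2 :: 'a::comm_monoid_add)"
  unfolding UNIV_3_eq by (simp add: add.assoc)

lemma homogeneous3_iff: "homogeneous3 n p \<longleftrightarrow> (\<forall>t. lk p t \<noteq> 0 \<longrightarrow> tdeg t = n)"
  by (auto simp: homogeneous3_def tdeg_def in_keys_iff)

lemma homogeneous3_0 [simp]: "homogeneous3 n 0"
  by (simp add: homogeneous3_iff)

lemma homogeneous3_add:
  "homogeneous3 n p \<Longrightarrow> homogeneous3 n q \<Longrightarrow> homogeneous3 n (p + q :: 'k::comm_monoid_add poly3)"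
  by (auto simp: homogeneous3_iff lookup_add) (metis add.right_neutral)

lemma homogeneous3_uminus:
  "homogeneous3 n p \<Longrightarrow> homogeneous3 n (- p :: 'k::ab_group_add poly3)"
  by (auto simp: homogeneous3_iff)

lemma homogeneous3_diff:
  "homogeneous3 n p \<Longrightarrow> homogeneous3 n q \<Longrightarrow> homogeneous3 n (p - q :: 'k::ab_group_add poly3)"
  using homogeneous3_add[OF _ homogeneous3_uminus] by (metis diff_conv_add_uminus)

lemma homogeneous3_sum:
  "(\<And>i. i \<in> A \<Longrightarrow> homogeneous3 n (f i)) \<Longrightarrow> homogeneous3 n (sum f A :: 'k::comm_monoid_add poly3)"
  by (induction A rule: infinite_finite_induct) (auto intro: homogeneous3_add)

lemma homogeneous3_single: "tdeg t = n \<Longrightarrow> homogeneous3 n (mon t a)"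
  by (auto simp: homogeneous3_iff lookup_single when_def)

lemma homogeneous3_const [simp]: "homogeneous3 0 (const3 c)"
  by (simp add: const3_def homogeneous3_single)

lemma homogeneous3_var [simp]: "homogeneous3 1 (var3 i)"
  by (simp add: var3_def homogeneous3_single)

lemma homogeneous3_mult:
  assumes "homogeneous3 n p" "homogeneous3 m (q :: 'k::comm_semiring_1 poly3)"
  shows "homogeneous3 (n + m) (p * q)"
proof -
  have "tdeg t = n + m" if t: "t \<in> ks (p * q)" for t
  proof -
    obtain a b where "t = a + b" "a \<in> ks p" "b \<in> ks q"
      using subsetD[OF keys_mult t] by blast
    then show ?thesis
      using assms by (auto simp: homogeneous3_iff in_keys_iff tdeg_add)
  qed
  then show ?thesis
    by (auto simp: homogeneous3_iff in_keys_iff)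
qed

lemma homogeneous3_const_mult [intro]:
  "homogeneous3 n (p :: 'k::comm_semiring_1 poly3) \<Longrightarrow> homogeneous3 n (const3 c * p)"
  using homogeneous3_mult[OF homogeneous3_const] by fastforce

lemma homogeneous3_var_mult [intro]:
  "homogeneous3 n (p :: 'k::comm_semiring_1 poly3) \<Longrightarrow> homogeneous3 (Suc n) (var3 i * p)"
  using homogeneous3_mult[OF homogeneous3_var] by fastforce

lemma homogeneous3_1 [simp]: "homogeneous3 0 (1 :: 'k::comm_semiring_1 poly3)"
  by (auto simp: homogeneous3_iff lookup_one when_def)

lemma homogeneous3_power:
  "homogeneous3 n p \<Longrightarrow> homogeneous3 (k * n) (p ^ k :: 'k::comm_semiring_1 poly3)"
  by (induction k) (auto intro: homogeneous3_mult)

lemma homogeneous3_var_power [simp]: "homogeneous3 n (var3 i ^ n :: 'k::comm_semiring_1 poly3)"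
  using homogeneous3_power[OF homogeneous3_var, where k = n] by simp

lemma const3_0 [simp]: "const3 0 = 0"
  by (simp add: const3_def)

lemma const3_1 [simp]: "const3 1 = 1"
  by (simp add: const3_def)

lemma const3_add: "const3 (a + b) = const3 a + const3 (b :: 'k::comm_monoid_add)"
  by (simp add: const3_def single_add)

lemma const3_diff: "const3 (a - b) = const3 a - const3 (b :: 'k::ab_group_add)"
  by (simp add: const3_def single_diff)

lemma const3_uminus: "const3 (- b) = - const3 (b :: 'k::ab_group_add)"
  by (simp add: const3_def single_uminus)

lemma const3_mult: "const3 (a * b) = const3 a * const3 (b :: 'k::comm_semiring_1)"
  by (simp add: const3_def mult_single)

lemma const3_of_nat: "const3 (of_nat n :: 'k::comm_semiring_1) = of_nat n"
  by (induction n) (auto simp: const3_add)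

lemma const3_eq_iff [simp]: "const3 a = const3 b \<longleftrightarrow> a = b"
  by (metis const3_def lookup_single_eq)

lemma const3_eq_0_iff [simp]: "const3 a = 0 \<longleftrightarrow> a = 0"
  using const3_eq_iff[of a 0] by simp

lemma lookup_const3_mult: "lk (const3 c * p) t = c * lk (p :: 'k::comm_semiring_1 poly3) t"
proof -
  have "const3 c * p = Poly_Mapping.map ((*) c) p"
    by (simp add: const3_def mult_map_scale_conv_mult)
  then show ?thesis
    by (simp add: Poly_Mapping.map.rep_eq when_def)
qed

lemma var3_mult_single: "var3 i * mon t a = mon (unit_exp i + t) (a :: 'k::comm_semiring_1)"
  by (simp add: var3_def mult_single)

lemma poly3_eq_sum_single: "p = (\<Sum>t\<in>ks p. mon t (lk p t))"
proof (rule poly_mapping_eqI)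
  fix s
  have "lk (\<Sum>t\<in>ks p. mon t (lk p t)) s = (\<Sum>t\<in>ks p. if t = s then lk p t else 0)"
    by (simp add: lookup_sum lookup_single when_def)
  also have "\<dots> = lk p s"
    by (simp add: in_keys_iff)
  finally show "lk p s = lk (\<Sum>t\<in>ks p. mon t (lk p t)) s"
    by simp
qed

lemma poly3_add_induct:
  fixes p :: "'k::comm_monoid_add poly3"
  assumes "\<And>t a. P (mon t a)" "\<And>p q. P p \<Longrightarrow> P q \<Longrightarrow> P (p + q)"
  shows "P p"
proof -
  have "P (\<Sum>t\<in>A. mon t (lk p t))" if "finite A" for A
    using that by (induction A) (use assms(1)[of _ 0] assms in auto)
  from this[of "ks p"] show ?thesis
    using poly3_eq_sum_single[of p] by simp
qed

text \<open>A monomial of positive degree splits off a variable, so forms arise from constants by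
  addition and multiplication by variables. Keeping the degree as an argument of \<open>P\<close>
  allows claims about graded pieces \<open>I n\<close> or about fractions with denominator
  \<open>X ^ n\<close>.\<close>

lemma homogeneous3_induct [consumes 1, case_names const add var]:
  fixes p :: "'k::comm_semiring_1 poly3"
  assumes p: "homogeneous3 n p"
    and const: "\<And>c. P 0 (const3 c)"
    and add: "\<And>n p q. homogeneous3 n p \<Longrightarrow> homogeneous3 n q \<Longrightarrow> P n p \<Longrightarrow> P n q \<Longrightarrow> P n (p + q)"
    and var: "\<And>n p i. homogeneous3 n p \<Longrightarrow> P n p \<Longrightarrow> P (Suc n) (var3 i * p)"
  shows "P n p"
proof -
  have single: "P n (mon t a)" if "tdeg t = n" for n t a
    using that
  proof (induction n arbitrary: t)
    case 0
    then have "t = 0"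
      by (simp add: tdeg_eq_0_iff)
    then show ?case
      using const[of a] by (simp add: const3_def)
  next
    case (Suc n)
    then obtain i where i: "lk t i \<noteq> 0"
      by (metis lookup_zero nat.distinct(1) poly_mapping_eqI tdeg_eq_0_iff)
    define s where "s = t - unit_exp i"
    have t: "t = unit_exp i + s"
      using i by (auto simp: s_def lookup_add lookup_minus lookup_single when_def intro!: poly_mapping_eqI)
    then have "tdeg s = n"
      using Suc.prems by (simp add: tdeg_add)
    then have "P (Suc n) (var3 i * mon s a)"
      by (intro var homogeneous3_single Suc.IH)
    then show ?case
      by (simp add: var3_mult_single t)
  qed
  have "P n (\<Sum>t\<in>A. mon t (lk p t)) \<and> homogeneous3 n (\<Sum>t\<in>A. mon t (lk p t))"
    if "finite A" "A \<subseteq> ks p" for A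
    using that
  proof (induction A)
    case empty
    \<comment> \<open>The empty sum has to be treated in degree \<open>n\<close>, not 0: it is
      written as a monomial of degree \<open>n\<close> with coefficient 0.\<close>
    obtain t :: "3 \<Rightarrow>\<^sub>0 nat" where "tdeg t = n"
      using tdeg_single by blast
    then show ?case
      using single[of t n 0] by simp
  next
    case (insert t A)
    then have "tdeg t = n"
      using p by (auto simp: homogeneous3_iff in_keys_iff)
    then show ?case
      using insert by (auto intro!: add single homogeneous3_add homogeneous3_single)
  qed
  from this[of "ks p"] show ?thesis
    using poly3_eq_sum_single[of p] by simp
qed

lemma poly3_induct [case_names const add var]:
  fixes p :: "'k::comm_semiring_1 poly3"
  assumes const: "\<And>c. P (const3 c)"
    and add: "\<And>p q. P p \<Longrightarrow> P q \<Longrightarrow> P (p + q)"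
    and var: "\<And>p i. P p \<Longrightarrow> P (var3 i * p)"
  shows "P p"
proof (rule poly3_add_induct)
  fix t and a :: 'k
  have "homogeneous3 (tdeg t) (mon t a)"
    by (simp add: homogeneous3_single)
  then show "P (mon t a)"
    by (induction rule: homogeneous3_induct) (use assms in auto)
qed (use add in auto)

subsection \<open>Evaluation\<close>

text \<open>Coefficients are carried along \<open>c\<close>, so that one substitution homomorphism
  yields evaluation at a vector, the grading map \<open>graded_poly\<close> and the isomorphism
  \<open>nested\<close>.\<close>

definition evalm :: "('k::comm_semiring_1 \<Rightarrow> 'r::comm_semiring_1) \<Rightarrow> (3 \<Rightarrow> 'r) \<Rightarrow> 'k poly3 \<Rightarrow> 'r" where
  "evalm c v p = (\<Sum>t\<in>ks p. c (lk p t) * (\<Prod>i\<in>UNIV. v i ^ lk t i))"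

locale coeff_hom =
  fixes c :: "'k::comm_semiring_1 \<Rightarrow> 'r::comm_semiring_1"
  assumes c_0: "c 0 = 0" and c_1: "c 1 = 1"
    and c_add: "c (a + b) = c a + c b" and c_mult: "c (a * b) = c a * c b"
begin

lemma evalm_superset:
  assumes "finite T" "ks p \<subseteq> T"
  shows "evalm c v p = (\<Sum>t\<in>T. c (lk p t) * (\<Prod>i\<in>UNIV. v i ^ lk t i))"
  unfolding evalm_def
  by (rule sum.mono_neutral_left) (use assms in \<open>auto simp: in_keys_iff c_0\<close>)

lemma evalm_0 [simp]: "evalm c v 0 = 0"
  by (simp add: evalm_def)

lemma evalm_add: "evalm c v (p + q) = evalm c v p + evalm c v q"
proof -
  let ?T = "ks p \<union> ks q"
  have "ks (p + q) \<subseteq> ?T"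
    by (rule keys_add)
  then show ?thesis
    by (subst (1 2 3) evalm_superset[of ?T]) (auto simp: lookup_add c_add algebra_simps sum.distrib)
qed

lemma evalm_single: "evalm c v (mon t a) = c a * (\<Prod>i\<in>UNIV. v i ^ lk t i)"
  by (cases "a = 0") (simp_all add: evalm_def c_0)

lemma evalm_const [simp]: "evalm c v (const3 a) = c a"
  by (simp add: const3_def evalm_single)

lemma evalm_1 [simp]: "evalm c v 1 = 1"
  using evalm_const[of v 1] by (simp add: c_1)

lemma prod_power_unit_exp: "(\<Prod>j\<in>UNIV. (v :: 3 \<Rightarrow> 'r) j ^ lk (unit_exp i) j) = v i"
proof -
  have "(\<Prod>j\<in>UNIV. v j ^ lk (unit_exp i) j) = (\<Prod>j\<in>UNIV. if j = i then v j else 1)"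
    by (rule prod.cong) (auto simp: lookup_single when_def)
  then show ?thesis
    by simp
qed

lemma evalm_var [simp]: "evalm c v (var3 i) = v i"
  by (simp only: var3_def evalm_single prod_power_unit_exp c_1 mult_1_left)

lemma evalm_mult: "evalm c v (p * q) = evalm c v p * evalm c v q"
proof (induction p rule: poly3_add_induct)
  case (1 t a)
  show ?case
  proof (induction q rule: poly3_add_induct)
    case (1 s b)
    then show ?case
      by (simp add: mult_single evalm_single c_mult lookup_add power_add prod.distrib algebra_simps)
  qed (simp add: evalm_add algebra_simps)
qed (simp add: evalm_add algebra_simps)

lemma evalm_power: "evalm c v (p ^ n) = evalm c v p ^ n"
  by (induction n) (simp_all add: evalm_mult)

lemma evalm_sum: "evalm c v (sum f A) = (\<Sum>x\<in>A. evalm c v (f x))"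
  by (induction A rule: infinite_finite_induct) (auto simp: evalm_add)

end

interpretation id_hom: coeff_hom "\<lambda>x. x"
  by unfold_locales auto

lemma eval3_eq_evalm: "eval3 p v = evalm (\<lambda>x. x) v p"
  by (simp add: eval3_def evalm_def)

lemmas eval3_simps [simp] = id_hom.evalm_0[folded eval3_eq_evalm] id_hom.evalm_1[folded eval3_eq_evalm]
  id_hom.evalm_const[folded eval3_eq_evalm] id_hom.evalm_var[folded eval3_eq_evalm]
  id_hom.evalm_add[folded eval3_eq_evalm] id_hom.evalm_mult[folded eval3_eq_evalm]
  id_hom.evalm_power[folded eval3_eq_evalm] id_hom.evalm_sum[folded eval3_eq_evalm]

lemma eval3_diff [simp]: "eval3 (p - q) v = eval3 p v - eval3 (q :: 'k::comm_ring_1 poly3) v"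
  using eval3_simps(5)[of "p - q" q v] by (simp add: eq_diff_eq)

lemma eval3_scale:
  assumes "homogeneous3 n p"
  shows "eval3 p (\<lambda>i. c * v i) = c ^ n * eval3 p v"
  using assms by (induction rule: homogeneous3_induct) (simp_all add: algebra_simps)

subsection \<open>Partial derivatives\<close>

lemma lookup_partial3:
  fixes p :: "'k::comm_semiring_1 poly3"
  shows "lk (partial3 i p) s = of_nat (Suc (lk s i)) * lk p (s + unit_exp i)"
proof -
  have "lk (partial3 i p) s =
      (\<Sum>t\<in>ks p. of_nat (lk t i) * lk p t when t - unit_exp i = s)"
    by (simp add: partial3_def lookup_sum lookup_single)
  also have "\<dots> = (\<Sum>t\<in>ks p. if t = s + unit_exp i then of_nat (Suc (lk s i)) * lk p t else 0)"
  proof (rule sum.cong)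
    fix t
    show "(of_nat (lk t i) * lk p t when t - unit_exp i = s) =
        (if t = s + unit_exp i then of_nat (Suc (lk s i)) * lk p t else 0)"
    \<comment> \<open>For exponent 0 the truncated subtraction leaves \<open>t\<close> unchanged,
      but then the factor \<open>of_nat (lk t i)\<close> vanishes.\<close>
    proof (cases "lk t i = 0")
      case True
      then have "t \<noteq> s + unit_exp i"
        by (auto simp: lookup_add)
      with True show ?thesis
        by (simp add: when_def)
    next
      case False
      then have "t - unit_exp i = s \<longleftrightarrow> t = s + unit_exp i"
        by (auto simp: lookup_add lookup_minus lookup_single when_def intro!: poly_mapping_eqI)
      then show ?thesis
        by (auto simp: when_def lookup_add)
    qed
  qed simp
  also have "\<dots> = of_nat (Suc (lk s i)) * lk p (s + unit_exp i)"
    by (simp add: in_keys_iff del: of_nat_Suc)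
  finally show ?thesis .
qed

lemma partial3_add: "partial3 i (p + q) = partial3 i p + partial3 i (q :: 'k::comm_semiring_1 poly3)"
  by (rule poly_mapping_eqI) (simp add: lookup_partial3 lookup_add algebra_simps)

lemma partial3_const [simp]: "partial3 i (const3 (c :: 'k::comm_semiring_1)) = 0"
proof (rule poly_mapping_eqI)
  fix s
  have "s + unit_exp i \<noteq> 0"
    by (metis add_is_0 lookup_add lookup_single_eq lookup_zero one_neq_zero)
  then show "lk (partial3 i (const3 c)) s = lk 0 s"
    by (simp add: lookup_partial3 const3_def lookup_single when_def)
qed

lemma partial3_single:
  "partial3 i (mon t a) = mon (t - unit_exp i) (of_nat (lk t i) * (a :: 'k::comm_semiring_1))"
  by (cases "a = 0") (simp_all add: partial3_def)

lemma partial3_var: "partial3 i (var3 j :: 'k::comm_semiring_1 poly3) = (if i = j then 1 else 0)"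
  by (auto simp: var3_def partial3_single lookup_single when_def)

lemma partial3_var_mult:
  fixes q :: "'k::comm_semiring_1 poly3"
  shows "partial3 i (var3 j * q) = partial3 i (var3 j) * q + var3 j * partial3 i q"
proof (induction q rule: poly3_add_induct)
  case (1 t a)
  show ?case
  proof (cases "i = j")
    case False
    have "unit_exp j + t - unit_exp i = unit_exp j + (t - unit_exp i)"
      using False by (auto simp: lookup_add lookup_minus lookup_single when_def intro!: poly_mapping_eqI)
    then show ?thesis
      using False by (simp add: partial3_var var3_mult_single partial3_single lookup_add lookup_single when_def)
  next
    case True
    have "var3 j * partial3 j (mon t a) = mon t (of_nat (lk t j) * a)"
    proof (cases "lk t j = 0")
      case False
      then have "unit_exp j + (t - unit_exp j) = t"
        by (auto simp: lookup_add lookup_minus lookup_single when_def intro!: poly_mapping_eqI)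
      then show ?thesis
        by (simp add: partial3_single var3_mult_single)
    qed (simp add: partial3_single)
    then show ?thesis
      using True by (simp add: partial3_var var3_mult_single partial3_single lookup_add
          single_add[symmetric] algebra_simps)
  qed
qed (simp add: partial3_add algebra_simps)

lemma partial3_mult:
  fixes p q :: "'k::comm_semiring_1 poly3"
  shows "partial3 i (p * q) = partial3 i p * q + p * partial3 i q"
proof (induction p rule: poly3_induct)
  case (const c)
  show ?case
    by (rule poly_mapping_eqI) (simp add: lookup_partial3 lookup_const3_mult lookup_add mult.left_commute del: of_nat_Suc)
next
  case (add p q)
  then show ?case
    by (simp add: partial3_add algebra_simps)
next
  case (var p j)
  then show ?case
    by (simp only: mult.assoc partial3_var_mult var distrib_left distrib_right) (simp add: ac_simps)
qed

text \<open>Truncation is harmless: for \<open>n = 0\<close> the derivative is 0, which is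
  homogeneous of every degree.\<close>

lemma homogeneous3_partial:
  fixes p :: "'k::comm_semiring_1 poly3"
  assumes "homogeneous3 n p"
  shows "homogeneous3 (n - 1) (partial3 i p)"
  unfolding homogeneous3_iff
proof (intro allI impI)
  fix t assume "lk (partial3 i p) t \<noteq> 0"
  then have "lk p (t + unit_exp i) \<noteq> 0"
    by (auto simp: lookup_partial3)
  then have "tdeg (t + unit_exp i) = n"
    using assms by (auto simp: homogeneous3_iff)
  then show "tdeg t = n - 1"
    by (simp add: tdeg_add)
qed

lemma euler_identity:
  fixes p :: "'k::comm_semiring_1 poly3"
  assumes "homogeneous3 n p"
  shows "(\<Sum>i\<in>UNIV. var3 i * partial3 i p) = of_nat n * p"
  using assms
proof (induction rule: homogeneous3_induct)
  case (add n p q)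
  then show ?case
    by (simp add: partial3_add algebra_simps sum.distrib)
next
  case (var n p i)
  have "(\<Sum>j\<in>UNIV. var3 j * partial3 j (var3 i * p)) =
      (\<Sum>j\<in>UNIV. if j = i then var3 i * p else 0) + (\<Sum>j\<in>UNIV. var3 i * (var3 j * partial3 j p))"
    unfolding sum.distrib[symmetric]
    by (rule sum.cong) (auto simp: partial3_var_mult partial3_var distrib_left mult.left_commute)
  also have "(\<Sum>j\<in>UNIV. var3 i * (var3 j * partial3 j p)) = var3 i * (of_nat n * p)"
    by (simp only: var.IH flip: sum_distrib_left)
  also have "(\<Sum>j\<in>UNIV. if j = i then var3 i * p else 0) + var3 i * (of_nat n * p) = of_nat (Suc n) * (var3 i * p)"
    by (simp add: algebra_simps)
  finally show ?case .
qed simp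

subsection \<open>Degree and homogeneous components\<close>

text \<open>Substituting \<open>x\<^sub>i T\<close> for \<open>x\<^sub>i\<close> turns the total degree into the degree in \<open>T\<close>.\<close>

definition graded_poly :: "'k::comm_semiring_1 poly3 \<Rightarrow> 'k poly3 poly" where
  "graded_poly p = evalm (\<lambda>c. [:const3 c:]) (\<lambda>i. [:0, var3 i:]) p"

text \<open>Total degree is read off from \<open>graded_poly\<close>, so that additivity on products
  is inherited from univariate polynomials over a domain.\<close>

definition deg3 :: "'k::comm_semiring_1 poly3 \<Rightarrow> nat" where
  "deg3 p = degree (graded_poly p)"

definition hcomp :: "nat \<Rightarrow> 'k::comm_semiring_1 poly3 \<Rightarrow> 'k poly3" where
  "hcomp n p = coeff (graded_poly p) n"

interpretation graded_hom: coeff_hom "\<lambda>c. [:const3 c:]"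
  by unfold_locales (simp_all add: const3_add const3_mult mult.commute flip: one_pCons)

lemmas graded_poly_simps [simp] =
  graded_hom.evalm_0[where v = "\<lambda>i. [:0, var3 i:]", folded graded_poly_def]
  graded_hom.evalm_1[where v = "\<lambda>i. [:0, var3 i:]", folded graded_poly_def]
  graded_hom.evalm_const[where v = "\<lambda>i. [:0, var3 i:]", folded graded_poly_def]
  graded_hom.evalm_var[where v = "\<lambda>i. [:0, var3 i:]", folded graded_poly_def]
  graded_hom.evalm_add[where v = "\<lambda>i. [:0, var3 i:]", folded graded_poly_def]
  graded_hom.evalm_mult[where v = "\<lambda>i. [:0, var3 i:]", folded graded_poly_def]
  graded_hom.evalm_sum[where v = "\<lambda>i. [:0, var3 i:]", folded graded_poly_def]

lemma graded_poly_homogeneous: "homogeneous3 n p \<Longrightarrow> graded_poly p = monom p n"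
proof (induction rule: homogeneous3_induct)
  case (var n p i)
  have "[:0, var3 i:] = monom (var3 i) 1"
    by (simp add: monom_Suc monom_0)
  then show ?case
    using var by (simp add: monom_Suc smult_monom)
qed (simp_all add: monom_0 add_monom)

lemma graded_poly_single: "graded_poly (mon t a) = monom (mon t a) (tdeg t)"
  by (simp add: graded_poly_homogeneous homogeneous3_single)

lemma lookup_hcomp: "lk (hcomp n p) t = (lk p t when tdeg t = n)"
proof (induction p rule: poly3_add_induct)
  case (1 s a)
  then show ?case
    by (auto simp: hcomp_def graded_poly_single lookup_single when_def)
next
  case (2 p q)
  then show ?case
    by (simp add: hcomp_def lookup_add when_def)
qed

lemma hcomp_homogeneous: "homogeneous3 n (hcomp n p)"
  by (simp add: homogeneous3_iff lookup_hcomp when_def)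

lemma hcomp_sum: "hcomp n (sum f A) = (\<Sum>x\<in>A. hcomp n (f x))"
  by (simp add: hcomp_def coeff_sum)

lemma hcomp_mult_homogeneous:
  assumes "homogeneous3 m q"
  shows "hcomp (n + m) (p * q) = hcomp n p * q"
proof -
  have "coeff (graded_poly p * monom q m) (n + m) = coeff (monom q m * graded_poly p) (n + m)"
    by (simp only: mult.commute)
  also have "\<dots> = q * coeff (graded_poly p) n"
    by (simp add: coeff_monom_mult)
  finally show ?thesis
    by (simp only: hcomp_def graded_poly_simps graded_poly_homogeneous[OF assms] mult.commute)
qed

lemma poly_graded_poly_1 [simp]: "poly (graded_poly p) 1 = p"
  by (induction p rule: poly3_induct) simp_all

lemma graded_poly_eq_0_iff [simp]: "graded_poly p = 0 \<longleftrightarrow> p = 0"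
  by (metis graded_poly_simps(1) poly_graded_poly_1)

lemma deg3_mult: "p \<noteq> 0 \<Longrightarrow> q \<noteq> 0 \<Longrightarrow> deg3 (p * q) = deg3 p + deg3 (q :: 'k::idom poly3)"
  by (simp add: deg3_def degree_mult_eq)

lemma deg3_homogeneous: "homogeneous3 n p \<Longrightarrow> p \<noteq> 0 \<Longrightarrow> deg3 p = n"
  by (simp add: deg3_def graded_poly_homogeneous degree_monom_eq)

lemma deg3_le: "(\<And>t. lk p t \<noteq> 0 \<Longrightarrow> tdeg t \<le> n) \<Longrightarrow> deg3 p \<le> n"
proof -
  assume *: "\<And>t. lk p t \<noteq> 0 \<Longrightarrow> tdeg t \<le> n"
  have "hcomp m p = 0" if "n < m" for m
    using * that by (intro poly_mapping_eqI) (force simp: lookup_hcomp when_def)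
  then show ?thesis
    unfolding deg3_def hcomp_def by (intro degree_le) auto
qed

lemma tdeg_le_deg3: "lk p t \<noteq> 0 \<Longrightarrow> tdeg t \<le> deg3 p"
proof -
  assume "lk p t \<noteq> 0"
  then have "lk (hcomp (tdeg t) p) t \<noteq> lk 0 t"
    by (simp add: lookup_hcomp)
  then show ?thesis
    unfolding deg3_def hcomp_def by (intro le_degree) auto
qed

lemma deg3_eq_0: "deg3 p = 0 \<Longrightarrow> \<exists>c. p = const3 c"
proof -
  assume "deg3 p = 0"
  then have "lk p t = lk (const3 (lk p 0)) t" for t
    using tdeg_le_deg3[of p t] by (auto simp: const3_def lookup_single when_def tdeg_eq_0_iff)
  then show ?thesis
    using poly_mapping_eqI by blast
qed

lemma is_unit_const3: "c \<noteq> 0 \<Longrightarrow> const3 (c :: 'k::field) dvd 1"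
  by (rule dvdI[of _ _ "const3 (inverse c)"]) (simp flip: const3_mult)

lemma is_unit_iff_deg3: "p dvd 1 \<longleftrightarrow> p \<noteq> 0 \<and> deg3 (p :: 'k::field poly3) = 0"
proof
  assume "p dvd 1"
  then obtain q where q: "1 = p * q"
    by (elim dvdE)
  then have "p \<noteq> 0" "q \<noteq> 0"
    by auto
  then have "deg3 p + deg3 q = deg3 (1 :: 'k poly3)"
    using deg3_mult[of p q] q by simp
  also have "\<dots> = 0"
    using deg3_homogeneous[OF homogeneous3_1] by simp
  finally show "p \<noteq> 0 \<and> deg3 p = 0"
    using \<open>p \<noteq> 0\<close> by simp
next
  assume "p \<noteq> 0 \<and> deg3 p = 0"
  then show "p dvd 1"
    using deg3_eq_0[of p] is_unit_const3 by auto
qed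

lemma deg3_partial:
  assumes "partial3 i p \<noteq> (0 :: 'k::comm_semiring_1 poly3)"
  shows "deg3 (partial3 i p) < deg3 p"
proof -
  have *: "Suc (tdeg t) \<le> deg3 p" if "lk (partial3 i p) t \<noteq> 0" for t
  proof -
    have "lk p (t + unit_exp i) \<noteq> 0"
      using that by (auto simp: lookup_partial3)
    then show ?thesis
      using tdeg_le_deg3[of p "t + unit_exp i"] by (simp add: tdeg_add)
  qed
  obtain t where t: "lk (partial3 i p) t \<noteq> 0"
    using assms poly_mapping_eqI[of "partial3 i p" 0] by auto
  have "deg3 (partial3 i p) \<le> deg3 p - 1"
    by (rule deg3_le) (use * in force)
  then show ?thesis
    using *[OF t] by linarith
qed

lemma dvd_deg3_less_imp_0:
  assumes "p dvd q" "deg3 q < deg3 (p :: 'k::idom poly3)"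
  shows "q = 0"
proof (rule ccontr)
  assume "q \<noteq> 0"
  obtain r where "q = p * r"
    using assms(1) by (elim dvdE)
  then show False
    using assms(2) \<open>q \<noteq> 0\<close> deg3_mult[of p r] by auto
qed

subsection \<open>Unique factorization\<close>

text \<open>The identification of k[x,y,z] with k[x][y][z], \<open>z\<close> outermost. Factoriality
  of the iterated polynomial ring is imported through it.\<close>

definition nested :: "'k::comm_semiring_1 poly3 \<Rightarrow> 'k poly poly poly" where
  "nested p = evalm (\<lambda>c. [:[:[:c:]:]:])
     (\<lambda>i. if i = 0 then [:[:[:0, 1:]:]:] else if i = 1 then [:[:0, 1:]:] else [:0, 1:]) p"

interpretation nested_hom: coeff_hom "\<lambda>c. [:[:[:c:]:]:]"
  by unfold_locales (simp_all add: mult.commute flip: one_pCons)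

lemmas nested_simps [simp] =
  nested_hom.evalm_0[where v = "\<lambda>i. if i = 0 then [:[:[:0, 1:]:]:] else if i = 1 then [:[:0, 1:]:] else [:0, 1:]", folded nested_def]
  nested_hom.evalm_1[where v = "\<lambda>i. if i = 0 then [:[:[:0, 1:]:]:] else if i = 1 then [:[:0, 1:]:] else [:0, 1:]", folded nested_def]
  nested_hom.evalm_const[where v = "\<lambda>i. if i = 0 then [:[:[:0, 1:]:]:] else if i = 1 then [:[:0, 1:]:] else [:0, 1:]", folded nested_def]
  nested_hom.evalm_var[where v = "\<lambda>i. if i = 0 then [:[:[:0, 1:]:]:] else if i = 1 then [:[:0, 1:]:] else [:0, 1:]", folded nested_def]
  nested_hom.evalm_add[where v = "\<lambda>i. if i = 0 then [:[:[:0, 1:]:]:] else if i = 1 then [:[:0, 1:]:] else [:0, 1:]", folded nested_def]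
  nested_hom.evalm_mult[where v = "\<lambda>i. if i = 0 then [:[:[:0, 1:]:]:] else if i = 1 then [:[:0, 1:]:] else [:0, 1:]", folded nested_def]

lemma coeff_nested:
  "coeff (coeff (coeff (nested p) (lk t 2)) (lk t 1)) (lk t 0) = lk p t"
proof (induction p rule: poly3_add_induct)
  case (1 s a)
  have s: "s = t \<longleftrightarrow> lk s 0 = lk t 0 \<and> lk s 1 = lk t 1 \<and> lk s 2 = lk t 2"
  proof
    assume *: "lk s 0 = lk t 0 \<and> lk s 1 = lk t 1 \<and> lk s 2 = lk t 2"
    have "lk s i = lk t i" for i
      using exhaust_index3[of i] * by (elim disjE) (simp_all only:)
    then show "s = t"
      by (rule poly_mapping_eqI)
  qed simp
  have "nested (mon s a) = [:[:[:a:]:]:] *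
      ([:[:[:0, 1:]:]:] ^ lk s 0 * ([:[:0, 1:]:] ^ lk s 1 * [:0, 1:] ^ lk s 2))"
    unfolding nested_def nested_hom.evalm_single UNIV_3_eq by simp
  also have "[:0, 1:] ^ lk s 2 = monom (1 :: 'a poly poly) (lk s 2)"
    by (simp add: monom_altdef)
  also have "[:[:0, 1:]:] ^ lk s 1 = [:monom (1 :: 'a poly) (lk s 1):]"
    by (simp only: poly_const_pow) (simp add: monom_altdef)
  also have "[:[:[:0, 1:]:]:] ^ lk s 0 = [:[:monom (1 :: 'a) (lk s 0):]:]"
    by (simp only: poly_const_pow) (simp add: monom_altdef)
  also have "[:[:[:a:]:]:] * ([:[:monom 1 (lk s 0):]:] * ([:monom 1 (lk s 1):] * monom 1 (lk s 2))) =
      monom (monom (monom a (lk s 0)) (lk s 1)) (lk s 2)"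
    by (simp add: smult_monom)
  finally show ?case
    by (simp add: s lookup_single when_def)
next
  case (2 p q)
  then show ?case
    by (simp add: lookup_add)
qed

lemma inj_nested:
  assumes "nested p = nested q"
  shows "p = q"
proof (rule poly_mapping_eqI)
  fix t
  show "lk p t = lk q t"
    using coeff_nested[of p t] coeff_nested[of q t] assms by simp
qed

lemma surj_nested: "\<exists>p. nested p = (f :: 'k::comm_semiring_1 poly poly poly)"
proof -
  have 1: "\<exists>p. nested p = [:[:a:]:]" for a :: "'k poly"
  proof (induction a)
    case 0
    show ?case by (rule exI[of _ 0]) simp
  next
    case (pCons c a)
    then obtain p where "nested p = [:[:a:]:]" by blast
    then have "nested (const3 c + var3 0 * p) = [:[:pCons c a:]:]"
      by simp
    then show ?case by blast
  qed
  have 2: "\<exists>p. nested p = [:a:]" for a :: "'k poly poly"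
  proof (induction a)
    case 0
    show ?case by (rule exI[of _ 0]) simp
  next
    case (pCons c a)
    then obtain p q where "nested p = [:a:]" "nested q = [:[:c:]:]" using 1 by blast
    then have "nested (q + var3 1 * p) = [:pCons c a:]"
      by simp
    then show ?case by blast
  qed
  show ?thesis
  proof (induction f)
    case 0
    show ?case by (rule exI[of _ 0]) simp
  next
    case (pCons c a)
    then obtain p q where "nested p = a" "nested q = [:c:]" using 2 by blast
    then have "nested (q + var3 2 * p) = pCons c a"
      by simp
    then show ?case by blast
  qed
qed

lemma nested_eq_0_iff: "nested p = 0 \<longleftrightarrow> p = 0"
  using inj_nested[of p 0] by auto

lemma nested_dvd_iff: "nested p dvd nested q \<longleftrightarrow> p dvd q"
proof
  assume "nested p dvd nested q"
  then obtain f where f: "nested q = nested p * f"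
    by (elim dvdE)
  obtain r where "nested r = f"
    using surj_nested[of f] by (elim exE)
  then have "nested q = nested (p * r)"
    using f by simp
  then have "q = p * r"
    by (rule inj_nested)
  then show "p dvd q"
    by simp
next
  assume "p dvd q"
  then obtain r where "q = p * r"
    by (elim dvdE)
  then show "nested p dvd nested q"
    by simp
qed

lemma nested_is_unit_iff: "nested p dvd 1 \<longleftrightarrow> p dvd 1"
  using nested_dvd_iff[of p 1] by simp

text \<open>\<open>nested\<close> is a bijective homomorphism that preserves and reflects
  divisibility, so irreducibility passes to the factorial ring k[x][y][z] and primality comes
  back.\<close>

lemma irreducible3_imp_prime_elem:
  fixes p :: "'k::field poly3"
  assumes "irreducible p"
  shows "prime_elem p"
proof -
  have irr: "irreducible (nested p)"
  proof (rule irreducibleI)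
    show "nested p \<noteq> 0"
      using assms by (simp add: nested_eq_0_iff irreducible_def)
    show "\<not> nested p dvd 1"
      using assms by (simp add: nested_is_unit_iff irreducible_def)
    fix a b assume ab: "nested p = a * b"
    obtain x where x: "nested x = a"
      using surj_nested[of a] by (elim exE)
    obtain y where y: "nested y = b"
      using surj_nested[of b] by (elim exE)
    have "nested p = nested (x * y)"
      using ab x y by simp
    then have "p = x * y"
      by (rule inj_nested)
    then have "x dvd 1 \<or> y dvd 1"
      using irreducibleD[OF assms] by blast
    then show "a dvd 1 \<or> b dvd 1"
      using nested_is_unit_iff[of x] nested_is_unit_iff[of y] x y by simp
  qed
  have prime: "prime_elem (nested p)"
    using irr by (simp only: prime_elem_iff_irreducible)
  show ?thesis
  proof (rule prime_elemI)
    show "p \<noteq> 0" "\<not> p dvd 1"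
      using assms by (simp_all add: irreducible_def)
    fix a b assume "p dvd a * b"
    then have "nested p dvd nested (a * b)"
      by (simp only: nested_dvd_iff)
    then have "nested p dvd nested a \<or> nested p dvd nested b"
      using prime by (simp add: prime_elem_dvd_mult_iff)
    then show "p dvd a \<or> p dvd b"
      by (simp only: nested_dvd_iff)
  qed
qed

text \<open>Over a field the nonzero nonunits are the polynomials of positive degree, so both
  factors of a proper factorization have smaller degree and the induction descends.\<close>

lemma exists_prime_elem_divisor3:
  fixes p :: "'k::field poly3"
  assumes "p \<noteq> 0" "\<not> p dvd 1"
  obtains q where "prime_elem q" "q dvd p"
proof -
  have "\<exists>q. prime_elem q \<and> q dvd p"
    using assms
  proof (induction "deg3 p" arbitrary: p rule: less_induct)
    case less
    show ?case
    proof (cases "irreducible p")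
      case True
      show ?thesis
        by (rule exI[of _ p]) (simp add: irreducible3_imp_prime_elem[OF True])
    next
      case False
      then obtain a b where ab: "p = a * b" "\<not> a dvd 1" "\<not> b dvd 1"
        using less.prems unfolding irreducible_def by metis
      then have "a \<noteq> 0" "b \<noteq> 0"
        using less.prems by auto
      have "deg3 b \<noteq> 0"
        using ab(3) \<open>b \<noteq> 0\<close> is_unit_iff_deg3[of b] by simp
      then have "deg3 a < deg3 p"
        using ab(1) deg3_mult[OF \<open>a \<noteq> 0\<close> \<open>b \<noteq> 0\<close>] by simp
      from less.hyps[OF this \<open>a \<noteq> 0\<close> ab(2)] obtain q where "prime_elem q" "q dvd a"
        by (elim exE conjE)
      then show ?thesis
        unfolding ab(1) by (intro exI[of _ q] conjI dvd_mult2)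
    qed
  qed
  then show ?thesis
    using that by (elim exE conjE)
qed

section \<open>Dimensions of graded pieces\<close>

text \<open>A copy of the locale \<^locale>\<open>vector_space\<close>, which is interpreted without qualifier for
  real vector spaces.\<close>

locale vspace = vector_space scale for scale :: "'a::field \<Rightarrow> 'b::ab_group_add \<Rightarrow> 'b"
begin

text \<open>The polynomial spaces are infinite-dimensional and \<open>dim\<close> is a cardinality,
  0 for an infinite basis; this condition guards the dimension arguments against that
  collapse.\<close>

definition fin_span :: "'b set \<Rightarrow> bool" where
  "fin_span U \<longleftrightarrow> (\<exists>B. finite B \<and> U \<subseteq> span B)"

lemma fin_span_subset: "fin_span V \<Longrightarrow> U \<subseteq> V \<Longrightarrow> fin_span U"
  unfolding fin_span_def by blast

lemma fin_span_basis:
  assumes "fin_span V"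
  obtains B where "B \<subseteq> V" "independent B" "V \<subseteq> span B" "card B = dim V" "finite B"
proof -
  obtain B where B: "B \<subseteq> V" "independent B" "V \<subseteq> span B" "card B = dim V"
    by (rule basis_exists)
  obtain T where "finite T" "V \<subseteq> span T"
    using assms unfolding fin_span_def by blast
  then have "finite B"
    using independent_span_bound[of T B] B by blast
  then show ?thesis
    using B that by blast
qed

lemma dim_mono_fin:
  assumes "fin_span V" "U \<subseteq> span V"
  shows "dim U \<le> dim V"
proof -
  obtain C where C: "C \<subseteq> V" "independent C" "V \<subseteq> span C" "card C = dim V" "finite C"
    using fin_span_basis[OF assms(1)] .
  obtain B where B: "B \<subseteq> U" "independent B" "U \<subseteq> span B" "card B = dim U"
    by (rule basis_exists)
  have "span V \<subseteq> span C"
    using C(3) by (simp add: span_minimal)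
  then have "B \<subseteq> span C"
    using B(1) assms(2) by blast
  then show ?thesis
    using independent_span_bound[of C B] B C by auto
qed

lemma dim_insert_fin:
  assumes "fin_span S" "x \<notin> span S"
  shows "dim (insert x S) = Suc (dim S)"
proof -
  obtain B where B: "B \<subseteq> S" "independent B" "S \<subseteq> span B" "card B = dim S" "finite B"
    using fin_span_basis[OF assms(1)] .
  have x: "x \<notin> span B"
    using assms(2) span_mono[OF B(1)] by blast
  then have "independent (insert x B)"
    using B(2) by (rule independent_insertI)
  moreover have "insert x S \<subseteq> span (insert x B)"
    using B(3) span_mono[of B "insert x B"] span_base[of x "insert x B"] by auto
  ultimately have "card (insert x B) = dim (insert x S)"
    using B(1) by (intro basis_card_eq_dim) auto
  moreover have "x \<notin> B"
    using x span_base by blast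
  ultimately show ?thesis
    using B by simp
qed

lemma subspace_eqI_dim:
  assumes "subspace U" "U \<subseteq> V" "fin_span V" "dim V \<le> dim U"
  shows "U = V"
proof (rule ccontr)
  assume "U \<noteq> V"
  moreover have "span U = U"
    using assms(1) by (simp add: span_eq_iff)
  ultimately obtain x where x: "x \<in> V" "x \<notin> span U"
    using assms(2) by auto
  have "Suc (dim U) = dim (insert x U)"
    using dim_insert_fin[OF fin_span_subset[OF assms(3,2)] x(2)] by simp
  also have "\<dots> \<le> dim V"
    using x(1) assms(2) span_superset by (intro dim_mono_fin[OF assms(3)]) blast
  finally show False
    using assms(4) by simp
qed

text \<open>If none of the \<open>B + 1\<close> vectors depended on \<open>U\<close> and its
  predecessors, each would raise the dimension by one and exceed that of \<open>W\<close>. This is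
  how finite codimension produces a polynomial relation later.\<close>

lemma dependent_modulo:
  assumes "subspace W" "fin_span W" "U \<subseteq> W" "\<And>j. j \<le> B \<Longrightarrow> v j \<in> W" "dim W \<le> dim U + B"
  shows "\<exists>j\<le>B. v j \<in> span (U \<union> v ` {..<j})"
proof (rule ccontr)
  assume *: "\<not> ?thesis"
  have "dim (U \<union> v ` {..<k}) = dim U + k" if "k \<le> Suc B" for k
    using that
  proof (induction k)
    case (Suc k)
    have "U \<union> v ` {..<k} \<subseteq> W"
      using assms(3,4) Suc.prems by fastforce
    then have "fin_span (U \<union> v ` {..<k})"
      using assms(2) fin_span_subset by blast
    moreover have "v k \<notin> span (U \<union> v ` {..<k})"
      using * Suc.prems by simp
    moreover have "U \<union> v ` {..<Suc k} = insert (v k) (U \<union> v ` {..<k})"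
      by (auto simp: lessThan_Suc)
    ultimately show ?case
      using dim_insert_fin Suc by simp
  qed simp
  from this[of "Suc B"] have "dim (U \<union> v ` {..<Suc B}) = dim U + Suc B"
    by simp
  moreover have "U \<union> v ` {..<Suc B} \<subseteq> W"
    using assms(3,4) by fastforce
  then have "dim (U \<union> v ` {..<Suc B}) \<le> dim W"
    using span_superset by (intro dim_mono_fin assms(2)) blast
  ultimately show False
    using assms(5) by simp
qed

end

locale vspace_pair = vs1: vspace s1 + vs2: vspace s2
  for s1 :: "'a::field \<Rightarrow> 'b::ab_group_add \<Rightarrow> 'b" and s2 :: "'a::field \<Rightarrow> 'c::ab_group_add \<Rightarrow> 'c"
begin

text \<open>Vectors of a basis of \<open>U\<close> are adjoined to the kernel one at a time: each
  raises the dimension upstairs and in the image together, or neither.\<close>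

lemma rank_nullity_fin:
  assumes f: "Vector_Spaces.linear s1 s2 f" and U: "vs1.subspace U" "vs1.fin_span U"
  shows "vs1.dim U = vs1.dim {x \<in> U. f x = 0} + vs2.dim (f ` U)"
proof -
  interpret f: Vector_Spaces.linear s1 s2 f
    by (rule f)
  define K where "K = {x \<in> U. f x = 0}"
  have K: "vs1.subspace K"
    using U(1) unfolding K_def vs1.subspace_def by (auto simp: f.add f.scale)
  have *: "vs1.dim (K \<union> D) = vs1.dim K + vs2.dim (f ` (K \<union> D))" if "finite D" "D \<subseteq> U" for D
    using that
  proof (induction D)
    case empty
    have "f ` K \<subseteq> vs2.span {}"
      by (auto simp: K_def)
    then have "vs2.dim (f ` K) = 0"
      using vs2.dim_le_card[of "f ` K" "{}"] by simp
    then show ?case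
      by simp
  next
    case (insert x D)
    let ?E = "K \<union> D"
    have E: "?E \<subseteq> U" "K \<union> insert x D = insert x ?E"
      using insert.prems by (auto simp: K_def)
    have fin: "vs1.fin_span ?E"
      using vs1.fin_span_subset U(2) E(1) by blast
    have fin2: "vs2.fin_span (f ` ?E)"
      using fin unfolding vs1.fin_span_def vs2.fin_span_def
      by (metis f.span_image finite_imageI image_mono)
    show ?case
    proof (cases "x \<in> vs1.span ?E")
      case True
      then have "vs1.span (insert x ?E) = vs1.span ?E"
        by (rule vs1.span_redundant)
      then have 1: "vs1.dim (insert x ?E) = vs1.dim ?E"
        by (rule vs1.span_eq_dim)
      have "f x \<in> vs2.span (f ` ?E)"
        using True by (simp add: f.span_image)
      then have "vs2.span (insert (f x) (f ` ?E)) = vs2.span (f ` ?E)"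
        by (rule vs2.span_redundant)
      then have "vs2.dim (insert (f x) (f ` ?E)) = vs2.dim (f ` ?E)"
        by (rule vs2.span_eq_dim)
      then show ?thesis
        using 1 insert by (simp only: E image_insert) auto
    next
      case False
      \<comment> \<open>If \<open>f x = f y\<close> with \<open>y\<close> in the span, then
        \<open>x - y\<close> lies in the kernel \<open>K\<close>, which is part of
        \<open>?E\<close>, so \<open>x\<close> would be in the span as well.\<close>
      have "f x \<notin> vs2.span (f ` ?E)"
      proof
        assume "f x \<in> vs2.span (f ` ?E)"
        then obtain y where y: "y \<in> vs1.span ?E" "f x = f y"
          by (auto simp: f.span_image)
        have "y \<in> U"
          using y(1) vs1.span_minimal[OF E(1) U(1)] by blast
        then have "x - y \<in> K"
          using insert.prems y(2) U(1) by (simp add: K_def f.diff vs1.subspace_diff)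
        then have "x - y \<in> vs1.span ?E"
          by (simp add: vs1.span_base)
        then have "x - y + y \<in> vs1.span ?E"
          using y(1) by (rule vs1.span_add)
        then show False
          using False by simp
      qed
      then show ?thesis
        using False vs1.dim_insert_fin[OF fin] vs2.dim_insert_fin[OF fin2] insert
        by (simp only: E image_insert) auto
    qed
  qed
  obtain B where B: "B \<subseteq> U" "U \<subseteq> vs1.span B" "finite B"
    using vs1.fin_span_basis[OF U(2)] by metis
  have "vs1.span (K \<union> B) = vs1.span U"
  proof (rule vs1.span_eq[THEN iffD2, OF conjI])
    show "K \<union> B \<subseteq> vs1.span U"
      using B(1) vs1.span_superset[of U] by (auto simp: K_def)
    show "U \<subseteq> vs1.span (K \<union> B)"
      using B(2) vs1.span_mono[of B "K \<union> B"] by auto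
  qed
  then have 1: "vs1.dim (K \<union> B) = vs1.dim U" and "f ` vs1.span (K \<union> B) = f ` vs1.span U"
    by (auto intro: vs1.span_eq_dim)
  then have "vs2.dim (f ` (K \<union> B)) = vs2.dim (f ` U)"
    by (intro vs2.span_eq_dim) (simp add: f.span_image)
  then show ?thesis
    using *[OF B(3,1)] 1 by (simp add: K_def)
qed

end

interpretation p3: vspace "\<lambda>(c::'k::field) p. const3 c * p"
  by unfold_locales (simp_all add: const3_add const3_mult algebra_simps)

interpretation v3: vspace "\<lambda>(c::'k::field) (v :: 3 \<Rightarrow> 'k poly3) i. const3 c * v i"
  by unfold_locales (auto simp: const3_add const3_mult algebra_simps fun_eq_iff)

interpretation vp: vspace_pair "\<lambda>(c::'k::field) (v :: 3 \<Rightarrow> 'k poly3) i. const3 c * v i" "\<lambda>(c::'k::field) p. const3 c * p"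
  ..

interpretation vv: vspace_pair "\<lambda>(c::'k::field) (v :: 3 \<Rightarrow> 'k poly3) i. const3 c * v i"
  "\<lambda>(c::'k::field) (v :: 3 \<Rightarrow> 'k poly3) i. const3 c * v i"
  ..

interpretation pv: vspace_pair "\<lambda>(c::'k::field) p. const3 c * p"
  "\<lambda>(c::'k::field) (v :: 3 \<Rightarrow> 'k poly3) i. const3 c * v i"
  ..

definition hdim :: "nat \<Rightarrow> nat" where "hdim n = card {t. tdeg t = n}"

definition hspace :: "nat \<Rightarrow> 'k::zero poly3 set" where "hspace n = {p. homogeneous3 n p}"

text \<open>The support set \<open>A\<close> covers single forms, pairs and triples by one basis
  computation: it is \<open>{0}\<close>, \<open>{0, 1}\<close> or \<open>UNIV\<close> below.\<close>

definition hspace3 :: "3 set \<Rightarrow> nat \<Rightarrow> (3 \<Rightarrow> 'k::zero poly3) set" where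
  "hspace3 A n = {v. \<forall>i. homogeneous3 n (v i) \<and> (i \<notin> A \<longrightarrow> v i = 0)}"

lemma bij_tdeg: "bij_betw (\<lambda>t. (lk t 0, lk t 1)) {t. tdeg t = n} {(a, b). a + b \<le> n}"
proof (rule bij_betwI[where g = "\<lambda>(a, b). Poly_Mapping.single 0 a + Poly_Mapping.single 1 b
      + Poly_Mapping.single 2 (n - a - b)"])
  show "(\<lambda>t. (lk t 0, lk t 1)) \<in> {t. tdeg t = n} \<rightarrow> {(a, b). a + b \<le> n}"
    by (auto simp: tdeg_def sum_UNIV_3)
  show "(\<lambda>(a, b). Poly_Mapping.single 0 a + Poly_Mapping.single 1 b
      + Poly_Mapping.single 2 (n - a - b)) \<in> {(a, b). a + b \<le> n} \<rightarrow> {t. tdeg t = n}"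
    by (auto simp: tdeg_add)
  fix t assume t: "t \<in> {t. tdeg t = n}"
  have "lk (Poly_Mapping.single 0 (lk t 0) + Poly_Mapping.single 1 (lk t 1)
      + Poly_Mapping.single 2 (n - lk t 0 - lk t 1)) i = lk t i" for i
    using t exhaust_index3[of i] by (auto simp: tdeg_def sum_UNIV_3 lookup_add lookup_single when_def)
  then show "(case (lk t 0, lk t 1) of (a, b) \<Rightarrow> Poly_Mapping.single 0 a + Poly_Mapping.single 1 b
      + Poly_Mapping.single 2 (n - a - b)) = t"
    by (simp add: poly_mapping_eqI)
qed (auto simp: lookup_add lookup_single when_def)

lemma finite_pairs_le: "finite {(a, b). a + b \<le> (n::nat)}"
  by (rule finite_subset[of _ "{..n} \<times> {..n}"]) auto

lemma finite_tdeg: "finite {t. tdeg t = n}"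
  using bij_betw_finite[OF bij_tdeg] finite_pairs_le by blast

text \<open>The binomial coefficient (n+2 choose 2), doubled so that the later Hilbert function
  identities are polynomial identities without division.\<close>

lemma two_hdim: "2 * hdim n = (n + 1) * (n + 2)"
proof -
  have "2 * card {(a, b). a + b \<le> (n::nat)} = (n + 1) * (n + 2)"
  proof (induction n)
    case 0
    have "{(a, b). a + b \<le> (0::nat)} = {(0, 0)}"
      by auto
    then show ?case
      by simp
  next
    case (Suc n)
    have "{(a, b). a + b \<le> Suc n} = {(a, b). a + b \<le> n} \<union> (\<lambda>a. (a, Suc n - a)) ` {..Suc n}"
      by (auto simp: image_iff)
    also have "card \<dots> = card {(a, b). a + b \<le> n} + card ((\<lambda>a. (a, Suc n - a)) ` {..Suc n})"
      by (rule card_Un_disjoint) (auto simp: finite_pairs_le)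
    also have "card ((\<lambda>a. (a, Suc n - a)) ` {..Suc n}) = Suc (Suc n)"
      by (subst card_image) (auto simp: inj_on_def)
    finally show ?case
      using Suc by simp
  qed
  then show ?thesis
    using bij_betw_same_card[OF bij_tdeg, of n] by (simp add: hdim_def)
qed

lemma hspace_subspace: "p3.subspace (hspace n)"
  by (auto simp: p3.subspace_def hspace_def intro: homogeneous3_add)

lemma hspace3_subspace: "v3.subspace (hspace3 A n)"
  by (auto simp: v3.subspace_def hspace3_def intro: homogeneous3_add)

lemma mon_eq_const3_mult: "mon t (a :: 'k::field) = const3 a * mon t 1"
  by (simp add: const3_def mult_single)

lemma inj_mon_1: "mon t (1 :: 'k::field) = mon s 1 \<longleftrightarrow> t = s"
  by (metis lookup_single_eq lookup_single_not_eq one_neq_zero)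

lemma lookup_sum_single: "finite T \<Longrightarrow> t \<in> T \<Longrightarrow> lk (\<Sum>s\<in>T. mon s (f s)) t = f t"
  by (simp add: lookup_sum lookup_single when_def)

lemma sum_apply: "(\<Sum>x\<in>X. g x) j = (\<Sum>x\<in>X. g x j)"
  for g :: "'x \<Rightarrow> 'j \<Rightarrow> 'm::comm_monoid_add"
  by (induction X rule: infinite_finite_induct) simp_all

lemma hspace3_basis:
  fixes A :: "3 set"
  defines "e \<equiv> \<lambda>(i, t) j. if j = i then mon t (1 :: 'k::field) else 0"
  shows "v3.independent (e ` (A \<times> {t. tdeg t = n}))"
    and "hspace3 A n \<subseteq> v3.span (e ` (A \<times> {t. tdeg t = n}))"
    and "e ` (A \<times> {t. tdeg t = n}) \<subseteq> hspace3 A n"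
    and "card (e ` (A \<times> {t. tdeg t = n})) = card A * hdim n"
proof -
  let ?T = "{t. tdeg t = n}"
  have inj: "inj e"
  proof (rule injI, clarify)
    fix i j t s assume *: "e (i, t) = e (j, s)"
    have "e (i, t) i \<noteq> 0"
      by (simp add: e_def) (metis lookup_single_eq lookup_zero one_neq_zero)
    then have "e (j, s) i \<noteq> 0"
      using * by simp
    then have "i = j"
      by (simp add: e_def split: if_splits)
    moreover have "e (i, t) i = e (j, s) i"
      using * by simp
    ultimately show "i = j \<and> t = s"
      by (simp add: e_def inj_mon_1)
  qed
  have fin: "finite (A \<times> ?T)"
    by (simp add: finite_tdeg)
  have comb: "(\<Sum>x\<in>e ` (A \<times> ?T). (\<lambda>i. const3 (f x) * x i)) j =
      (\<Sum>t\<in>?T. mon t (f (e (j, t))))" if "j \<in> A" for f j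
  proof -
    have "(\<Sum>x\<in>e ` (A \<times> ?T). (\<lambda>i. const3 (f x) * x i)) j = (\<Sum>x\<in>e ` (A \<times> ?T). const3 (f x) * x j)"
      by (rule sum_apply)
    also have "\<dots> = (\<Sum>y\<in>A \<times> ?T. const3 (f (e y)) * e y j)"
      by (subst sum.reindex) (auto intro: inj_on_subset[OF inj])
    also have "\<dots> = (\<Sum>i\<in>A. \<Sum>t\<in>?T. if i = j then mon t (f (e (j, t))) else 0)"
      unfolding sum.cartesian_product
      by (rule sum.cong) (auto simp: e_def mon_eq_const3_mult[of _ "f _"])
    also have "\<dots> = (\<Sum>i\<in>A. if i = j then (\<Sum>t\<in>?T. mon t (f (e (j, t)))) else 0)"
      by (rule sum.cong) auto
    finally show ?thesis
      using that by simp
  qed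
  show "v3.independent (e ` (A \<times> ?T))"
  proof (rule v3.independent_if_scalars_zero)
    fix f x assume 0: "(\<Sum>x\<in>e ` (A \<times> ?T). (\<lambda>i. const3 (f x) * x i)) = 0" and "x \<in> e ` (A \<times> ?T)"
    then obtain j t where x: "x = e (j, t)" "j \<in> A" "t \<in> ?T"
      by auto
    have "f (e (j, t)) = lk (\<Sum>t\<in>?T. mon t (f (e (j, t)))) t"
      using x by (simp add: lookup_sum_single finite_tdeg)
    also have "\<dots> = 0"
      using comb[OF x(2), of f] 0 by simp
    finally show "f x = 0"
      using x by simp
  qed (use fin in auto)
  show sub: "e ` (A \<times> ?T) \<subseteq> hspace3 A n"
    by (auto simp: e_def hspace3_def homogeneous3_single)
  show "hspace3 A n \<subseteq> v3.span (e ` (A \<times> ?T))"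
  proof
    fix v :: "3 \<Rightarrow> 'k poly3" assume v: "v \<in> hspace3 A n"
    define f where "f x = lk (v (fst (the_inv e x))) (snd (the_inv e x))" for x
    have f: "f (e (j, t)) = lk (v j) t" for j t
      by (simp add: f_def the_inv_f_f[OF inj])
    let ?w = "\<Sum>x\<in>e ` (A \<times> ?T). (\<lambda>i. const3 (f x) * x i)"
    have "?w \<in> v3.span (e ` (A \<times> ?T))"
      by (intro v3.span_sum v3.span_scale v3.span_base)
    moreover have "?w \<in> hspace3 A n"
      using sub hspace3_subspace by (intro v3.subspace_sum v3.subspace_scale) auto
    moreover have "v j = ?w j" if "j \<in> A" for j
    proof -
      have "?w j = (\<Sum>t\<in>?T. mon t (lk (v j) t))"
        using comb[OF that, of f] f by simp
      also have "\<dots> = (\<Sum>t\<in>ks (v j). mon t (lk (v j) t))"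
        using v by (intro sum.mono_neutral_right finite_tdeg) (auto simp: hspace3_def homogeneous3_iff in_keys_iff)
      finally show ?thesis
        using poly3_eq_sum_single[of "v j"] by simp
    qed
    moreover have "v j = ?w j" if "j \<notin> A" for j
      using that v calculation(2) by (simp add: hspace3_def)
    ultimately have "v = ?w"
      by blast
    then show "v \<in> v3.span (e ` (A \<times> ?T))"
      using \<open>?w \<in> v3.span (e ` (A \<times> ?T))\<close> by simp
  qed
  show "card (e ` (A \<times> ?T)) = card A * hdim n"
    by (simp add: card_image inj_on_subset[OF inj] hdim_def card_cartesian_product)
qed

lemma hspace3_fin_span: "v3.fin_span (hspace3 A n)"
  unfolding v3.fin_span_def using hspace3_basis(2)[of A n]
  by (intro exI conjI) (simp_all add: finite_tdeg)

lemma hspace3_dim: "v3.dim (hspace3 A n) = card A * hdim n"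
  using v3.basis_card_eq_dim[OF hspace3_basis(3,2,1)] hspace3_basis(4) by metis

lemma linear_component: "Vector_Spaces.linear (\<lambda>c v i. const3 c * v i) (\<lambda>c p. const3 c * p) (\<lambda>v. v j)"
  by unfold_locales (simp_all add: fun_eq_iff plus_fun_def const3_add const3_mult algebra_simps)

lemma hspace_eq_image: "hspace n = (\<lambda>v. v 0) ` hspace3 {0} n"
proof (intro equalityI subsetI)
  fix p :: "'a poly3" assume "p \<in> hspace n"
  then have "(\<lambda>i. if i = 0 then p else 0) \<in> hspace3 {0} n"
    by (simp add: hspace_def hspace3_def)
  then show "p \<in> (\<lambda>v. v 0) ` hspace3 {0} n"
    by (rule rev_image_eqI) simp
qed (auto simp: hspace_def hspace3_def)

lemma hspace_fin_span: "p3.fin_span (hspace n :: 'k::field poly3 set)"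
proof -
  interpret l: Vector_Spaces.linear "\<lambda>c v i. const3 c * v i" "\<lambda>c p. const3 c * p" "\<lambda>v. v (0::3)"
    by (rule linear_component)
  obtain B :: "(3 \<Rightarrow> 'k poly3) set" where "finite B" "hspace3 {0} n \<subseteq> v3.span B"
    using hspace3_fin_span v3.fin_span_def by blast
  then show ?thesis
    unfolding p3.fin_span_def hspace_eq_image
    by (intro exI[of _ "(\<lambda>v. v 0) ` B"]) (simp add: image_mono l.span_image)
qed

lemma hspace_dim: "p3.dim (hspace n :: 'k::field poly3 set) = hdim n"
proof -
  let ?U = "hspace3 {0} n :: (3 \<Rightarrow> 'k poly3) set"
  have "{v \<in> ?U. v 0 = 0} \<subseteq> {0}"
  proof
    fix v assume v: "v \<in> {v \<in> ?U. v 0 = 0}"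
    have "v i = 0" for i
      using v by (cases "i = 0") (simp_all add: hspace3_def)
    then show "v \<in> {0}"
      by (simp add: fun_eq_iff)
  qed
  then have "v3.dim {v \<in> ?U. v 0 = 0} = 0"
    using v3.dim_le_card[of "{v \<in> ?U. v 0 = 0}" "{}"] by simp
  moreover have "v3.dim ?U = v3.dim {v \<in> ?U. v 0 = 0} + p3.dim ((\<lambda>v. v 0) ` ?U)"
    by (rule vp.rank_nullity_fin[OF linear_component hspace3_subspace hspace3_fin_span])
  ultimately show ?thesis
    by (simp add: hspace3_dim flip: hspace_eq_image)
qed

section \<open>Filtrations of graded ideals\<close>

text \<open>A homogeneous ideal is represented by the family of its graded pieces.\<close>

definition graded_ideal :: "(nat \<Rightarrow> 'k::field poly3 set) \<Rightarrow> bool" where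
  "graded_ideal I \<longleftrightarrow>
    (\<forall>n. I n \<subseteq> hspace n \<and> 0 \<in> I n \<and> (\<forall>p\<in>I n. \<forall>q\<in>I n. p + q \<in> I n)) \<and>
    (\<forall>m n p q. homogeneous3 m q \<longrightarrow> p \<in> I n \<longrightarrow> q * p \<in> I (m + n))"

context
  fixes I :: "nat \<Rightarrow> 'k::field poly3 set"
  assumes I: "graded_ideal I"
begin

lemma graded_ideal_hom: "p \<in> I n \<Longrightarrow> homogeneous3 n p"
  using I by (auto simp: graded_ideal_def hspace_def)

lemma graded_ideal_0: "0 \<in> I n"
  using I by (auto simp: graded_ideal_def)

lemma graded_ideal_add: "p \<in> I n \<Longrightarrow> q \<in> I n \<Longrightarrow> p + q \<in> I n"
  using I by (auto simp: graded_ideal_def)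

lemma graded_ideal_mult: "homogeneous3 m q \<Longrightarrow> p \<in> I n \<Longrightarrow> q * p \<in> I (m + n)"
  using I by (auto simp: graded_ideal_def)

lemma graded_ideal_mult': "homogeneous3 m q \<Longrightarrow> p \<in> I n \<Longrightarrow> N = m + n \<Longrightarrow> q * p \<in> I N"
  using graded_ideal_mult by blast

lemma graded_ideal_const_mult: "p \<in> I n \<Longrightarrow> const3 c * p \<in> I n"
  by (rule graded_ideal_mult'[OF homogeneous3_const]) auto

lemma graded_ideal_uminus: "p \<in> I n \<Longrightarrow> - p \<in> I n"
  using graded_ideal_const_mult[of p n "-1"] by (simp add: const3_uminus)

lemma graded_ideal_diff: "p \<in> I n \<Longrightarrow> q \<in> I n \<Longrightarrow> p - q \<in> I n"
  using graded_ideal_add[OF _ graded_ideal_uminus] by (metis diff_conv_add_uminus)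

lemma graded_ideal_subspace: "p3.subspace (I n)"
  by (simp add: p3.subspace_def graded_ideal_0 graded_ideal_add graded_ideal_const_mult)

lemma graded_ideal_subset: "I n \<subseteq> hspace n"
  using I by (auto simp: graded_ideal_def)

lemma graded_ideal_fin_span: "p3.fin_span (I n)"
  using p3.fin_span_subset[OF hspace_fin_span graded_ideal_subset] .

lemma graded_ideal_const_mult_iff: "c \<noteq> 0 \<Longrightarrow> const3 c * p \<in> I n \<longleftrightarrow> p \<in> I n"
  using graded_ideal_const_mult[of "const3 c * p" n "inverse c"] graded_ideal_const_mult[of p n c]
  by (auto simp flip: const3_mult mult.assoc)

end

section \<open>Colon ideals and the adjunction of one form\<close>

definition colon_ideal :: "(nat \<Rightarrow> 'k::field poly3 set) \<Rightarrow> 'k poly3 \<Rightarrow> nat \<Rightarrow> nat \<Rightarrow> 'k poly3 set" where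
  "colon_ideal I a r n = {b. homogeneous3 n b \<and> b * a \<in> I (n + r)}"

lemma colon_ideal_graded: "graded_ideal I \<Longrightarrow> graded_ideal (colon_ideal I a r)"
  using graded_ideal_mult[of I]
  by (auto simp: graded_ideal_def[of "colon_ideal I a r"] colon_ideal_def hspace_def graded_ideal_0
      distrib_right graded_ideal_add homogeneous3_add homogeneous3_mult mult.assoc add.assoc)

lemma colon_ideal_superset:
  assumes "graded_ideal I" "homogeneous3 r a"
  shows "I n \<subseteq> colon_ideal I a r n"
  using graded_ideal_mult[OF assms] graded_ideal_hom[OF assms(1)]
  by (auto simp: colon_ideal_def mult.commute add.commute)

text \<open>The ideal I + (a). Below degree \<open>r\<close> the truncated \<open>n - r\<close> is 0
  and would admit constants as cofactors, hence the clause forcing \<open>b = 0\<close>.\<close>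

definition adjoin :: "(nat \<Rightarrow> 'k::field poly3 set) \<Rightarrow> 'k poly3 \<Rightarrow> nat \<Rightarrow> nat \<Rightarrow> 'k poly3 set" where
  "adjoin I a r n = {p + b * a | p b. p \<in> I n \<and> homogeneous3 (n - r) b \<and> (n < r \<longrightarrow> b = 0)}"

lemma adjoin_graded:
  fixes I :: "nat \<Rightarrow> 'k::field poly3 set"
  assumes "graded_ideal I" "homogeneous3 r a"
  shows "graded_ideal (adjoin I a r)"
  unfolding graded_ideal_def
proof (intro conjI allI impI ballI)
  fix n
  show "adjoin I a r n \<subseteq> hspace n"
  proof
    fix x assume "x \<in> adjoin I a r n"
    then obtain p b where x: "x = p + b * a" "p \<in> I n" "homogeneous3 (n - r) b" "n < r \<longrightarrow> b = 0"
      by (auto simp: adjoin_def)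
    have "homogeneous3 n (b * a)"
      using x(4) homogeneous3_mult[OF x(3) assms(2)] by (cases "n < r") auto
    then show "x \<in> hspace n"
      using x(1) graded_ideal_hom[OF assms(1) x(2)] by (auto simp: hspace_def intro: homogeneous3_add)
  qed
  show "0 \<in> adjoin I a r n"
    using graded_ideal_0[OF assms(1), of n] by (force simp: adjoin_def)
  fix x y assume "x \<in> adjoin I a r n" "y \<in> adjoin I a r n"
  then obtain p b q c where
    "x = p + b * a" "p \<in> I n" "homogeneous3 (n - r) b" "n < r \<longrightarrow> b = 0"
    "y = q + c * a" "q \<in> I n" "homogeneous3 (n - r) c" "n < r \<longrightarrow> c = 0"
    unfolding adjoin_def by blast
  then show "x + y \<in> adjoin I a r n"
    unfolding adjoin_def using graded_ideal_add[OF assms(1)] homogeneous3_add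
    by (intro CollectI exI[of _ "p + q"] exI[of _ "b + c"]) (auto simp: algebra_simps)
next
  fix m n and x q :: "'k poly3"
  assume q: "homogeneous3 m q" and "x \<in> adjoin I a r n"
  then obtain p b where x: "x = p + b * a" "p \<in> I n" "homogeneous3 (n - r) b" "n < r \<longrightarrow> b = 0"
    unfolding adjoin_def by blast
  have "homogeneous3 (m + n - r) (q * b)"
    using homogeneous3_mult[OF q x(3)] x(4) by (cases "n < r") auto
  then show "q * x \<in> adjoin I a r (m + n)"
    unfolding adjoin_def using graded_ideal_mult[OF assms(1) q x(2)] x
    by (intro CollectI exI[of _ "q * p"] exI[of _ "q * b"]) (auto simp: algebra_simps)
qed

lemma adjoin_superset: "I n \<subseteq> adjoin I a r n"
  unfolding adjoin_def by (force intro: exI[of _ 0])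

text \<open>These conditions say that \<open>(I : a)\<close> is the ideal of the point \<open>w\<close>, normalised by \<open>w i = 1\<close>.\<close>

definition eigen :: "(nat \<Rightarrow> 'k::field poly3 set) \<Rightarrow> 'k poly3 \<Rightarrow> nat \<Rightarrow> 3 \<Rightarrow> (3 \<Rightarrow> 'k) \<Rightarrow> bool" where
  "eigen I a r i w \<longleftrightarrow> homogeneous3 r a \<and> w i = 1 \<and> (\<forall>N. var3 i ^ N * a \<notin> I (N + r)) \<and>
     (\<forall>j. (var3 j - const3 (w j) * var3 i) * a \<in> I (Suc r))"

lemma eigen_eval_aux:
  "x * ((p - e * X) * a) + e * X * ((x - f * y) * a) = (x * p - f * e * (y * X)) * a"
  for x y e f X p a :: "'r::comm_ring_1"
  by (simp only: algebra_simps)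

text \<open>Modulo the colon ideal (I : a) each \<open>x_j\<close> equals \<open>w j\<close> times
  \<open>x_i\<close>; replacing the variables one after another turns a form \<open>b\<close> of
  degree \<open>n\<close> into \<open>b(w)\<close> times \<open>x_i^n\<close>.\<close>

lemma eigen_eval:
  assumes I: "graded_ideal I" and e: "eigen I a r i w" and "homogeneous3 n b"
  shows "(b - const3 (eval3 b w) * var3 i ^ n) * a \<in> I (n + r)"
  using assms(3)
proof (induction rule: homogeneous3_induct)
  case (const c)
  then show ?case
    by (simp add: graded_ideal_0[OF I])
next
  case (add n p q)
  then show ?case
    using graded_ideal_add[OF I add(3,4)] by (simp add: const3_add algebra_simps)
next
  case (var n p j)
  have "var3 j * ((p - const3 (eval3 p w) * var3 i ^ n) * a) \<in> I (Suc n + r)"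
    by (rule graded_ideal_mult'[OF I homogeneous3_var var(2)]) simp
  moreover have "const3 (eval3 p w) * var3 i ^ n * ((var3 j - const3 (w j) * var3 i) * a) \<in> I (Suc n + r)"
    using e by (intro graded_ideal_mult'[OF I homogeneous3_const_mult[OF homogeneous3_var_power]])
      (auto simp: eigen_def)
  ultimately have "var3 j * ((p - const3 (eval3 p w) * var3 i ^ n) * a) +
      const3 (eval3 p w) * var3 i ^ n * ((var3 j - const3 (w j) * var3 i) * a) \<in> I (Suc n + r)"
    by (rule graded_ideal_add[OF I])
  then show ?case
    by (simp only: eval3_simps const3_mult power_Suc eigen_eval_aux)
qed

text \<open>By \<open>eigen_eval\<close> only the scalar \<open>b(w)\<close> matters, and since no
  power of \<open>x_i\<close> multiplies \<open>a\<close> into \<open>I\<close>, this scalar has to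
  be 0.\<close>

lemma eigen_mult_mem_iff:
  assumes I: "graded_ideal I" and e: "eigen I a r i w" and b: "homogeneous3 n b"
  shows "b * a \<in> I (n + r) \<longleftrightarrow> eval3 b w = 0"
proof
  assume "eval3 b w = 0"
  then show "b * a \<in> I (n + r)"
    using eigen_eval[OF assms] by simp
next
  assume "b * a \<in> I (n + r)"
  from graded_ideal_diff[OF I this eigen_eval[OF assms]]
  have *: "const3 (eval3 b w) * (var3 i ^ n * a) \<in> I (n + r)"
    by (simp add: algebra_simps)
  show "eval3 b w = 0"
  proof (rule ccontr)
    assume "eval3 b w \<noteq> 0"
    then have "var3 i ^ n * a \<in> I (n + r)"
      using * graded_ideal_const_mult_iff[OF I] by blast
    then show False
      using e by (auto simp: eigen_def)
  qed
qed

text \<open>Modulo \<open>I n\<close> every multiple of \<open>a\<close> is a scalar multiple of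
  \<open>x_i^(n-r) a\<close>, and this element is not in \<open>I n\<close>.\<close>

lemma adjoin_dim:
  assumes I: "graded_ideal I" and e: "eigen I a r i w" and n: "r \<le> n"
  shows "p3.dim (adjoin I a r n) = Suc (p3.dim (I n))"
proof -
  define v where "v = var3 i ^ (n - r) * a"
  have a: "homogeneous3 r a"
    using e by (simp add: eigen_def)
  have "v \<notin> I n"
    using e n unfolding eigen_def v_def by (metis le_add_diff_inverse2)
  then have "v \<notin> p3.span (I n)"
    using graded_ideal_subspace[OF I] by (metis p3.span_eq_iff)
  then have 1: "p3.dim (insert v (I n)) = Suc (p3.dim (I n))"
    by (rule p3.dim_insert_fin[OF graded_ideal_fin_span[OF I]])
  have "v \<in> adjoin I a r n"
    unfolding adjoin_def v_def using graded_ideal_0[OF I, of n] n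
    by (intro CollectI exI[of _ 0] exI[of _ "var3 i ^ (n - r)"]) auto
  then have "insert v (I n) \<subseteq> adjoin I a r n"
    using adjoin_superset by blast
  moreover have "adjoin I a r n \<subseteq> p3.span (insert v (I n))"
  proof
    fix x assume "x \<in> adjoin I a r n"
    then obtain p b where x: "x = p + b * a" "p \<in> I n" "homogeneous3 (n - r) b"
      unfolding adjoin_def by blast
    have "(b - const3 (eval3 b w) * var3 i ^ (n - r)) * a \<in> I n"
      using eigen_eval[OF I e x(3)] n by simp
    then have "p + (b - const3 (eval3 b w) * var3 i ^ (n - r)) * a \<in> I n"
      using graded_ideal_add[OF I x(2)] by blast
    then have "p + (b - const3 (eval3 b w) * var3 i ^ (n - r)) * a + const3 (eval3 b w) * v
        \<in> p3.span (insert v (I n))"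
      by (intro p3.span_add p3.span_scale p3.span_base) auto
    then show "x \<in> p3.span (insert v (I n))"
      by (simp add: x v_def algebra_simps)
  qed
  ultimately have "p3.span (adjoin I a r n) = p3.span (insert v (I n))"
    by (metis p3.span_minimal p3.span_mono p3.subspace_span subset_antisym)
  then show ?thesis
    using 1 p3.span_eq_dim by metis
qed

section \<open>Eigenvectors for multiplication by a coordinate\<close>

lemma (in vspace) span_Un_image_lessThan:
  fixes k :: nat
  assumes "subspace U" "x \<in> span (U \<union> v ` {..<k})"
  shows "\<exists>c. x - (\<Sum>l<k. scale (c l) (v l)) \<in> U"
  using assms(2)
proof (induction k arbitrary: x)
  case 0
  then show ?case
    using assms(1) by (simp add: span_eq_iff[THEN iffD2])
next
  case (Suc k)
  have "U \<union> v ` {..<Suc k} = insert (v k) (U \<union> v ` {..<k})"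
    by (auto simp: lessThan_Suc)
  then obtain d where "x - scale d (v k) \<in> span (U \<union> v ` {..<k})"
    using Suc.prems span_breakdown_eq by auto
  from Suc.IH[OF this] obtain c where c: "x - scale d (v k) - (\<Sum>l<k. scale (c l) (v l)) \<in> U"
    by blast
  have "(\<Sum>l<k. scale ((c(k := d)) l) (v l)) = (\<Sum>l<k. scale (c l) (v l))"
    by (rule sum.cong) auto
  then have "x - (\<Sum>l<Suc k. scale ((c(k := d)) l) (v l)) = x - scale d (v k) - (\<Sum>l<k. scale (c l) (v l))"
    by (simp add: algebra_simps)
  then show ?case
    using c by metis
qed

text \<open>The binary form of degree \<open>N\<close> in \<open>x\<^sub>i\<close> and \<open>x\<^sub>j\<close> whose dehomogenisation is the given polynomial.\<close>

definition binary_form :: "3 \<Rightarrow> 3 \<Rightarrow> nat \<Rightarrow> 'k::field poly \<Rightarrow> 'k poly3" where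
  "binary_form i j N f = (\<Sum>l\<le>N. const3 (coeff f l) * (var3 j ^ l * var3 i ^ (N - l)))"

lemma homogeneous3_binary:
  "homogeneous3 (l + m) (var3 j ^ l * var3 i ^ m :: 'k::comm_semiring_1 poly3)"
  by (intro homogeneous3_mult homogeneous3_var_power)

lemma binary_form_homogeneous: "homogeneous3 N (binary_form i j N f)"
  unfolding binary_form_def
proof (intro homogeneous3_sum homogeneous3_const_mult)
  fix l assume "l \<in> {..N}"
  then show "homogeneous3 N (var3 j ^ l * var3 i ^ (N - l) :: 'a poly3)"
    using homogeneous3_binary[of l "N - l" j i] by simp
qed

lemma binary_form_Suc:
  assumes "degree f \<le> N"
  shows "binary_form i j (Suc N) f = var3 i * binary_form i j N f"
proof -
  have "coeff f (Suc N) = 0"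
    using assms by (simp add: coeff_eq_0)
  then have "binary_form i j (Suc N) f = (\<Sum>l\<le>N. const3 (coeff f l) * (var3 j ^ l * var3 i ^ (Suc N - l)))"
    by (simp add: binary_form_def)
  also have "\<dots> = (\<Sum>l\<le>N. var3 i * (const3 (coeff f l) * (var3 j ^ l * var3 i ^ (N - l))))"
    by (rule sum.cong) (auto simp: Suc_diff_le)
  finally show ?thesis
    by (simp add: binary_form_def sum_distrib_left)
qed

lemma binary_form_add_exponent:
  "degree f \<le> N \<Longrightarrow> binary_form i j (M + N) f = var3 i ^ M * binary_form i j N f"
  by (induction M) (simp_all add: binary_form_Suc mult.assoc)

lemma binary_form_diff: "binary_form i j N (f - g) = binary_form i j N f - binary_form i j N g"
  by (simp add: binary_form_def const3_diff left_diff_distrib sum_subtractf)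

lemma binary_form_smult: "binary_form i j N (Polynomial.smult c f) = const3 c * binary_form i j N f"
  by (simp only: binary_form_def coeff_smult const3_mult mult.assoc sum_distrib_left)

lemma binary_form_pCons_0: "binary_form i j (Suc N) (pCons 0 f) = var3 j * binary_form i j N f"
  unfolding binary_form_def
  by (subst sum.atMost_Suc_shift) (simp add: sum_distrib_left ac_simps)

lemma binary_form_linear_mult:
  assumes "degree g \<le> N"
  shows "binary_form i j (Suc N) ([:- c, 1:] * g) = (var3 j - const3 c * var3 i) * binary_form i j N g"
proof -
  have "[:- c, 1:] * g = pCons 0 g - Polynomial.smult c g"
    by simp
  then show ?thesis
    by (simp only: binary_form_diff binary_form_smult binary_form_pCons_0 binary_form_Suc[OF assms]
        left_diff_distrib mult.assoc)
qed

text \<open>Over an algebraically closed field \<open>f\<close> splits into linear factors. Factors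
  \<open>x_j - c x_i\<close> are peeled off until the cofactor is no longer multiplied into
  \<open>I\<close> by any power of \<open>x_i\<close>; that cofactor is the eigenvector. The process
  stops before degree 0, where a power of \<open>x_i\<close> itself would lie in
  \<open>I\<close>.\<close>

lemma binary_form_eigenvector:
  fixes I :: "nat \<Rightarrow> 'k::alg_closed_field poly3 set"
  assumes I: "graded_ideal I" and i: "\<And>N. var3 i ^ N \<notin> I N"
    and "f \<noteq> 0" "degree f \<le> N" "binary_form i j N f \<in> I N"
  shows "\<exists>a r c. homogeneous3 r a \<and> (\<forall>M. var3 i ^ M * a \<notin> I (M + r)) \<and>
    (var3 j - const3 c * var3 i) * a \<in> I (Suc r)"
  using assms(3-5)
proof (induction "degree f" arbitrary: f N)
  case 0
  then obtain d where d: "f = [:d:]" "d \<noteq> 0"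
    by (metis degree_0_id pCons_0_0)
  have "binary_form i j N f = (\<Sum>l\<le>N. if l = 0 then const3 d * var3 i ^ N else 0)"
    unfolding binary_form_def d by (rule sum.cong) (auto simp: coeff_pCons split: nat.splits)
  then have "const3 d * var3 i ^ N \<in> I N"
    using "0.prems" by simp
  then show ?case
    using graded_ideal_const_mult_iff[OF I d(2)] i by blast
next
  case (Suc e)
  then obtain c where "poly f c = 0"
    using alg_closed_imp_poly_has_root[of f] by auto
  then obtain g where g: "f = [:- c, 1:] * g"
    by (auto simp: poly_eq_0_iff_dvd elim: dvdE)
  have "g \<noteq> 0"
    using g Suc.prems by auto
  then have deg: "degree f = Suc (degree g)"
    unfolding g by (subst degree_mult_eq) auto
  obtain N' where N: "N = Suc N'"
    using Suc by (cases N) auto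
  have dg: "degree g \<le> N'"
    using deg N Suc.prems by simp
  have mem: "(var3 j - const3 c * var3 i) * binary_form i j N' g \<in> I (Suc N')"
    using Suc.prems(3) unfolding N g binary_form_linear_mult[OF dg] .
  show ?case
  \<comment> \<open>A power of \<open>x_i\<close> in front of the form is absorbed into its formal
    degree, so the induction hypothesis applies to \<open>g\<close> with \<open>M + N'\<close> in
    place of \<open>N\<close>.\<close>
  proof (cases "\<exists>M. var3 i ^ M * binary_form i j N' g \<in> I (M + N')")
    case True
    then obtain M where "binary_form i j (M + N') g \<in> I (M + N')"
      using binary_form_add_exponent[OF dg] by metis
    then show ?thesis
      using Suc.hyps(1)[of g "M + N'"] Suc.hyps(2) deg dg \<open>g \<noteq> 0\<close> by simp
  next
    case False
    then show ?thesis
      using mem binary_form_homogeneous by blast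
  qed
qed

text \<open>This is the existence of an eigenvalue of \<open>x_j / x_i\<close> on the
  finite-dimensional quotient obtained by inverting \<open>x_i\<close>: the monomials in
  \<open>x_i\<close> and \<open>x_j\<close> of one large degree are linearly dependent modulo
  \<open>I\<close>, and the relation plays the part of an annihilating polynomial.\<close>

lemma exists_eigenvector:
  fixes I :: "nat \<Rightarrow> 'k::alg_closed_field poly3 set"
  assumes I: "graded_ideal I" and i: "\<And>N. var3 i ^ N \<notin> I N"
    and bound: "\<And>n. N0 \<le> n \<Longrightarrow> hdim n \<le> p3.dim (I n) + B"
  shows "\<exists>a r c. homogeneous3 r a \<and> (\<forall>M. var3 i ^ M * a \<notin> I (M + r)) \<and>
    (var3 j - const3 c * var3 i) * a \<in> I (Suc r)"
proof -
  \<comment> \<open>At least \<open>N0\<close> so that the codimension bound holds, and at least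
    \<open>B\<close> so that the exponents \<open>N - l\<close> with \<open>l \<le> B\<close> are
    not truncated.\<close>
  define N where "N = max N0 B"
  define v :: "nat \<Rightarrow> 'k poly3" where "v l = var3 j ^ l * var3 i ^ (N - l)" for l
  have "\<exists>k\<le>B. v k \<in> p3.span (I N \<union> v ` {..<k})"
  proof (rule p3.dependent_modulo[OF hspace_subspace hspace_fin_span graded_ideal_subset[OF I]])
    show "v l \<in> hspace N" if "l \<le> B" for l
      using homogeneous3_binary[of l "N - l" j i] that
      by (simp add: v_def hspace_def N_def)
    show "p3.dim (hspace N :: 'k poly3 set) \<le> p3.dim (I N) + B"
      using bound[of N] by (simp add: hspace_dim N_def)
  qed
  then obtain k where k: "k \<le> B" "v k \<in> p3.span (I N \<union> v ` {..<k})"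
    by blast
  from p3.span_Un_image_lessThan[OF graded_ideal_subspace[OF I] this(2)]
  obtain c where c: "v k - (\<Sum>l<k. const3 (c l) * v l) \<in> I N"
    by blast
  define f where "f = monom 1 k - (\<Sum>l<k. monom (c l) l)"
  have cf: "coeff f l = (if l = k then 1 else if l < k then - c l else 0)" for l
    by (auto simp: f_def coeff_sum)
  have "k \<le> N"
    using k by (simp add: N_def)
  have "f \<noteq> 0"
    using cf[of k] by auto
  moreover have "degree f \<le> N"
    using cf \<open>k \<le> N\<close> by (intro degree_le) auto
  moreover have "binary_form i j N f = v k - (\<Sum>l<k. const3 (c l) * v l)"
  proof -
    have "binary_form i j N f = (\<Sum>l\<le>k. const3 (coeff f l) * v l)"
      unfolding binary_form_def v_def
      using \<open>k \<le> N\<close> by (intro sum.mono_neutral_right) (auto simp: cf)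
    also have "\<dots> = v k + (\<Sum>l<k. const3 (coeff f l) * v l)"
      by (simp add: cf lessThan_Suc_atMost[symmetric])
    also have "(\<Sum>l<k. const3 (coeff f l) * v l) = (\<Sum>l<k. - (const3 (c l) * v l))"
      by (rule sum.cong) (auto simp: cf const3_uminus)
    finally show ?thesis
      by (simp add: sum_negf)
  qed
  ultimately show ?thesis
    using binary_form_eigenvector[OF I i, of f N j] c by simp
qed

text \<open>A simultaneous eigenvector, built one variable at a time: after \<open>a\<close> has
  been found, the search continues in (I : a). This ideal contains \<open>I\<close>, so the same
  codimension bound \<open>B\<close> holds, and the relations already obtained survive
  multiplication by the new factor.\<close>

lemma exists_eigen:
  fixes I :: "nat \<Rightarrow> 'k::alg_closed_field poly3 set"
  assumes I: "graded_ideal I" and i: "\<And>N. var3 i ^ N \<notin> I N"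
    and bound: "\<And>n. N0 \<le> n \<Longrightarrow> hdim n \<le> p3.dim (I n) + B"
  shows "\<exists>a r w. eigen I a r i w"
proof -
  have "\<exists>a r w. homogeneous3 r a \<and> (\<forall>N. var3 i ^ N * a \<notin> I (N + r)) \<and>
      (\<forall>j\<in>A. (var3 j - const3 (w j) * var3 i) * a \<in> I (Suc r))" if "finite A" for A :: "3 set"
    using that
  proof (induction A)
    case empty
    show ?case
      using i by (intro exI[of _ 1] exI[of _ 0]) simp
  next
    case (insert j A)
    then obtain a r w where a: "homogeneous3 r a" "\<And>N. var3 i ^ N * a \<notin> I (N + r)"
      "\<And>j. j \<in> A \<Longrightarrow> (var3 j - const3 (w j) * var3 i) * a \<in> I (Suc r)"
      by blast
    let ?Q = "colon_ideal I a r"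
    have "\<exists>a' r' c. homogeneous3 r' a' \<and> (\<forall>M. var3 i ^ M * a' \<notin> ?Q (M + r')) \<and>
        (var3 j - const3 c * var3 i) * a' \<in> ?Q (Suc r')"
    proof (rule exists_eigenvector[OF colon_ideal_graded[OF I]])
      show "var3 i ^ N \<notin> ?Q N" for N
        using a(2) by (simp add: colon_ideal_def)
      fix n assume "N0 \<le> n"
      have "p3.dim (I n) \<le> p3.dim (?Q n)"
        using colon_ideal_superset[OF I a(1)] p3.span_superset
        by (intro p3.dim_mono_fin graded_ideal_fin_span colon_ideal_graded I) blast
      then show "hdim n \<le> p3.dim (?Q n) + B"
        using bound[OF \<open>N0 \<le> n\<close>] by simp
    qed
    then obtain a' r' c where a': "homogeneous3 r' a'" "\<And>M. var3 i ^ M * a' \<notin> ?Q (M + r')"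
      "(var3 j - const3 c * var3 i) * a' \<in> ?Q (Suc r')"
      by blast
    have "homogeneous3 (r' + r) (a' * a)"
      using a a' by (intro homogeneous3_mult)
    moreover have "var3 i ^ N * (a' * a) \<notin> I (N + (r' + r))" for N
      using a'(2)[of N] homogeneous3_mult[OF homogeneous3_var_power a'(1), of N i]
      by (simp add: colon_ideal_def mult.assoc add.assoc)
    moreover have "(var3 l - const3 ((w(j := c)) l) * var3 i) * (a' * a) \<in> I (Suc (r' + r))"
      if "l \<in> insert j A" for l
    proof (cases "l = j")
      case True
      then show ?thesis
        using a'(3) by (simp add: colon_ideal_def mult.assoc)
    next
      case False
      then have "a' * ((var3 l - const3 (w l) * var3 i) * a) \<in> I (Suc (r' + r))"
        using that by (intro graded_ideal_mult'[OF I a'(1) a(3)]) auto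
      then show ?thesis
        using False by (simp add: algebra_simps)
    qed
    ultimately show ?case
      by blast
  qed
  from this[of UNIV] obtain a r w where a: "homogeneous3 r a" "\<And>N. var3 i ^ N * a \<notin> I (N + r)"
    "\<And>j. (var3 j - const3 (w j) * var3 i) * a \<in> I (Suc r)"
    by auto
  \<comment> \<open>Resetting the coordinate \<open>w i\<close> to 1 makes the relation for
    \<open>j = i\<close> trivial and normalises the point.\<close>
  have "(var3 j - const3 ((w(i := 1)) j) * var3 i) * a \<in> I (Suc r)" for j
    using a(3)[of j] graded_ideal_0[OF I] by (cases "j = i") auto
  then have "eigen I a r i (w(i := 1))"
    using a by (simp add: eigen_def)
  then show ?thesis
    by blast
qed

section \<open>Finite filtrations of an ideal of finite codimension\<close>

lemma var3_power: "var3 i ^ n = mon (Poly_Mapping.single i n) (1 :: 'k::comm_semiring_1)"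
  by (induction n) (simp_all add: var3_def mult_single flip: single_add)

text \<open>Pigeonhole on exponents: a monomial whose degree is the sum of the \<open>N i\<close>
  has some exponent at least \<open>N i\<close>.\<close>

lemma graded_ideal_full_if_powers:
  fixes I :: "nat \<Rightarrow> 'k::field poly3 set"
  assumes I: "graded_ideal I" and pow: "\<And>i. var3 i ^ N i \<in> I (N i)"
  shows "I (\<Sum>i\<in>UNIV. N i) = hspace (\<Sum>i\<in>UNIV. N i)"
proof
  let ?n = "\<Sum>i\<in>UNIV. N i"
  show "hspace ?n \<subseteq> I ?n"
  proof
    fix p :: "'k poly3" assume p: "p \<in> hspace ?n"
    have "mon t (lk p t) \<in> I ?n" if "t \<in> ks p" for t
    proof -
      have "tdeg t = ?n"
        using p that by (simp add: hspace_def homogeneous3_iff in_keys_iff)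
      then have "\<exists>i. N i \<le> lk t i"
        using sum_strict_mono[of UNIV "lk t" N] unfolding tdeg_def by (force simp: not_le)
      then obtain i where i: "N i \<le> lk t i"
        by (elim exE)
      define s where "s = t - Poly_Mapping.single i (N i)"
      have t: "t = s + Poly_Mapping.single i (N i)"
        using i by (auto simp: s_def lookup_add lookup_minus lookup_single when_def intro!: poly_mapping_eqI)
      have "mon t (lk p t) = mon s (lk p t) * var3 i ^ N i"
        by (simp add: var3_power mult_single flip: t)
      moreover have "mon s (lk p t) * var3 i ^ N i \<in> I ?n"
        using \<open>tdeg t = ?n\<close> t
        by (intro graded_ideal_mult'[OF I homogeneous3_single[OF refl] pow]) (simp add: tdeg_add)
      ultimately show ?thesis
        by simp
    qed
    then have "(\<Sum>t\<in>ks p. mon t (lk p t)) \<in> I ?n"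
      by (intro p3.subspace_sum[OF graded_ideal_subspace[OF I]])
    then show "p \<in> I ?n"
      using poly3_eq_sum_single[of p] by simp
  qed
qed (rule graded_ideal_subset[OF I])

lemma graded_ideal_full_mono:
  fixes I :: "nat \<Rightarrow> 'k::field poly3 set"
  assumes I: "graded_ideal I" and "I n = hspace n" "n \<le> m"
  shows "I m = hspace m"
  using assms(3)
proof (induction m rule: dec_induct)
  case (step m)
  have "var3 i * p \<in> I (Suc m)" if "homogeneous3 m p" for i p
    using that step.IH by (intro graded_ideal_mult'[OF I homogeneous3_var]) (auto simp: hspace_def)
  have "p \<in> I N" if "homogeneous3 N p" "N = Suc m" for N p
    using that
  proof (induction rule: homogeneous3_induct)
    case (add n p q)
    then show ?case
      by (intro graded_ideal_add[OF I]) auto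
  next
    case (var n p i)
    then show ?case
      using step.IH by (intro graded_ideal_mult'[OF I homogeneous3_var, of p m]) (auto simp: hspace_def)
  qed simp
  then show ?case
    using graded_ideal_subset[OF I] by (auto simp: hspace_def)
qed (rule assms(2))

text \<open>\<open>ip s\<close> is the chart and \<open>wp s\<close> the normalised coordinate
  vector of the point at which step \<open>s\<close> happens. Recording the point lets the steps be
  sorted by points later.\<close>

definition filtration ::
    "(nat \<Rightarrow> 'k::field poly3 set) \<Rightarrow> nat \<Rightarrow> (nat \<Rightarrow> nat \<Rightarrow> 'k poly3 set) \<Rightarrow> (nat \<Rightarrow> 3) \<Rightarrow> (nat \<Rightarrow> 3 \<Rightarrow> 'k) \<Rightarrow> bool" where
  "filtration J t I ip wp \<longleftrightarrow> I 0 = J \<and> (\<forall>s\<le>t. graded_ideal (I s)) \<and>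
     (\<forall>s<t. \<exists>a r. eigen (I s) a r (ip s) (wp s) \<and> I (Suc s) = adjoin (I s) a r) \<and>
     (\<exists>N. \<forall>n\<ge>N. I t n = hspace n)"

text \<open>Unless some power of every variable, and hence every form of high degree, is in
  \<open>J\<close>, an eigenvector exists; adjoining it lowers the eventual codimension bound
  \<open>B\<close> by one.\<close>

lemma exists_filtration:
  fixes J :: "nat \<Rightarrow> 'k::alg_closed_field poly3 set"
  assumes "graded_ideal J" "\<And>n. N0 \<le> n \<Longrightarrow> hdim n \<le> p3.dim (J n) + B"
  shows "\<exists>t I ip wp. filtration J t I ip wp"
  using assms
proof (induction B arbitrary: J N0 rule: less_induct)
  case (less B)
  note J = less.prems(1)
  show ?case
  proof (cases "\<exists>n. J n = hspace n")
    case True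
    then have "\<exists>N. \<forall>n\<ge>N. J n = hspace n"
      using graded_ideal_full_mono[OF J] by blast
    then have "filtration J 0 (\<lambda>_. J) (\<lambda>_. 0) (\<lambda>_ _. 0)"
      using J by (simp add: filtration_def)
    then show ?thesis
      by blast
  next
    case False
    have "\<exists>i. \<forall>N. var3 i ^ N \<notin> J N"
      using graded_ideal_full_if_powers[OF J] False by metis
    then obtain i a r w where e: "eigen J a r i w"
      using exists_eigen[OF J _ less.prems(2)] by metis
    have J': "graded_ideal (adjoin J a r)"
      using e by (intro adjoin_graded J) (simp add: eigen_def)
    have dim: "p3.dim (adjoin J a r n) = Suc (p3.dim (J n))" if "r \<le> n" for n
      using adjoin_dim[OF J e that] .
    \<comment> \<open>With \<open>B = 0\<close> the bound in degree \<open>N0\<close> would make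
      \<open>J N0\<close> the full space, against the case assumption; so \<open>B - 1\<close> is a
      genuine decrease.\<close>
    have "0 < B"
    proof (rule ccontr)
      assume "\<not> 0 < B"
      then have "p3.dim (hspace N0 :: 'k poly3 set) \<le> p3.dim (J N0)"
        using less.prems(2)[of N0] by (simp add: hspace_dim)
      then have "J N0 = hspace N0"
        using p3.subspace_eqI_dim[OF graded_ideal_subspace[OF J] graded_ideal_subset[OF J] hspace_fin_span]
        by blast
      then show False
        using False by blast
    qed
    have "hdim n \<le> p3.dim (adjoin J a r n) + (B - 1)" if "max N0 r \<le> n" for n
      using less.prems(2)[of n] dim[of n] that \<open>0 < B\<close> by simp
    then have "\<exists>t I ip wp. filtration (adjoin J a r) t I ip wp"
      using \<open>0 < B\<close> by (intro less.IH[OF _ J', of "B - 1" "max N0 r"]) auto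
    then obtain t I ip wp where F: "filtration (adjoin J a r) t I ip wp"
      by blast
    have "filtration J (Suc t) (case_nat J I) (case_nat i ip) (case_nat w wp)"
      unfolding filtration_def
    proof (intro conjI allI impI)
      fix s assume "s \<le> Suc t"
      then show "graded_ideal (case_nat J I s)"
        using F J by (auto simp: filtration_def split: nat.split)
    next
      fix s assume "s < Suc t"
      then show "\<exists>a r. eigen (case_nat J I s) a r (case_nat i ip s) (case_nat w wp s) \<and>
          case_nat J I (Suc s) = adjoin (case_nat J I s) a r"
        using F e by (cases s) (auto simp: filtration_def)
    qed (use F in \<open>auto simp: filtration_def\<close>)
    then show ?thesis
      by blast
  qed
qed

text \<open>Every step adds one dimension from the degree of its eigenvector on, and the last ideal
  is everything in high degree; so the number of steps is the eventual codimension of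
  \<open>J\<close>.\<close>

lemma filtration_dim:
  fixes J :: "nat \<Rightarrow> 'k::field poly3 set"
  assumes F: "filtration J t I ip wp"
  shows "\<exists>N. \<forall>n\<ge>N. hdim n = p3.dim (J n) + t"
proof -
  have "\<exists>N. \<forall>n\<ge>N. p3.dim (I s n) = p3.dim (J n) + s" if "s \<le> t" for s
    using that
  proof (induction s)
    case 0
    then show ?case
      using F by (simp add: filtration_def)
  next
    case (Suc s)
    then obtain N where N: "\<And>n. N \<le> n \<Longrightarrow> p3.dim (I s n) = p3.dim (J n) + s"
      by auto
    have "\<exists>a r. eigen (I s) a r (ip s) (wp s) \<and> I (Suc s) = adjoin (I s) a r"
      using F Suc_le_lessD[OF Suc.prems] by (simp add: filtration_def)
    then obtain a r where ar: "eigen (I s) a r (ip s) (wp s)" "I (Suc s) = adjoin (I s) a r"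
      by blast
    have "graded_ideal (I s)"
      using F Suc.prems by (simp add: filtration_def)
    then have "p3.dim (I (Suc s) n) = p3.dim (J n) + Suc s" if "max N r \<le> n" for n
      using adjoin_dim[OF _ ar(1), of n] N[of n] that ar(2) by simp
    then show ?case
      by blast
  qed
  from this[of t] obtain N where N: "\<And>n. N \<le> n \<Longrightarrow> p3.dim (I t n) = p3.dim (J n) + t"
    by auto
  obtain N' where "\<And>n. N' \<le> n \<Longrightarrow> I t n = hspace n"
    using F by (auto simp: filtration_def)
  then have "hdim n = p3.dim (J n) + t" if "max N N' \<le> n" for n
    using N[of n] that hspace_dim[of n] by (metis max.boundedE)
  then show ?thesis
    by blast
qed

section \<open>Syzygies of the gradient\<close>

text \<open>In a finite field, one plus the product of all \<open>X - a\<close> would be nonconstant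
  and without roots.\<close>

lemma infinite_UNIV_alg_closed: "infinite (UNIV :: 'k::alg_closed_field set)"
proof
  assume fin: "finite (UNIV :: 'k set)"
  define f :: "'k poly" where "f = (\<Prod>a\<in>UNIV. [:- a, 1:])"
  have "degree f = card (UNIV :: 'k set)"
    unfolding f_def by (subst degree_prod_eq_sum_degree) auto
  then have "degree (f + 1) > 0"
    using fin by (subst degree_add_eq_left) (auto simp: card_gt_0_iff)
  then obtain x where "poly (f + 1) x = 0"
    using alg_closed_imp_poly_has_root by blast
  moreover have "poly f x = 0"
    unfolding f_def poly_prod using fin by (intro prod_zero bexI[of _ x]) auto
  ultimately show False
    by simp
qed

subsection \<open>Families without common factor\<close>

definition coprime_family :: "('i \<Rightarrow> 'k::field poly3) \<Rightarrow> bool" where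
  "coprime_family u \<longleftrightarrow> (\<forall>q. prime_elem q \<longrightarrow> (\<exists>j. \<not> q dvd u j))"

lemma coprime_familyI:
  assumes "\<And>q. prime_elem q \<Longrightarrow> (\<And>j. q dvd u j) \<Longrightarrow> False"
  shows "coprime_family u"
  unfolding coprime_family_def
proof (intro allI impI, rule ccontr)
  fix q assume q: "prime_elem q" and "\<not> (\<exists>j. \<not> q dvd u j)"
  then have "\<forall>j. q dvd u j"
    by (simp only: not_ex not_not simp_thms)
  then show False
    by (intro assms[OF q]) (rule spec)
qed

text \<open>Prime factors of \<open>c\<close> are cancelled one by one: such a prime divides every
  \<open>b * u j\<close> but misses some \<open>u j\<close>, hence divides \<open>b\<close>. The
  degree of \<open>c\<close> drops until \<open>c\<close> is a unit.\<close>

lemma coprime_family_proportional: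
  fixes u w :: "'i \<Rightarrow> 'k::field poly3"
  assumes u: "coprime_family u" and "c \<noteq> 0" "\<And>j. c * w j = b * u j"
  obtains l where "\<And>j. w j = l * u j"
proof -
  have "\<exists>l. \<forall>j. w j = l * u j"
    using assms(2,3)
  proof (induction "deg3 c" arbitrary: b c rule: less_induct)
    case less
    show ?case
    proof (cases "c dvd 1")
      case True
      then obtain c' where c': "1 = c * c'"
        by (elim dvdE)
      have "w j = c' * b * u j" for j
      proof -
        have "w j = c' * (c * w j)"
          using c' by (simp add: mult.commute mult.left_commute flip: mult.assoc)
        then show ?thesis
          using less.prems(2)[of j] by (simp add: mult.assoc)
      qed
      then show ?thesis
        by blast
    next
      case False
      obtain q where q: "prime_elem q" "q dvd c"
        using exists_prime_elem_divisor3[OF less.prems(1) False] .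
      obtain c' where c': "c = q * c'"
        using q(2) by (elim dvdE)
      obtain j where j: "\<not> q dvd u j"
        using u q(1) by (auto simp: coprime_family_def)
      have "q dvd b * u j"
        using less.prems(2)[of j] q(2) by (metis dvd_mult2)
      then have "q dvd b"
        using q(1) j by (auto simp: prime_elem_dvd_mult_iff)
      then obtain b' where b': "b = q * b'"
        by (elim dvdE)
      have "q \<noteq> 0" "c' \<noteq> 0"
        using less.prems(1) c' by auto
      have "deg3 q \<noteq> 0"
        using q(1) is_unit_iff_deg3[of q] by (auto simp: prime_elem_def)
      then have "deg3 c' < deg3 c"
        using deg3_mult[OF \<open>q \<noteq> 0\<close> \<open>c' \<noteq> 0\<close>] c' by simp
      moreover have "c' * w j = b' * u j" for j
        using less.prems(2)[of j] \<open>q \<noteq> 0\<close> by (simp add: c' b' mult.assoc)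
      ultimately show ?thesis
        using less.hyps \<open>c' \<noteq> 0\<close> by blast
    qed
  qed
  then show ?thesis
    using that by blast
qed

text \<open>The factor \<open>l\<close> is not known to be homogeneous; its component of degree
  \<open>n\<close> does the same job by comparison of degrees.\<close>

lemma homogeneous_quotient:
  fixes u w :: "'i \<Rightarrow> 'k::field poly3"
  assumes "\<And>j. w j = l * u j" "\<And>j. homogeneous3 m (u j)" "\<And>j. homogeneous3 (n + m) (w j)"
  shows "\<exists>l'. homogeneous3 n l' \<and> (\<forall>j. w j = l' * u j)"
proof (intro exI conjI allI)
  show "homogeneous3 n (hcomp n l)"
    by (rule hcomp_homogeneous)
  fix j
  have "hcomp (n + m) (w j) = hcomp n l * u j"
    using hcomp_mult_homogeneous[OF assms(2)] assms(1) by metis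
  moreover have "hcomp (n + m) (w j) = w j"
    using assms(3)[of j] by (intro poly_mapping_eqI) (auto simp: lookup_hcomp homogeneous3_iff when_def)
  ultimately show "w j = hcomp n l * u j"
    by simp
qed

subsection \<open>Cross products\<close>

definition dot3 :: "(3 \<Rightarrow> 'r::comm_ring_1) \<Rightarrow> (3 \<Rightarrow> 'r) \<Rightarrow> 'r" where
  "dot3 a b = (\<Sum>i\<in>UNIV. a i * b i)"

definition cross3 :: "(3 \<Rightarrow> 'r::comm_ring_1) \<Rightarrow> (3 \<Rightarrow> 'r) \<Rightarrow> 3 \<Rightarrow> 'r" where
  "cross3 a b i = (if i = 0 then a 1 * b 2 - a 2 * b 1
     else if i = 1 then a 2 * b 0 - a 0 * b 2 else a 0 * b 1 - a 1 * b 0)"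

lemma cross3_simps [simp]:
  "cross3 a b 0 = a 1 * b 2 - a 2 * b 1"
  "cross3 a b 1 = a 2 * b 0 - a 0 * b 2"
  "cross3 a b 2 = a 0 * b 1 - a 1 * b 0"
  by (simp_all add: cross3_def)

lemma dot3_eq: "dot3 a b = a 0 * b 0 + a 1 * b 1 + a 2 * b 2"
  by (simp add: dot3_def sum_UNIV_3)

lemma cross3_cross3: "cross3 x (cross3 y z) i = y i * dot3 x z - z i * dot3 x y"
  using exhaust_index3[of i]
  by (elim disjE) (simp_all only: cross3_simps dot3_eq algebra_simps)

lemma dot3_cross3: "dot3 (cross3 a b) b = 0"
  by (simp add: dot3_eq algebra_simps)

lemma cross3_eq_0D:
  assumes "\<And>i. cross3 a b i = 0"
  shows "a i * b j = b i * a j"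
proof -
  have "a 1 * b 2 = a 2 * b 1" "a 2 * b 0 = a 0 * b 2" "a 0 * b 1 = a 1 * b 0"
    using assms[of 0] assms[of 1] assms[of 2] by simp_all
  then show ?thesis
    using exhaust_index3[of i] exhaust_index3[of j] by (auto simp: mult.commute)
qed

lemma cross3_eq_0_proportional:
  fixes a b :: "3 \<Rightarrow> 'k::field poly3"
  assumes "coprime_family a" "a \<noteq> (\<lambda>i. 0)" "\<And>i. cross3 a b i = 0"
  obtains l where "\<And>j. b j = l * a j"
proof -
  obtain i where "a i \<noteq> 0"
    using assms(2) by auto
  then show ?thesis
    using coprime_family_proportional[OF assms(1), of "a i" b "b i"] cross3_eq_0D[OF assms(3)] that
    by blast
qed

lemma homogeneous3_cross:
  fixes a b :: "3 \<Rightarrow> 'k::field poly3"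
  assumes "\<And>i. homogeneous3 n (a i)" "\<And>i. homogeneous3 m (b i)"
  shows "homogeneous3 (n + m) (cross3 a b i)"
  unfolding cross3_def using assms by (auto intro!: homogeneous3_diff homogeneous3_mult)

lemma homogeneous3_dot:
  fixes a b :: "3 \<Rightarrow> 'k::field poly3"
  assumes "\<And>i. homogeneous3 n (a i)" "\<And>i. homogeneous3 m (b i)"
  shows "homogeneous3 (n + m) (dot3 a b)"
  unfolding dot3_def using assms by (intro homogeneous3_sum homogeneous3_mult) auto

subsection \<open>Coprime combinations\<close>

text \<open>If every \<open>c\<close> failed, each would come with a prime \<open>q c\<close>
  dividing \<open>F\<close>. A prime dividing two members of the pencil divides \<open>b\<close> and
  then \<open>a\<close>, so these primes do not divide one another. As the field is infinite,
  products of arbitrarily many of them divide \<open>F\<close>, against its degree.\<close>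

lemma exists_coprime_combination:
  fixes F a b :: "'k::alg_closed_field poly3"
  assumes "F \<noteq> 0" and cop: "\<And>q. prime_elem q \<Longrightarrow> q dvd F \<Longrightarrow> q dvd a \<Longrightarrow> q dvd b \<Longrightarrow> False"
  shows "\<exists>c. \<forall>q. prime_elem q \<longrightarrow> q dvd F \<longrightarrow> \<not> q dvd a + const3 c * b"
proof (rule ccontr)
  assume "\<not> ?thesis"
  then have "\<forall>c. \<exists>q. prime_elem q \<and> q dvd F \<and> q dvd a + const3 c * b"
    by (simp only: not_ex not_all not_imp not_not simp_thms)
  then obtain q where q: "\<And>c. prime_elem (q c)" "\<And>c. q c dvd F" "\<And>c. q c dvd a + const3 c * b"
    by metis
  have qq: "\<not> q c dvd q c'" if "c \<noteq> c'" for c c'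
  proof
    assume "q c dvd q c'"
    then have 1: "q c dvd a + const3 c' * b"
      using q(3) dvd_trans by blast
    have "q c dvd (a + const3 c * b) - (a + const3 c' * b)"
      using q(3) 1 by (rule dvd_diff)
    moreover have "(a + const3 c * b) - (a + const3 c' * b) = const3 (c - c') * b"
      by (simp add: const3_diff algebra_simps)
    ultimately have "q c dvd const3 (c - c') * b"
      by simp
    moreover have "\<not> q c dvd const3 (c - c')"
      using is_unit_const3[of "c - c'"] q(1)[of c] that dvd_trans by (auto simp: prime_elem_def)
    ultimately have b: "q c dvd b"
      using q(1) by (auto simp: prime_elem_dvd_mult_iff)
    have "q c dvd (a + const3 c * b) - const3 c * b"
      using q(3) b by (intro dvd_diff dvd_mult)
    then have "q c dvd a"
      by simp
    then show False
      by (rule cop[OF q(1,2) _ b])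
  qed
  have nd: "\<not> q c dvd prod q T" if "finite T" "c \<notin> T" for c T
    using that
  proof (induction T)
    case empty
    then show ?case
      using q(1)[of c] by (auto simp: prime_elem_def)
  next
    case (insert c' T)
    then show ?case
      using qq[of c c'] q(1)[of c] by (auto simp: prime_elem_dvd_mult_iff)
  qed
  have dv: "prod q T dvd F" if "finite T" for T
    using that
  proof (induction T)
    case (insert c T)
    then obtain F' where F': "F = prod q T * F'"
      by (elim dvdE)
    have "q c dvd F'"
      using q(1,2)[of c] nd[of T c] insert F' by (auto simp: prime_elem_dvd_mult_iff)
    then have "q c * prod q T dvd F' * prod q T"
      by (rule mult_dvd_mono) simp
    then show ?case
      using insert F' by (simp add: mult.commute)
  qed simp
  have q0: "q c \<noteq> 0" for c
    using q(1)[of c] by (auto simp: prime_elem_def)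
  have dq: "deg3 (q c) \<ge> 1" for c
    using q(1)[of c] is_unit_iff_deg3[of "q c"] by (auto simp: prime_elem_def)
  have dg: "card T \<le> deg3 (prod q T)" if "finite T" for T
    using that
  proof (induction T)
    case (insert c T)
    then have "prod q T \<noteq> 0"
      using q0 by simp
    then have "deg3 (q c * prod q T) = deg3 (q c) + deg3 (prod q T)"
      by (rule deg3_mult[OF q0])
    then show ?case
      using insert dq[of c] by simp
  qed simp
  obtain T :: "'k set" where T: "finite T" "card T = Suc (deg3 F)"
    using infinite_arbitrarily_large[OF infinite_UNIV_alg_closed] by blast
  then show False
    using dvd_deg3_less_imp_0[OF dv[OF T(1)]] dg[OF T(1)] assms(1) by auto
qed

subsection \<open>Dimension counts\<close>

lemma (in vspace) dim_0: "U \<subseteq> {0} \<Longrightarrow> dim U = 0"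
  using dim_le_card[of U "{}"] by simp

lemma (in vspace_pair) dim_image_inj_fin:
  assumes "Vector_Spaces.linear s1 s2 f" "vs1.subspace U" "vs1.fin_span U" "\<And>x. x \<in> U \<Longrightarrow> f x = 0 \<Longrightarrow> x = 0"
  shows "vs2.dim (f ` U) = vs1.dim U"
proof -
  have "vs1.dim {x \<in> U. f x = 0} = 0"
    using assms(4) by (intro vs1.dim_0) blast
  then show ?thesis
    using rank_nullity_fin[OF assms(1-3)] by simp
qed

lemma linear_dot3:
  "Vector_Spaces.linear (\<lambda>c v i. const3 c * v i) (\<lambda>c p. const3 c * p)
    (\<lambda>v. dot3 v (g :: 3 \<Rightarrow> 'k::field poly3))"
  by unfold_locales
    (simp_all add: dot3_eq fun_eq_iff plus_fun_def const3_add const3_mult algebra_simps)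

lemma linear_cross3:
  "Vector_Spaces.linear (\<lambda>c v i. const3 c * v i) (\<lambda>c v i. const3 c * v i)
    (cross3 (g :: 3 \<Rightarrow> 'k::field poly3))"
  by unfold_locales
    (simp_all add: cross3_def fun_eq_iff plus_fun_def const3_add const3_mult algebra_simps)

lemma linear_smult3:
  "Vector_Spaces.linear (\<lambda>c p. const3 c * p) (\<lambda>c v i. const3 c * v i)
    (\<lambda>p i. p * (g i :: 'k::field poly3))"
  by unfold_locales
    (simp_all add: fun_eq_iff plus_fun_def const3_add const3_mult algebra_simps)

text \<open>The numerical Koszul resolution of two forms of degree \<open>m\<close>; the excess
  \<open>m^2\<close> is the Bezout number.\<close>

lemma hdim_complete_intersection:
  assumes "2 * m \<le> n"
  shows "hdim n + hdim (n - 2 * m) = 2 * hdim (n - m) + m\<^sup>2"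
proof -
  obtain k where k: "n = 2 * m + k"
    using assms le_Suc_ex by blast
  have "2 * (hdim n + hdim (n - 2 * m)) = 2 * (2 * hdim (n - m) + m\<^sup>2)"
    using two_hdim[of n] two_hdim[of "n - 2 * m"] two_hdim[of "n - m"]
    by (simp add: k algebra_simps power2_eq_square)
  then show ?thesis
    by simp
qed

text \<open>By coprimality the relations between \<open>F\<close> and \<open>G\<close> are the
  multiples of the Koszul relation, so the kernel of the pair map has dimension at most
  \<open>hdim (n - 2 * m)\<close>; rank-nullity and the Koszul count give the rest.\<close>

lemma complete_intersection_dim:
  fixes F G :: "'k::field poly3"
  assumes F: "homogeneous3 m F" "F \<noteq> 0" and G: "homogeneous3 m G"
    and cop: "\<And>q. prime_elem q \<Longrightarrow> q dvd F \<Longrightarrow> \<not> q dvd G" and n: "2 * m \<le> n"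
  shows "hdim n \<le> p3.dim ((\<lambda>v. dot3 v (\<lambda>i. if i = 0 then F else if i = 1 then G else 0)) ` hspace3 {0, 1} (n - m)) + m\<^sup>2"
proof -
  define g where "g = (\<lambda>i::3. if i = 0 then F else if i = 1 then G else 0)"
  \<comment> \<open>The Koszul relation (G, -F), padded by 0 to a triple.\<close>
  define h where "h = (\<lambda>i::3. if i = 0 then G else if i = 1 then - F else 0)"
  have h_simps: "h 0 = G" "h 1 = - F" "h 2 = 0" "g 0 = F" "g 1 = G" "g 2 = 0"
    by (simp_all add: h_def g_def)
  have hcop: "coprime_family h"
  proof (rule coprime_familyI)
    fix q assume q: "prime_elem q" and h: "\<And>j. q dvd h j"
    show False
      using cop[OF q] h[of 0] h[of 1] by (simp add: h_simps)
  qed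
  let ?U = "hspace3 {0, 1} (n - m) :: (3 \<Rightarrow> 'k poly3) set"
  have "{v \<in> ?U. dot3 v g = 0} \<subseteq> (\<lambda>p i. p * h i) ` hspace (n - 2 * m)"
  proof
    fix v assume "v \<in> {v \<in> ?U. dot3 v g = 0}"
    then have v: "\<And>i. homogeneous3 (n - m) (v i)" "v 2 = 0" "dot3 v g = 0"
      by (simp_all add: hspace3_def)
    have "F * v 0 = - (G * v 1)"
      using v(3) by (simp add: dot3_eq h_simps v(2) eq_neg_iff_add_eq_0 mult.commute)
    then have "- F * v j = v 1 * h j" for j
      using exhaust_index3[of j] by (elim disjE) (simp_all add: h_simps v(2) mult.commute)
    then obtain l where l: "\<And>j. v j = l * h j"
      using coprime_family_proportional[OF hcop, of "- F" v "v 1"] F(2) by auto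
    have h: "homogeneous3 m (h j)" for j
      using F G by (auto simp: h_def homogeneous3_uminus)
    have "homogeneous3 (n - 2 * m + m) (v j)" for j
      using v(1)[of j] n by simp
    from homogeneous_quotient[of v l h m "n - 2 * m", OF l h this]
    obtain l' where "homogeneous3 (n - 2 * m) l'" "\<forall>j. v j = l' * h j"
      by (elim exE conjE)
    then show "v \<in> (\<lambda>p i. p * h i) ` hspace (n - 2 * m)"
      by (intro image_eqI[of _ _ l']) (auto simp: hspace_def)
  qed
  moreover have "v3.fin_span ((\<lambda>p i. p * h i) ` hspace (n - 2 * m))"
  proof -
    have "(\<lambda>p i. p * h i) ` hspace (n - 2 * m) \<subseteq> hspace3 UNIV (n - 2 * m + m)"
      using F G by (auto simp: hspace3_def hspace_def h_def intro!: homogeneous3_mult homogeneous3_uminus homogeneous3_0)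
    then show ?thesis
      using v3.fin_span_subset[OF hspace3_fin_span] by blast
  qed
  ultimately have "v3.dim {v \<in> ?U. dot3 v g = 0} \<le> v3.dim ((\<lambda>p i. p * h i) ` hspace (n - 2 * m))"
    using v3.span_superset by (intro v3.dim_mono_fin) blast+
  also have "\<dots> = p3.dim (hspace (n - 2 * m) :: 'k poly3 set)"
  proof (rule pv.dim_image_inj_fin[OF linear_smult3 hspace_subspace hspace_fin_span])
    fix p assume p: "(\<lambda>i. p * h i) = 0"
    have "p * h 1 = 0"
      using fun_cong[OF p, of 1] by simp
    then show "p = 0"
      using F(2) by (simp add: h_simps)
  qed
  finally have "v3.dim {v \<in> ?U. dot3 v g = 0} \<le> hdim (n - 2 * m)"
    by (simp add: hspace_dim)
  moreover have "v3.dim ?U = 2 * hdim (n - m)"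
    by (simp add: hspace3_dim)
  moreover have "v3.dim ?U = v3.dim {v \<in> ?U. dot3 v g = 0} + p3.dim ((\<lambda>v. dot3 v g) ` ?U)"
    by (rule vp.rank_nullity_fin[OF linear_dot3 hspace3_subspace hspace3_fin_span])
  ultimately show ?thesis
    using hdim_complete_intersection[OF n] unfolding g_def by linarith
qed

subsection \<open>Reduced plane curves\<close>

lemma CHAR_poly3 [simp]: "CHAR('k::field poly3) = CHAR('k)"
  by (rule CHAR_eqI) (simp_all add: of_nat_eq_0_iff_char_dvd flip: const3_of_nat)

lemma single_power: "mon s b ^ n = mon (Poly_Mapping.map ((*) n) s) (b ^ n :: 'k::comm_semiring_1)"
proof (induction n)
  case 0
  have "Poly_Mapping.map ((*) 0) s = 0"
    by (rule poly_mapping_eqI) (simp add: Poly_Mapping.map.rep_eq when_def)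
  then show ?case
    by (simp only: power_0 single_one)
next
  case (Suc n)
  have "s + Poly_Mapping.map ((*) n) s = Poly_Mapping.map ((*) (Suc n)) s"
    by (rule poly_mapping_eqI) (simp add: Poly_Mapping.map.rep_eq when_def lookup_add)
  then show ?case
    by (simp only: power_Suc Suc mult_single)
qed

lemma partial3_eq_0_imp_CHAR_dvd:
  fixes q :: "'k::field poly3"
  assumes "\<And>i. partial3 i q = 0" "lk q t \<noteq> 0"
  shows "CHAR('k) dvd lk t i"
proof (cases "lk t i")
  case (Suc e)
  define s where "s = t - unit_exp i"
  have t: "t = s + unit_exp i" and "lk s i = e"
    using Suc by (auto simp: s_def lookup_add lookup_minus lookup_single when_def intro!: poly_mapping_eqI)
  then have "of_nat (lk t i) * lk q t = lk (partial3 i q) s"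
    by (simp add: lookup_partial3 lookup_add)
  then show ?thesis
    using assms by (auto simp: of_nat_eq_0_iff_char_dvd)
qed simp

text \<open>In characteristic 0 such a polynomial is constant. In characteristic \<open>p\<close>
  all its exponents are multiples of \<open>p\<close> and its coefficients are \<open>p\<close>-th
  powers, so \<open>q = r ^ p\<close>; primality gives \<open>q dvd r\<close>, and cancelling one
  \<open>q\<close> leaves a positive power of \<open>q\<close> dividing 1.\<close>

lemma not_prime_elem_if_partials_0:
  fixes q :: "'k::alg_closed_field poly3"
  assumes q: "\<And>i. partial3 i q = 0"
  shows "\<not> prime_elem q"
proof
  assume prime: "prime_elem q"
  then have q0: "q \<noteq> 0" and nu: "\<not> q dvd 1"
    by (auto simp: prime_elem_def)
  show False
  proof (cases "CHAR('k) = 0")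
    case True
    then have "lk q t = 0" if "t \<noteq> 0" for t
      using partial3_eq_0_imp_CHAR_dvd[OF q, of t] that poly_mapping_eqI[of t 0] by fastforce
    then have "deg3 q \<le> 0"
      by (intro deg3_le) (metis le_refl tdeg_0)
    then show False
      using nu q0 is_unit_iff_deg3[of q] by simp
  next
    case False
    define p where "p = CHAR('k)"
    have p: "prime p"
      using False prime_CHAR_semidom[where ?'a = 'k] by (simp add: p_def)
    then have "p > 0"
      by (simp add: prime_gt_0_nat)
    have "\<forall>x. \<exists>y :: 'k. y ^ p = x"
      using nth_root_exists[OF \<open>p > 0\<close>] by blast
    then obtain rt :: "'k \<Rightarrow> 'k" where rt: "\<And>x. rt x ^ p = x"
      by metis
    define dv :: "(3 \<Rightarrow>\<^sub>0 nat) \<Rightarrow> 3 \<Rightarrow>\<^sub>0 nat" where "dv = Poly_Mapping.map (\<lambda>n. n div p)"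
    have dv: "Poly_Mapping.map ((*) p) (dv t) = t" if "lk q t \<noteq> 0" for t
    proof (rule poly_mapping_eqI)
      fix i
      show "lk (Poly_Mapping.map ((*) p) (dv t)) i = lk t i"
        using partial3_eq_0_imp_CHAR_dvd[OF q that, of i] \<open>p > 0\<close>
        by (auto simp: dv_def Poly_Mapping.map.rep_eq when_def simp flip: p_def elim!: dvdE)
    qed
    define r where "r = (\<Sum>t\<in>ks q. mon (dv t) (rt (lk q t)))"
    have "r ^ p = (\<Sum>t\<in>ks q. mon (dv t) (rt (lk q t)) ^ p)"
      unfolding r_def using p by (intro freshmans_dream_sum) (simp_all add: p_def)
    also have "\<dots> = (\<Sum>t\<in>ks q. mon t (lk q t))"
      by (rule sum.cong) (simp_all add: single_power rt dv in_keys_iff)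
    finally have r: "q = r ^ p"
      using poly3_eq_sum_single[of q] by simp
    then have "q dvd r"
      using prime prime_elem_dvd_power[of q r p] by simp
    then obtain s where s: "r = q * s"
      by (elim dvdE)
    have "q * 1 = r ^ p"
      by (simp flip: r)
    also have "\<dots> = (q * s) ^ p"
      by (simp only: s)
    also have "\<dots> = q * (q ^ (p - 1) * s ^ p)"
      using \<open>p > 0\<close> by (cases p) (simp_all add: power_mult_distrib mult.assoc)
    finally have "1 = q ^ (p - 1) * s ^ p"
      using q0 by simp
    moreover have "p - 1 \<noteq> 0"
      using prime_gt_1_nat[OF p] by simp
    then have "q dvd q ^ (p - 1)"
      by (simp add: dvd_power)
    ultimately show False
      using nu dvd_mult2 by metis
  qed
qed

locale reduced_curve =
  fixes u :: "'k::alg_closed_field poly3" and d :: nat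
  assumes hom: "homogeneous3 d u" and sqf: "squarefree u" and char: "\<not> CHAR('k) dvd d"
begin

abbreviation grad :: "3 \<Rightarrow> 'k poly3" where "grad \<equiv> \<lambda>i. partial3 i u"

lemma u_nonzero: "u \<noteq> 0"
  using sqf by (auto simp: squarefree_def dest: spec[of _ 0])

lemma d_nonzero: "of_nat d \<noteq> (0 :: 'k)"
  using char by (simp add: of_nat_eq_0_iff_char_dvd)

text \<open>Every characteristic divides 0, so the hypothesis on \<open>d\<close> excludes constant
  equations.\<close>

lemma d_pos: "d > 0"
  using char by (cases d) auto

lemma hom_grad: "homogeneous3 (d - 1) (grad i)"
  using hom by (rule homogeneous3_partial)

lemma euler_const: "u = const3 (inverse (of_nat d)) * dot3 var3 grad"
proof -
  have "dot3 var3 grad = const3 (of_nat d) * u"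
    using euler_identity[OF hom] by (simp add: dot3_def const3_of_nat)
  then show ?thesis
    using d_nonzero by (simp flip: const3_mult mult.assoc)
qed

text \<open>By the Euler identity a common prime factor \<open>q\<close> divides
  \<open>u = q r\<close>, and squarefreeness gives that \<open>q\<close> does not divide
  \<open>r\<close>. The product rule then makes \<open>q\<close> divide its own partial derivatives,
  which have smaller degree and so vanish.\<close>

lemma coprime_grad: "coprime_family grad"
proof (rule coprime_familyI)
  fix q assume q: "prime_elem q" and dv: "\<And>j. q dvd grad j"
  then have "q dvd dot3 var3 grad"
    unfolding dot3_def by (intro dvd_sum dvd_mult)
  then have "q dvd u"
    using euler_const by (metis dvd_mult)
  then obtain r where r: "u = q * r"
    by (elim dvdE)
  have "\<not> q dvd r"
  proof
    assume "q dvd r"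
    then have "q ^ 2 dvd u"
      unfolding r power2_eq_square by (intro mult_dvd_mono) auto
    then show False
      using sqf q by (auto simp: squarefree_def prime_elem_def)
  qed
  have "partial3 j q = 0" for j
  proof -
    have "q dvd partial3 j q * r + q * partial3 j r"
      using dv[of j] by (simp add: r partial3_mult)
    then have "q dvd partial3 j q * r"
      by (simp add: dvd_add_left_iff)
    then have "q dvd partial3 j q"
      using \<open>\<not> q dvd r\<close> q by (auto simp: prime_elem_dvd_mult_iff)
    then show ?thesis
      using dvd_deg3_less_imp_0 deg3_partial by blast
  qed
  then show False
    using not_prime_elem_if_partials_0[of q] q by simp
qed

lemma grad_nonzero: "grad \<noteq> (\<lambda>i. 0)"
proof
  assume "grad = (\<lambda>i. 0)"
  then have "dot3 var3 grad = 0"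
    by (simp add: dot3_def fun_eq_iff)
  then show False
    using euler_const u_nonzero by simp
qed

text \<open>Below degree \<open>d - 1\<close> the truncated difference is 0 and would admit constant
  coefficients, hence the second clause.\<close>

definition jacobian :: "nat \<Rightarrow> 'k poly3 set" where
  "jacobian n = {dot3 a grad | a. (\<forall>i. homogeneous3 (n - (d - 1)) (a i)) \<and> (n < d - 1 \<longrightarrow> a = (\<lambda>i. 0))}"

lemma jacobian_add: "jacobian (n + (d - 1)) = (\<lambda>v. dot3 v grad) ` hspace3 UNIV n"
  by (auto simp: jacobian_def hspace3_def)

lemma dot3_0 [simp]: "dot3 (\<lambda>i. 0) g = 0"
  by (simp add: dot3_def)

lemma dot3_add: "dot3 (\<lambda>i. a i + b i) g = dot3 a g + dot3 b g"
  by (simp add: dot3_def distrib_right sum.distrib)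

lemma dot3_mult: "dot3 (\<lambda>i. p * a i) g = p * dot3 a g"
  by (simp add: dot3_def sum_distrib_left mult.assoc)

lemma jacobian_graded: "graded_ideal jacobian"
  unfolding graded_ideal_def
proof (intro conjI allI impI ballI)
  fix n
  show "jacobian n \<subseteq> hspace n"
  proof
    fix x assume "x \<in> jacobian n"
    then obtain a where a: "x = dot3 a grad" "\<And>i. homogeneous3 (n - (d - 1)) (a i)"
      "n < d - 1 \<longrightarrow> a = (\<lambda>i. 0)"
      by (auto simp: jacobian_def)
    show "x \<in> hspace n"
    proof (cases "n < d - 1")
      case False
      then show ?thesis
        using homogeneous3_dot[OF a(2) hom_grad] a(1) by (simp add: hspace_def)
    qed (use a in \<open>simp add: hspace_def\<close>)
  qed
  show "0 \<in> jacobian n"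
    unfolding jacobian_def by (intro CollectI exI[of _ "\<lambda>i. 0"]) simp
  fix x y assume "x \<in> jacobian n" "y \<in> jacobian n"
  then obtain a b where
    "x = dot3 a grad" "\<And>i. homogeneous3 (n - (d - 1)) (a i)" "n < d - 1 \<longrightarrow> a = (\<lambda>i. 0)"
    "y = dot3 b grad" "\<And>i. homogeneous3 (n - (d - 1)) (b i)" "n < d - 1 \<longrightarrow> b = (\<lambda>i. 0)"
    unfolding jacobian_def by blast
  then show "x + y \<in> jacobian n"
    unfolding jacobian_def
    by (intro CollectI exI[of _ "\<lambda>i. a i + b i"]) (simp add: dot3_add homogeneous3_add)
next
  fix m n x and q :: "'k poly3" assume q: "homogeneous3 m q" and "x \<in> jacobian n"
  then obtain a where a: "x = dot3 a grad" "\<And>i. homogeneous3 (n - (d - 1)) (a i)"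
    "n < d - 1 \<longrightarrow> a = (\<lambda>i. 0)"
    by (auto simp: jacobian_def)
  have "homogeneous3 (m + n - (d - 1)) (q * a i)" for i
    using homogeneous3_mult[OF q a(2)] a(3) by (cases "n < d - 1") auto
  then show "q * x \<in> jacobian (m + n)"
    unfolding jacobian_def using a
    by (intro CollectI exI[of _ "\<lambda>i. q * a i"]) (auto simp: dot3_mult)
qed

lemma apply_field_eq: "apply_field v u = dot3 v grad"
  by (simp add: apply_field_def dot3_def)

text \<open>A Koszul field: two of the partial derivatives, exchanged and with one sign changed, as
  coefficients. It bounds the least degree by \<open>d - 1\<close>.\<close>

lemma exists_annihilating_field: "\<exists>v. annihilating_field u (d - 1) v"
proof -
  obtain i where i: "grad i \<noteq> 0"
    using grad_nonzero by auto
  obtain j :: 3 where j: "j \<noteq> i"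
    using exhaust_index3[of i] by (metis zero_neq_one)
  define v where "v l = (if l = j then grad i else if l = i then - grad j else 0)" for l
  have "apply_field v u = (\<Sum>l\<in>UNIV. (if l = j then grad i * grad j else 0) + (if l = i then - (grad j * grad i) else 0))"
    unfolding apply_field_def using j by (intro sum.cong) (auto simp: v_def)
  also have "\<dots> = 0"
    by (subst sum.distrib) (simp add: mult.commute)
  finally have "apply_field v u = 0" .
  moreover have "vector_field (d - 1) v"
    using hom_grad homogeneous3_uminus[OF hom_grad] by (auto simp: vector_field_def v_def)
  moreover have "v \<noteq> (\<lambda>i. 0)"
    using i by (auto simp: v_def fun_eq_iff intro!: exI[of _ j])
  ultimately show ?thesis
    by (auto simp: annihilating_field_def)
qed

end

section \<open>Syzygies modulo multiples of the field of least degree\<close>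

locale minimal_syzygy = reduced_curve u d for u :: "'k::alg_closed_field poly3" and d +
  fixes m :: nat and \<phi> :: "3 \<Rightarrow> 'k poly3"
  assumes m_least: "\<And>n v. annihilating_field u n v \<Longrightarrow> m \<le> n" and phi: "annihilating_field u m \<phi>"
begin

lemma m_le: "m \<le> d - 1"
  using exists_annihilating_field m_least by blast

lemma hom_phi: "homogeneous3 m (\<phi> i)"
  using phi by (simp add: annihilating_field_def vector_field_def)

lemma phi_nonzero: "\<phi> \<noteq> (\<lambda>i. 0)"
  using phi by (simp add: annihilating_field_def)

lemma dot_phi: "dot3 \<phi> grad = 0"
  using phi by (simp add: annihilating_field_def apply_field_eq)

text \<open>Cancelling a common prime factor leaves a syzygy of smaller degree. As homogeneity of
  the quotient \<open>p\<close> is not immediate, one nonzero homogeneous component of it is used to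
  contradict minimality.\<close>

lemma coprime_phi: "coprime_family \<phi>"
proof (rule coprime_familyI)
  fix q assume q: "prime_elem q" and "\<And>j. q dvd \<phi> j"
  then have "\<forall>j. \<exists>p. \<phi> j = q * p"
    by (simp add: dvd_def)
  then obtain p where p: "\<And>j. \<phi> j = q * p j"
    by metis
  have "q \<noteq> 0"
    using q by (simp add: prime_elem_def)
  have dq: "deg3 q \<noteq> 0"
    using q is_unit_iff_deg3[of q] by (auto simp: prime_elem_def)
  obtain i where i: "\<phi> i \<noteq> 0"
    using phi_nonzero by auto
  then have "p i \<noteq> 0"
    using p by auto
  then obtain t where t: "lk (p i) t \<noteq> 0"
    using poly_mapping_eqI[of "p i" 0] by auto
  have "deg3 q + deg3 (p i) = m"
    using deg3_homogeneous[OF hom_phi i] deg3_mult[OF \<open>q \<noteq> 0\<close> \<open>p i \<noteq> 0\<close>] p by simp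
  then have "tdeg t < m"
    using tdeg_le_deg3[OF t] dq by simp
  have "q * dot3 p grad = 0"
    using dot_phi by (simp add: p dot3_mult[symmetric] fun_eq_iff dot3_def sum_distrib_left mult.assoc)
  then have "dot3 p grad = 0"
    using \<open>q \<noteq> 0\<close> by simp
  \<comment> \<open>The gradient is homogeneous of degree \<open>d - 1\<close>, so the relation
    holds separately for each homogeneous component of \<open>p\<close>; the one containing the
    monomial \<open>t\<close> is nonzero.\<close>
  then have "hcomp (tdeg t + (d - 1)) (\<Sum>j\<in>UNIV. p j * grad j) = 0"
    by (simp add: dot3_def hcomp_def)
  then have "dot3 (\<lambda>j. hcomp (tdeg t) (p j)) grad = 0"
    by (simp only: hcomp_sum hcomp_mult_homogeneous[OF hom_grad] dot3_def)
  moreover have "lk (hcomp (tdeg t) (p i)) t \<noteq> 0"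
    using t by (simp add: lookup_hcomp)
  then have "(\<lambda>j. hcomp (tdeg t) (p j)) \<noteq> (\<lambda>i. 0)"
    by (metis lookup_zero)
  ultimately have "annihilating_field u (tdeg t) (\<lambda>j. hcomp (tdeg t) (p j))"
    by (simp add: annihilating_field_def vector_field_def hcomp_homogeneous apply_field_eq)
  then show False
    using m_least \<open>tdeg t < m\<close> by (meson not_le)
qed

definition syz :: "nat \<Rightarrow> (3 \<Rightarrow> 'k poly3) set" where
  "syz n = {v \<in> hspace3 UNIV n. dot3 v grad = 0}"

text \<open>The index \<open>n\<close> is the degree of the syzygy \<open>v\<close>, not that of
  \<open>l\<close>: \<open>cross3 \<phi> v\<close> has degree \<open>n + m\<close> and the gradient
  has degree \<open>d - 1\<close>.\<close>

definition multipliers :: "nat \<Rightarrow> 'k poly3 set" where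
  "multipliers n = {l \<in> hspace (n + m - (d - 1)). \<exists>v\<in>syz n. \<forall>i. cross3 \<phi> v i = l * grad i}"

lemma syz_subspace: "v3.subspace (syz n)"
proof -
  interpret l: Vector_Spaces.linear "\<lambda>c v i. const3 c * v i" "\<lambda>c p. const3 c * p" "\<lambda>v. dot3 v grad"
    by (rule linear_dot3)
  have "syz n = hspace3 UNIV n \<inter> {v. dot3 v grad = 0}"
    by (auto simp: syz_def)
  then show ?thesis
    using v3.subspace_inter[OF hspace3_subspace l.subspace_kernel] by simp
qed

lemma syz_fin_span: "v3.fin_span (syz n)"
  by (rule v3.fin_span_subset[OF hspace3_fin_span[of UNIV n]]) (auto simp: syz_def)

lemma multipliers_subspace: "p3.subspace (multipliers n)"
proof -
  interpret x: Vector_Spaces.linear "\<lambda>c v i. const3 c * v i" "\<lambda>c v i. const3 c * v i" "cross3 \<phi>"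
    by (rule linear_cross3)
  show ?thesis
    unfolding p3.subspace_def
  proof (intro conjI ballI allI)
    show "0 \<in> multipliers n"
      using v3.subspace_0[OF syz_subspace] x.zero
      by (auto simp: multipliers_def hspace_def intro!: bexI[of _ 0])
    fix l assume "l \<in> multipliers n"
    then obtain v where v: "l \<in> hspace (n + m - (d - 1))" "v \<in> syz n" "\<And>i. cross3 \<phi> v i = l * grad i"
      by (auto simp: multipliers_def)
    show "const3 c * l \<in> multipliers n" for c
      using v p3.subspace_scale[OF hspace_subspace v(1)] v3.subspace_scale[OF syz_subspace v(2)]
      by (auto simp: multipliers_def x.scale mult.assoc intro!: bexI[of _ "\<lambda>i. const3 c * v i"])
    fix l' assume "l' \<in> multipliers n"
    then obtain v' where v': "l' \<in> hspace (n + m - (d - 1))" "v' \<in> syz n" "\<And>i. cross3 \<phi> v' i = l' * grad i"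
      by (auto simp: multipliers_def)
    show "l + l' \<in> multipliers n"
      using v v' p3.subspace_add[OF hspace_subspace v(1) v'(1)] v3.subspace_add[OF syz_subspace v(2) v'(2)]
      by (auto simp: multipliers_def x.add distrib_right intro!: bexI[of _ "v + v'"])
  qed
qed

lemma multipliers_fin_span: "p3.fin_span (multipliers n)"
  by (rule p3.fin_span_subset[OF hspace_fin_span[of "n + m - (d - 1)"]]) (auto simp: multipliers_def)

text \<open>Rank-nullity for the cross product with \<open>\<phi>\<close>. Its kernel consists of
  the multiples of \<open>\<phi>\<close> because \<open>\<phi>\<close> has no common factor, and its
  image is identified with the multipliers because the gradient has none. The hypotheses keep the
  degree subtractions exact.\<close>

lemma syz_dim:
  assumes "m \<le> n" "d - 1 \<le> n + m"
  shows "v3.dim (syz n) = hdim (n - m) + p3.dim (multipliers n)"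
proof -
  have "{v \<in> syz n. cross3 \<phi> v = 0} = (\<lambda>p i. p * \<phi> i) ` hspace (n - m)"
  proof (intro equalityI subsetI)
    fix v assume v: "v \<in> {v \<in> syz n. cross3 \<phi> v = 0}"
    then have "cross3 \<phi> v i = 0" for i
      by simp
    then obtain l where l: "\<And>j. v j = l * \<phi> j"
      using cross3_eq_0_proportional[OF coprime_phi phi_nonzero, of v] by blast
    have "homogeneous3 (n - m + m) (v j)" for j
      using v assms by (simp add: syz_def hspace3_def)
    from homogeneous_quotient[of v l \<phi> m "n - m", OF l hom_phi this]
    obtain l' where "homogeneous3 (n - m) l'" "\<forall>j. v j = l' * \<phi> j"
      by (elim exE conjE)
    then show "v \<in> (\<lambda>p i. p * \<phi> i) ` hspace (n - m)"
      by (intro image_eqI[of _ _ l']) (auto simp: hspace_def)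
  next
    fix v assume "v \<in> (\<lambda>p i. p * \<phi> i) ` hspace (n - m)"
    then obtain p where p: "v = (\<lambda>i. p * \<phi> i)" "homogeneous3 (n - m) p"
      by (auto simp: hspace_def)
    have "homogeneous3 n (p * \<phi> i)" for i
      using homogeneous3_mult[OF p(2) hom_phi] assms by simp
    moreover have "cross3 \<phi> v = 0"
      by (simp add: p cross3_def fun_eq_iff algebra_simps)
    ultimately show "v \<in> {v \<in> syz n. cross3 \<phi> v = 0}"
      by (simp add: syz_def p hspace3_def dot3_mult dot_phi)
  qed
  moreover have "v3.dim ((\<lambda>p i. p * \<phi> i) ` hspace (n - m)) = p3.dim (hspace (n - m) :: 'k poly3 set)"
  proof (rule pv.dim_image_inj_fin[OF linear_smult3 hspace_subspace hspace_fin_span])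
    fix p assume p: "(\<lambda>i. p * \<phi> i) = 0"
    have "p * \<phi> i = 0" for i
      using fun_cong[OF p, of i] by simp
    then show "p = 0"
      using phi_nonzero by auto
  qed
  ultimately have "v3.dim {v \<in> syz n. cross3 \<phi> v = 0} = hdim (n - m)"
    by (simp add: hspace_dim)
  moreover have "cross3 \<phi> ` syz n = (\<lambda>p i. p * grad i) ` multipliers n"
  proof (intro equalityI subsetI)
    fix w assume "w \<in> cross3 \<phi> ` syz n"
    then obtain v where v: "w = cross3 \<phi> v" "v \<in> syz n"
      by blast
    \<comment> \<open>Both vectors are orthogonal to the gradient, so by the triple product formula
      their cross product is parallel to it.\<close>
    have "dot3 grad \<phi> = 0" "dot3 grad v = 0"
      using dot_phi v(2) by (simp_all add: syz_def dot3_def mult.commute)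
    then have "cross3 grad w i = 0" for i
      by (simp add: v(1) cross3_cross3)
    then obtain l where l: "\<And>j. w j = l * grad j"
      using cross3_eq_0_proportional[OF coprime_grad grad_nonzero] by blast
    have "homogeneous3 (n + m - (d - 1) + (d - 1)) (w j)" for j
      using homogeneous3_cross[OF hom_phi, where m = n and b = v and i = j] v assms
      by (simp add: syz_def hspace3_def add.commute)
    from homogeneous_quotient[of w l grad "d - 1" "n + m - (d - 1)", OF l hom_grad this]
    obtain l' where l': "homogeneous3 (n + m - (d - 1)) l'" "\<forall>j. w j = l' * grad j"
      by (elim exE conjE)
    then have "l' \<in> multipliers n"
      using v by (auto simp: multipliers_def hspace_def)
    then show "w \<in> (\<lambda>p i. p * grad i) ` multipliers n"
      using l'(2) by (intro image_eqI[of _ _ l']) auto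
  next
    fix w assume "w \<in> (\<lambda>p i. p * grad i) ` multipliers n"
    then obtain l v where "w = (\<lambda>i. l * grad i)" "v \<in> syz n" "\<And>i. cross3 \<phi> v i = l * grad i"
      by (auto simp: multipliers_def)
    then show "w \<in> cross3 \<phi> ` syz n"
      by (intro image_eqI[of _ _ v]) auto
  qed
  moreover have "v3.dim ((\<lambda>p i. p * grad i) ` multipliers n) = p3.dim (multipliers n)"
  proof (rule pv.dim_image_inj_fin[OF linear_smult3 multipliers_subspace multipliers_fin_span])
    fix p assume p: "(\<lambda>i. p * grad i) = 0"
    have "p * grad i = 0" for i
      using fun_cong[OF p, of i] by simp
    then show "p = 0"
      using grad_nonzero by auto
  qed
  moreover have "v3.dim (syz n) = v3.dim {v \<in> syz n. cross3 \<phi> v = 0} + v3.dim (cross3 \<phi> ` syz n)"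
    by (rule vv.rank_nullity_fin[OF linear_cross3 syz_subspace syz_fin_span])
  ultimately show ?thesis
    by simp
qed

lemma jacobian_dim: "p3.dim (jacobian (n + (d - 1))) + v3.dim (syz n) = 3 * hdim n"
proof -
  have "v3.dim (hspace3 UNIV n :: (3 \<Rightarrow> 'k poly3) set) =
      v3.dim {v \<in> hspace3 UNIV n. dot3 v grad = 0} + p3.dim ((\<lambda>v. dot3 v grad) ` hspace3 UNIV n)"
    by (rule vp.rank_nullity_fin[OF linear_dot3 hspace3_subspace hspace3_fin_span])
  then show ?thesis
    unfolding jacobian_add syz_def hspace3_dim by simp
qed

lemma multipliers_dim_le: "p3.dim (multipliers n) \<le> hdim (n + m - (d - 1))"
proof -
  have "p3.dim (multipliers n) \<le> p3.dim (hspace (n + m - (d - 1)) :: 'k poly3 set)"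
    using p3.span_superset[of "hspace (n + m - (d - 1))"] hspace_fin_span
    by (intro p3.dim_mono_fin) (auto simp: multipliers_def)
  then show ?thesis
    by (simp add: hspace_dim)
qed

text \<open>The witness is the Koszul syzygy \<open>cross3 (- a) grad\<close>: in the triple product
  formula the term with \<open>dot3 \<phi> grad\<close> vanishes and the other one is
  \<open>dot3 a \<phi>\<close> times the gradient. Thus the multipliers contain the ideal generated
  by the components of \<open>\<phi>\<close>.\<close>

lemma dot3_phi_in_multipliers:
  assumes "d - 1 \<le> n" "\<And>i. homogeneous3 (n - (d - 1)) (a i)"
  shows "dot3 a \<phi> \<in> multipliers n"
proof -
  have dot: "homogeneous3 (n + m - (d - 1)) (dot3 a \<phi>)"
    using homogeneous3_dot[OF assms(2) hom_phi] assms(1) by simp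
  define b where "b = (\<lambda>i. - a i)"
  have b: "homogeneous3 (n - (d - 1)) (b i)" for i
    using assms(2) by (simp add: b_def homogeneous3_uminus)
  have "homogeneous3 n (cross3 b grad i)" for i
    using homogeneous3_cross[OF b hom_grad] assms(1) by simp
  then have "cross3 b grad \<in> syz n"
    by (simp add: syz_def hspace3_def dot3_cross3)
  moreover have "cross3 \<phi> (cross3 b grad) i = dot3 a \<phi> * grad i" for i
  proof -
    have "dot3 \<phi> b = - dot3 a \<phi>"
      by (simp add: b_def dot3_def sum_negf mult.commute)
    then show ?thesis
      by (simp add: cross3_cross3 dot_phi)
  qed
  ultimately show ?thesis
    using dot by (auto simp: multipliers_def hspace_def)
qed

lemma multipliers_dim_ge:
  assumes n: "d - 1 + m \<le> n"
  shows "hdim (n + m - (d - 1)) \<le> p3.dim (multipliers n) + m\<^sup>2"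
proof -
  obtain i where i: "\<phi> i \<noteq> 0"
    using phi_nonzero by auto
  obtain j k where jk: "\<And>l. l = i \<or> l = j \<or> l = k" "i \<noteq> j" "i \<noteq> k" "j \<noteq> k"
  proof -
    have "(0::3) \<noteq> 1" "(0::3) \<noteq> 2" "(1::3) \<noteq> 2"
      by simp_all
    then show ?thesis
      using exhaust_index3[of i] exhaust_index3 that[of 1 2] that[of 0 2] that[of 0 1] by metis
  qed
  have cop: False if "prime_elem q" "q dvd \<phi> i" "q dvd \<phi> j" "q dvd \<phi> k" for q
    using coprime_phi that jk(1) unfolding coprime_family_def by metis
  have "\<exists>c. \<forall>q. prime_elem q \<longrightarrow> q dvd \<phi> i \<longrightarrow> \<not> q dvd \<phi> j + const3 c * \<phi> k"
    by (rule exists_coprime_combination[OF i]) (rule cop)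
  then obtain c where c: "\<forall>q. prime_elem q \<longrightarrow> q dvd \<phi> i \<longrightarrow> \<not> q dvd \<phi> j + const3 c * \<phi> k"
    by (elim exE)
  define N where "N = n + m - (d - 1)"
  have Nm: "N - m = n - (d - 1)" "2 * m \<le> N"
    using n by (simp_all add: N_def)
  define g where "g = (\<lambda>l::3. if l = 0 then \<phi> i else if l = 1 then \<phi> j + const3 c * \<phi> k else 0)"
  have g: "g 0 = \<phi> i" "g 1 = \<phi> j + const3 c * \<phi> k" "g 2 = 0"
    by (simp_all add: g_def)
  have "hdim N \<le> p3.dim ((\<lambda>v. dot3 v g) ` hspace3 {0, 1} (N - m)) + m\<^sup>2"
    unfolding g_def
    by (intro complete_intersection_dim hom_phi i homogeneous3_add homogeneous3_const_mult
        c[rule_format] Nm(2))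
  also have "(\<lambda>v. dot3 v g) ` hspace3 {0, 1} (N - m) \<subseteq> multipliers n"
  proof
    fix x assume "x \<in> (\<lambda>v. dot3 v g) ` hspace3 {0, 1} (N - m)"
    then obtain v where v: "x = dot3 v g" "\<And>l. homogeneous3 (n - (d - 1)) (v l)"
      by (auto simp: hspace3_def Nm)
    \<comment> \<open>The combination
      \<open>v 0 * \<phi> i + v 1 * (\<phi> j + c * \<phi> k)\<close>, rewritten as a product with
      the whole vector \<open>\<phi>\<close>.\<close>
    define a where "a l = (if l = i then v 0 else if l = j then v 1 else const3 c * v 1)" for l
    have "dot3 a \<phi> = (\<Sum>l\<in>{i, j, k}. a l * \<phi> l)"
      unfolding dot3_def using jk(1) by (intro sum.mono_neutral_right) auto
    also have "\<dots> = x"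
      using jk by (simp add: v(1) dot3_eq g a_def algebra_simps)
    finally have "x = dot3 a \<phi>"
      by simp
    moreover have "homogeneous3 (n - (d - 1)) (a l)" for l
      using v(2) by (auto simp: a_def)
    ultimately show "x \<in> multipliers n"
      using dot3_phi_in_multipliers n by simp
  qed
  then have "p3.dim ((\<lambda>v. dot3 v g) ` hspace3 {0, 1} (N - m)) \<le> p3.dim (multipliers n)"
    using p3.span_superset by (intro p3.dim_mono_fin multipliers_fin_span) blast
  finally show ?thesis
    by (simp add: N_def)
qed

text \<open>Here \<open>e\<close> stands for \<open>d - 1\<close>. The terms are the Hilbert
  functions of all forms, of the multiples of \<open>\<phi>\<close>, of all conceivable multipliers,
  and of coefficient triples; the constant is the codimension of the Jacobian ideal when the
  multipliers fill their degree.\<close>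

lemma hdim_syzygy_count:
  assumes "e + m \<le> n" "m \<le> e"
  shows "hdim (n + e) + hdim (n - m) + hdim (n + m - e) = 3 * hdim n + e * (e - m) + m\<^sup>2"
proof -
  obtain k where k: "e = m + k"
    using assms(2) le_Suc_ex by blast
  obtain j where j: "n = 2 * m + k + j"
    using assms(1) le_Suc_ex k by (metis add.assoc add.commute mult_2)
  have "2 * (hdim (n + e) + hdim (n - m) + hdim (n + m - e)) = 2 * (3 * hdim n + e * (e - m) + m\<^sup>2)"
    using two_hdim[of "n + e"] two_hdim[of "n - m"] two_hdim[of "n + m - e"] two_hdim[of n]
    by (simp add: j k algebra_simps power2_eq_square)
  then show ?thesis
    by simp
qed

text \<open>The codimension is \<open>(d - 1) * (d - m - 1) + m\<^sup>2\<close> minus the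
  codimension of the multipliers, which is at least 0 and at most \<open>m\<^sup>2\<close>. The
  degree bound ensures that the coefficient degree \<open>N\<close> is at least
  \<open>d - 1 + m\<close>.\<close>

theorem jacobian_codim_bounds:
  assumes n: "2 * (d - 1) + m \<le> n"
  shows "p3.dim (jacobian n) + (d - 1) * (d - m - 1) \<le> hdim n"
    and "hdim n \<le> p3.dim (jacobian n) + ((d - 1) * (d - m - 1) + m\<^sup>2)"
proof -
  define N where "N = n - (d - 1)"
  have N: "n = N + (d - 1)" "d - 1 + m \<le> N" "m \<le> N" "d - 1 \<le> N + m"
    using n m_le by (auto simp: N_def)
  have "(d - 1) * (d - 1 - m) = (d - 1) * (d - m - 1)"
    by simp
  then show "p3.dim (jacobian n) + (d - 1) * (d - m - 1) \<le> hdim n"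
    "hdim n \<le> p3.dim (jacobian n) + ((d - 1) * (d - m - 1) + m\<^sup>2)"
    using jacobian_dim[of N] syz_dim[OF N(3,4)] multipliers_dim_le[of N] multipliers_dim_ge[OF N(2)]
      hdim_syzygy_count[OF N(2) m_le] unfolding N(1)
    by linarith+
qed

end

section \<open>Modules: quotients, linear maps and \<open>Ext\<^sup>1\<close>\<close>

subsection \<open>Quotient modules\<close>

locale quotient_mod = M: Module.module R M for R and M :: "('a, 'b, 's) module_scheme" +
  fixes N
  assumes N: "submodule N R M"
begin

sublocale N: abelian_subgroup N M
  using N by (intro abelian_subgroupI3 additive_subgroup.intro M.M.abelian_group_axioms)
    (simp add: submodule_def)

abbreviation proj :: "'b \<Rightarrow> 'b set" where "proj x \<equiv> N +>\<^bsub>M\<^esub> x"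

abbreviation Q where "Q \<equiv> quotient_module R M N"

lemma N_smult: "r \<in> carrier R \<Longrightarrow> x \<in> N \<Longrightarrow> r \<odot>\<^bsub>M\<^esub> x \<in> N"
  using N by (rule submodule.smult_closed)

lemma quotient_carrier: "carrier Q = proj ` carrier M"
  by (auto simp: quotient_module_def A_RCOSETS_def')

lemma proj_closed: "x \<in> carrier M \<Longrightarrow> proj x \<in> carrier Q"
  by (simp add: quotient_carrier)

lemma proj_add: "x \<in> carrier M \<Longrightarrow> y \<in> carrier M \<Longrightarrow> proj x \<oplus>\<^bsub>Q\<^esub> proj y = proj (x \<oplus>\<^bsub>M\<^esub> y)"
  by (simp add: quotient_module_def N.a_rcos_sum)

lemma proj_eq_iff:
  assumes "x \<in> carrier M" "y \<in> carrier M"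
  shows "proj x = proj y \<longleftrightarrow> x \<ominus>\<^bsub>M\<^esub> y \<in> N"
  using N.a_rcos_module[OF assms(2,1)] M.M.a_repr_independence[OF _ assms(2) N.a_subgroup]
    N.a_rcos_self[OF assms(1)] by (auto simp: a_minus_def)

lemma proj_0: "proj \<zero>\<^bsub>M\<^esub> = N"
  using N.a_subset by simp

lemma quotient_zero: "\<zero>\<^bsub>Q\<^esub> = proj \<zero>\<^bsub>M\<^esub>"
  by (simp add: proj_0) (simp add: quotient_module_def)

lemma proj_eq_0_iff: "x \<in> carrier M \<Longrightarrow> proj x = \<zero>\<^bsub>Q\<^esub> \<longleftrightarrow> x \<in> N"
proof -
  assume x: "x \<in> carrier M"
  then have "x \<ominus>\<^bsub>M\<^esub> \<zero>\<^bsub>M\<^esub> = x"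
    by (metis M.M.add.inv_closed M.M.l_neg M.M.r_zero M.M.zero_closed a_minus_def)
  then show ?thesis
    using proj_eq_iff[of x "\<zero>\<^bsub>M\<^esub>"] x by (simp add: quotient_zero)
qed

text \<open>All members of the coset yield the same class, so the union in the definition is taken
  over copies of one coset; the coset being nonempty, the union equals it.\<close>

lemma proj_smult:
  assumes "r \<in> carrier R" "x \<in> carrier M"
  shows "r \<odot>\<^bsub>Q\<^esub> proj x = proj (r \<odot>\<^bsub>M\<^esub> x)"
proof -
  have "proj (r \<odot>\<^bsub>M\<^esub> y) = proj (r \<odot>\<^bsub>M\<^esub> x)" if y: "y \<in> proj x" for y
  proof -
    obtain n where n: "n \<in> N" "y = n \<oplus>\<^bsub>M\<^esub> x"
      using y by (auto simp: a_r_coset_def')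
    then have nM: "n \<in> carrier M"
      using N.a_subset by blast
    have "r \<odot>\<^bsub>M\<^esub> y \<ominus>\<^bsub>M\<^esub> r \<odot>\<^bsub>M\<^esub> x = r \<odot>\<^bsub>M\<^esub> n"
      using assms nM by (simp add: n(2) M.smult_r_distr a_minus_def M.M.a_assoc M.M.r_neg)
    then show ?thesis
      using assms nM n N_smult by (simp add: proj_eq_iff)
  qed
  then have "(\<Union>y\<in>proj x. proj (r \<odot>\<^bsub>M\<^esub> y)) = (\<Union>y\<in>proj x. proj (r \<odot>\<^bsub>M\<^esub> x))"
    by (intro SUP_cong refl)
  moreover have "proj x \<noteq> {}"
    using N.a_rcos_self[OF assms(2)] by blast
  ultimately show ?thesis
    by (simp add: quotient_module_def)
qed

lemma quotient_is_module: "Module.module R Q"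
proof (rule moduleI)
  show "abelian_group Q"
  proof (rule abelian_groupI)
    fix x assume "x \<in> carrier Q"
    then obtain a where "x = proj a" "a \<in> carrier M"
      by (auto simp: quotient_carrier)
    then show "\<exists>y\<in>carrier Q. y \<oplus>\<^bsub>Q\<^esub> x = \<zero>\<^bsub>Q\<^esub>"
      by (intro bexI[of _ "proj (\<ominus>\<^bsub>M\<^esub> a)"])
        (simp_all add: proj_closed proj_add quotient_zero M.M.l_neg del: N.a_rcos_sum)
  qed (auto simp: quotient_carrier proj_add quotient_zero M.M.a_ac simp del: N.a_rcos_sum)
qed (auto simp: quotient_carrier proj_add proj_smult M.smult_l_distr M.smult_r_distr M.smult_assoc1
    M.R.is_cring simp del: N.a_rcos_sum intro!: imageI)

end

subsection \<open>Linear maps\<close>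

text \<open>Linearity without extensionality, so that sums and composites are written freely;
  elements of \<open>hom_module\<close> arise by restriction at the end.\<close>

definition lin_map :: "('a, 'r) ring_scheme \<Rightarrow> ('a, 'b, 's) module_scheme
    \<Rightarrow> ('a, 'c, 't) module_scheme \<Rightarrow> ('b \<Rightarrow> 'c) \<Rightarrow> bool" where
  "lin_map R M N f \<longleftrightarrow> (\<forall>x\<in>carrier M. f x \<in> carrier N) \<and>
    (\<forall>x\<in>carrier M. \<forall>y\<in>carrier M. f (x \<oplus>\<^bsub>M\<^esub> y) = f x \<oplus>\<^bsub>N\<^esub> f y) \<and>
    (\<forall>r\<in>carrier R. \<forall>x\<in>carrier M. f (r \<odot>\<^bsub>M\<^esub> x) = r \<odot>\<^bsub>N\<^esub> f x)"

lemma lin_map_closed: "lin_map R M N f \<Longrightarrow> x \<in> carrier M \<Longrightarrow> f x \<in> carrier N"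
  by (simp add: lin_map_def)

lemma lin_map_add_distrib:
  "lin_map R M N f \<Longrightarrow> x \<in> carrier M \<Longrightarrow> y \<in> carrier M \<Longrightarrow> f (x \<oplus>\<^bsub>M\<^esub> y) = f x \<oplus>\<^bsub>N\<^esub> f y"
  by (simp add: lin_map_def)

lemma lin_map_smult_distrib:
  "lin_map R M N f \<Longrightarrow> r \<in> carrier R \<Longrightarrow> x \<in> carrier M \<Longrightarrow> f (r \<odot>\<^bsub>M\<^esub> x) = r \<odot>\<^bsub>N\<^esub> f x"
  by (simp add: lin_map_def)

lemma lin_map_comp: "lin_map R M N f \<Longrightarrow> lin_map R N P g \<Longrightarrow> lin_map R M P (\<lambda>x. g (f x))"
  by (auto simp: lin_map_def)

lemma lin_map_uminus_distrib:
  assumes "Module.module R M" "Module.module R N" "lin_map R M N f" "x \<in> carrier M"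
  shows "f (\<ominus>\<^bsub>M\<^esub> x) = \<ominus>\<^bsub>N\<^esub> f x"
proof -
  interpret M: Module.module R M by fact
  interpret N: Module.module R N by fact
  have "f ((\<ominus>\<^bsub>R\<^esub> \<one>\<^bsub>R\<^esub>) \<odot>\<^bsub>M\<^esub> x) = (\<ominus>\<^bsub>R\<^esub> \<one>\<^bsub>R\<^esub>) \<odot>\<^bsub>N\<^esub> f x"
    using assms by (intro lin_map_smult_distrib) auto
  then show ?thesis
    using assms(4) lin_map_closed[OF assms(3,4)] by (simp add: M.smult_l_minus N.smult_l_minus)
qed

lemma lin_map_plus:
  assumes "Module.module R N" "lin_map R M N f" "lin_map R M N g"
  shows "lin_map R M N (\<lambda>x. f x \<oplus>\<^bsub>N\<^esub> g x)"
proof -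
  interpret N: Module.module R N by fact
  show ?thesis
    using assms(2,3) by (auto simp: lin_map_def N.M.a_ac N.smult_r_distr)
qed

lemma lin_map_uminus:
  assumes "Module.module R N" "lin_map R M N f"
  shows "lin_map R M N (\<lambda>x. \<ominus>\<^bsub>N\<^esub> f x)"
proof -
  interpret N: Module.module R N by fact
  show ?thesis
    using assms(2) by (auto simp: lin_map_def N.M.minus_add N.smult_r_minus)
qed

lemma lin_map_id: "lin_map R M M (\<lambda>x. x)"
  by (simp add: lin_map_def)

lemma regular_module_simps [simp]:
  "carrier (regular_module A) = carrier A" "add (regular_module A) = add A"
  "zero (regular_module A) = zero A" "smult (regular_module A) = mult A"
  by (simp_all add: regular_module_def)

lemma regular_module_is_module:
  assumes "cring A"
  shows "Module.module A (regular_module A)"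
proof -
  interpret A: cring A by fact
  show ?thesis
  proof (rule moduleI)
    show "abelian_group (regular_module A)"
    proof (rule abelian_groupI)
      fix x assume "x \<in> carrier (regular_module A)"
      then show "\<exists>y\<in>carrier (regular_module A). y \<oplus>\<^bsub>regular_module A\<^esub> x = \<zero>\<^bsub>regular_module A\<^esub>"
        by (intro bexI[of _ "\<ominus>\<^bsub>A\<^esub> x"]) (simp_all add: A.l_neg)
    qed (simp_all add: A.a_ac)
  qed (simp_all add: A.l_distr A.r_distr A.m_assoc assms)
qed

lemma lin_map_smult_vector:
  assumes "Module.module R N" "lin_map R M (regular_module R) f" "e \<in> carrier N"
  shows "lin_map R M N (\<lambda>x. f x \<odot>\<^bsub>N\<^esub> e)"
proof -
  interpret N: Module.module R N by fact
  show ?thesis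
    using assms(2,3) by (auto simp: lin_map_def N.smult_l_distr N.smult_assoc1)
qed

subsection \<open>Modules of homomorphisms\<close>

lemma hom_module_carrier:
  "f \<in> carrier (hom_module R M N) \<longleftrightarrow> f \<in> extensional (carrier M) \<and> lin_map R M N f"
  by (auto simp: hom_module_def lin_map_def PiE_def)

lemma hom_module_simps:
  "f \<oplus>\<^bsub>hom_module R M N\<^esub> g = (\<lambda>x\<in>carrier M. f x \<oplus>\<^bsub>N\<^esub> g x)"
  "\<zero>\<^bsub>hom_module R M N\<^esub> = (\<lambda>x\<in>carrier M. \<zero>\<^bsub>N\<^esub>)"
  "r \<odot>\<^bsub>hom_module R M N\<^esub> f = (\<lambda>x\<in>carrier M. r \<odot>\<^bsub>N\<^esub> f x)"
  by (simp_all add: hom_module_def)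

lemma restrict_in_hom_module:
  assumes "Module.module R M" "lin_map R M N f"
  shows "restrict f (carrier M) \<in> carrier (hom_module R M N)"
proof -
  interpret M: Module.module R M by fact
  show ?thesis
    using assms(2) by (auto simp: hom_module_carrier lin_map_def)
qed

lemma hom_module_is_module:
  fixes M :: "('a, 'b, 's) module_scheme" and N :: "('a, 'c, 't) module_scheme"
  assumes "Module.module R M" "Module.module R N"
  shows "Module.module R (hom_module R M N)"
proof -
  interpret M: Module.module R M by fact
  interpret N: Module.module R N by fact
  let ?H = "hom_module R M N"
  have ext: "f = g" if "f \<in> extensional (carrier M)" "g \<in> extensional (carrier M)"
    "\<And>x. x \<in> carrier M \<Longrightarrow> f x = g x" for f g :: "'b \<Rightarrow> 'c"
    using that by (rule extensionalityI)
  have closed: "f x \<in> carrier N" if "f \<in> carrier ?H" "x \<in> carrier M" for f x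
    using that by (simp add: hom_module_carrier lin_map_def)
  have extn: "f \<in> extensional (carrier M)" if "f \<in> carrier ?H" for f
    using that by (simp add: hom_module_carrier)
  have zero: "lin_map R M N (\<lambda>x. \<zero>\<^bsub>N\<^esub>)"
    by (simp add: lin_map_def)
  have smult: "lin_map R M N (\<lambda>x. r \<odot>\<^bsub>N\<^esub> f x)" if "r \<in> carrier R" "lin_map R M N f" for r f
    using that by (auto simp: lin_map_def N.smult_r_distr M.m_comm simp flip: N.smult_assoc1)
  show ?thesis
  proof (rule moduleI)
    show "abelian_group ?H"
    proof (rule abelian_groupI)
      show "f \<oplus>\<^bsub>?H\<^esub> g \<in> carrier ?H" if "f \<in> carrier ?H" "g \<in> carrier ?H" for f g
        using that unfolding hom_module_simps
        by (intro restrict_in_hom_module lin_map_plus assms) (simp_all add: hom_module_carrier)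
      show "\<zero>\<^bsub>?H\<^esub> \<in> carrier ?H"
        unfolding hom_module_simps by (intro restrict_in_hom_module assms zero)
      show "\<exists>g\<in>carrier ?H. g \<oplus>\<^bsub>?H\<^esub> f = \<zero>\<^bsub>?H\<^esub>" if f: "f \<in> carrier ?H" for f
      proof (rule bexI)
        show "restrict (\<lambda>x. \<ominus>\<^bsub>N\<^esub> f x) (carrier M) \<in> carrier ?H"
          using f by (intro restrict_in_hom_module lin_map_uminus assms) (simp add: hom_module_carrier)
        show "restrict (\<lambda>x. \<ominus>\<^bsub>N\<^esub> f x) (carrier M) \<oplus>\<^bsub>?H\<^esub> f = \<zero>\<^bsub>?H\<^esub>"
          using f by (intro ext) (simp_all add: hom_module_simps closed N.M.l_neg)
      qed
    qed (intro ext; simp add: hom_module_simps closed extn N.M.a_ac)+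
    show "r \<odot>\<^bsub>?H\<^esub> f \<in> carrier ?H" if "r \<in> carrier R" "f \<in> carrier ?H" for r f
      using that unfolding hom_module_simps
      by (intro restrict_in_hom_module smult assms) (simp_all add: hom_module_carrier)
  qed (rule M.is_cring, (intro ext; simp add: hom_module_simps closed extn
      N.smult_l_distr N.smult_r_distr N.smult_assoc1)+)
qed

subsection \<open>Free modules\<close>

lemma free_module_simps [simp]:
  "(v \<oplus>\<^bsub>free_module A S\<^esub> w) = (\<lambda>s. v s \<oplus>\<^bsub>A\<^esub> w s)" "\<zero>\<^bsub>free_module A S\<^esub> = (\<lambda>s. \<zero>\<^bsub>A\<^esub>)"
  "r \<odot>\<^bsub>free_module A S\<^esub> v = (\<lambda>s. r \<otimes>\<^bsub>A\<^esub> v s)"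
  by (simp_all add: free_module_def)

lemma free_module_carrier:
  "v \<in> carrier (free_module A S) \<longleftrightarrow>
    (\<forall>s\<in>S. v s \<in> carrier A) \<and> (\<forall>s. s \<notin> S \<longrightarrow> v s = \<zero>\<^bsub>A\<^esub>) \<and> finite {s. v s \<noteq> \<zero>\<^bsub>A\<^esub>}"
  by (simp add: free_module_def)

context cring
begin

lemma free_module_closed: "v \<in> carrier (free_module R S) \<Longrightarrow> v s \<in> carrier R"
  by (cases "s \<in> S") (auto simp: free_module_carrier)

lemma free_module_plus_closed:
  assumes "v \<in> carrier (free_module R S)" "w \<in> carrier (free_module R S)"
  shows "(\<lambda>s. v s \<oplus> w s) \<in> carrier (free_module R S)"
proof -
  have "{s. v s \<oplus> w s \<noteq> \<zero>} \<subseteq> {s. v s \<noteq> \<zero>} \<union> {s. w s \<noteq> \<zero>}"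
    by auto
  then show ?thesis
    using assms by (auto simp: free_module_carrier intro: finite_subset)
qed

lemma free_module_smult_closed:
  assumes "r \<in> carrier R" "v \<in> carrier (free_module R S)"
  shows "(\<lambda>s. r \<otimes> v s) \<in> carrier (free_module R S)"
proof -
  have "{s. r \<otimes> v s \<noteq> \<zero>} \<subseteq> {s. v s \<noteq> \<zero>}"
    using assms by auto
  then show ?thesis
    using assms by (auto simp: free_module_carrier intro: finite_subset)
qed

lemma free_module_is_module: "Module.module R (free_module R S)"
proof (rule moduleI)
  let ?F = "free_module R S"
  note closed = free_module_closed[of _ S]
  show "abelian_group ?F"
  proof (rule abelian_groupI)
    fix v assume v: "v \<in> carrier ?F"
    show "\<exists>w\<in>carrier ?F. w \<oplus>\<^bsub>?F\<^esub> v = \<zero>\<^bsub>?F\<^esub>"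
      using free_module_smult_closed[OF _ v, of "\<ominus> \<one>"] closed[OF v]
      by (intro bexI[of _ "\<lambda>s. \<ominus> \<one> \<otimes> v s"]) (simp_all add: l_minus l_neg)
  qed (simp_all add: free_module_plus_closed closed a_ac, simp add: free_module_carrier)
qed (simp_all add: is_cring free_module_smult_closed free_module_closed[of _ S] l_distr r_distr m_assoc)

lemma free_gen_closed:
  assumes "s \<in> S"
  shows "free_gen R s \<in> carrier (free_module R S)"
proof -
  have "{t. free_gen R s t \<noteq> \<zero>} \<subseteq> {s}"
    by (auto simp: free_gen_def)
  then show ?thesis
    using assms by (auto simp: free_module_carrier free_gen_def intro: finite_subset)
qed

text \<open>The sum over the support has the shape used in \<open>free_cover_kernel\<close>, which
  thereby becomes the kernel of the extension of the identity.\<close>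

definition lin_ext :: "('a, 'c, 's) module_scheme \<Rightarrow> 'i set \<Rightarrow> ('i \<Rightarrow> 'c) \<Rightarrow> ('i \<Rightarrow> 'a) \<Rightarrow> 'c" where
  "lin_ext M S h v = finsum M (\<lambda>s. v s \<odot>\<^bsub>M\<^esub> h s) {s \<in> S. v s \<noteq> \<zero>}"

context
  fixes M :: "('a, 'c, 's) module_scheme" and S :: "'i set" and h :: "'i \<Rightarrow> 'c"
  assumes M: "Module.module R M" and h: "\<And>s. s \<in> S \<Longrightarrow> h s \<in> carrier M"
begin

interpretation M: Module.module R M by (rule M)

lemma lin_ext_superset:
  assumes "v \<in> carrier (free_module R S)" "finite T" "{s \<in> S. v s \<noteq> \<zero>} \<subseteq> T" "T \<subseteq> S"
  shows "lin_ext M S h v = finsum M (\<lambda>s. v s \<odot>\<^bsub>M\<^esub> h s) T"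
  unfolding lin_ext_def
  using assms free_module_closed[OF assms(1)] h
  by (intro M.M.add.finprod_mono_neutral_cong_left) (auto simp: subset_iff)

lemma lin_ext_lin_map: "lin_map R (free_module R S) M (lin_ext M S h)"
  unfolding lin_map_def
proof (intro conjI ballI)
  note closed = free_module_closed[of _ S]
  have hT: "(\<lambda>s. v s \<odot>\<^bsub>M\<^esub> h s) \<in> T \<rightarrow> carrier M" if "v \<in> carrier (free_module R S)" "T \<subseteq> S" for v T
    using closed[OF that(1)] that(2) h by auto
  have fin: "finite {s \<in> S. v s \<noteq> \<zero>}" if "v \<in> carrier (free_module R S)" for v
    using that by (auto simp: free_module_carrier intro: rev_finite_subset)
  fix v assume v: "v \<in> carrier (free_module R S)"
  show "lin_ext M S h v \<in> carrier M"
    unfolding lin_ext_def by (intro M.M.finsum_closed hT v) auto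
  show "lin_ext M S h (r \<odot>\<^bsub>free_module R S\<^esub> v) = r \<odot>\<^bsub>M\<^esub> lin_ext M S h v" if r: "r \<in> carrier R" for r
  proof -
    let ?T = "{s \<in> S. v s \<noteq> \<zero>}"
    have "lin_ext M S h (\<lambda>s. r \<otimes> v s) = finsum M (\<lambda>s. (r \<otimes> v s) \<odot>\<^bsub>M\<^esub> h s) ?T"
      using r free_module_smult_closed[OF r v] fin[OF v] by (intro lin_ext_superset) auto
    also have "\<dots> = finsum M (\<lambda>s. r \<odot>\<^bsub>M\<^esub> (v s \<odot>\<^bsub>M\<^esub> h s)) ?T"
      using r closed[OF v] h by (intro M.M.finsum_cong') (auto simp: M.smult_assoc1)
    also have "\<dots> = r \<odot>\<^bsub>M\<^esub> lin_ext M S h v"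
      unfolding lin_ext_def using r by (intro M.finsum_smult_ldistr[symmetric] fin hT v) auto
    finally show ?thesis
      by simp
  qed
  fix w assume w: "w \<in> carrier (free_module R S)"
  let ?T = "{s \<in> S. v s \<noteq> \<zero>} \<union> {s \<in> S. w s \<noteq> \<zero>}"
  have T: "finite ?T" "?T \<subseteq> S"
    using fin v w by auto
  have "lin_ext M S h (\<lambda>s. v s \<oplus> w s) = finsum M (\<lambda>s. (v s \<oplus> w s) \<odot>\<^bsub>M\<^esub> h s) ?T"
    using T by (intro lin_ext_superset free_module_plus_closed v w) auto
  also have "\<dots> = finsum M (\<lambda>s. v s \<odot>\<^bsub>M\<^esub> h s \<oplus>\<^bsub>M\<^esub> w s \<odot>\<^bsub>M\<^esub> h s) ?T"
    using closed[OF v] closed[OF w] h by (intro M.M.finsum_cong') (auto simp: M.smult_l_distr)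
  also have "\<dots> = finsum M (\<lambda>s. v s \<odot>\<^bsub>M\<^esub> h s) ?T \<oplus>\<^bsub>M\<^esub> finsum M (\<lambda>s. w s \<odot>\<^bsub>M\<^esub> h s) ?T"
    by (intro M.M.finsum_addf hT v w T)
  also have "\<dots> = lin_ext M S h v \<oplus>\<^bsub>M\<^esub> lin_ext M S h w"
    using T lin_ext_superset[OF v, of ?T] lin_ext_superset[OF w, of ?T] by simp
  finally show "lin_ext M S h (v \<oplus>\<^bsub>free_module R S\<^esub> w) = lin_ext M S h v \<oplus>\<^bsub>M\<^esub> lin_ext M S h w"
    by simp
qed

lemma lin_ext_gen:
  assumes "s \<in> S"
  shows "lin_ext M S h (free_gen R s) = h s"
proof -
  have "lin_ext M S h (free_gen R s) = finsum M (\<lambda>t. free_gen R s t \<odot>\<^bsub>M\<^esub> h t) {s}"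
    using assms by (intro lin_ext_superset free_gen_closed) (auto simp: free_gen_def)
  then show ?thesis
    using assms h by (simp add: free_gen_def)
qed

end

end

lemma submoduleI_no_inv:
  assumes "Module.module R M" "H \<subseteq> carrier M" "\<zero>\<^bsub>M\<^esub> \<in> H"
    "\<And>x y. x \<in> H \<Longrightarrow> y \<in> H \<Longrightarrow> x \<oplus>\<^bsub>M\<^esub> y \<in> H"
    "\<And>r x. r \<in> carrier R \<Longrightarrow> x \<in> H \<Longrightarrow> r \<odot>\<^bsub>M\<^esub> x \<in> H"
  shows "submodule H R M"
proof -
  interpret M: Module.module R M by fact
  show ?thesis
  proof (rule M.submoduleI)
    fix x assume x: "x \<in> H"
    then have "\<ominus>\<^bsub>M\<^esub> x = (\<ominus>\<^bsub>R\<^esub> \<one>\<^bsub>R\<^esub>) \<odot>\<^bsub>M\<^esub> x"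
      using assms(2) by (simp add: M.smult_l_minus subset_iff)
    then show "\<ominus>\<^bsub>M\<^esub> x \<in> H"
      using assms(5)[OF _ x, of "\<ominus>\<^bsub>R\<^esub> \<one>\<^bsub>R\<^esub>"] by simp
  qed (use assms in auto)
qed

lemma lin_map_zero:
  assumes "Module.module R M" "Module.module R N" "lin_map R M N f"
  shows "f \<zero>\<^bsub>M\<^esub> = \<zero>\<^bsub>N\<^esub>"
proof -
  interpret M: Module.module R M by fact
  interpret N: Module.module R N by fact
  have "f (\<zero>\<^bsub>R\<^esub> \<odot>\<^bsub>M\<^esub> \<zero>\<^bsub>M\<^esub>) = \<zero>\<^bsub>R\<^esub> \<odot>\<^bsub>N\<^esub> f \<zero>\<^bsub>M\<^esub>"
    using assms(3) by (rule lin_map_smult_distrib) auto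
  then show ?thesis
    using lin_map_closed[OF assms(3)] by simp
qed

lemma lin_map_finsum:
  assumes "Module.module R M" "Module.module R N" "lin_map R M N f" "finite T" "g \<in> T \<rightarrow> carrier M"
  shows "f (finsum M g T) = finsum N (\<lambda>t. f (g t)) T"
proof -
  interpret M: Module.module R M by fact
  interpret N: Module.module R N by fact
  show ?thesis
    using assms(4,5)
  proof (induction T)
    case (insert t T)
    then have "(\<lambda>t. f (g t)) \<in> insert t T \<rightarrow> carrier N"
      using lin_map_closed[OF assms(3)] by blast
    then show ?case
      using insert lin_map_closed[OF assms(3)]
      by (simp add: lin_map_add_distrib[OF assms(3)] Pi_iff)
  qed (simp add: lin_map_zero[OF assms(1-3)])
qed

subsection \<open>\<open>Ext\<^sup>1\<close> of a module with two generators and one relation\<close>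

text \<open>
  If \<open>0 \<rightarrow> A \<rightarrow> A\<^sup>2 \<rightarrow> M \<rightarrow> 0\<close> is exact, where \<open>1\<close> maps to \<open>(g\<^sub>1, g\<^sub>2)\<close>, then \<open>Ext\<^sup>1(M, A) = A / (g\<^sub>1, g\<^sub>2)\<close>.
  Comparison of this resolution with the canonical one sends \<open>r\<close> to the class of the
  homomorphism \<open>v \<mapsto> chi v \<cdot> r\<close>.
\<close>

locale two_generators = M: Module.module A M
  for A :: "('a, 'r) ring_scheme" and M :: "('a, 'b, 's) module_scheme" +
  fixes m1 m2 g1 g2
  assumes m_closed: "m1 \<in> carrier M" "m2 \<in> carrier M"
    and g_closed: "g1 \<in> carrier A" "g2 \<in> carrier A"
    and generate: "\<And>m. m \<in> carrier M \<Longrightarrow>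
      \<exists>a\<in>carrier A. \<exists>b\<in>carrier A. m = a \<odot>\<^bsub>M\<^esub> m1 \<oplus>\<^bsub>M\<^esub> b \<odot>\<^bsub>M\<^esub> m2"
    and relation: "g1 \<odot>\<^bsub>M\<^esub> m1 \<oplus>\<^bsub>M\<^esub> g2 \<odot>\<^bsub>M\<^esub> m2 = \<zero>\<^bsub>M\<^esub>"
    and relations: "\<And>a b. a \<in> carrier A \<Longrightarrow> b \<in> carrier A \<Longrightarrow>
      a \<odot>\<^bsub>M\<^esub> m1 \<oplus>\<^bsub>M\<^esub> b \<odot>\<^bsub>M\<^esub> m2 = \<zero>\<^bsub>M\<^esub> \<Longrightarrow>
      \<exists>c\<in>carrier A. a = c \<otimes>\<^bsub>A\<^esub> g1 \<and> b = c \<otimes>\<^bsub>A\<^esub> g2"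
    and injective: "\<And>c. c \<in> carrier A \<Longrightarrow> c \<otimes>\<^bsub>A\<^esub> g1 = \<zero>\<^bsub>A\<^esub> \<Longrightarrow> c \<otimes>\<^bsub>A\<^esub> g2 = \<zero>\<^bsub>A\<^esub> \<Longrightarrow> c = \<zero>\<^bsub>A\<^esub>"
begin

abbreviation "F \<equiv> free_module A (carrier M)"
abbreviation "K \<equiv> free_cover_kernel A M"
abbreviation "RA \<equiv> regular_module A"
abbreviation "H \<equiv> hom_module A (F\<lparr>carrier := K\<rparr>) RA"
abbreviation "N0 \<equiv> (\<lambda>f. restrict f K) ` carrier (hom_module A F RA)"

lemma RA_module: "Module.module A RA"
  by (rule regular_module_is_module[OF M.is_cring])

sublocale F: Module.module A F
  by (rule M.free_module_is_module)

definition eps where "eps = M.lin_ext M (carrier M) (\<lambda>x. x)"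

lemma eps_lin: "lin_map A F M eps"
  unfolding eps_def by (intro M.lin_ext_lin_map M.module_axioms)

lemma K_iff: "v \<in> K \<longleftrightarrow> v \<in> carrier F \<and> eps v = \<zero>\<^bsub>M\<^esub>"
  by (simp add: free_cover_kernel_def eps_def M.lin_ext_def)

lemma K_submodule: "submodule K A F"
proof (rule submoduleI_no_inv[OF F.module_axioms])
  show "\<zero>\<^bsub>F\<^esub> \<in> K"
    using lin_map_zero[OF F.module_axioms M.module_axioms eps_lin] F.M.zero_closed
    by (simp only: K_iff)
  fix x y assume "x \<in> K" "y \<in> K"
  then show "x \<oplus>\<^bsub>F\<^esub> y \<in> K"
    using lin_map_add_distrib[OF eps_lin] F.M.a_closed by (simp only: K_iff M.M.l_zero M.M.zero_closed)
next
  fix r x assume "r \<in> carrier A" "x \<in> K"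
  then show "r \<odot>\<^bsub>F\<^esub> x \<in> K"
    using lin_map_smult_distrib[OF eps_lin] F.smult_closed by (simp only: K_iff M.smult_r_null)
qed (auto simp: K_iff)

lemma K_subset: "v \<in> K \<Longrightarrow> v \<in> carrier F"
  by (simp add: K_iff)

lemma FK_module: "Module.module A (F\<lparr>carrier := K\<rparr>)"
  by (rule submodule.submodule_is_module[OF K_submodule F.module_axioms])

lemma H_module: "Module.module A H"
  by (rule hom_module_is_module[OF FK_module RA_module])

lemma N0_iff: "n \<in> N0 \<longleftrightarrow> (\<exists>f. lin_map A F RA f \<and> n = restrict f K)"
proof
  assume "n \<in> N0"
  then show "\<exists>f. lin_map A F RA f \<and> n = restrict f K"
    by (auto simp: hom_module_carrier)
next
  assume "\<exists>f. lin_map A F RA f \<and> n = restrict f K"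
  then obtain f where f: "lin_map A F RA f" "n = restrict f K"
    by blast
  have "restrict (restrict f (carrier F)) K = n"
    using f(2) K_subset by (auto simp: restrict_def fun_eq_iff)
  then show "n \<in> N0"
    using restrict_in_hom_module[OF F.module_axioms f(1)] by blast
qed

lemma lin_map_FK:
  assumes "lin_map A F P f"
  shows "lin_map A (F\<lparr>carrier := K\<rparr>) P f"
  using assms K_subset by (simp add: lin_map_def)

lemma N0_submodule: "submodule N0 A H"
proof (rule submoduleI_no_inv[OF H_module])
  interpret RA: Module.module A RA by (rule RA_module)
  show "N0 \<subseteq> carrier H"
  proof
    fix n assume "n \<in> N0"
    then obtain f where f: "lin_map A F RA f" "n = restrict f K"
      unfolding N0_iff by blast
    then show "n \<in> carrier H"
      using restrict_in_hom_module[OF FK_module lin_map_FK[OF f(1)]] by simp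
  qed
  have "lin_map A F RA (\<lambda>x. \<zero>\<^bsub>A\<^esub>)"
    by (simp add: lin_map_def)
  then show "\<zero>\<^bsub>H\<^esub> \<in> N0"
    unfolding N0_iff hom_module_simps by (intro exI[of _ "\<lambda>x. \<zero>\<^bsub>A\<^esub>"]) simp
  fix x y assume "x \<in> N0" "y \<in> N0"
  then obtain f g where f: "lin_map A F RA f" "x = restrict f K" and g: "lin_map A F RA g" "y = restrict g K"
    unfolding N0_iff by blast
  have "x \<oplus>\<^bsub>H\<^esub> y = restrict (\<lambda>v. f v \<oplus>\<^bsub>RA\<^esub> g v) K"
    by (auto simp: hom_module_simps f g fun_eq_iff restrict_def)
  then show "x \<oplus>\<^bsub>H\<^esub> y \<in> N0"
    unfolding N0_iff using lin_map_plus[OF RA_module f(1) g(1)] by blast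
next
  interpret RA: Module.module A RA by (rule RA_module)
  fix r x assume r: "r \<in> carrier A" and "x \<in> N0"
  then obtain f where f: "lin_map A F RA f" "x = restrict f K"
    unfolding N0_iff by blast
  have "r \<odot>\<^bsub>H\<^esub> x = restrict (\<lambda>v. r \<odot>\<^bsub>RA\<^esub> f v) K"
    by (auto simp: hom_module_simps f fun_eq_iff restrict_def)
  moreover have "lin_map A F RA (\<lambda>v. r \<odot>\<^bsub>RA\<^esub> f v)"
    using f(1) r by (auto simp: lin_map_def M.r_distr M.m_lcomm)
  ultimately show "r \<odot>\<^bsub>H\<^esub> x \<in> N0"
    unfolding N0_iff by blast
qed

sublocale Q: quotient_mod A H N0
  by (intro quotient_mod.intro quotient_mod_axioms.intro H_module N0_submodule)

lemma Ext1_eq: "Ext1 A M RA = Q.Q"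
  by (simp add: Ext1_def Let_def)

text \<open>A mere choice, in general not linear in \<open>m\<close>. Linearity is regained by
  extending the two coordinates from the generators of the free module.\<close>

definition coords where
  "coords m = (SOME p. fst p \<in> carrier A \<and> snd p \<in> carrier A \<and>
     m = fst p \<odot>\<^bsub>M\<^esub> m1 \<oplus>\<^bsub>M\<^esub> snd p \<odot>\<^bsub>M\<^esub> m2)"

lemma coords:
  assumes "m \<in> carrier M"
  shows "fst (coords m) \<in> carrier A" "snd (coords m) \<in> carrier A"
    "fst (coords m) \<odot>\<^bsub>M\<^esub> m1 \<oplus>\<^bsub>M\<^esub> snd (coords m) \<odot>\<^bsub>M\<^esub> m2 = m"
proof -
  obtain a b where "a \<in> carrier A" "b \<in> carrier A" "m = a \<odot>\<^bsub>M\<^esub> m1 \<oplus>\<^bsub>M\<^esub> b \<odot>\<^bsub>M\<^esub> m2"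
    using generate[OF assms] by blast
  then have "\<exists>p. fst p \<in> carrier A \<and> snd p \<in> carrier A \<and>
     m = fst p \<odot>\<^bsub>M\<^esub> m1 \<oplus>\<^bsub>M\<^esub> snd p \<odot>\<^bsub>M\<^esub> m2"
    by (intro exI[of _ "(a, b)"]) simp
  from someI_ex[OF this]
  show "fst (coords m) \<in> carrier A" "snd (coords m) \<in> carrier A"
    "fst (coords m) \<odot>\<^bsub>M\<^esub> m1 \<oplus>\<^bsub>M\<^esub> snd (coords m) \<odot>\<^bsub>M\<^esub> m2 = m"
    unfolding coords_def by simp_all
qed

definition L1 where "L1 = M.lin_ext RA (carrier M) (\<lambda>m. fst (coords m))"
definition L2 where "L2 = M.lin_ext RA (carrier M) (\<lambda>m. snd (coords m))"

lemma L_lin: "lin_map A F RA L1" "lin_map A F RA L2"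
  unfolding L1_def L2_def
  by (intro M.lin_ext_lin_map RA_module; simp add: coords)+

lemma L_closed: "v \<in> carrier F \<Longrightarrow> L1 v \<in> carrier A" "v \<in> carrier F \<Longrightarrow> L2 v \<in> carrier A"
  using L_lin by (auto simp: lin_map_def)

text \<open>Says that \<open>(L1, L2)\<close> is a lift of the identity of \<open>M\<close> to a map
  from the canonical free cover to \<open>A\<^sup>2\<close>; it holds on generators by the choice of
  \<open>coords\<close>.\<close>

lemma eps_eq:
  assumes v: "v \<in> carrier F"
  shows "eps v = L1 v \<odot>\<^bsub>M\<^esub> m1 \<oplus>\<^bsub>M\<^esub> L2 v \<odot>\<^bsub>M\<^esub> m2"
proof -
  let ?T = "{s \<in> carrier M. v s \<noteq> \<zero>\<^bsub>A\<^esub>}"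
  have fin: "finite ?T"
    using v by (auto simp: free_module_carrier intro: rev_finite_subset)
  have vA: "v s \<in> carrier A" for s
    using M.free_module_closed[OF v] .
  have lm: "lin_map A RA M (\<lambda>a. a \<odot>\<^bsub>M\<^esub> m)" if "m \<in> carrier M" for m
    using lin_map_smult_vector[OF M.module_axioms lin_map_id that] .
  have *: "M.lin_ext RA (carrier M) h v \<odot>\<^bsub>M\<^esub> m = finsum M (\<lambda>s. (v s \<otimes>\<^bsub>A\<^esub> h s) \<odot>\<^bsub>M\<^esub> m) ?T"
    if "m \<in> carrier M" "\<And>s. s \<in> carrier M \<Longrightarrow> h s \<in> carrier A" for m h
    unfolding M.lin_ext_def
    using vA that by (subst lin_map_finsum[OF RA_module M.module_axioms lm fin]) auto
  have "eps v = finsum M (\<lambda>s. (v s \<otimes>\<^bsub>A\<^esub> fst (coords s)) \<odot>\<^bsub>M\<^esub> m1 \<oplus>\<^bsub>M\<^esub> (v s \<otimes>\<^bsub>A\<^esub> snd (coords s)) \<odot>\<^bsub>M\<^esub> m2) ?T"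
    unfolding eps_def M.lin_ext_def
  proof (rule M.M.finsum_cong')
    fix s assume "s \<in> ?T"
    then have s: "s \<in> carrier M"
      by simp
    have "v s \<odot>\<^bsub>M\<^esub> (fst (coords s) \<odot>\<^bsub>M\<^esub> m1 \<oplus>\<^bsub>M\<^esub> snd (coords s) \<odot>\<^bsub>M\<^esub> m2) =
        (v s \<otimes>\<^bsub>A\<^esub> fst (coords s)) \<odot>\<^bsub>M\<^esub> m1 \<oplus>\<^bsub>M\<^esub> (v s \<otimes>\<^bsub>A\<^esub> snd (coords s)) \<odot>\<^bsub>M\<^esub> m2"
      using coords(1,2)[OF s] vA m_closed by (simp add: M.smult_r_distr M.smult_assoc1)
    then show "v s \<odot>\<^bsub>M\<^esub> s = (v s \<otimes>\<^bsub>A\<^esub> fst (coords s)) \<odot>\<^bsub>M\<^esub> m1 \<oplus>\<^bsub>M\<^esub> (v s \<otimes>\<^bsub>A\<^esub> snd (coords s)) \<odot>\<^bsub>M\<^esub> m2"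
      by (simp only: coords(3)[OF s])
  qed (use coords(1,2) vA m_closed in auto)
  also have "\<dots> = finsum M (\<lambda>s. (v s \<otimes>\<^bsub>A\<^esub> fst (coords s)) \<odot>\<^bsub>M\<^esub> m1) ?T \<oplus>\<^bsub>M\<^esub>
      finsum M (\<lambda>s. (v s \<otimes>\<^bsub>A\<^esub> snd (coords s)) \<odot>\<^bsub>M\<^esub> m2) ?T"
    using coords(1,2) vA m_closed by (intro M.M.finsum_addf) auto
  finally show ?thesis
    unfolding L1_def L2_def using *[OF m_closed(1) coords(1)] *[OF m_closed(2) coords(2)] by simp
qed

abbreviation "e1 \<equiv> free_gen A m1"
abbreviation "e2 \<equiv> free_gen A m2"

lemma e_closed: "e1 \<in> carrier F" "e2 \<in> carrier F"
  using m_closed by (simp_all add: M.free_gen_closed)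

text \<open>The map induced on kernels by the lift \<open>(L1, L2)\<close>. It exists because all
  relations are multiples of \<open>(g1, g2)\<close>, and it is unique and linear by
  \<open>injective\<close>.\<close>

definition chi where
  "chi v = (SOME c. c \<in> carrier A \<and> L1 v = c \<otimes>\<^bsub>A\<^esub> g1 \<and> L2 v = c \<otimes>\<^bsub>A\<^esub> g2)"

lemma chi:
  assumes "v \<in> K"
  shows "chi v \<in> carrier A" "L1 v = chi v \<otimes>\<^bsub>A\<^esub> g1" "L2 v = chi v \<otimes>\<^bsub>A\<^esub> g2"
proof -
  have v: "v \<in> carrier F" "eps v = \<zero>\<^bsub>M\<^esub>"
    using assms by (simp_all add: K_iff)
  have "\<exists>c. c \<in> carrier A \<and> L1 v = c \<otimes>\<^bsub>A\<^esub> g1 \<and> L2 v = c \<otimes>\<^bsub>A\<^esub> g2"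
    using relations[OF L_closed[OF v(1) ] ] L_closed v eps_eq by auto
  from someI_ex[OF this] show "chi v \<in> carrier A" "L1 v = chi v \<otimes>\<^bsub>A\<^esub> g1" "L2 v = chi v \<otimes>\<^bsub>A\<^esub> g2"
    unfolding chi_def by simp_all
qed

lemma chi_eqI:
  assumes "v \<in> K" "c \<in> carrier A" "L1 v = c \<otimes>\<^bsub>A\<^esub> g1" "L2 v = c \<otimes>\<^bsub>A\<^esub> g2"
  shows "chi v = c"
proof -
  note c = chi[OF assms(1)]
  have "(chi v \<ominus>\<^bsub>A\<^esub> c) \<otimes>\<^bsub>A\<^esub> g1 = \<zero>\<^bsub>A\<^esub>" "(chi v \<ominus>\<^bsub>A\<^esub> c) \<otimes>\<^bsub>A\<^esub> g2 = \<zero>\<^bsub>A\<^esub>"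
    using c assms g_closed by (simp_all add: M.l_distr a_minus_def M.l_minus M.R.r_neg)
  then have "chi v \<ominus>\<^bsub>A\<^esub> c = \<zero>\<^bsub>A\<^esub>"
    using c(1) assms(2) injective[of "chi v \<ominus>\<^bsub>A\<^esub> c"] by simp
  then show ?thesis
    using c(1) assms(2) M.R.minus_equality[of "chi v" "\<ominus>\<^bsub>A\<^esub> c"]
    by (simp add: a_minus_def M.R.minus_minus)
qed

lemma chi_lin: "lin_map A (F\<lparr>carrier := K\<rparr>) RA chi"
  unfolding lin_map_def
proof (intro conjI ballI; simp del: free_module_simps)
  fix v assume v: "v \<in> K"
  note cv = chi[OF v] and vF = K_subset[OF v]
  show "chi v \<in> carrier A"
    by (rule cv)
  show "chi (r \<odot>\<^bsub>F\<^esub> v) = r \<otimes>\<^bsub>A\<^esub> chi v" if r: "r \<in> carrier A" for r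
    using r v cv vF g_closed
    by (intro chi_eqI submodule.smult_closed[OF K_submodule])
      (simp_all add: lin_map_smult_distrib[OF L_lin(1)] lin_map_smult_distrib[OF L_lin(2)] M.m_assoc
        del: free_module_simps)
  fix w assume w: "w \<in> K"
  note cw = chi[OF w] and wF = K_subset[OF w]
  have "v \<oplus>\<^bsub>F\<^esub> w \<in> K"
    using F.submoduleE(5)[OF K_submodule v w] .
  then show "chi (v \<oplus>\<^bsub>F\<^esub> w) = chi v \<oplus>\<^bsub>A\<^esub> chi w"
    using v w cv cw vF wF g_closed
    by (intro chi_eqI)
      (simp_all add: lin_map_add_distrib[OF L_lin(1)] lin_map_add_distrib[OF L_lin(2)] M.l_distr
        del: free_module_simps)
qed

text \<open>The given relation, viewed in the canonical kernel: the image of 1 under a comparison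
  map in the opposite direction. \<open>chi kappa\<close> is 1 only modulo \<open>g1\<close> and
  \<open>g2\<close>, since \<open>coords\<close> need not send \<open>m1\<close> and
  \<open>m2\<close> to unit vectors.\<close>

definition kappa where "kappa = g1 \<odot>\<^bsub>F\<^esub> e1 \<oplus>\<^bsub>F\<^esub> g2 \<odot>\<^bsub>F\<^esub> e2"

lemma eps_gen: "m \<in> carrier M \<Longrightarrow> eps (free_gen A m) = m"
  unfolding eps_def by (simp add: M.lin_ext_gen[OF M.module_axioms])

lemma kappa_closed: "kappa \<in> carrier F"
  unfolding kappa_def by (intro F.M.a_closed F.smult_closed g_closed e_closed)

lemma lin_map_kappa:
  assumes "lin_map A F P f"
  shows "f kappa = g1 \<odot>\<^bsub>P\<^esub> f e1 \<oplus>\<^bsub>P\<^esub> g2 \<odot>\<^bsub>P\<^esub> f e2"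
  unfolding kappa_def
  using g_closed e_closed F.smult_closed
  by (simp only: lin_map_add_distrib[OF assms] lin_map_smult_distrib[OF assms])

lemma kappa_K: "kappa \<in> K"
  using lin_map_kappa[OF eps_lin] relation by (simp add: K_iff kappa_closed eps_gen m_closed)

text \<open>One minus the composite of the two comparison maps. It is defined on all of
  \<open>F\<close> with values in \<open>K\<close>, so a homomorphism on \<open>K\<close> composed
  with it extends to \<open>F\<close>.\<close>

definition retract where
  "retract v = v \<oplus>\<^bsub>F\<^esub> (\<ominus>\<^bsub>F\<^esub> (L1 v \<odot>\<^bsub>F\<^esub> e1 \<oplus>\<^bsub>F\<^esub> L2 v \<odot>\<^bsub>F\<^esub> e2))"

lemma comb_lin: "lin_map A F F (\<lambda>v. L1 v \<odot>\<^bsub>F\<^esub> e1 \<oplus>\<^bsub>F\<^esub> L2 v \<odot>\<^bsub>F\<^esub> e2)"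
  by (intro lin_map_plus lin_map_smult_vector F.module_axioms L_lin e_closed)

lemma retract_lin: "lin_map A F F retract"
  unfolding retract_def by (intro lin_map_plus lin_map_uminus lin_map_id comb_lin F.module_axioms)

lemma eps_comb:
  assumes "v \<in> carrier F"
  shows "eps (L1 v \<odot>\<^bsub>F\<^esub> e1 \<oplus>\<^bsub>F\<^esub> L2 v \<odot>\<^bsub>F\<^esub> e2) = eps v"
proof -
  have "eps (L1 v \<odot>\<^bsub>F\<^esub> e1 \<oplus>\<^bsub>F\<^esub> L2 v \<odot>\<^bsub>F\<^esub> e2) = L1 v \<odot>\<^bsub>M\<^esub> eps e1 \<oplus>\<^bsub>M\<^esub> L2 v \<odot>\<^bsub>M\<^esub> eps e2"
    using L_closed[OF assms] e_closed F.smult_closed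
    by (simp only: lin_map_add_distrib[OF eps_lin] lin_map_smult_distrib[OF eps_lin])
  then show ?thesis
    using eps_eq[OF assms] m_closed by (simp only: eps_gen)
qed

lemma retract_K:
  assumes "v \<in> carrier F"
  shows "retract v \<in> K"
proof -
  let ?c = "L1 v \<odot>\<^bsub>F\<^esub> e1 \<oplus>\<^bsub>F\<^esub> L2 v \<odot>\<^bsub>F\<^esub> e2"
  have c: "?c \<in> carrier F"
    by (rule lin_map_closed[OF comb_lin assms])
  have "eps (retract v) = eps v \<oplus>\<^bsub>M\<^esub> eps (\<ominus>\<^bsub>F\<^esub> ?c)"
    unfolding retract_def using assms F.M.a_inv_closed[OF c] by (rule lin_map_add_distrib[OF eps_lin])
  also have "eps (\<ominus>\<^bsub>F\<^esub> ?c) = \<ominus>\<^bsub>M\<^esub> eps v"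
    unfolding lin_map_uminus_distrib[OF F.module_axioms M.module_axioms eps_lin c] eps_comb[OF assms] ..
  also have "eps v \<oplus>\<^bsub>M\<^esub> \<ominus>\<^bsub>M\<^esub> eps v = \<zero>\<^bsub>M\<^esub>"
    using lin_map_closed[OF eps_lin assms] by (rule M.M.r_neg)
  finally show ?thesis
    using lin_map_closed[OF retract_lin assms] by (simp add: K_iff)
qed

lemma retract_lin_K: "lin_map A F (F\<lparr>carrier := K\<rparr>) retract"
  using retract_lin retract_K by (simp add: lin_map_def)

lemma decompose_K:
  assumes v: "v \<in> K"
  shows "v = retract v \<oplus>\<^bsub>F\<^esub> chi v \<odot>\<^bsub>F\<^esub> kappa"
proof -
  have vF: "v \<in> carrier F"
    using v by (rule K_subset)
  let ?c = "L1 v \<odot>\<^bsub>F\<^esub> e1 \<oplus>\<^bsub>F\<^esub> L2 v \<odot>\<^bsub>F\<^esub> e2"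
  have "chi v \<odot>\<^bsub>F\<^esub> kappa = ?c"
    unfolding kappa_def using chi[OF v] g_closed e_closed F.smult_closed
    by (simp only: F.smult_r_distr F.smult_assoc1)
  moreover have "?c \<in> carrier F"
    by (rule lin_map_closed[OF comb_lin vF])
  ultimately show ?thesis
    unfolding retract_def using vF by (simp only: F.M.a_assoc F.M.a_inv_closed F.M.l_neg F.M.r_zero)
qed

definition chi_hom where "chi_hom r = (\<lambda>v\<in>K. chi v \<otimes>\<^bsub>A\<^esub> r)"

definition theta where "theta r = Q.proj (chi_hom r)"

lemma chi_hom_closed:
  assumes "r \<in> carrier A"
  shows "chi_hom r \<in> carrier H"
proof -
  have "lin_map A (F\<lparr>carrier := K\<rparr>) RA (\<lambda>v. chi v \<otimes>\<^bsub>A\<^esub> r)"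
    using lin_map_smult_vector[OF RA_module chi_lin, of r] assms by simp
  from restrict_in_hom_module[OF FK_module this] show ?thesis
    by (simp add: chi_hom_def)
qed

lemma theta_closed: "r \<in> carrier A \<Longrightarrow> theta r \<in> carrier (Ext1 A M RA)"
  unfolding theta_def Ext1_eq by (intro Q.proj_closed chi_hom_closed)

lemma theta_add:
  assumes "r \<in> carrier A" "s \<in> carrier A"
  shows "theta (r \<oplus>\<^bsub>A\<^esub> s) = theta r \<oplus>\<^bsub>Ext1 A M RA\<^esub> theta s"
proof -
  have "chi_hom (r \<oplus>\<^bsub>A\<^esub> s) = chi_hom r \<oplus>\<^bsub>H\<^esub> chi_hom s"
    using assms chi by (auto simp: chi_hom_def hom_module_simps fun_eq_iff M.r_distr)
  then show ?thesis
    using assms by (simp add: theta_def Ext1_eq Q.proj_add chi_hom_closed del: Q.N.a_rcos_sum)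
qed

lemma theta_smult:
  assumes "r \<in> carrier A" "s \<in> carrier A"
  shows "theta (r \<otimes>\<^bsub>A\<^esub> s) = r \<odot>\<^bsub>Ext1 A M RA\<^esub> theta s"
proof -
  have "chi_hom (r \<otimes>\<^bsub>A\<^esub> s) = r \<odot>\<^bsub>H\<^esub> chi_hom s"
    using assms chi by (auto simp: chi_hom_def hom_module_simps fun_eq_iff M.m_lcomm)
  then show ?thesis
    using assms by (simp add: theta_def Ext1_eq Q.proj_smult chi_hom_closed)
qed

text \<open>By \<open>decompose_K\<close> a homomorphism \<open>f\<close> on \<open>K\<close> is
  \<open>f\<close> after \<open>retract\<close> plus \<open>chi\<close> times
  \<open>f kappa\<close>. The first summand extends to \<open>F\<close> and vanishes in the
  quotient, so \<open>r = f kappa\<close> represents the class.\<close>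

lemma theta_surj:
  assumes "X \<in> carrier (Ext1 A M RA)"
  shows "\<exists>r\<in>carrier A. X = theta r"
proof -
  obtain f where f: "f \<in> carrier H" "X = Q.proj f"
    using assms by (auto simp: Ext1_eq Q.quotient_carrier)
  have flin: "lin_map A (F\<lparr>carrier := K\<rparr>) RA f" and fext: "f \<in> extensional K"
    using f(1) by (simp_all add: hom_module_carrier)
  define r where "r = f kappa"
  have r: "r \<in> carrier A"
    using lin_map_closed[OF flin, of kappa] kappa_K by (simp add: r_def)
  define n where "n = restrict (\<lambda>v. f (retract v)) K"
  have n: "n \<in> N0"
    unfolding N0_iff n_def using lin_map_comp[OF retract_lin_K flin] by blast
  then have nH: "n \<in> carrier H"
    using N0_submodule Q.M.submoduleE(1) by blast
  have "f = n \<oplus>\<^bsub>H\<^esub> chi_hom r"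
  proof (rule extensionalityI[OF fext])
    show "n \<oplus>\<^bsub>H\<^esub> chi_hom r \<in> extensional K"
      by (simp add: hom_module_simps)
    fix v assume v: "v \<in> K"
    have "f v = f (retract v \<oplus>\<^bsub>F\<^esub> chi v \<odot>\<^bsub>F\<^esub> kappa)"
      using decompose_K[OF v] by (rule arg_cong)
    also have "\<dots> = f (retract v) \<oplus>\<^bsub>A\<^esub> f (chi v \<odot>\<^bsub>F\<^esub> kappa)"
      using lin_map_add_distrib[OF flin, of "retract v" "chi v \<odot>\<^bsub>F\<^esub> kappa"] retract_K K_subset v
        submodule.smult_closed[OF K_submodule chi(1)[OF v] kappa_K]
      by (simp del: free_module_simps)
    also have "f (chi v \<odot>\<^bsub>F\<^esub> kappa) = chi v \<otimes>\<^bsub>A\<^esub> r"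
      using lin_map_smult_distrib[OF flin, of "chi v" kappa] chi(1)[OF v] kappa_K
      by (simp add: r_def del: free_module_simps)
    finally show "f v = (n \<oplus>\<^bsub>H\<^esub> chi_hom r) v"
      using v by (simp add: hom_module_simps n_def chi_hom_def)
  qed
  then have "f \<ominus>\<^bsub>H\<^esub> chi_hom r = n"
    using nH chi_hom_closed[OF r] by (simp add: a_minus_def Q.M.M.a_assoc Q.M.M.r_neg)
  then have "X = theta r"
    using f n chi_hom_closed[OF r] by (simp add: theta_def Q.proj_eq_iff)
  then show ?thesis
    using r by blast
qed

text \<open>If \<open>r\<close> is a combination of \<open>g1\<close> and \<open>g2\<close>, then
  \<open>chi\<close> times \<open>r\<close> is the restriction of a combination of \<open>L1\<close>
  and \<open>L2\<close>. Conversely an extension to \<open>F\<close>, evaluated at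
  \<open>kappa\<close>, puts \<open>chi kappa\<close> times \<open>r\<close> into the ideal, and
  \<open>chi kappa\<close> is congruent to 1.\<close>

lemma theta_eq_0_iff:
  assumes r: "r \<in> carrier A"
  shows "theta r = \<zero>\<^bsub>Ext1 A M RA\<^esub> \<longleftrightarrow>
    (\<exists>s1\<in>carrier A. \<exists>s2\<in>carrier A. r = g1 \<otimes>\<^bsub>A\<^esub> s1 \<oplus>\<^bsub>A\<^esub> g2 \<otimes>\<^bsub>A\<^esub> s2)"
proof -
  have "theta r = \<zero>\<^bsub>Ext1 A M RA\<^esub> \<longleftrightarrow> chi_hom r \<in> N0"
    using Q.proj_eq_0_iff[OF chi_hom_closed[OF r]] by (simp add: theta_def Ext1_eq)
  also have "\<dots> \<longleftrightarrow> (\<exists>s1\<in>carrier A. \<exists>s2\<in>carrier A. r = g1 \<otimes>\<^bsub>A\<^esub> s1 \<oplus>\<^bsub>A\<^esub> g2 \<otimes>\<^bsub>A\<^esub> s2)"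
  proof
    assume "\<exists>s1\<in>carrier A. \<exists>s2\<in>carrier A. r = g1 \<otimes>\<^bsub>A\<^esub> s1 \<oplus>\<^bsub>A\<^esub> g2 \<otimes>\<^bsub>A\<^esub> s2"
    then obtain s1 s2 where s: "s1 \<in> carrier A" "s2 \<in> carrier A" "r = g1 \<otimes>\<^bsub>A\<^esub> s1 \<oplus>\<^bsub>A\<^esub> g2 \<otimes>\<^bsub>A\<^esub> s2"
      by blast
    have "lin_map A F RA (\<lambda>v. L1 v \<odot>\<^bsub>RA\<^esub> s1 \<oplus>\<^bsub>RA\<^esub> L2 v \<odot>\<^bsub>RA\<^esub> s2)"
      using s by (intro lin_map_plus lin_map_smult_vector RA_module L_lin) simp_all
    moreover have "chi_hom r = restrict (\<lambda>v. L1 v \<odot>\<^bsub>RA\<^esub> s1 \<oplus>\<^bsub>RA\<^esub> L2 v \<odot>\<^bsub>RA\<^esub> s2) K"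
      using chi s g_closed by (auto simp: chi_hom_def fun_eq_iff restrict_def M.r_distr M.m_assoc)
    ultimately show "chi_hom r \<in> N0"
      unfolding N0_iff by blast
  next
    assume "chi_hom r \<in> N0"
    then obtain f where f: "lin_map A F RA f" "chi_hom r = restrict f K"
      unfolding N0_iff by blast
    have eq: "chi kappa \<otimes>\<^bsub>A\<^esub> r = g1 \<otimes>\<^bsub>A\<^esub> f e1 \<oplus>\<^bsub>A\<^esub> g2 \<otimes>\<^bsub>A\<^esub> f e2"
      using fun_cong[OF f(2), of kappa] kappa_K lin_map_kappa[OF f(1)] by (simp add: chi_hom_def)
    have fe: "f e1 \<in> carrier A" "f e2 \<in> carrier A"
      using lin_map_closed[OF f(1)] e_closed by simp_all
    have L_gen: "L1 (free_gen A m) = fst (coords m)" "L2 (free_gen A m) = snd (coords m)"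
      if "m \<in> carrier M" for m
      unfolding L1_def L2_def using that by (simp_all add: M.lin_ext_gen[OF RA_module] coords)
    note co1 = coords[OF m_closed(1)] and co2 = coords[OF m_closed(2)]
    \<comment> \<open>The coordinate vectors of \<open>m1\<close> and \<open>m2\<close> differ from
      the unit vectors by relations, that is by multiples \<open>c1\<close>, \<open>c2\<close> of
      \<open>(g1, g2)\<close>; this determines \<open>chi kappa\<close> modulo \<open>g1\<close> and
      \<open>g2\<close>.\<close>
    define l11 l12 l21 l22 where "l11 = fst (coords m1)" "l12 = snd (coords m1)"
      "l21 = fst (coords m2)" "l22 = snd (coords m2)"
    have l: "l11 \<in> carrier A" "l12 \<in> carrier A" "l21 \<in> carrier A" "l22 \<in> carrier A"
      "l11 \<odot>\<^bsub>M\<^esub> m1 \<oplus>\<^bsub>M\<^esub> l12 \<odot>\<^bsub>M\<^esub> m2 = m1" "l21 \<odot>\<^bsub>M\<^esub> m1 \<oplus>\<^bsub>M\<^esub> l22 \<odot>\<^bsub>M\<^esub> m2 = m2"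
      using co1 co2 by (simp_all add: l11_l12_l21_l22_def)
    have "(l11 \<ominus>\<^bsub>A\<^esub> \<one>\<^bsub>A\<^esub>) \<odot>\<^bsub>M\<^esub> m1 \<oplus>\<^bsub>M\<^esub> l12 \<odot>\<^bsub>M\<^esub> m2 = (l11 \<odot>\<^bsub>M\<^esub> m1 \<oplus>\<^bsub>M\<^esub> l12 \<odot>\<^bsub>M\<^esub> m2) \<oplus>\<^bsub>M\<^esub> \<ominus>\<^bsub>M\<^esub> m1"
      using l(1-4) m_closed by (simp add: a_minus_def M.smult_l_distr M.smult_l_minus M.M.a_ac)
    then have "(l11 \<ominus>\<^bsub>A\<^esub> \<one>\<^bsub>A\<^esub>) \<odot>\<^bsub>M\<^esub> m1 \<oplus>\<^bsub>M\<^esub> l12 \<odot>\<^bsub>M\<^esub> m2 = \<zero>\<^bsub>M\<^esub>"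
      using l(5) m_closed by (simp add: M.M.r_neg)
    then obtain c1 where c1: "c1 \<in> carrier A" "l11 \<ominus>\<^bsub>A\<^esub> \<one>\<^bsub>A\<^esub> = c1 \<otimes>\<^bsub>A\<^esub> g1" "l12 = c1 \<otimes>\<^bsub>A\<^esub> g2"
      using relations[of "l11 \<ominus>\<^bsub>A\<^esub> \<one>\<^bsub>A\<^esub>" l12] l by auto
    have "l21 \<odot>\<^bsub>M\<^esub> m1 \<oplus>\<^bsub>M\<^esub> (l22 \<ominus>\<^bsub>A\<^esub> \<one>\<^bsub>A\<^esub>) \<odot>\<^bsub>M\<^esub> m2 = (l21 \<odot>\<^bsub>M\<^esub> m1 \<oplus>\<^bsub>M\<^esub> l22 \<odot>\<^bsub>M\<^esub> m2) \<oplus>\<^bsub>M\<^esub> \<ominus>\<^bsub>M\<^esub> m2"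
      using l(1-4) m_closed by (simp add: a_minus_def M.smult_l_distr M.smult_l_minus M.M.a_ac)
    then have "l21 \<odot>\<^bsub>M\<^esub> m1 \<oplus>\<^bsub>M\<^esub> (l22 \<ominus>\<^bsub>A\<^esub> \<one>\<^bsub>A\<^esub>) \<odot>\<^bsub>M\<^esub> m2 = \<zero>\<^bsub>M\<^esub>"
      using l(6) m_closed by (simp add: M.M.r_neg)
    then obtain c2 where c2: "c2 \<in> carrier A" "l21 = c2 \<otimes>\<^bsub>A\<^esub> g1" "l22 \<ominus>\<^bsub>A\<^esub> \<one>\<^bsub>A\<^esub> = c2 \<otimes>\<^bsub>A\<^esub> g2"
      using relations[of l21 "l22 \<ominus>\<^bsub>A\<^esub> \<one>\<^bsub>A\<^esub>"] l by auto
    have add_minus: "a = b \<oplus>\<^bsub>A\<^esub> \<one>\<^bsub>A\<^esub>" if "a \<ominus>\<^bsub>A\<^esub> \<one>\<^bsub>A\<^esub> = b" "a \<in> carrier A" for a b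
      using that by (auto simp: a_minus_def M.R.a_assoc M.R.l_neg)
    have l11: "l11 = c1 \<otimes>\<^bsub>A\<^esub> g1 \<oplus>\<^bsub>A\<^esub> \<one>\<^bsub>A\<^esub>" and l22: "l22 = c2 \<otimes>\<^bsub>A\<^esub> g2 \<oplus>\<^bsub>A\<^esub> \<one>\<^bsub>A\<^esub>"
      using add_minus[OF c1(2) l(1)] add_minus[OF c2(3) l(4)] by simp_all
    have "chi kappa = \<one>\<^bsub>A\<^esub> \<oplus>\<^bsub>A\<^esub> g1 \<otimes>\<^bsub>A\<^esub> c1 \<oplus>\<^bsub>A\<^esub> g2 \<otimes>\<^bsub>A\<^esub> c2"
    proof (rule chi_eqI[OF kappa_K])
      show "\<one>\<^bsub>A\<^esub> \<oplus>\<^bsub>A\<^esub> g1 \<otimes>\<^bsub>A\<^esub> c1 \<oplus>\<^bsub>A\<^esub> g2 \<otimes>\<^bsub>A\<^esub> c2 \<in> carrier A"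
        using g_closed c1 c2 by simp
      have "L1 kappa = g1 \<otimes>\<^bsub>A\<^esub> l11 \<oplus>\<^bsub>A\<^esub> g2 \<otimes>\<^bsub>A\<^esub> l21"
        using lin_map_kappa[OF L_lin(1)] m_closed by (simp add: L_gen l11_l12_l21_l22_def)
      then show "L1 kappa = (\<one>\<^bsub>A\<^esub> \<oplus>\<^bsub>A\<^esub> g1 \<otimes>\<^bsub>A\<^esub> c1 \<oplus>\<^bsub>A\<^esub> g2 \<otimes>\<^bsub>A\<^esub> c2) \<otimes>\<^bsub>A\<^esub> g1"
        unfolding l11 c2(2) using g_closed c1(1) c2(1) by (simp add: M.r_distr M.l_distr M.m_ac M.R.a_ac)
      have "L2 kappa = g1 \<otimes>\<^bsub>A\<^esub> l12 \<oplus>\<^bsub>A\<^esub> g2 \<otimes>\<^bsub>A\<^esub> l22"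
        using lin_map_kappa[OF L_lin(2)] m_closed by (simp add: L_gen l11_l12_l21_l22_def)
      then show "L2 kappa = (\<one>\<^bsub>A\<^esub> \<oplus>\<^bsub>A\<^esub> g1 \<otimes>\<^bsub>A\<^esub> c1 \<oplus>\<^bsub>A\<^esub> g2 \<otimes>\<^bsub>A\<^esub> c2) \<otimes>\<^bsub>A\<^esub> g2"
        unfolding l22 c1(3) using g_closed c1(1) c2(1) by (simp add: M.r_distr M.l_distr M.m_ac M.R.a_ac)
    qed
    then have "(\<one>\<^bsub>A\<^esub> \<oplus>\<^bsub>A\<^esub> g1 \<otimes>\<^bsub>A\<^esub> c1 \<oplus>\<^bsub>A\<^esub> g2 \<otimes>\<^bsub>A\<^esub> c2) \<otimes>\<^bsub>A\<^esub> r = g1 \<otimes>\<^bsub>A\<^esub> f e1 \<oplus>\<^bsub>A\<^esub> g2 \<otimes>\<^bsub>A\<^esub> f e2"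
      using eq by simp
    then have "r \<oplus>\<^bsub>A\<^esub> (g1 \<otimes>\<^bsub>A\<^esub> (c1 \<otimes>\<^bsub>A\<^esub> r) \<oplus>\<^bsub>A\<^esub> g2 \<otimes>\<^bsub>A\<^esub> (c2 \<otimes>\<^bsub>A\<^esub> r)) =
        g1 \<otimes>\<^bsub>A\<^esub> f e1 \<oplus>\<^bsub>A\<^esub> g2 \<otimes>\<^bsub>A\<^esub> f e2"
      using g_closed c1(1) c2(1) r by (simp add: M.l_distr M.m_assoc M.R.a_assoc)
    then have "r = (g1 \<otimes>\<^bsub>A\<^esub> f e1 \<oplus>\<^bsub>A\<^esub> g2 \<otimes>\<^bsub>A\<^esub> f e2) \<ominus>\<^bsub>A\<^esub>
        (g1 \<otimes>\<^bsub>A\<^esub> (c1 \<otimes>\<^bsub>A\<^esub> r) \<oplus>\<^bsub>A\<^esub> g2 \<otimes>\<^bsub>A\<^esub> (c2 \<otimes>\<^bsub>A\<^esub> r))"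
      using g_closed c1(1) c2(1) r fe by (simp add: a_minus_def M.R.add.inv_solve_right)
    also have "\<dots> = g1 \<otimes>\<^bsub>A\<^esub> (f e1 \<ominus>\<^bsub>A\<^esub> c1 \<otimes>\<^bsub>A\<^esub> r) \<oplus>\<^bsub>A\<^esub> g2 \<otimes>\<^bsub>A\<^esub> (f e2 \<ominus>\<^bsub>A\<^esub> c2 \<otimes>\<^bsub>A\<^esub> r)"
      using g_closed c1(1) c2(1) r fe
      by (simp add: a_minus_def M.r_distr M.r_minus M.R.minus_add M.R.a_ac)
    finally show "\<exists>s1\<in>carrier A. \<exists>s2\<in>carrier A. r = g1 \<otimes>\<^bsub>A\<^esub> s1 \<oplus>\<^bsub>A\<^esub> g2 \<otimes>\<^bsub>A\<^esub> s2"
      using c1(1) c2(1) r fe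
      by (intro bexI[of _ "f e1 \<ominus>\<^bsub>A\<^esub> c1 \<otimes>\<^bsub>A\<^esub> r"] bexI[of _ "f e2 \<ominus>\<^bsub>A\<^esub> c2 \<otimes>\<^bsub>A\<^esub> r"]) auto
  qed
  finally show ?thesis .
qed

lemma Ext1_module: "Module.module A (Ext1 A M RA)"
  unfolding Ext1_eq by (rule Q.quotient_is_module)

end

section \<open>Kaehler differentials and \<open>Ext\<^sup>1\<close> for a curve in a regular local surface\<close>

lemma module_span_submodule:
  assumes "Module.module R M" "X \<subseteq> carrier M"
  shows "submodule (module_span R M X) R M"
proof (rule submoduleI_no_inv[OF assms(1)])
  interpret M: Module.module R M by fact
  show "module_span R M X \<subseteq> carrier M"
    using assms(2) M.carrier_is_submodule by (auto simp: module_span_def)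
  show "\<zero>\<^bsub>M\<^esub> \<in> module_span R M X"
    by (auto simp: module_span_def dest!: submodule.axioms(1) subgroup.one_closed)
  show "x \<oplus>\<^bsub>M\<^esub> y \<in> module_span R M X" if "x \<in> module_span R M X" "y \<in> module_span R M X" for x y
    using that M.submoduleE(5) by (auto simp: module_span_def)
  show "r \<odot>\<^bsub>M\<^esub> x \<in> module_span R M X" if "r \<in> carrier R" "x \<in> module_span R M X" for r x
    using that M.submoduleE(4) by (auto simp: module_span_def)
qed

lemma module_span_superset: "X \<subseteq> module_span R M X"
  by (auto simp: module_span_def)

lemma module_span_minimal: "submodule N R M \<Longrightarrow> X \<subseteq> N \<Longrightarrow> module_span R M X \<subseteq> N"
  by (auto simp: module_span_def)

lemma (in cring) free_module_generated:
  assumes W: "submodule W R (free_module R S)" and gen: "\<And>s. s \<in> S \<Longrightarrow> free_gen R s \<in> W"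
    and v: "v \<in> carrier (free_module R S)"
  shows "v \<in> W"
proof -
  let ?F = "free_module R S"
  interpret F: Module.module R ?F by (rule free_module_is_module)
  have "v \<in> W" if "finite T" "{s. v s \<noteq> \<zero>} \<subseteq> T" "v \<in> carrier ?F" for T v
    using that
  proof (induction T arbitrary: v)
    case empty
    then have "v = \<zero>\<^bsub>?F\<^esub>"
      by auto
    moreover have "\<zero>\<^bsub>?F\<^esub> \<in> W"
      using W subgroup.one_closed[OF submodule.axioms(1)[OF W]] by simp
    ultimately show ?case
      by (simp only:)
  next
    case (insert t T)
    show ?case
    proof (cases "t \<in> S")
      case False
      then have "v t = \<zero>"
        using insert.prems by (simp add: free_module_carrier)
      then show ?thesis
        using insert.prems by (intro insert.IH) auto
    next
      case True
      define v' where "v' = v(t := \<zero>)"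
      have vc: "v s \<in> carrier R" for s
        by (rule free_module_closed[OF insert.prems(2)])
      have "{s. v' s \<noteq> \<zero>} \<subseteq> {s. v s \<noteq> \<zero>}"
        by (auto simp: v'_def)
      then have v': "v' \<in> carrier ?F"
        using insert.prems(2) by (auto simp: free_module_carrier v'_def intro: finite_subset)
      have "v' \<in> W"
        using insert.prems by (intro insert.IH[OF _ v']) (auto simp: v'_def)
      moreover have "v t \<odot>\<^bsub>?F\<^esub> free_gen R t \<in> W"
        using gen[OF True] vc by (intro submodule.smult_closed[OF W])
      ultimately have "v' \<oplus>\<^bsub>?F\<^esub> v t \<odot>\<^bsub>?F\<^esub> free_gen R t \<in> W"
        by (rule F.submoduleE(5)[OF W])
      moreover have "v' \<oplus>\<^bsub>?F\<^esub> v t \<odot>\<^bsub>?F\<^esub> free_gen R t = v"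
        using vc by (auto simp: v'_def free_gen_def fun_eq_iff)
      ultimately show ?thesis
        by (simp only:)
    qed
  qed
  then show ?thesis
    using v by (auto simp: free_module_carrier)
qed

text \<open>The shape of the chains in \<open>module_length\<close>, freed from modules, so that
  lengths can be compared along strictly monotone maps between families of sets.\<close>

definition has_chain :: "'x set set \<Rightarrow> nat \<Rightarrow> bool" where
  "has_chain \<L> n \<longleftrightarrow> (\<exists>c. (\<forall>i\<le>n. c i \<in> \<L>) \<and> (\<forall>i<n. c i \<subset> c (Suc i)))"

lemma has_chain_transfer:
  assumes "has_chain \<L> n" "\<And>X. X \<in> \<L> \<Longrightarrow> f X \<in> \<M>"
    "\<And>X Y. X \<in> \<L> \<Longrightarrow> Y \<in> \<L> \<Longrightarrow> X \<subset> Y \<Longrightarrow> f X \<subset> f Y"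
  shows "has_chain \<M> n"
proof -
  obtain c where "\<forall>i\<le>n. c i \<in> \<L>" "\<forall>i<n. c i \<subset> c (Suc i)"
    using assms(1) by (auto simp: has_chain_def)
  then have "(\<forall>i\<le>n. f (c i) \<in> \<M>) \<and> (\<forall>i<n. f (c i) \<subset> f (c (Suc i)))"
    using assms(2,3) by (metis Suc_leI less_imp_le)
  then show ?thesis
    unfolding has_chain_def by (intro exI[of _ "\<lambda>i. f (c i)"])
qed

text \<open>\<open>S\<close> models the local ring of a surface inside its field of fractions, with
  coordinates \<open>t1\<close>, \<open>t2\<close>, the dual derivations \<open>D1\<close>,
  \<open>D2\<close> and a local equation \<open>g\<close>. \<open>S_induct\<close> says that
  \<open>S\<close> arises from constants and coordinates by sums, products and division by units.
  \<open>no_common_zero_divisor\<close> is injectivity of the gradient modulo \<open>g\<close>, the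
  left exactness of the presentation of the differentials.\<close>

locale local_curve =
  fixes S :: "'f::field set" and \<kappa> :: "'k \<Rightarrow> 'f" and D1 D2 :: "'f \<Rightarrow> 'f" and t1 t2 g :: 'f
  assumes S_closed: "0 \<in> S" "1 \<in> S" "\<And>a b. a \<in> S \<Longrightarrow> b \<in> S \<Longrightarrow> a + b \<in> S"
      "\<And>a. a \<in> S \<Longrightarrow> - a \<in> S" "\<And>a b. a \<in> S \<Longrightarrow> b \<in> S \<Longrightarrow> a * b \<in> S" "\<And>c. \<kappa> c \<in> S"
    and D_closed: "\<And>a. a \<in> S \<Longrightarrow> D1 a \<in> S" "\<And>a. a \<in> S \<Longrightarrow> D2 a \<in> S"
    and D_add: "\<And>a b. a \<in> S \<Longrightarrow> b \<in> S \<Longrightarrow> D1 (a + b) = D1 a + D1 b"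
      "\<And>a b. a \<in> S \<Longrightarrow> b \<in> S \<Longrightarrow> D2 (a + b) = D2 a + D2 b"
    and D_mult: "\<And>a b. a \<in> S \<Longrightarrow> b \<in> S \<Longrightarrow> D1 (a * b) = a * D1 b + b * D1 a"
      "\<And>a b. a \<in> S \<Longrightarrow> b \<in> S \<Longrightarrow> D2 (a * b) = a * D2 b + b * D2 a"
    and D_const: "\<And>c. D1 (\<kappa> c) = 0" "\<And>c. D2 (\<kappa> c) = 0"
    and \<kappa>_0: "\<exists>c. \<kappa> c = 0"
    and t_S: "t1 \<in> S" "t2 \<in> S" and g_S: "g \<in> S"
    and D_t: "D1 t1 = 1" "D1 t2 = 0" "D2 t1 = 0" "D2 t2 = 1"
    and S_induct: "\<And>X. (\<And>c. \<kappa> c \<in> X) \<Longrightarrow> t1 \<in> X \<Longrightarrow> t2 \<in> X \<Longrightarrow>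
      (\<And>a b. a \<in> S \<Longrightarrow> b \<in> S \<Longrightarrow> a \<in> X \<Longrightarrow> b \<in> X \<Longrightarrow> a + b \<in> X) \<Longrightarrow>
      (\<And>a b. a \<in> S \<Longrightarrow> b \<in> S \<Longrightarrow> a \<in> X \<Longrightarrow> b \<in> X \<Longrightarrow> a * b \<in> X) \<Longrightarrow>
      (\<And>a b b'. a \<in> S \<Longrightarrow> b \<in> S \<Longrightarrow> b' \<in> S \<Longrightarrow> b * b' = 1 \<Longrightarrow> b * a \<in> X \<Longrightarrow> b \<in> X \<Longrightarrow> a \<in> X) \<Longrightarrow> S \<subseteq> X"
    and no_common_zero_divisor: "\<And>r. r \<in> S \<Longrightarrow> (\<exists>c\<in>S. r * D1 g = c * g) \<Longrightarrow> (\<exists>c\<in>S. r * D2 g = c * g)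
      \<Longrightarrow> (\<exists>c\<in>S. r = c * g)"
begin

definition R :: "'f ring" where
  "R = \<lparr>carrier = S, mult = (*), one = 1, zero = 0, add = (+)\<rparr>"

lemma R_simps [simp]: "carrier R = S" "mult R = (*)" "one R = 1" "zero R = 0" "add R = (+)"
  by (simp_all add: R_def)

definition I where "I = {c * g | c. c \<in> S}"

lemma R_cring: "cring R"
proof (rule cringI)
  show "abelian_group R"
  proof (rule abelian_groupI)
    fix x assume "x \<in> carrier R"
    then show "\<exists>y\<in>carrier R. y \<oplus>\<^bsub>R\<^esub> x = \<zero>\<^bsub>R\<^esub>"
      using S_closed by (intro bexI[of _ "- x"]) auto
  qed (use S_closed in \<open>auto simp: add_ac\<close>)
  show "Group.comm_monoid R"
    by (rule comm_monoidI) (use S_closed in \<open>auto simp: mult_ac\<close>)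
qed (simp add: distrib_right)

sublocale R: cring R
  by (rule R_cring)

lemma R_inv: "x \<in> S \<Longrightarrow> \<ominus>\<^bsub>R\<^esub> x = - x"
  using R.minus_equality[of "- x" x] S_closed by simp

definition is_ideal :: "'f set \<Rightarrow> bool" where
  "is_ideal L \<longleftrightarrow> L \<subseteq> S \<and> 0 \<in> L \<and> (\<forall>x\<in>L. \<forall>y\<in>L. x + y \<in> L) \<and> (\<forall>s\<in>S. \<forall>x\<in>L. s * x \<in> L)"

lemma is_ideal_uminus: "is_ideal L \<Longrightarrow> x \<in> L \<Longrightarrow> - x \<in> L"
  unfolding is_ideal_def using S_closed(2,4) by (metis mult_minus1)

lemma is_ideal_diff: "is_ideal L \<Longrightarrow> x \<in> L \<Longrightarrow> y \<in> L \<Longrightarrow> x - y \<in> L"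
  using is_ideal_uminus[of L y] unfolding is_ideal_def by (metis diff_conv_add_uminus)

lemma ideal_R: 
  assumes "is_ideal L"
  shows "ideal L R"
proof (rule idealI)
  show "ring R"
    by (rule R.ring_axioms)
  show "subgroup L (add_monoid R)"
  proof (rule R.add.subgroupI)
    show "L \<subseteq> carrier R" "L \<noteq> {}"
      using assms by (auto simp: is_ideal_def)
    show "\<ominus>\<^bsub>R\<^esub> a \<in> L" if "a \<in> L" for a
      using that assms is_ideal_uminus[OF assms that] R_inv[of a] by (auto simp: is_ideal_def)
    show "a \<oplus>\<^bsub>R\<^esub> b \<in> L" if "a \<in> L" "b \<in> L" for a b
      using that assms by (auto simp: is_ideal_def)
  qed
next
  fix a x assume "a \<in> L" "x \<in> carrier R"
  then have "x * a \<in> L"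
    using assms by (simp add: is_ideal_def)
  then show "x \<otimes>\<^bsub>R\<^esub> a \<in> L" "a \<otimes>\<^bsub>R\<^esub> x \<in> L"
    by (simp_all add: mult.commute)
qed

lemma I_is_ideal: "is_ideal I"
  unfolding is_ideal_def I_def
proof (intro conjI ballI)
  show "{c * g |c. c \<in> S} \<subseteq> S"
    using S_closed g_S by auto
  show "0 \<in> {c * g |c. c \<in> S}"
    using S_closed(1) by force
  fix x assume "x \<in> {c * g |c. c \<in> S}"
  then obtain c where c: "x = c * g" "c \<in> S"
    by blast
  show "s * x \<in> {c * g |c. c \<in> S}" if "s \<in> S" for s
    using c S_closed(5)[OF that c(2)] by (auto simp: mult.assoc)
  fix y assume "y \<in> {c * g |c. c \<in> S}"
  then obtain b where b: "y = b * g" "b \<in> S"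
    by blast
  show "x + y \<in> {c * g |c. c \<in> S}"
    using b c S_closed(3)[OF c(2) b(2)] by (auto simp flip: distrib_right)
qed

sublocale I: ideal I R
  by (rule ideal_R[OF I_is_ideal])

definition A where "A = R Quot I"

definition \<pi> :: "'f \<Rightarrow> 'f set" where "\<pi> r = I +>\<^bsub>R\<^esub> r"

lemma A_cring: "cring A"
  unfolding A_def by (rule I.quotient_is_cring[OF R_cring])

sublocale A: cring A
  by (rule A_cring)

lemma \<pi>_hom: "\<pi> \<in> Ring.ring_hom R A"
proof -
  have "\<pi> = (+>\<^bsub>R\<^esub>) I"
    by (simp add: \<pi>_def fun_eq_iff)
  then show ?thesis
    unfolding A_def using I.rcos_ring_hom by simp
qed

lemma \<pi>_simps:
  "r \<in> S \<Longrightarrow> \<pi> r \<in> carrier A"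
  "r \<in> S \<Longrightarrow> s \<in> S \<Longrightarrow> \<pi> r \<otimes>\<^bsub>A\<^esub> \<pi> s = \<pi> (r * s)"
  "r \<in> S \<Longrightarrow> s \<in> S \<Longrightarrow> \<pi> r \<oplus>\<^bsub>A\<^esub> \<pi> s = \<pi> (r + s)"
  "\<one>\<^bsub>A\<^esub> = \<pi> 1"
  using ring_hom_closed[OF \<pi>_hom, of r] ring_hom_mult[OF \<pi>_hom, of r s]
    ring_hom_add[OF \<pi>_hom, of r s] ring_hom_one[OF \<pi>_hom] by simp_all

lemma \<pi>_zero: "\<zero>\<^bsub>A\<^esub> = \<pi> 0"
proof -
  have "\<pi> 0 \<oplus>\<^bsub>A\<^esub> \<pi> 0 = \<pi> 0"
    using S_closed(1) by (simp add: \<pi>_simps)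
  then show ?thesis
    using A.add.l_cancel_one'[of "\<pi> 0" "\<pi> 0"] S_closed(1) by (simp add: \<pi>_simps)
qed

lemma \<pi>_uminus: "r \<in> S \<Longrightarrow> \<ominus>\<^bsub>A\<^esub> \<pi> r = \<pi> (- r)"
  using A.minus_equality[of "\<pi> (- r)" "\<pi> r"] S_closed by (simp add: \<pi>_simps \<pi>_zero)

lemma \<pi>_diff: "r \<in> S \<Longrightarrow> s \<in> S \<Longrightarrow> \<pi> r \<ominus>\<^bsub>A\<^esub> \<pi> s = \<pi> (r - s)"
  using S_closed by (simp add: a_minus_def \<pi>_uminus \<pi>_simps)

lemma \<pi>_eq_iff:
  assumes "r \<in> S" "s \<in> S"
  shows "\<pi> r = \<pi> s \<longleftrightarrow> r - s \<in> I"
  using R.quotient_eq_iff_same_a_r_cos[OF I.is_ideal, of r s] assms R_inv[of s]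
  by (simp add: \<pi>_def a_minus_def)

lemma \<pi>_surj: "\<alpha> \<in> carrier A \<Longrightarrow> \<exists>r\<in>S. \<alpha> = \<pi> r"
  by (auto simp: A_def FactRing_def A_RCOSETS_def' \<pi>_def)

lemma \<pi>_surjE:
  assumes "\<alpha> \<in> carrier A"
  obtains r where "r \<in> S" "\<alpha> = \<pi> r"
  using \<pi>_surj[OF assms] by (elim bexE)

section \<open>Presentation of the differentials of the curve\<close>

definition \<iota> :: "'k \<Rightarrow> 'f set" where "\<iota> c = \<pi> (\<kappa> c)"

abbreviation "RA \<equiv> regular_module A"
abbreviation "F \<equiv> free_module A (carrier A)"
abbreviation "gen \<equiv> free_gen A"
abbreviation "rels \<equiv> kaehler_relations A \<iota>"
abbreviation "rel_span \<equiv> module_span A F rels"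
abbreviation "\<Omega> \<equiv> kaehler_module A \<iota>"

sublocale F: Module.module A F
  by (rule A.free_module_is_module)

lemma gen_closed: "\<alpha> \<in> carrier A \<Longrightarrow> gen \<alpha> \<in> carrier F"
  by (rule A.free_gen_closed)

lemma \<iota>_closed: "\<iota> c \<in> carrier A"
  by (simp add: \<iota>_def \<pi>_simps S_closed)

lemma rels_subset: "rels \<subseteq> carrier F"
proof -
  have "gen (a \<oplus>\<^bsub>A\<^esub> b) \<ominus>\<^bsub>F\<^esub> (gen a \<oplus>\<^bsub>F\<^esub> gen b) \<in> carrier F"
    "gen (a \<otimes>\<^bsub>A\<^esub> b) \<ominus>\<^bsub>F\<^esub> (a \<odot>\<^bsub>F\<^esub> gen b \<oplus>\<^bsub>F\<^esub> b \<odot>\<^bsub>F\<^esub> gen a) \<in> carrier F"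
    if "a \<in> carrier A" "b \<in> carrier A" for a b
    using that gen_closed F.smult_closed F.M.a_closed F.M.minus_closed A.a_closed A.m_closed
    by presburger+
  moreover have "gen (\<iota> c) \<in> carrier F" for c
    by (intro gen_closed \<iota>_closed)
  ultimately show ?thesis
    unfolding kaehler_relations_def Let_def by blast
qed

lemma span_submodule: "submodule rel_span A F"
  by (rule module_span_submodule[OF F.module_axioms rels_subset])

sublocale Q: quotient_mod A F rel_span
  by (intro quotient_mod.intro quotient_mod_axioms.intro F.module_axioms span_submodule)

lemma \<Omega>_eq: "\<Omega> = Q.Q"
  by (simp add: kaehler_module_def Let_def)

lemma \<Omega>_module: "Module.module A \<Omega>"
  unfolding \<Omega>_eq by (rule Q.quotient_is_module)

sublocale \<Omega>: Module.module A \<Omega>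
  by (rule \<Omega>_module)

definition d :: "'f set \<Rightarrow> ('f set \<Rightarrow> 'f set) set" where "d \<alpha> = Q.proj (gen \<alpha>)"

lemma d_closed: "\<alpha> \<in> carrier A \<Longrightarrow> d \<alpha> \<in> carrier \<Omega>"
  unfolding d_def \<Omega>_eq by (intro Q.proj_closed gen_closed)

lemma d_add:
  assumes "a \<in> carrier A" "b \<in> carrier A"
  shows "d (a \<oplus>\<^bsub>A\<^esub> b) = d a \<oplus>\<^bsub>\<Omega>\<^esub> d b"
proof -
  have "gen (a \<oplus>\<^bsub>A\<^esub> b) \<ominus>\<^bsub>F\<^esub> (gen a \<oplus>\<^bsub>F\<^esub> gen b) \<in> rels"
    unfolding kaehler_relations_def Let_def using assms by blast
  then have "Q.proj (gen (a \<oplus>\<^bsub>A\<^esub> b)) = Q.proj (gen a \<oplus>\<^bsub>F\<^esub> gen b)"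
    using assms gen_closed F.M.a_closed A.a_closed module_span_superset[of rels A F]
    by (subst Q.proj_eq_iff) blast+
  then show ?thesis
    using Q.proj_add[OF gen_closed gen_closed, OF assms] by (simp only: d_def \<Omega>_eq)
qed

lemma d_mult:
  assumes "a \<in> carrier A" "b \<in> carrier A"
  shows "d (a \<otimes>\<^bsub>A\<^esub> b) = a \<odot>\<^bsub>\<Omega>\<^esub> d b \<oplus>\<^bsub>\<Omega>\<^esub> b \<odot>\<^bsub>\<Omega>\<^esub> d a"
proof -
  note ab = F.smult_closed[OF assms(1) gen_closed[OF assms(2)]] F.smult_closed[OF assms(2) gen_closed[OF assms(1)]]
  have "gen (a \<otimes>\<^bsub>A\<^esub> b) \<ominus>\<^bsub>F\<^esub> (a \<odot>\<^bsub>F\<^esub> gen b \<oplus>\<^bsub>F\<^esub> b \<odot>\<^bsub>F\<^esub> gen a) \<in> rels"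
    unfolding kaehler_relations_def Let_def using assms by blast
  then have "Q.proj (gen (a \<otimes>\<^bsub>A\<^esub> b)) = Q.proj (a \<odot>\<^bsub>F\<^esub> gen b \<oplus>\<^bsub>F\<^esub> b \<odot>\<^bsub>F\<^esub> gen a)"
    using assms gen_closed F.M.a_closed[OF ab] A.m_closed module_span_superset[of rels A F]
    by (subst Q.proj_eq_iff) blast+
  then show ?thesis
    using Q.proj_add[OF ab] Q.proj_smult[OF assms(1) gen_closed[OF assms(2)]]
      Q.proj_smult[OF assms(2) gen_closed[OF assms(1)]] by (simp only: d_def \<Omega>_eq)
qed

lemma d_\<iota>: "d (\<iota> c) = \<zero>\<^bsub>\<Omega>\<^esub>"
proof -
  have "gen (\<iota> c) \<in> rels"
    unfolding kaehler_relations_def Let_def by blast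
  then show ?thesis
    unfolding d_def \<Omega>_eq
    using Q.proj_eq_0_iff[OF gen_closed[OF \<iota>_closed]] module_span_superset[of rels A F] by blast
qed

abbreviation m1 where "m1 \<equiv> d (\<pi> t1)"
abbreviation m2 where "m2 \<equiv> d (\<pi> t2)"

lemma m_closed: "m1 \<in> carrier \<Omega>" "m2 \<in> carrier \<Omega>"
  by (simp_all add: d_closed \<pi>_simps t_S)

definition comb :: "'f \<Rightarrow> 'f \<Rightarrow> ('f set \<Rightarrow> 'f set) set" where
  "comb a b = \<pi> a \<odot>\<^bsub>\<Omega>\<^esub> m1 \<oplus>\<^bsub>\<Omega>\<^esub> \<pi> b \<odot>\<^bsub>\<Omega>\<^esub> m2"

lemma comb_closed: "a \<in> S \<Longrightarrow> b \<in> S \<Longrightarrow> comb a b \<in> carrier \<Omega>"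
  using m_closed by (simp add: comb_def \<pi>_simps)

lemma comb_add:
  assumes "a \<in> S" "b \<in> S" "a' \<in> S" "b' \<in> S"
  shows "comb a b \<oplus>\<^bsub>\<Omega>\<^esub> comb a' b' = comb (a + a') (b + b')"
proof -
  have "comb (a + a') (b + b') =
      (\<pi> a \<odot>\<^bsub>\<Omega>\<^esub> m1 \<oplus>\<^bsub>\<Omega>\<^esub> \<pi> a' \<odot>\<^bsub>\<Omega>\<^esub> m1) \<oplus>\<^bsub>\<Omega>\<^esub> (\<pi> b \<odot>\<^bsub>\<Omega>\<^esub> m2 \<oplus>\<^bsub>\<Omega>\<^esub> \<pi> b' \<odot>\<^bsub>\<Omega>\<^esub> m2)"
    using assms m_closed
    by (simp add: comb_def \<pi>_simps(1) flip: \<pi>_simps(3) add: \<Omega>.smult_l_distr)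
  then show ?thesis
    using assms m_closed by (simp add: comb_def \<pi>_simps \<Omega>.M.a_ac)
qed

lemma comb_smult:
  assumes "r \<in> S" "a \<in> S" "b \<in> S"
  shows "\<pi> r \<odot>\<^bsub>\<Omega>\<^esub> comb a b = comb (r * a) (r * b)"
  using assms m_closed
  by (simp add: comb_def \<pi>_simps(1) \<Omega>.smult_r_distr flip: \<pi>_simps(2) add: \<Omega>.smult_assoc1)

text \<open>The chain rule \<open>dr = D1 r dt1 + D2 r dt2\<close>, proved along the generation of
  \<open>S\<close>; both sides satisfy the Leibniz rule.\<close>

lemma d_eq_comb:
  assumes "r \<in> S"
  shows "d (\<pi> r) = comb (D1 r) (D2 r)"
proof -
  let ?X = "{r \<in> S. d (\<pi> r) = comb (D1 r) (D2 r)}"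
  have "S \<subseteq> ?X"
  proof (rule S_induct)
    have 0: "comb 0 0 = \<zero>\<^bsub>\<Omega>\<^esub>"
      using m_closed by (simp add: comb_def flip: \<pi>_zero)
    show "\<kappa> c \<in> ?X" for c
      using d_\<iota>[of c] by (simp add: \<iota>_def S_closed D_const 0)
    show "t1 \<in> ?X" "t2 \<in> ?X"
      using m_closed t_S by (simp_all add: D_t comb_def flip: \<pi>_zero \<pi>_simps(4))
    fix a b assume S: "a \<in> S" "b \<in> S"
    {
      assume X: "a \<in> ?X" "b \<in> ?X"
      have "d (\<pi> (a + b)) = d (\<pi> a) \<oplus>\<^bsub>\<Omega>\<^esub> d (\<pi> b)"
        using S d_add[of "\<pi> a" "\<pi> b"] by (simp add: \<pi>_simps)
      then show "a + b \<in> ?X"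
        using S X by (simp add: S_closed comb_add D_add D_closed)
      have "d (\<pi> (a * b)) = \<pi> a \<odot>\<^bsub>\<Omega>\<^esub> d (\<pi> b) \<oplus>\<^bsub>\<Omega>\<^esub> \<pi> b \<odot>\<^bsub>\<Omega>\<^esub> d (\<pi> a)"
        using S d_mult[of "\<pi> a" "\<pi> b"] by (simp add: \<pi>_simps)
      then show "a * b \<in> ?X"
        using S X by (simp add: S_closed comb_add comb_smult D_mult D_closed)
    }
    \<comment> \<open>Division by a unit \<open>b\<close>: the Leibniz rule for \<open>b * a\<close>
      determines \<open>b da\<close>, and multiplication by the inverse \<open>b'\<close> recovers
      \<open>da\<close>.\<close>
    fix b' assume b': "b' \<in> S" "b * b' = 1" and X: "b * a \<in> ?X" "b \<in> ?X"
    have da: "d (\<pi> a) \<in> carrier \<Omega>"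
      using S by (simp add: d_closed \<pi>_simps)
    have c1: "\<pi> b \<odot>\<^bsub>\<Omega>\<^esub> d (\<pi> a) \<in> carrier \<Omega>" and c3: "\<pi> a \<odot>\<^bsub>\<Omega>\<^esub> d (\<pi> b) \<in> carrier \<Omega>"
      and c2: "comb (b * D1 a) (b * D2 a) \<in> carrier \<Omega>"
      using S da by (auto intro!: \<Omega>.smult_closed d_closed comb_closed S_closed D_closed \<pi>_simps(1))
    have "\<pi> b \<odot>\<^bsub>\<Omega>\<^esub> d (\<pi> a) \<oplus>\<^bsub>\<Omega>\<^esub> \<pi> a \<odot>\<^bsub>\<Omega>\<^esub> d (\<pi> b) = d (\<pi> (b * a))"
      using S d_mult[of "\<pi> b" "\<pi> a"] by (simp add: \<pi>_simps)
    also have "\<dots> = comb (b * D1 a) (b * D2 a) \<oplus>\<^bsub>\<Omega>\<^esub> \<pi> a \<odot>\<^bsub>\<Omega>\<^esub> d (\<pi> b)"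
      using S X by (simp add: comb_add comb_smult D_mult D_closed S_closed)
    finally have "\<pi> b \<odot>\<^bsub>\<Omega>\<^esub> d (\<pi> a) = comb (b * D1 a) (b * D2 a)"
      by (rule iffD1[OF \<Omega>.M.add.right_cancel[OF c3 c1 c2]])
    then have "\<pi> b' \<odot>\<^bsub>\<Omega>\<^esub> (\<pi> b \<odot>\<^bsub>\<Omega>\<^esub> d (\<pi> a)) = comb (b' * (b * D1 a)) (b' * (b * D2 a))"
      using S b' by (simp add: comb_smult S_closed D_closed)
    moreover have "\<pi> b' \<odot>\<^bsub>\<Omega>\<^esub> (\<pi> b \<odot>\<^bsub>\<Omega>\<^esub> d (\<pi> a)) = d (\<pi> a)"
    proof -
      have "\<pi> b' \<otimes>\<^bsub>A\<^esub> \<pi> b = \<one>\<^bsub>A\<^esub>"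
        using S b' by (simp add: \<pi>_simps mult.commute)
      then show ?thesis
        using S b' da by (simp add: \<pi>_simps(1) flip: \<Omega>.smult_assoc1)
    qed
    moreover have "b' * (b * x) = x" for x
      using b'(2) by (metis mult.assoc mult.commute mult_1)
    ultimately show "a \<in> ?X"
      using S by simp
  qed
  then show ?thesis
    using assms by blast
qed

lemma generate:
  assumes "m \<in> carrier \<Omega>"
  shows "\<exists>a\<in>S. \<exists>b\<in>S. m = comb a b"
proof -
  define W where "W = {v \<in> carrier F. \<exists>a\<in>S. \<exists>b\<in>S. Q.proj v = comb a b}"
  have W_I: "v \<in> W" if "v \<in> carrier F" "a \<in> S" "b \<in> S" "Q.proj v = comb a b" for v a b
    unfolding W_def using that by (intro CollectI conjI bexI)
  have "submodule W A F"
  proof (rule submoduleI_no_inv[OF F.module_axioms])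
    have "comb 0 0 = \<zero>\<^bsub>\<Omega>\<^esub>"
      using m_closed by (simp add: comb_def flip: \<pi>_zero)
    then show "\<zero>\<^bsub>F\<^esub> \<in> W"
      by (intro W_I[OF F.M.zero_closed S_closed(1,1)]) (simp only: \<Omega>_eq Q.quotient_zero)
    fix x y assume "x \<in> W" "y \<in> W"
    then obtain a b a' b' where "x \<in> carrier F" "y \<in> carrier F" "a \<in> S" "b \<in> S" "a' \<in> S" "b' \<in> S"
      "Q.proj x = comb a b" "Q.proj y = comb a' b'"
      unfolding W_def mem_Collect_eq by (elim conjE bexE)
    then have "x \<oplus>\<^bsub>F\<^esub> y \<in> carrier F \<and> Q.proj (x \<oplus>\<^bsub>F\<^esub> y) = comb (a + a') (b + b')"
      using Q.proj_add[of x y] comb_add[of a b a' b'] F.M.a_closed by (simp only: \<Omega>_eq)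
    then show "x \<oplus>\<^bsub>F\<^esub> y \<in> W"
      using S_closed(3)[OF \<open>a \<in> S\<close> \<open>a' \<in> S\<close>] S_closed(3)[OF \<open>b \<in> S\<close> \<open>b' \<in> S\<close>] by (elim conjE) (rule W_I)
  next
    fix \<rho> x assume \<rho>: "\<rho> \<in> carrier A" and "x \<in> W"
    then obtain a b where x: "x \<in> carrier F" "a \<in> S" "b \<in> S" "Q.proj x = comb a b"
      unfolding W_def mem_Collect_eq by (elim conjE bexE)
    obtain r where r: "r \<in> S" "\<rho> = \<pi> r"
      by (rule \<pi>_surjE[OF \<rho>])
    with x have "\<rho> \<odot>\<^bsub>F\<^esub> x \<in> carrier F \<and> Q.proj (\<rho> \<odot>\<^bsub>F\<^esub> x) = comb (r * a) (r * b)"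
      using Q.proj_smult[of \<rho> x] comb_smult[of r a b] F.smult_closed \<pi>_simps(1) by (simp only: \<Omega>_eq)
    then show "\<rho> \<odot>\<^bsub>F\<^esub> x \<in> W"
      using S_closed(5)[OF r(1) \<open>a \<in> S\<close>] S_closed(5)[OF r(1) \<open>b \<in> S\<close>] by (elim conjE) (rule W_I)
  qed (auto simp: W_def)
  moreover have "gen \<alpha> \<in> W" if \<alpha>: "\<alpha> \<in> carrier A" for \<alpha>
  proof -
    obtain r where r: "r \<in> S" "\<alpha> = \<pi> r"
      by (rule \<pi>_surjE[OF \<alpha>])
    then have "Q.proj (gen \<alpha>) = comb (D1 r) (D2 r)"
      using d_eq_comb by (simp add: d_def)
    then show ?thesis
      by (rule W_I[OF gen_closed[OF \<alpha>] D_closed(1)[OF r(1)] D_closed(2)[OF r(1)]])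
  qed
  moreover obtain v where v: "v \<in> carrier F" "m = Q.proj v"
    using assms unfolding \<Omega>_eq Q.quotient_carrier by (elim imageE)
  ultimately have "v \<in> W"
    using A.free_module_generated by metis
  then show ?thesis
    unfolding W_def v(2) mem_Collect_eq by (elim conjE)
qed

text \<open>
  The derivations descend to \<open>A\<close> only modulo multiples of \<open>(\<pi> (D1 g), \<pi> (D2 g))\<close>: two lifts of an
  element of \<open>A\<close> differ by some \<open>c g\<close>.
\<close>

definition lift :: "'f set \<Rightarrow> 'f" where "lift \<alpha> = (SOME r. r \<in> S \<and> \<alpha> = \<pi> r)"

lemma lift: 
  assumes "\<alpha> \<in> carrier A"
  shows "lift \<alpha> \<in> S" "\<pi> (lift \<alpha>) = \<alpha>"
proof -
  have "\<exists>r. r \<in> S \<and> \<alpha> = \<pi> r"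
    using \<pi>_surj[OF assms] by (simp only: Bex_def)
  from someI_ex[OF this] show "lift \<alpha> \<in> S" "\<pi> (lift \<alpha>) = \<alpha>"
    unfolding lift_def by simp_all
qed

text \<open>Membership in the expected relation module, the multiples of the gradient modulo
  \<open>g\<close>, phrased with representatives in \<open>S\<close>.\<close>

definition gpair :: "'f \<Rightarrow> 'f \<Rightarrow> bool" where
  "gpair a b \<longleftrightarrow> (\<exists>c\<in>S. a - c * D1 g \<in> I \<and> b - c * D2 g \<in> I)"

lemma I_add: "x \<in> I \<Longrightarrow> y \<in> I \<Longrightarrow> x + y \<in> I"
  using I_is_ideal by (simp add: is_ideal_def)

lemma I_mult: "s \<in> S \<Longrightarrow> x \<in> I \<Longrightarrow> s * x \<in> I"
  using I_is_ideal by (simp add: is_ideal_def)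

lemma gpair_0: "gpair 0 0"
  unfolding gpair_def using I_is_ideal S_closed(1) by (intro bexI[of _ 0]) (auto simp: is_ideal_def)

lemma gpair_add: 
  assumes "gpair a b" "gpair a' b'"
  shows "gpair (a + a') (b + b')"
proof -
  obtain c c' where c: "c \<in> S" "a - c * D1 g \<in> I" "b - c * D2 g \<in> I"
    and c': "c' \<in> S" "a' - c' * D1 g \<in> I" "b' - c' * D2 g \<in> I"
    using assms by (auto simp: gpair_def)
  have "a + a' - (c + c') * D1 g \<in> I" "b + b' - (c + c') * D2 g \<in> I"
    using I_add[OF c(2) c'(2)] I_add[OF c(3) c'(3)] by (simp_all add: algebra_simps)
  then show ?thesis
    unfolding gpair_def using S_closed(3)[OF c(1) c'(1)] by blast
qed

lemma gpair_mult: 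
  assumes "s \<in> S" "gpair a b"
  shows "gpair (s * a) (s * b)"
proof -
  obtain c where c: "c \<in> S" "a - c * D1 g \<in> I" "b - c * D2 g \<in> I"
    using assms by (auto simp: gpair_def)
  have "s * a - (s * c) * D1 g \<in> I" "s * b - (s * c) * D2 g \<in> I"
    using I_mult[OF assms(1) c(2)] I_mult[OF assms(1) c(3)] by (simp_all add: algebra_simps)
  then show ?thesis
    unfolding gpair_def using S_closed(5)[OF assms(1) c(1)] by blast
qed

lemma gpair_cong:
  assumes "gpair a b" "a' - a \<in> I" "b' - b \<in> I"
  shows "gpair a' b'"
proof -
  obtain c where c: "c \<in> S" "a - c * D1 g \<in> I" "b - c * D2 g \<in> I"
    using assms by (auto simp: gpair_def)
  have "a' - c * D1 g \<in> I" "b' - c * D2 g \<in> I"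
    using I_add[OF assms(2) c(2)] I_add[OF assms(3) c(3)] by simp_all
  then show ?thesis
    unfolding gpair_def using c(1) by blast
qed

lemma gpair_D_I:
  assumes "x \<in> I"
  shows "gpair (D1 x) (D2 x)"
proof -
  obtain c where c: "c \<in> S" "x = c * g"
    using assms by (auto simp: I_def)
  have "D1 x - c * D1 g = D1 c * g" "D2 x - c * D2 g = D2 c * g"
    using c g_S by (simp_all add: D_mult)
  then show ?thesis
    unfolding gpair_def using c(1) D_closed by (intro bexI[of _ c]) (auto simp: I_def)
qed

lemma D_diff:
  assumes "a \<in> S" "b \<in> S"
  shows "D1 (a - b) = D1 a - D1 b" "D2 (a - b) = D2 a - D2 b"
  using D_add[of "a - b" b] S_closed(3)[OF assms(1) S_closed(4)[OF assms(2)]] assms by simp_all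

lemma gpair_D_lift:
  assumes "r \<in> S"
  shows "gpair (D1 (lift (\<pi> r)) - D1 r) (D2 (lift (\<pi> r)) - D2 r)"
proof -
  have l: "lift (\<pi> r) \<in> S" "\<pi> (lift (\<pi> r)) = \<pi> r"
    using lift[OF \<pi>_simps(1)[OF assms]] by simp_all
  then have "lift (\<pi> r) - r \<in> I"
    using \<pi>_eq_iff assms by blast
  then show ?thesis
    using gpair_D_I D_diff[OF l(1) assms] by fastforce
qed

text \<open>Together with \<open>\<Phi>2\<close> the candidate inverse of the presentation, taken on
  the free module on all symbols. It depends on the chosen lifts, which is why its values are used
  only up to \<open>gpair\<close>.\<close>

definition \<Phi>1 where "\<Phi>1 = A.lin_ext RA (carrier A) (\<lambda>\<alpha>. \<pi> (D1 (lift \<alpha>)))"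
definition \<Phi>2 where "\<Phi>2 = A.lin_ext RA (carrier A) (\<lambda>\<alpha>. \<pi> (D2 (lift \<alpha>)))"

lemma RA_module: "Module.module A RA"
  by (rule regular_module_is_module[OF A_cring])

lemma \<Phi>_lin: "lin_map A F RA \<Phi>1" "lin_map A F RA \<Phi>2"
  unfolding \<Phi>1_def \<Phi>2_def
  by (intro A.lin_ext_lin_map RA_module; simp add: \<pi>_simps D_closed lift)+

lemma \<Phi>_gen: "\<alpha> \<in> carrier A \<Longrightarrow> \<Phi>1 (gen \<alpha>) = \<pi> (D1 (lift \<alpha>))"
  "\<alpha> \<in> carrier A \<Longrightarrow> \<Phi>2 (gen \<alpha>) = \<pi> (D2 (lift \<alpha>))"
  unfolding \<Phi>1_def \<Phi>2_def
  by (simp_all add: A.lin_ext_gen[OF RA_module] \<pi>_simps D_closed lift)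

text \<open>The preimage of the expected relation module. Being a submodule that contains the
  Kaehler relations, it contains their span, which bounds the actual relations from above.\<close>

definition NS where
  "NS = {v \<in> carrier F. \<exists>a\<in>S. \<exists>b\<in>S. \<Phi>1 v = \<pi> a \<and> \<Phi>2 v = \<pi> b \<and> gpair a b}"

lemma NS_I:
  "v \<in> carrier F \<Longrightarrow> a \<in> S \<Longrightarrow> b \<in> S \<Longrightarrow> \<Phi>1 v = \<pi> a \<Longrightarrow> \<Phi>2 v = \<pi> b \<Longrightarrow> gpair a b \<Longrightarrow> v \<in> NS"
  unfolding NS_def by (intro CollectI conjI bexI)

lemma NS_E:
  assumes "v \<in> NS"
  obtains a b where "v \<in> carrier F" "a \<in> S" "b \<in> S" "\<Phi>1 v = \<pi> a" "\<Phi>2 v = \<pi> b" "gpair a b"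
  using assms unfolding NS_def mem_Collect_eq by (elim conjE bexE)

lemma NS_submodule: "submodule NS A F"
proof (rule submoduleI_no_inv[OF F.module_axioms])
  have "\<Phi>1 \<zero>\<^bsub>F\<^esub> = \<pi> 0" "\<Phi>2 \<zero>\<^bsub>F\<^esub> = \<pi> 0"
    using lin_map_zero[OF F.module_axioms RA_module \<Phi>_lin(1)]
      lin_map_zero[OF F.module_axioms RA_module \<Phi>_lin(2)] \<pi>_zero by (simp_all only: regular_module_simps)
  then show "\<zero>\<^bsub>F\<^esub> \<in> NS"
    by (intro NS_I[OF F.M.zero_closed S_closed(1,1)] gpair_0)
  fix x y assume "x \<in> NS" "y \<in> NS"
  then obtain a b a' b' where *: "x \<in> carrier F" "y \<in> carrier F" "a \<in> S" "b \<in> S" "a' \<in> S" "b' \<in> S"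
    "\<Phi>1 x = \<pi> a" "\<Phi>2 x = \<pi> b" "gpair a b" "\<Phi>1 y = \<pi> a'" "\<Phi>2 y = \<pi> b'" "gpair a' b'"
    by (elim NS_E)
  then have "\<Phi>1 (x \<oplus>\<^bsub>F\<^esub> y) = \<pi> (a + a')" "\<Phi>2 (x \<oplus>\<^bsub>F\<^esub> y) = \<pi> (b + b')"
    using lin_map_add_distrib[OF \<Phi>_lin(1), of x y] lin_map_add_distrib[OF \<Phi>_lin(2), of x y] \<pi>_simps(3)
    by (simp_all only: regular_module_simps)
  then show "x \<oplus>\<^bsub>F\<^esub> y \<in> NS"
    by (rule NS_I[OF F.M.a_closed[OF *(1,2)] S_closed(3)[OF *(3,5)] S_closed(3)[OF *(4,6)] _ _ gpair_add[OF *(9,12)]])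
next
  fix \<rho> x assume \<rho>: "\<rho> \<in> carrier A" and x: "x \<in> NS"
  obtain r where r: "r \<in> S" "\<rho> = \<pi> r"
    by (rule \<pi>_surjE[OF \<rho>])
  obtain a b where ab: "x \<in> carrier F" "a \<in> S" "b \<in> S" "\<Phi>1 x = \<pi> a" "\<Phi>2 x = \<pi> b" "gpair a b"
    by (rule NS_E[OF x])
  note * = r \<rho> ab
  then have "\<Phi>1 (\<rho> \<odot>\<^bsub>F\<^esub> x) = \<pi> (r * a)" "\<Phi>2 (\<rho> \<odot>\<^bsub>F\<^esub> x) = \<pi> (r * b)"
    using lin_map_smult_distrib[OF \<Phi>_lin(1), of \<rho> x] lin_map_smult_distrib[OF \<Phi>_lin(2), of \<rho> x] \<pi>_simps(2)
    by (simp_all only: regular_module_simps)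
  then show "\<rho> \<odot>\<^bsub>F\<^esub> x \<in> NS"
    by (rule NS_I[OF F.smult_closed[OF *(3,4)] S_closed(5)[OF *(1,5)] S_closed(5)[OF *(1,6)] _ _ gpair_mult[OF *(1,9)]])
qed (auto simp: NS_def)

lemma \<Phi>_minus:
  assumes "v \<in> carrier F" "w \<in> carrier F" "a \<in> S" "b \<in> S"
  shows "\<Phi>1 v = \<pi> a \<Longrightarrow> \<Phi>1 w = \<pi> b \<Longrightarrow> \<Phi>1 (v \<ominus>\<^bsub>F\<^esub> w) = \<pi> (a - b)"
    "\<Phi>2 v = \<pi> a \<Longrightarrow> \<Phi>2 w = \<pi> b \<Longrightarrow> \<Phi>2 (v \<ominus>\<^bsub>F\<^esub> w) = \<pi> (a - b)"
proof -
  have "\<ominus>\<^bsub>RA\<^esub> \<pi> b = \<pi> (- b)"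
    using abelian_group.minus_equality[of RA "\<pi> (- b)" "\<pi> b"] Module.module.axioms(2)[OF RA_module]
      assms(4) S_closed by (simp add: \<pi>_simps \<pi>_zero)
  then show "\<Phi>1 v = \<pi> a \<Longrightarrow> \<Phi>1 w = \<pi> b \<Longrightarrow> \<Phi>1 (v \<ominus>\<^bsub>F\<^esub> w) = \<pi> (a - b)"
    "\<Phi>2 v = \<pi> a \<Longrightarrow> \<Phi>2 w = \<pi> b \<Longrightarrow> \<Phi>2 (v \<ominus>\<^bsub>F\<^esub> w) = \<pi> (a - b)"
    using lin_map_add_distrib[OF \<Phi>_lin(1) assms(1) F.M.a_inv_closed[OF assms(2)]]
      lin_map_add_distrib[OF \<Phi>_lin(2) assms(1) F.M.a_inv_closed[OF assms(2)]]
      lin_map_uminus_distrib[OF F.module_axioms RA_module \<Phi>_lin(1) assms(2)]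
      lin_map_uminus_distrib[OF F.module_axioms RA_module \<Phi>_lin(2) assms(2)]
      \<pi>_simps(3)[OF assms(3) S_closed(4)[OF assms(4)]]
    by (simp_all only: a_minus_def regular_module_simps) simp_all
qed

text \<open>In each relation the lift of a sum, product or constant and the corresponding expression
  in lifts or constants agree modulo \<open>g\<close>, so by \<open>gpair_D_lift\<close> their
  derivatives differ by a multiple of the gradient.\<close>

lemma rels_NS: "rels \<subseteq> NS"
proof -
  have 1: "gen (\<alpha> \<oplus>\<^bsub>A\<^esub> \<beta>) \<ominus>\<^bsub>F\<^esub> (gen \<alpha> \<oplus>\<^bsub>F\<^esub> gen \<beta>) \<in> NS" if ab: "\<alpha> \<in> carrier A" "\<beta> \<in> carrier A" for \<alpha> \<beta>
  proof -
    define a b where "a = lift \<alpha>" "b = lift \<beta>"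
    have S: "a \<in> S" "b \<in> S" "a + b \<in> S" and \<pi>: "\<alpha> \<oplus>\<^bsub>A\<^esub> \<beta> = \<pi> (a + b)"
      using lift ab S_closed by (simp_all add: a_b_def flip: \<pi>_simps(3))
    define s where "s = lift (\<pi> (a + b))"
    have s: "s \<in> S"
      using lift[OF \<pi>_simps(1)[OF S(3)]] by (simp add: s_def)
    have c: "gen (\<alpha> \<oplus>\<^bsub>A\<^esub> \<beta>) \<in> carrier F" "gen \<alpha> \<oplus>\<^bsub>F\<^esub> gen \<beta> \<in> carrier F"
      using gen_closed F.M.a_closed A.a_closed ab by blast+
    have v: "\<Phi>1 (gen (\<alpha> \<oplus>\<^bsub>A\<^esub> \<beta>)) = \<pi> (D1 s)" "\<Phi>2 (gen (\<alpha> \<oplus>\<^bsub>A\<^esub> \<beta>)) = \<pi> (D2 s)"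
      using \<Phi>_gen[OF A.a_closed[OF ab]] by (simp_all add: \<pi> s_def)
    have w: "\<Phi>1 (gen \<alpha> \<oplus>\<^bsub>F\<^esub> gen \<beta>) = \<pi> (D1 a + D1 b)" "\<Phi>2 (gen \<alpha> \<oplus>\<^bsub>F\<^esub> gen \<beta>) = \<pi> (D2 a + D2 b)"
      using lin_map_add_distrib[OF \<Phi>_lin(1) gen_closed gen_closed, OF ab]
        lin_map_add_distrib[OF \<Phi>_lin(2) gen_closed gen_closed, OF ab] \<Phi>_gen ab \<pi>_simps(3) D_closed S
      by (simp_all only: regular_module_simps a_b_def)
    have "gpair (D1 s - (D1 a + D1 b)) (D2 s - (D2 a + D2 b))"
      using gpair_D_lift[OF S(3)] D_add S by (simp add: s_def)
    moreover have "D1 s - (D1 a + D1 b) \<in> S" "D2 s - (D2 a + D2 b) \<in> S" "D1 a + D1 b \<in> S" "D2 a + D2 b \<in> S"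
      using s S D_closed S_closed by (simp_all only: diff_conv_add_uminus)
    ultimately show ?thesis
      using D_closed s by (intro NS_I[OF F.M.minus_closed[OF c] _ _ \<Phi>_minus(1)[OF c _ _ v(1) w(1)] \<Phi>_minus(2)[OF c _ _ v(2) w(2)]])
  qed
  have 2: "gen (\<alpha> \<otimes>\<^bsub>A\<^esub> \<beta>) \<ominus>\<^bsub>F\<^esub> (\<alpha> \<odot>\<^bsub>F\<^esub> gen \<beta> \<oplus>\<^bsub>F\<^esub> \<beta> \<odot>\<^bsub>F\<^esub> gen \<alpha>) \<in> NS"
    if ab: "\<alpha> \<in> carrier A" "\<beta> \<in> carrier A" for \<alpha> \<beta>
  proof -
    define a b where "a = lift \<alpha>" "b = lift \<beta>"
    have S: "a \<in> S" "b \<in> S" "a * b \<in> S" and \<pi>: "\<alpha> \<otimes>\<^bsub>A\<^esub> \<beta> = \<pi> (a * b)" "\<alpha> = \<pi> a" "\<beta> = \<pi> b"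
      using lift ab S_closed by (simp_all add: a_b_def flip: \<pi>_simps(2))
    define s where "s = lift (\<pi> (a * b))"
    have s: "s \<in> S"
      using lift[OF \<pi>_simps(1)[OF S(3)]] by (simp add: s_def)
    have c1: "\<alpha> \<odot>\<^bsub>F\<^esub> gen \<beta> \<in> carrier F" "\<beta> \<odot>\<^bsub>F\<^esub> gen \<alpha> \<in> carrier F"
      using gen_closed F.smult_closed ab by blast+
    have c: "gen (\<alpha> \<otimes>\<^bsub>A\<^esub> \<beta>) \<in> carrier F" "\<alpha> \<odot>\<^bsub>F\<^esub> gen \<beta> \<oplus>\<^bsub>F\<^esub> \<beta> \<odot>\<^bsub>F\<^esub> gen \<alpha> \<in> carrier F"
      using gen_closed F.M.a_closed[OF c1] A.m_closed ab by blast+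
    have v: "\<Phi>1 (gen (\<alpha> \<otimes>\<^bsub>A\<^esub> \<beta>)) = \<pi> (D1 s)" "\<Phi>2 (gen (\<alpha> \<otimes>\<^bsub>A\<^esub> \<beta>)) = \<pi> (D2 s)"
      using \<Phi>_gen[OF A.m_closed[OF ab]] by (simp_all add: \<pi>(1) s_def)
    have gen: "\<Phi>1 (gen \<alpha>) = \<pi> (D1 a)" "\<Phi>2 (gen \<alpha>) = \<pi> (D2 a)"
      "\<Phi>1 (gen \<beta>) = \<pi> (D1 b)" "\<Phi>2 (gen \<beta>) = \<pi> (D2 b)"
      using \<Phi>_gen ab by (simp_all only: a_b_def)
    have mult: "\<alpha> \<otimes>\<^bsub>A\<^esub> \<pi> x = \<pi> (a * x)" "\<beta> \<otimes>\<^bsub>A\<^esub> \<pi> x = \<pi> (b * x)" if "x \<in> S" for x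
      unfolding \<pi>(2,3) by (rule \<pi>_simps(2)[OF S(1) that] \<pi>_simps(2)[OF S(2) that])+
    have sm: "\<Phi>1 (\<alpha> \<odot>\<^bsub>F\<^esub> gen \<beta>) = \<pi> (a * D1 b)" "\<Phi>2 (\<alpha> \<odot>\<^bsub>F\<^esub> gen \<beta>) = \<pi> (a * D2 b)"
      "\<Phi>1 (\<beta> \<odot>\<^bsub>F\<^esub> gen \<alpha>) = \<pi> (b * D1 a)" "\<Phi>2 (\<beta> \<odot>\<^bsub>F\<^esub> gen \<alpha>) = \<pi> (b * D2 a)"
      using lin_map_smult_distrib[OF \<Phi>_lin(1) ab(1) gen_closed[OF ab(2)]]
        lin_map_smult_distrib[OF \<Phi>_lin(2) ab(1) gen_closed[OF ab(2)]]
        lin_map_smult_distrib[OF \<Phi>_lin(1) ab(2) gen_closed[OF ab(1)]]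
        lin_map_smult_distrib[OF \<Phi>_lin(2) ab(2) gen_closed[OF ab(1)]]
        gen mult D_closed S
      by (simp_all only: regular_module_simps)
    have w: "\<Phi>1 (\<alpha> \<odot>\<^bsub>F\<^esub> gen \<beta> \<oplus>\<^bsub>F\<^esub> \<beta> \<odot>\<^bsub>F\<^esub> gen \<alpha>) = \<pi> (a * D1 b + b * D1 a)"
      "\<Phi>2 (\<alpha> \<odot>\<^bsub>F\<^esub> gen \<beta> \<oplus>\<^bsub>F\<^esub> \<beta> \<odot>\<^bsub>F\<^esub> gen \<alpha>) = \<pi> (a * D2 b + b * D2 a)"
      using lin_map_add_distrib[OF \<Phi>_lin(1) c1] lin_map_add_distrib[OF \<Phi>_lin(2) c1] sm
        \<pi>_simps(3) D_closed S S_closed(5)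
      by (simp_all only: regular_module_simps)
    have "gpair (D1 s - (a * D1 b + b * D1 a)) (D2 s - (a * D2 b + b * D2 a))"
      using gpair_D_lift[OF S(3)] D_mult S by (simp add: s_def)
    moreover have "D1 s - (a * D1 b + b * D1 a) \<in> S" "D2 s - (a * D2 b + b * D2 a) \<in> S" "a * D1 b + b * D1 a \<in> S" "a * D2 b + b * D2 a \<in> S"
      using s S D_closed S_closed by (simp_all only: diff_conv_add_uminus)
    ultimately show ?thesis
      using D_closed s by (intro NS_I[OF F.M.minus_closed[OF c] _ _ \<Phi>_minus(1)[OF c _ _ v(1) w(1)] \<Phi>_minus(2)[OF c _ _ v(2) w(2)]])
  qed
  have 3: "gen (\<iota> c) \<in> NS" for c
  proof -
    define s where "s = lift (\<iota> c)"
    have "s \<in> S"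
      using lift[OF \<iota>_closed] by (simp add: s_def)
    moreover have "gpair (D1 s) (D2 s)"
      using gpair_D_lift[OF S_closed(6)[of c]] by (simp add: s_def \<iota>_def D_const)
    ultimately show ?thesis
      using D_closed \<Phi>_gen[OF \<iota>_closed, of c] by (intro NS_I[OF gen_closed[OF \<iota>_closed], of "D1 s" "D2 s"]) (simp_all add: s_def)
  qed
  show ?thesis
    unfolding kaehler_relations_def Let_def using 1 2 3 by blast
qed

text \<open>There are no unexpected relations between \<open>dt1\<close> and \<open>dt2\<close>: a
  vanishing combination lifts to \<open>rel_span\<close>, hence to \<open>NS\<close>, where
  \<open>\<Phi>1\<close> and \<open>\<Phi>2\<close> read off its coefficients.\<close>

lemma comb_eq_0:
  assumes "a \<in> S" "b \<in> S" "comb a b = \<zero>\<^bsub>\<Omega>\<^esub>"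
  shows "gpair a b"
proof -
  note \<pi>t = \<pi>_simps(1)[OF t_S(1)] \<pi>_simps(1)[OF t_S(2)]
  note \<pi>a = \<pi>_simps(1)[OF assms(1)] and \<pi>b = \<pi>_simps(1)[OF assms(2)]
  let ?v1 = "\<pi> a \<odot>\<^bsub>F\<^esub> gen (\<pi> t1)" and ?v2 = "\<pi> b \<odot>\<^bsub>F\<^esub> gen (\<pi> t2)"
  have c: "?v1 \<in> carrier F" "?v2 \<in> carrier F"
    using F.smult_closed gen_closed \<pi>t \<pi>a \<pi>b by blast+
  have "Q.proj (?v1 \<oplus>\<^bsub>F\<^esub> ?v2) = comb a b"
    using Q.proj_add[OF c] Q.proj_smult[OF \<pi>a gen_closed[OF \<pi>t(1)]] Q.proj_smult[OF \<pi>b gen_closed[OF \<pi>t(2)]]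
    by (simp only: comb_def d_def \<Omega>_eq)
  then have "?v1 \<oplus>\<^bsub>F\<^esub> ?v2 \<in> rel_span"
    using assms(3) Q.proj_eq_0_iff[OF F.M.a_closed[OF c]] by (simp only: \<Omega>_eq)
  then have "?v1 \<oplus>\<^bsub>F\<^esub> ?v2 \<in> NS"
    by (rule subsetD[OF module_span_minimal[OF NS_submodule rels_NS]])
  then obtain p q where pq: "p \<in> S" "q \<in> S" "\<Phi>1 (?v1 \<oplus>\<^bsub>F\<^esub> ?v2) = \<pi> p" "\<Phi>2 (?v1 \<oplus>\<^bsub>F\<^esub> ?v2) = \<pi> q" "gpair p q"
    by (elim NS_E)
  define s1 s2 where "s1 = lift (\<pi> t1)" "s2 = lift (\<pi> t2)"
  have s: "s1 \<in> S" "s2 \<in> S"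
    using lift \<pi>t by (simp_all add: s1_s2_def)
  have sm: "\<Phi>1 ?v1 = \<pi> (a * D1 s1)" "\<Phi>2 ?v1 = \<pi> (a * D2 s1)" "\<Phi>1 ?v2 = \<pi> (b * D1 s2)" "\<Phi>2 ?v2 = \<pi> (b * D2 s2)"
    using lin_map_smult_distrib[OF \<Phi>_lin(1) \<pi>a gen_closed[OF \<pi>t(1)]]
      lin_map_smult_distrib[OF \<Phi>_lin(2) \<pi>a gen_closed[OF \<pi>t(1)]]
      lin_map_smult_distrib[OF \<Phi>_lin(1) \<pi>b gen_closed[OF \<pi>t(2)]]
      lin_map_smult_distrib[OF \<Phi>_lin(2) \<pi>b gen_closed[OF \<pi>t(2)]]
      \<Phi>_gen[OF \<pi>t(1)] \<Phi>_gen[OF \<pi>t(2)] \<pi>_simps(2) assms(1,2) D_closed s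
    by (simp_all only: regular_module_simps flip: s1_s2_def)
  have "\<Phi>1 (?v1 \<oplus>\<^bsub>F\<^esub> ?v2) = \<pi> (a * D1 s1 + b * D1 s2)" "\<Phi>2 (?v1 \<oplus>\<^bsub>F\<^esub> ?v2) = \<pi> (a * D2 s1 + b * D2 s2)"
    using lin_map_add_distrib[OF \<Phi>_lin(1) c] lin_map_add_distrib[OF \<Phi>_lin(2) c] sm \<pi>_simps(3)
      S_closed(5) D_closed s assms(1,2)
    by (simp_all only: regular_module_simps)
  then have I: "a * D1 s1 + b * D1 s2 - p \<in> I" "a * D2 s1 + b * D2 s2 - q \<in> I"
    using pq assms(1,2) s D_closed S_closed(3,5) by (simp_all flip: \<pi>_eq_iff)
  have p1: "gpair (a * D1 s1 + b * D1 s2) (a * D2 s1 + b * D2 s2)"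
    using gpair_cong[OF pq(5) I] .
  \<comment> \<open>The chosen lifts \<open>s1\<close>, \<open>s2\<close> may differ from
    \<open>t1\<close>, \<open>t2\<close> by multiples of \<open>g\<close>; these pairs replace their
    derivatives by the Kronecker values.\<close>
  have p2: "gpair ((- a) * (D1 s1 - 1)) ((- a) * D2 s1)" "gpair ((- b) * D1 s2) ((- b) * (D2 s2 - 1))"
    using gpair_mult[OF S_closed(4)[OF assms(1)] gpair_D_lift[OF t_S(1)]]
      gpair_mult[OF S_closed(4)[OF assms(2)] gpair_D_lift[OF t_S(2)]]
    by (simp_all add: D_t flip: s1_s2_def)
  have "gpair (a * D1 s1 + b * D1 s2 + (- a) * (D1 s1 - 1) + (- b) * D1 s2)
      (a * D2 s1 + b * D2 s2 + (- a) * D2 s1 + (- b) * (D2 s2 - 1))"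
    by (rule gpair_add[OF gpair_add[OF p1 p2(1)] p2(2)])
  then show ?thesis
    by (simp add: algebra_simps)
qed

lemma \<pi>_g: "\<pi> g = \<zero>\<^bsub>A\<^esub>"
proof -
  have "g \<in> I"
    using S_closed(2) by (force simp: I_def)
  then show ?thesis
    using g_S S_closed(1) by (simp add: \<pi>_zero \<pi>_eq_iff)
qed

lemma gpair_\<pi>:
  assumes "a \<in> S" "b \<in> S" "gpair a b"
  shows "\<exists>c\<in>carrier A. \<pi> a = c \<otimes>\<^bsub>A\<^esub> \<pi> (D1 g) \<and> \<pi> b = c \<otimes>\<^bsub>A\<^esub> \<pi> (D2 g)"
proof -
  obtain c where c: "c \<in> S" "a - c * D1 g \<in> I" "b - c * D2 g \<in> I"
    using assms by (auto simp: gpair_def)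
  then show ?thesis
    using assms(1,2) g_S D_closed S_closed(5)
    by (intro bexI[of _ "\<pi> c"]) (simp_all add: \<pi>_simps \<pi>_eq_iff)
qed

sublocale T: two_generators A \<Omega> m1 m2 "\<pi> (D1 g)" "\<pi> (D2 g)"
proof
  show "m1 \<in> carrier \<Omega>" "m2 \<in> carrier \<Omega>"
    by (rule m_closed)+
  show g: "\<pi> (D1 g) \<in> carrier A" "\<pi> (D2 g) \<in> carrier A"
    by (simp_all add: \<pi>_simps D_closed g_S)
  show "\<exists>a\<in>carrier A. \<exists>b\<in>carrier A. m = a \<odot>\<^bsub>\<Omega>\<^esub> m1 \<oplus>\<^bsub>\<Omega>\<^esub> b \<odot>\<^bsub>\<Omega>\<^esub> m2" if m: "m \<in> carrier \<Omega>" for m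
  proof -
    obtain a b where "a \<in> S" "b \<in> S" "m = comb a b"
      using generate[OF m] by (elim bexE)
    then show ?thesis
      by (intro bexI[of _ "\<pi> a"] bexI[of _ "\<pi> b"]) (simp_all only: comb_def \<pi>_simps(1))
  qed
  obtain c where c: "\<kappa> c = 0"
    using \<kappa>_0 by (elim exE)
  have "comb (D1 g) (D2 g) = d \<zero>\<^bsub>A\<^esub>"
    using d_eq_comb[OF g_S] \<pi>_g by simp
  also have "\<dots> = \<zero>\<^bsub>\<Omega>\<^esub>"
    using d_\<iota>[of c] c by (simp add: \<iota>_def \<pi>_zero)
  finally show "\<pi> (D1 g) \<odot>\<^bsub>\<Omega>\<^esub> m1 \<oplus>\<^bsub>\<Omega>\<^esub> \<pi> (D2 g) \<odot>\<^bsub>\<Omega>\<^esub> m2 = \<zero>\<^bsub>\<Omega>\<^esub>"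
    by (simp add: comb_def)
  show "\<exists>c\<in>carrier A. \<alpha> = c \<otimes>\<^bsub>A\<^esub> \<pi> (D1 g) \<and> \<beta> = c \<otimes>\<^bsub>A\<^esub> \<pi> (D2 g)"
    if \<alpha>\<beta>: "\<alpha> \<in> carrier A" "\<beta> \<in> carrier A" "\<alpha> \<odot>\<^bsub>\<Omega>\<^esub> m1 \<oplus>\<^bsub>\<Omega>\<^esub> \<beta> \<odot>\<^bsub>\<Omega>\<^esub> m2 = \<zero>\<^bsub>\<Omega>\<^esub>" for \<alpha> \<beta>
  proof -
    obtain a where a: "a \<in> S" "\<alpha> = \<pi> a"
      by (rule \<pi>_surjE[OF \<alpha>\<beta>(1)])
    obtain b where b: "b \<in> S" "\<beta> = \<pi> b"
      by (rule \<pi>_surjE[OF \<alpha>\<beta>(2)])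
    have "gpair a b"
      using \<alpha>\<beta>(3) a b by (intro comb_eq_0) (simp_all add: comb_def)
    then show ?thesis
      unfolding a b by (rule gpair_\<pi>[OF a(1) b(1)])
  qed
  show "c = \<zero>\<^bsub>A\<^esub>" if c: "c \<in> carrier A" "c \<otimes>\<^bsub>A\<^esub> \<pi> (D1 g) = \<zero>\<^bsub>A\<^esub>" "c \<otimes>\<^bsub>A\<^esub> \<pi> (D2 g) = \<zero>\<^bsub>A\<^esub>" for c
  proof -
    obtain r where r: "r \<in> S" "c = \<pi> r"
      by (rule \<pi>_surjE[OF c(1)])
    have "r * D1 g \<in> I" "r * D2 g \<in> I"
      using c(2,3) r g_S D_closed S_closed by (simp_all add: \<pi>_simps \<pi>_zero \<pi>_eq_iff)
    then have "r \<in> I"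
      using no_common_zero_divisor[OF r(1)] by (auto simp: I_def)
    then show ?thesis
      using r S_closed(1) by (simp add: \<pi>_zero \<pi>_eq_iff)
  qed
qed

text \<open>The ideals corresponding to submodules of \<open>Ext1\<close>, which is \<open>S\<close>
  modulo \<open>g\<close> and its two derivatives. Lengths are counted with them from now on, inside
  one field.\<close>

definition tjurina_ideals :: "'f set set" where
  "tjurina_ideals = {L. is_ideal L \<and> g \<in> L \<and> D1 g \<in> L \<and> D2 g \<in> L}"

abbreviation "E \<equiv> Ext1 A \<Omega> RA"

definition \<theta> where "\<theta> r = T.theta (\<pi> r)"

lemma \<theta>_closed: "r \<in> S \<Longrightarrow> \<theta> r \<in> carrier E"
  by (simp add: \<theta>_def T.theta_closed \<pi>_simps)

lemma \<theta>_add: "r \<in> S \<Longrightarrow> s \<in> S \<Longrightarrow> \<theta> (r + s) = \<theta> r \<oplus>\<^bsub>E\<^esub> \<theta> s"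
  by (simp add: \<theta>_def \<pi>_simps(1) flip: T.theta_add \<pi>_simps(3))

lemma \<theta>_smult: "r \<in> S \<Longrightarrow> s \<in> S \<Longrightarrow> \<theta> (r * s) = \<pi> r \<odot>\<^bsub>E\<^esub> \<theta> s"
  by (simp add: \<theta>_def \<pi>_simps(1) flip: T.theta_smult \<pi>_simps(2))

lemma \<theta>_surjE:
  assumes "X \<in> carrier E"
  obtains r where "r \<in> S" "X = \<theta> r"
proof -
  obtain \<rho> where \<rho>: "\<rho> \<in> carrier A" "X = T.theta \<rho>"
    using T.theta_surj[OF assms] by (elim bexE)
  obtain r where "r \<in> S" "\<rho> = \<pi> r"
    by (rule \<pi>_surjE[OF \<rho>(1)])
  then show ?thesis
    using \<rho>(2) by (intro that) (simp_all only: \<theta>_def)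
qed

lemma \<theta>_eq_0_iff:
  assumes "r \<in> S"
  shows "\<theta> r = \<zero>\<^bsub>E\<^esub> \<longleftrightarrow> (\<exists>a\<in>S. \<exists>b\<in>S. \<exists>c\<in>S. r = a * g + b * D1 g + c * D2 g)"
proof
  assume "\<theta> r = \<zero>\<^bsub>E\<^esub>"
  then have "\<exists>\<beta>\<in>carrier A. \<exists>\<gamma>\<in>carrier A. \<pi> r = \<pi> (D1 g) \<otimes>\<^bsub>A\<^esub> \<beta> \<oplus>\<^bsub>A\<^esub> \<pi> (D2 g) \<otimes>\<^bsub>A\<^esub> \<gamma>"
    using T.theta_eq_0_iff[OF \<pi>_simps(1)[OF assms]] by (simp only: \<theta>_def)
  then obtain \<beta> \<gamma> where \<beta>\<gamma>: "\<beta> \<in> carrier A" "\<gamma> \<in> carrier A" "\<pi> r = \<pi> (D1 g) \<otimes>\<^bsub>A\<^esub> \<beta> \<oplus>\<^bsub>A\<^esub> \<pi> (D2 g) \<otimes>\<^bsub>A\<^esub> \<gamma>"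
    by (elim bexE)
  then obtain b c where bc: "b \<in> S" "c \<in> S" "\<beta> = \<pi> b" "\<gamma> = \<pi> c"
    by (elim \<pi>_surjE)
  with \<beta>\<gamma> have "\<pi> r = \<pi> (D1 g * b + D2 g * c)"
    using g_S by (simp add: \<pi>_simps S_closed D_closed)
  then have "r - (D1 g * b + D2 g * c) \<in> I"
    using assms bc g_S by (simp add: \<pi>_eq_iff S_closed D_closed)
  then obtain a where "a \<in> S" "r - (D1 g * b + D2 g * c) = a * g"
    by (auto simp: I_def)
  then have "r = a * g + b * D1 g + c * D2 g"
    by (simp add: algebra_simps)
  then show "\<exists>a\<in>S. \<exists>b\<in>S. \<exists>c\<in>S. r = a * g + b * D1 g + c * D2 g"
    using \<open>a \<in> S\<close> bc by blast
next
  assume "\<exists>a\<in>S. \<exists>b\<in>S. \<exists>c\<in>S. r = a * g + b * D1 g + c * D2 g"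
  then obtain a b c where abc: "a \<in> S" "b \<in> S" "c \<in> S" "r = a * g + b * D1 g + c * D2 g"
    by blast
  have "r - (D1 g * b + D2 g * c) \<in> I"
    using abc by (auto simp: I_def algebra_simps)
  then have "\<pi> r = \<pi> (D1 g * b + D2 g * c)"
    using assms abc g_S by (simp add: \<pi>_eq_iff S_closed D_closed)
  then have "\<pi> r = \<pi> (D1 g) \<otimes>\<^bsub>A\<^esub> \<pi> b \<oplus>\<^bsub>A\<^esub> \<pi> (D2 g) \<otimes>\<^bsub>A\<^esub> \<pi> c"
    using abc g_S by (simp add: \<pi>_simps S_closed D_closed)
  then show "\<theta> r = \<zero>\<^bsub>E\<^esub>"
    unfolding \<theta>_def T.theta_eq_0_iff[OF \<pi>_simps(1)[OF assms]]
    by (intro bexI[of _ "\<pi> b"] bexI[of _ "\<pi> c"]) (simp_all only: \<pi>_simps(1) abc(1-3))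
qed

lemma \<theta>_diff_ideal:
  assumes L: "L \<in> tjurina_ideals" and "x \<in> L" "r \<in> S" "\<theta> r = \<theta> x"
  shows "r \<in> L"
proof -
  interpret E: Module.module A E by (rule T.Ext1_module)
  have x: "x \<in> S"
    using L assms(2) by (auto simp: tjurina_ideals_def is_ideal_def)
  have "r - x + x = r"
    by simp
  then have "\<theta> (r - x) \<oplus>\<^bsub>E\<^esub> \<theta> x = \<theta> r"
    using \<theta>_add[of "r - x" x] S_closed(3)[OF assms(3) S_closed(4)[OF x]] x by simp
  then have "\<theta> (r - x) = \<zero>\<^bsub>E\<^esub>"
    using assms(4) \<theta>_closed[OF x] \<theta>_closed[of "r - x"] S_closed(3)[OF assms(3) S_closed(4)[OF x]]
    by (metis E.M.add.r_cancel_one diff_conv_add_uminus)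
  then obtain a b c where "a \<in> S" "b \<in> S" "c \<in> S" "r - x = a * g + b * D1 g + c * D2 g"
    using \<theta>_eq_0_iff[of "r - x"] S_closed(3)[OF assms(3) S_closed(4)[OF x]] by auto
  then have "r - x \<in> L"
    using L by (auto simp: tjurina_ideals_def is_ideal_def)
  moreover have "y + z \<in> L" if "y \<in> L" "z \<in> L" for y z
    using L that by (simp add: tjurina_ideals_def is_ideal_def)
  ultimately show ?thesis
    using assms(2) by (metis diff_add_cancel)
qed

lemma \<theta>_image_submodule:
  assumes "L \<in> tjurina_ideals"
  shows "submodule (\<theta> ` L) A E"
proof (rule submoduleI_no_inv[OF T.Ext1_module])
  have L: "L \<subseteq> S" "0 \<in> L" "\<And>x y. x \<in> L \<Longrightarrow> y \<in> L \<Longrightarrow> x + y \<in> L" "\<And>s x. s \<in> S \<Longrightarrow> x \<in> L \<Longrightarrow> s * x \<in> L"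
    using assms by (auto simp: tjurina_ideals_def is_ideal_def)
  show "\<theta> ` L \<subseteq> carrier E"
    using L(1) \<theta>_closed by blast
  have "\<theta> 0 = \<zero>\<^bsub>E\<^esub>"
    using \<theta>_eq_0_iff[of 0] S_closed(1) by (metis add.right_neutral mult_zero_left)
  then show "\<zero>\<^bsub>E\<^esub> \<in> \<theta> ` L"
    using L(2) by (metis imageI)
  show "x \<oplus>\<^bsub>E\<^esub> y \<in> \<theta> ` L" if xy: "x \<in> \<theta> ` L" "y \<in> \<theta> ` L" for x y
  proof -
    obtain a b where ab: "a \<in> L" "b \<in> L" "x = \<theta> a" "y = \<theta> b"
      using xy by blast
    then have "x \<oplus>\<^bsub>E\<^esub> y = \<theta> (a + b)"
      using \<theta>_add[of a b] L(1) by blast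
    then show ?thesis
      using L(3)[OF ab(1,2)] by blast
  qed
  show "\<rho> \<odot>\<^bsub>E\<^esub> x \<in> \<theta> ` L" if rx: "\<rho> \<in> carrier A" "x \<in> \<theta> ` L" for \<rho> x
  proof -
    obtain r a where ra: "r \<in> S" "\<rho> = \<pi> r" "a \<in> L" "x = \<theta> a"
      using rx by (elim \<pi>_surjE imageE)
    then have "\<rho> \<odot>\<^bsub>E\<^esub> x = \<theta> (r * a)"
      using \<theta>_smult[of r a] L(1) by blast
    then show ?thesis
      using L(4)[OF ra(1,3)] by blast
  qed
qed

lemma \<theta>_vimage_ideal:
  assumes "submodule X A E"
  shows "{r \<in> S. \<theta> r \<in> X} \<in> tjurina_ideals"
proof -
  interpret E: Module.module A E by (rule T.Ext1_module)
  note X = E.submoduleE[OF assms]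
  have 0: "\<zero>\<^bsub>E\<^esub> \<in> X"
    using subgroup.one_closed[OF submodule.axioms(1)[OF assms]] by simp
  have "g = 1 * g + 0 * D1 g + 0 * D2 g" "D1 g = 0 * g + 1 * D1 g + 0 * D2 g" "D2 g = 0 * g + 0 * D1 g + 1 * D2 g"
    "0 = 0 * g + 0 * D1 g + 0 * D2 g"
    by simp_all
  then have "\<theta> g = \<zero>\<^bsub>E\<^esub>" "\<theta> (D1 g) = \<zero>\<^bsub>E\<^esub>" "\<theta> (D2 g) = \<zero>\<^bsub>E\<^esub>" "\<theta> 0 = \<zero>\<^bsub>E\<^esub>"
    using \<theta>_eq_0_iff g_S D_closed S_closed(1,2) by metis+
  then show ?thesis
    unfolding tjurina_ideals_def is_ideal_def
    using 0 X(4,5) \<theta>_add \<theta>_smult g_S D_closed S_closed \<pi>_simps(1) by auto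
qed

text \<open>\<open>\<theta>\<close> maps \<open>S\<close> onto \<open>Ext1\<close> with kernel
  generated by \<open>g\<close>, \<open>D1 g\<close> and \<open>D2 g\<close>. Preimages and images
  under it are strictly monotone, so chains of either kind transfer to the other.\<close>

theorem module_length_Ext1:
  "module_length A E = (SUP n \<in> {n. has_chain tjurina_ideals n}. enat n)"
proof -
  have "has_chain {X. submodule X A E} n \<longleftrightarrow> has_chain tjurina_ideals n" for n
  proof
    assume "has_chain {X. submodule X A E} n"
    then show "has_chain tjurina_ideals n"
    proof (rule has_chain_transfer[where f = "\<lambda>X. {r \<in> S. \<theta> r \<in> X}"])
      fix X Y assume XY: "X \<in> {X. submodule X A E}" "Y \<in> {X. submodule X A E}" "X \<subset> Y"
      then obtain y where y: "y \<in> Y" "y \<notin> X"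
        by blast
      then have "y \<in> carrier E"
        using subsetD[OF Module.module.submoduleE(1)[OF T.Ext1_module, of Y]] XY(2) by simp
      then obtain r where "r \<in> S" "y = \<theta> r"
        by (rule \<theta>_surjE)
      then show "{r \<in> S. \<theta> r \<in> X} \<subset> {r \<in> S. \<theta> r \<in> Y}"
        using XY(3) y by blast
    qed (use \<theta>_vimage_ideal in blast)
  next
    assume "has_chain tjurina_ideals n"
    then show "has_chain {X. submodule X A E} n"
    proof (rule has_chain_transfer[where f = "\<lambda>L. \<theta> ` L"])
      fix L L' assume L: "L \<in> tjurina_ideals" "L' \<in> tjurina_ideals" "L \<subset> L'"
      then obtain y where y: "y \<in> L'" "y \<notin> L"
        by blast
      then have "y \<in> S"
        using L(2) by (auto simp: tjurina_ideals_def is_ideal_def)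
      then have "\<theta> y \<notin> \<theta> ` L"
        using \<theta>_diff_ideal[OF L(1)] y(2) by auto
      then show "\<theta> ` L \<subset> \<theta> ` L'"
        using L(3) y(1) by blast
    qed (use \<theta>_image_submodule in blast)
  qed
  then show ?thesis
    unfolding module_length_def by (simp add: has_chain_def)
qed

end

section \<open>Local rings of the projective plane\<close>

subsection \<open>Derivations of the field of fractions\<close>

text \<open>The quotient rule on a chosen representative; \<open>fder_Fract\<close> shows that the
  choice does not matter.\<close>

definition fder :: "3 \<Rightarrow> 'k::field poly3 fract \<Rightarrow> 'k poly3 fract" where
  "fder l r = (let p = (SOME p. snd p \<noteq> 0 \<and> r = Fract (fst p) (snd p)) in
     Fract (partial3 l (fst p) * snd p - fst p * partial3 l (snd p)) (snd p * snd p))"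

text \<open>The hypotheses are the equality of two fractions \<open>c/e = a/b\<close>,
  cross-multiplied, and its derivative by the product rule.\<close>

lemma quotient_rule_cong:
  fixes a b c e :: "'r::comm_ring_1"
  assumes "c * b = a * e" "dc * b + c * db = da * e + a * de"
  shows "(dc * e - c * de) * (b * b) = (da * b - a * db) * (e * e)"
proof -
  have "(dc * e - c * de) * (b * b) = e * b * (dc * b + c * db) - e * db * (c * b) - (c * b) * (b * de)"
    by (simp add: algebra_simps)
  also have "\<dots> = e * b * (da * e + a * de) - e * db * (a * e) - (a * e) * (b * de)"
    by (simp only: assms)
  also have "\<dots> = (da * b - a * db) * (e * e)"
    by (simp add: algebra_simps)
  finally show ?thesis .
qed

lemma fder_Fract:
  fixes a b :: "'k::field poly3"
  assumes b: "b \<noteq> 0"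
  shows "fder l (Fract a b) = Fract (partial3 l a * b - a * partial3 l b) (b * b)"
proof -
  define p where "p = (SOME p. snd p \<noteq> 0 \<and> Fract a b = Fract (fst p) (snd p))"
  obtain c e where ce: "p = (c, e)"
    by (cases p)
  have "\<exists>p. snd p \<noteq> 0 \<and> Fract a b = Fract (fst p) (snd p)"
    using b by (intro exI[of _ "(a, b)"]) simp
  from someI_ex[OF this] have e: "e \<noteq> 0" "Fract a b = Fract c e"
    using ce unfolding p_def[symmetric] by simp_all
  then have 1: "c * b = a * e"
    using b by (simp add: eq_fract)
  then have "partial3 l (c * b) = partial3 l (a * e)"
    by (simp only:)
  then have 2: "partial3 l c * b + c * partial3 l b = partial3 l a * e + a * partial3 l e"
    by (simp only: partial3_mult)
  have "fder l (Fract a b) = Fract (partial3 l c * e - c * partial3 l e) (e * e)"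
    unfolding fder_def Let_def p_def[symmetric] ce by simp
  also have "\<dots> = Fract (partial3 l a * b - a * partial3 l b) (b * b)"
    using b e quotient_rule_cong[OF 1 2] by (simp add: eq_fract)
  finally show ?thesis .
qed

lemma quotient_rule_add:
  fixes a b c e :: "'r::comm_ring_1"
  shows "((da * e + a * de + (dc * b + c * db)) * (b * e) - (a * e + c * b) * (db * e + b * de)) * ((b * b) * (e * e)) =
    ((da * b - a * db) * (e * e) + (dc * e - c * de) * (b * b)) * ((b * e) * (b * e))"
  by (simp add: algebra_simps)

lemma quotient_rule_mult:
  fixes a b c e :: "'r::comm_ring_1"
  shows "((da * c + a * dc) * (b * e) - a * c * (db * e + b * de)) * (b * (e * e) * (e * (b * b))) =
    (a * (dc * e - c * de) * (e * (b * b)) + c * (da * b - a * db) * (b * (e * e))) * (b * e * (b * e))"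
  by (simp add: algebra_simps)

lemma fder_add: "fder l (r + s) = fder l r + fder l (s :: 'k::field poly3 fract)"
proof (cases r, cases s)
  fix a b c e :: "'k poly3"
  assume *: "r = Fract a b" "b \<noteq> 0" "s = Fract c e" "e \<noteq> 0"
  then have be: "b * e \<noteq> 0" "b * b \<noteq> 0" "e * e \<noteq> 0" "(b * e) * (b * e) \<noteq> 0" "(b * b) * (e * e) \<noteq> 0"
    by simp_all
  have "fder l (r + s) = Fract (partial3 l (a * e + c * b) * (b * e) - (a * e + c * b) * partial3 l (b * e)) ((b * e) * (b * e))"
    unfolding *(1,3) add_fract[OF *(2,4)] fder_Fract[OF be(1)] ..
  moreover have "fder l r + fder l s = Fract ((partial3 l a * b - a * partial3 l b) * (e * e) + (partial3 l c * e - c * partial3 l e) * (b * b)) ((b * b) * (e * e))"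
    unfolding *(1,3) fder_Fract[OF *(2)] fder_Fract[OF *(4)] add_fract[OF be(2,3)] ..
  ultimately show ?thesis
    by (simp only: eq_fract(1)[OF be(4,5)] partial3_add partial3_mult quotient_rule_add)
qed

lemma fder_mult: "fder l (r * s) = r * fder l s + s * fder l (r :: 'k::field poly3 fract)"
proof (cases r, cases s)
  fix a b c e :: "'k poly3"
  assume *: "r = Fract a b" "b \<noteq> 0" "s = Fract c e" "e \<noteq> 0"
  then have be: "b * e \<noteq> 0" "b * (e * e) \<noteq> 0" "e * (b * b) \<noteq> 0" "(b * e) * (b * e) \<noteq> 0" "b * (e * e) * (e * (b * b)) \<noteq> 0"
    by simp_all
  have "fder l (r * s) = Fract (partial3 l (a * c) * (b * e) - a * c * partial3 l (b * e)) ((b * e) * (b * e))"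
    unfolding *(1,3) mult_fract fder_Fract[OF be(1)] ..
  moreover have "r * fder l s + s * fder l r = Fract (a * (partial3 l c * e - c * partial3 l e) * (e * (b * b)) + c * (partial3 l a * b - a * partial3 l b) * (b * (e * e))) (b * (e * e) * (e * (b * b)))"
    unfolding *(1,3) fder_Fract[OF *(2)] fder_Fract[OF *(4)] mult_fract add_fract[OF be(2,3)] ..
  ultimately show ?thesis
    by (simp only: eq_fract(1)[OF be(4,5)] partial3_add partial3_mult quotient_rule_mult)
qed

subsection \<open>Stalks\<close>

lemma proj_plane_representative:
  assumes "P \<in> proj_plane"
  obtains i w where "w i = (1 :: 'k::field)" "P = {\<lambda>j. c * w j | c. c \<noteq> 0}"
proof -
  obtain v where v: "P = {\<lambda>i. c * v i | c. c \<noteq> 0}" "v \<noteq> (\<lambda>i. 0)"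
    using assms by (auto simp: proj_plane_def)
  then obtain i where i: "v i \<noteq> 0"
    by auto
  define w where "w j = v j / v i" for j
  have "\<exists>c'. (\<lambda>j. c * v j) = (\<lambda>j. c' * w j) \<and> c' \<noteq> 0" if "c \<noteq> 0" for c
    using that i by (intro exI[of _ "c * v i"]) (simp add: w_def)
  moreover have "\<exists>c'. (\<lambda>j. c * w j) = (\<lambda>j. c' * v j) \<and> c' \<noteq> 0" if "c \<noteq> 0" for c
    using that i by (intro exI[of _ "c / v i"]) (simp add: w_def)
  ultimately have "P = {\<lambda>j. c * w j | c. c \<noteq> 0}"
    unfolding v(1) by (auto simp only: set_eq_iff mem_Collect_eq)
  moreover have "w i = 1"
    using i by (simp add: w_def)
  ultimately show ?thesis
    by (rule that[rotated])
qed

lemma homogeneous3_cast: "homogeneous3 n p \<Longrightarrow> n = m \<Longrightarrow> homogeneous3 m p"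
  by simp

lemma partial3_homogeneous_0:
  fixes a :: "'k::field poly3"
  assumes "homogeneous3 0 a"
  shows "partial3 l a = 0"
proof -
  have "a = const3 (lk a 0)"
    using assms by (intro poly_mapping_eqI)
      (auto simp: const3_def lookup_single when_def homogeneous3_iff tdeg_eq_0_iff)
  then show ?thesis
    by (metis partial3_const)
qed

lemma partial3_var_power:
  assumes "l \<noteq> i"
  shows "partial3 l (var3 i ^ n :: 'k::field poly3) = 0"
proof (induction n)
  case 0
  show ?case
    using partial3_const[of l "1 :: 'k"] by simp
qed (simp add: partial3_mult partial3_var assms)

lemma var3_nonzero [simp]: "var3 i \<noteq> (0 :: 'k::field poly3)"
proof
  assume "var3 i = (0 :: 'k poly3)"
  then have "eval3 (var3 i) (\<lambda>_. 1 :: 'k) = eval3 0 (\<lambda>_. 1)"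
    by (simp only:)
  then show False
    by simp
qed

locale plane_point =
  fixes i :: 3 and w :: "3 \<Rightarrow> 'k::alg_closed_field" and P :: "(3 \<Rightarrow> 'k) set"
  assumes w: "w i = 1" and P: "P = {\<lambda>j. c * w j | c. c \<noteq> 0}"
begin

abbreviation X :: "'k poly3" where "X \<equiv> var3 i"
abbreviation S where "S \<equiv> stalk_O P 0"

lemma nonvanishing_iff:
  assumes "homogeneous3 n b"
  shows "(\<forall>v\<in>P. eval3 b v \<noteq> 0) \<longleftrightarrow> eval3 b w \<noteq> 0"
proof
  have "(\<lambda>j. 1 * w j) \<in> P"
    unfolding P by (intro CollectI exI[of _ 1]) simp
  then show "\<forall>v\<in>P. eval3 b v \<noteq> 0 \<Longrightarrow> eval3 b w \<noteq> 0"
    by auto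
  assume "eval3 b w \<noteq> 0"
  then show "\<forall>v\<in>P. eval3 b v \<noteq> 0"
    by (auto simp: P eval3_scale[OF assms])
qed

lemma S_iff:
  "r \<in> S \<longleftrightarrow> (\<exists>n a b. homogeneous3 n a \<and> homogeneous3 n b \<and> eval3 b w \<noteq> 0 \<and> r = Fract a b)"
proof
  assume "r \<in> S"
  then obtain a b n m where *: "r = Fract a b" "homogeneous3 n a" "homogeneous3 m b"
    "\<forall>v\<in>P. eval3 b v \<noteq> 0" "int n = int m + 0"
    unfolding stalk_O_def mem_Collect_eq by (elim exE conjE)
  then have "m = n"
    by simp
  then show "\<exists>n a b. homogeneous3 n a \<and> homogeneous3 n b \<and> eval3 b w \<noteq> 0 \<and> r = Fract a b"
    using * nonvanishing_iff by metis
next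
  assume "\<exists>n a b. homogeneous3 n a \<and> homogeneous3 n b \<and> eval3 b w \<noteq> 0 \<and> r = Fract a b"
  then obtain n a b where *: "homogeneous3 n a" "homogeneous3 n b" "eval3 b w \<noteq> 0" "r = Fract a b"
    by (elim exE conjE)
  show "r \<in> S"
    unfolding stalk_O_def mem_Collect_eq
    by (rule exI[of _ a], rule exI[of _ b], rule exI[of _ n], rule exI[of _ n])
      (use * nonvanishing_iff[OF *(2)] in simp)
qed

lemma S_I: "homogeneous3 n a \<Longrightarrow> homogeneous3 n b \<Longrightarrow> eval3 b w \<noteq> 0 \<Longrightarrow> Fract a b \<in> S"
  unfolding S_iff by (rule exI[of _ n], rule exI[of _ a], rule exI[of _ b]) simp

lemma S_E:
  assumes "r \<in> S"
  obtains n a b where "homogeneous3 n a" "homogeneous3 n b" "eval3 b w \<noteq> 0" "b \<noteq> 0" "r = Fract a b"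
proof -
  obtain n a b where *: "homogeneous3 n a" "homogeneous3 n b" "eval3 b w \<noteq> 0" "r = Fract a b"
    using assms unfolding S_iff by (elim exE conjE)
  moreover have "b \<noteq> 0"
    using *(3) by auto
  ultimately show ?thesis
    by (intro that)
qed

definition \<kappa> :: "'k \<Rightarrow> 'k poly3 fract" where "\<kappa> c = Fract (const3 c) 1"

lemma \<kappa>_S: "\<kappa> c \<in> S"
  unfolding \<kappa>_def by (rule S_I[of 0]) simp_all

lemma zero_S: "0 \<in> S"
  using \<kappa>_S[of 0] by (simp add: \<kappa>_def Zero_fract_def)

lemma one_S: "1 \<in> S"
  using \<kappa>_S[of 1] by (simp add: \<kappa>_def One_fract_def)

lemma add_S:
  assumes "r \<in> S" "s \<in> S"
  shows "r + s \<in> S"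
proof -
  obtain n a b where 1: "homogeneous3 n a" "homogeneous3 n b" "eval3 b w \<noteq> 0" "b \<noteq> 0" "r = Fract a b"
    using assms(1) by (rule S_E)
  obtain m c e where 2: "homogeneous3 m c" "homogeneous3 m e" "eval3 e w \<noteq> 0" "e \<noteq> 0" "s = Fract c e"
    using assms(2) by (rule S_E)
  have "homogeneous3 (n + m) (a * e + c * b)"
    using homogeneous3_mult[OF 1(1) 2(2)] homogeneous3_mult[OF 2(1) 1(2)]
    by (intro homogeneous3_add) (simp_all add: add.commute)
  then have "Fract (a * e + c * b) (b * e) \<in> S"
    using homogeneous3_mult[OF 1(2) 2(2)] 1(3) 2(3) by (intro S_I) simp_all
  then show ?thesis
    using 1 2 by (simp add: add_fract)
qed

lemma mult_S:
  assumes "r \<in> S" "s \<in> S"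
  shows "r * s \<in> S"
proof -
  obtain n a b where 1: "homogeneous3 n a" "homogeneous3 n b" "eval3 b w \<noteq> 0" "b \<noteq> 0" "r = Fract a b"
    using assms(1) by (rule S_E)
  obtain m c e where 2: "homogeneous3 m c" "homogeneous3 m e" "eval3 e w \<noteq> 0" "e \<noteq> 0" "s = Fract c e"
    using assms(2) by (rule S_E)
  have "Fract (a * c) (b * e) \<in> S"
    using homogeneous3_mult[OF 1(2) 2(2)] homogeneous3_mult[OF 1(1) 2(1)] 1(3) 2(3) by (intro S_I) simp_all
  then show ?thesis
    using 1 2 by simp
qed

lemma uminus_S: "r \<in> S \<Longrightarrow> - r \<in> S"
  using mult_S[OF \<kappa>_S[of "- 1"], of r] by (simp add: \<kappa>_def const3_uminus One_fract_def[symmetric] flip: minus_fract)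

definition t :: "3 \<Rightarrow> 'k poly3 fract" where "t l = Fract (var3 l) X"

lemma t_S: "t l \<in> S"
  unfolding t_def by (rule S_I[of 1]) (simp_all only: homogeneous3_var eval3_simps w one_neq_zero not_False_eq_True)

lemma X_power_S: "homogeneous3 n a \<Longrightarrow> Fract a (X ^ n) \<in> S"
  by (rule S_I[of n]) (simp_all add: w)

text \<open>A partial derivative lowers the degree by one; the factor \<open>X\<close> restores
  degree 0. For \<open>l \<noteq> i\<close> this is the derivative with respect to the affine
  coordinate \<open>x_l / x_i\<close>.\<close>

definition D :: "3 \<Rightarrow> 'k poly3 fract \<Rightarrow> 'k poly3 fract" where "D l r = Fract X 1 * fder l r"

lemma D_add: "D l (r + s) = D l r + D l s"
  by (simp add: D_def fder_add distrib_left)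

lemma D_mult: "D l (r * s) = r * D l s + s * D l r"
  by (simp add: D_def fder_mult algebra_simps)

lemma D_\<kappa>: "D l (\<kappa> c) = 0"
proof -
  have "partial3 l (1 :: 'k poly3) = 0"
    using partial3_const[of l "1 :: 'k"] by simp
  then show ?thesis
    by (simp add: D_def \<kappa>_def fder_Fract Zero_fract_def)
qed

lemma D_t:
  assumes "l \<noteq> i"
  shows "D l (t k) = (if k = l then 1 else 0)"
  using assms partial3_var_power[OF assms, of 1]
  by (auto simp: D_def t_def fder_Fract partial3_var Zero_fract_def One_fract_def eq_fract)

lemma D_S:
  assumes "r \<in> S"
  shows "D l r \<in> S"
proof -
  obtain n a b where r: "homogeneous3 n a" "homogeneous3 n b" "eval3 b w \<noteq> 0" "b \<noteq> 0" "r = Fract a b"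
    using assms by (rule S_E)
  have "homogeneous3 (n + n) (X * (partial3 l a * b - a * partial3 l b))"
  \<comment> \<open>Degree 0 stands apart because \<open>n - 1\<close> truncates; there the
    derivatives vanish.\<close>
  proof (cases n)
    case 0
    then show ?thesis
      using r partial3_homogeneous_0[of a l] partial3_homogeneous_0[of b l] by simp
  next
    case (Suc k)
    have p: "homogeneous3 k (partial3 l a)" "homogeneous3 k (partial3 l b)"
      using homogeneous3_partial[OF r(1), of l] homogeneous3_partial[OF r(2), of l] Suc by simp_all
    have "homogeneous3 (k + n) (partial3 l a * b)" "homogeneous3 (n + k) (a * partial3 l b)"
      by (intro homogeneous3_mult p r)+
    then have "homogeneous3 (Suc (n + k)) (X * (partial3 l a * b - a * partial3 l b))"
      by (intro homogeneous3_var_mult homogeneous3_diff) (simp_all add: add.commute)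
    then show ?thesis
      by (rule homogeneous3_cast) (simp add: Suc)
  qed
  then have "Fract (X * (partial3 l a * b - a * partial3 l b)) (b * b) \<in> S"
    using homogeneous3_mult[OF r(2,2)] r(3) by (intro S_I) simp_all
  then show ?thesis
    using r by (simp add: D_def fder_Fract)
qed

text \<open>Dividing numerator and denominator by \<open>X ^ n\<close> makes both polynomials in the
  affine coordinates; the denominator, not vanishing at the point, becomes a unit by which the
  division rule applies.\<close>

lemma S_generated:
  assumes \<kappa>: "\<And>c. \<kappa> c \<in> Y" and t: "\<And>l. l \<noteq> i \<Longrightarrow> t l \<in> Y"
    and add: "\<And>a b. a \<in> S \<Longrightarrow> b \<in> S \<Longrightarrow> a \<in> Y \<Longrightarrow> b \<in> Y \<Longrightarrow> a + b \<in> Y"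
    and mult: "\<And>a b. a \<in> S \<Longrightarrow> b \<in> S \<Longrightarrow> a \<in> Y \<Longrightarrow> b \<in> Y \<Longrightarrow> a * b \<in> Y"
    and divide: "\<And>a b b'. a \<in> S \<Longrightarrow> b \<in> S \<Longrightarrow> b' \<in> S \<Longrightarrow> b * b' = 1 \<Longrightarrow> b * a \<in> Y \<Longrightarrow> b \<in> Y \<Longrightarrow> a \<in> Y"
  shows "S \<subseteq> Y"
proof
  have tY: "t l \<in> Y" for l
  proof (cases "l = i")
    case True
    then have "t l = \<kappa> 1"
      by (simp add: t_def \<kappa>_def eq_fract)
    then show ?thesis
      using \<kappa> by simp
  qed (rule t)
  have poly: "Fract a (X ^ n) \<in> Y" if "homogeneous3 n a" for n a
    using that
  proof (induction rule: homogeneous3_induct)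
    case (const c)
    then show ?case
      using \<kappa> by (simp add: \<kappa>_def)
  next
    case (add n p q)
    have "Fract (p + q) (X ^ n) = Fract p (X ^ n) + Fract q (X ^ n)"
      by (simp add: eq_fract algebra_simps)
    then show ?case
      using assms(3)[OF X_power_S[OF add(1)] X_power_S[OF add(2)] add(3,4)] by simp
  next
    case (var n p l)
    have "Fract (var3 l * p) (X ^ Suc n) = t l * Fract p (X ^ n)"
      by (simp add: t_def)
    then show ?case
      using mult[OF t_S X_power_S[OF var(1)] tY var(2)] by simp
  qed
  fix r assume "r \<in> S"
  then obtain n a b where r: "homogeneous3 n a" "homogeneous3 n b" "eval3 b w \<noteq> 0" "b \<noteq> 0" "r = Fract a b"
    by (rule S_E)
  have "Fract b (X ^ n) * r = Fract a (X ^ n)"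
    using r by (simp add: eq_fract)
  moreover have "Fract b (X ^ n) * Fract (X ^ n) b = 1"
    using r by (simp add: One_fract_def eq_fract)
  moreover have "Fract (X ^ n) b \<in> S"
    using r by (intro S_I) simp_all
  ultimately show "r \<in> Y"
    using divide[OF \<open>r \<in> S\<close> X_power_S[OF r(2)]] poly r(1,2) by metis
qed

end

section \<open>The curve in an affine chart around one point\<close>

locale curve_point = reduced_curve u d + plane_point i w P
  for u :: "'k::alg_closed_field poly3" and d i and w :: "3 \<Rightarrow> 'k" and P +
  fixes j k :: 3
  assumes jk: "j \<noteq> i" "k \<noteq> i" "j \<noteq> k"
begin

definition g :: "'k poly3 fract" where "g = Fract u (X ^ d)"

lemma ijk: "l = i \<or> l = j \<or> l = k"
proof -
  have "card {i, j, k} = 3"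
    using jk by auto
  then have "{i, j, k} = UNIV"
    using card_subset_eq[of UNIV "{i, j, k}"] by simp
  then show ?thesis
    by (metis UNIV_I insertE singletonD)
qed

lemma g_S: "g \<in> S"
  unfolding g_def using hom by (rule X_power_S)

lemma D_g:
  assumes "l \<noteq> i"
  shows "D l g = Fract (grad l) (X ^ (d - 1))"
proof -
  have X: "X ^ d = X * X ^ (d - 1)"
    using d_pos by (cases d) simp_all
  have "D l g = Fract (X * (grad l * X ^ d)) (X ^ d * X ^ d)"
    by (simp add: D_def g_def fder_Fract partial3_var_power[OF assms])
  also have "\<dots> = Fract (grad l) (X ^ (d - 1))"
    unfolding X by (simp add: eq_fract)
  finally show ?thesis .
qed

text \<open>Only the product \<open>u * a\<close> is known to be homogeneous. A homogeneous
  replacement of \<open>a\<close> is needed before powers of \<open>X\<close> can balance the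
  degrees.\<close>

lemma multiple_of_g:
  assumes "homogeneous3 n (u * a)" "homogeneous3 n b" "eval3 b w \<noteq> 0"
  shows "\<exists>c\<in>S. Fract (u * a) b = c * g"
proof (cases "a = 0")
  case True
  have "b \<noteq> 0"
    using assms(3) by auto
  then have "Fract (u * a) b = 0"
    by (simp add: True Zero_fract_def eq_fract)
  then show ?thesis
    using zero_S by (intro bexI[of _ 0]) simp_all
next
  case False
  have b: "b \<noteq> 0"
    using assms(3) by auto
  have "n = deg3 u + deg3 a"
    using deg3_homogeneous[OF assms(1)] u_nonzero False by (simp add: deg3_mult)
  then have n: "n - d + d = n"
    using deg3_homogeneous[OF hom u_nonzero] by simp
  \<comment> \<open>The statement about families is applied to a family with one member, indexed by
    \<open>unit\<close>.\<close>
  have "\<exists>a'. homogeneous3 (n - d) a' \<and> (\<forall>x::unit. u * a = a' * u)"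
    using assms(1) hom by (intro homogeneous_quotient[of "\<lambda>_. u * a" a "\<lambda>_. u" d]) (simp_all add: mult.commute n)
  then obtain a' where a': "homogeneous3 (n - d) a'" "u * a = a' * u"
    by auto
  have "homogeneous3 n (a' * X ^ d)"
    using homogeneous3_mult[OF a'(1) homogeneous3_var_power, of d i] n by simp
  then have "Fract (a' * X ^ d) b \<in> S"
    using assms by (intro S_I)
  moreover have "Fract (u * a) b = Fract (a' * X ^ d) b * g"
    using b by (simp add: a'(2) g_def eq_fract)
  ultimately show ?thesis
    by blast
qed

text \<open>After clearing denominators \<open>u\<close> divides a multiple of each of the two
  affine partial derivatives, and by Euler also of the third one. The gradient has no common factor,
  so \<open>u\<close> divides the multiplier \<open>s\<close> itself.\<close>

lemma common_zero_divisor: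
  assumes r: "r \<in> S" and cj: "cj \<in> S" "r * D j g = cj * g" and ck: "ck \<in> S" "r * D k g = ck * g"
  shows "\<exists>c\<in>S. r = c * g"
proof -
  obtain n a b where r: "homogeneous3 n a" "homogeneous3 n b" "eval3 b w \<noteq> 0" "b \<noteq> 0" "r = Fract a b"
    using r by (rule S_E)
  have X: "X ^ d = X * X ^ (d - 1)"
    using d_pos by (cases d) simp_all
  have dvd: "\<exists>a' b' m. homogeneous3 m b' \<and> eval3 b' w \<noteq> 0 \<and> X * a * b' * grad l = a' * u"
    if l: "l \<noteq> i" and c: "c \<in> S" "r * D l g = c * g" for l c
  proof -
    obtain m a' b' where c': "homogeneous3 m a'" "homogeneous3 m b'" "eval3 b' w \<noteq> 0" "b' \<noteq> 0" "c = Fract a' b'"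
      using c(1) by (rule S_E)
    have "Fract (a * grad l) (b * X ^ (d - 1)) = Fract (a' * u) (b' * X ^ d)"
      using c(2) unfolding D_g[OF l] unfolding r(5) c'(5) g_def by (simp only: mult_fract)
    then have "a * grad l * (b' * X ^ d) = a' * u * (b * X ^ (d - 1))"
      using r c' by (subst (asm) eq_fract) simp_all
    then have "X ^ (d - 1) * (X * a * b' * grad l) = X ^ (d - 1) * (a' * b * u)"
      by (simp add: X ac_simps)
    then have "X * a * b' * grad l = a' * b * u"
      by simp
    then show ?thesis
      using c' by blast
  qed
  obtain aj bj nj where bj: "homogeneous3 nj bj" "eval3 bj w \<noteq> 0" "X * a * bj * grad j = aj * u"
    using dvd[OF jk(1) cj] by (elim exE conjE)
  obtain ak bk nk where bk: "homogeneous3 nk bk" "eval3 bk w \<noteq> 0" "X * a * bk * grad k = ak * u"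
    using dvd[OF jk(2) ck] by (elim exE conjE)
  have euler: "X * grad i = of_nat d * u - var3 j * grad j - var3 k * grad k"
  proof -
    have "(\<Sum>l\<in>UNIV. var3 l * grad l) = (\<Sum>l\<in>{i, j, k}. var3 l * grad l)"
      using ijk by (intro sum.mono_neutral_right) auto
    also have "\<dots> = X * grad i + (var3 j * grad j + var3 k * grad k)"
      using jk by simp
    finally show ?thesis
      using euler_identity[OF hom] by (simp add: algebra_simps)
  qed
  define s0 where "s0 = X * (a * (bj * bk))"
  have s0: "s0 * grad j = u * (bk * aj)" "s0 * grad k = u * (bj * ak)"
  proof -
    have "s0 * grad j = bk * (X * a * bj * grad j)"
      unfolding s0_def by (simp only: ac_simps)
    also have "\<dots> = u * (bk * aj)"
      unfolding bj(3) by (simp only: ac_simps)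
    finally show "s0 * grad j = u * (bk * aj)" .
    have "s0 * grad k = bj * (X * a * bk * grad k)"
      unfolding s0_def by (simp only: ac_simps)
    also have "\<dots> = u * (bj * ak)"
      unfolding bk(3) by (simp only: ac_simps)
    finally show "s0 * grad k = u * (bj * ak)" .
  qed
  \<comment> \<open>One \<open>X\<close> in \<open>s0\<close> comes from the denominators
    \<open>X ^ d\<close> of \<open>g\<close> against \<open>X ^ (d - 1)\<close> of its derivatives;
    the second one is required since Euler expresses \<open>X * grad i\<close>.\<close>
  define s where "s = X * s0"
  have s: "s * grad j = u * (X * (bk * aj))" "s * grad k = u * (X * (bj * ak))"
    by (simp_all only: s_def mult.assoc s0) (simp_all only: mult.left_commute)
  have si: "s * grad i = u * (s0 * of_nat d - var3 j * (bk * aj) - var3 k * (bj * ak))"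
  proof -
    have "s * grad i = s0 * (X * grad i)"
      unfolding s_def by (simp only: ac_simps)
    also have "\<dots> = s0 * of_nat d * u - var3 j * (s0 * grad j) - var3 k * (s0 * grad k)"
      unfolding euler by (simp add: algebra_simps)
    also have "\<dots> = u * (s0 * of_nat d - var3 j * (bk * aj) - var3 k * (bj * ak))"
      unfolding s0 by (simp add: algebra_simps)
    finally show ?thesis .
  qed
  have "\<exists>v. u * v = s * grad l" for l
    using ijk[of l]
  proof (elim disjE)
    show "l = i \<Longrightarrow> \<exists>v. u * v = s * grad l"
      by (simp only: si) (rule exI, rule refl)
    show "l = j \<Longrightarrow> \<exists>v. u * v = s * grad l" "l = k \<Longrightarrow> \<exists>v. u * v = s * grad l"
      by (simp_all only: s) (rule exI, rule refl)+
  qed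
  then have "\<exists>v. \<forall>l. u * v l = s * grad l"
    by (intro choice allI)
  then obtain v where "\<forall>l. u * v l = s * grad l"
    by (elim exE)
  then have v: "u * v l = s * grad l" for l
    by simp
  obtain q where q: "\<And>l. v l = q * grad l"
    using coprime_family_proportional[OF coprime_grad u_nonzero v] by metis
  obtain l where l: "grad l \<noteq> 0"
    using grad_nonzero by auto
  have "u * q * grad l = s * grad l"
    using v[of l] q[of l] by (simp add: mult.assoc)
  then have uq: "u * q = s"
    using l by simp
  \<comment> \<open>\<open>e\<close> repeats the factors of \<open>s\<close> with \<open>b\<close>
    in place of \<open>a\<close>, so that \<open>s / e\<close> is \<open>r\<close>; \<open>N\<close>
    is the common degree, the 2 counting the two factors \<open>X\<close>.\<close>
  define N where "N = 2 + n + nj + nk"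
  define e where "e = X * (X * (b * (bj * bk)))"
  have "homogeneous3 N (u * q)" "homogeneous3 N e"
    unfolding uq s_def s0_def e_def N_def
    using homogeneous3_var_mult[OF homogeneous3_var_mult[OF homogeneous3_mult[OF r(1) homogeneous3_mult[OF bj(1) bk(1)]]], of i i]
      homogeneous3_var_mult[OF homogeneous3_var_mult[OF homogeneous3_mult[OF r(2) homogeneous3_mult[OF bj(1) bk(1)]]], of i i]
    by (auto elim!: homogeneous3_cast)
  moreover have "eval3 e w \<noteq> 0"
    using r(3) bj(2) bk(2) by (simp add: e_def w)
  ultimately have "\<exists>c\<in>S. Fract (u * q) e = c * g"
    by (rule multiple_of_g)
  moreover have "Fract (u * q) e = r"
  proof -
    have "bj \<noteq> 0" "bk \<noteq> 0"
      using bj(2) bk(2) by auto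
    then show ?thesis
      unfolding uq using r by (simp add: e_def s_def s0_def eq_fract)
  qed
  ultimately show ?thesis
    by simp
qed

sublocale L: local_curve S \<kappa> "D j" "D k" "t j" "t k" g
proof
  show "\<exists>c. \<kappa> c = 0"
    by (rule exI[of _ 0]) (simp add: \<kappa>_def Zero_fract_def)
  show "D j (t j) = 1" "D j (t k) = 0" "D k (t j) = 0" "D k (t k) = 1"
    using jk by (simp_all add: D_t)
  show "S \<subseteq> Y"
    if "\<And>c. \<kappa> c \<in> Y" "t j \<in> Y" "t k \<in> Y"
      "\<And>a b. a \<in> S \<Longrightarrow> b \<in> S \<Longrightarrow> a \<in> Y \<Longrightarrow> b \<in> Y \<Longrightarrow> a + b \<in> Y"
      "\<And>a b. a \<in> S \<Longrightarrow> b \<in> S \<Longrightarrow> a \<in> Y \<Longrightarrow> b \<in> Y \<Longrightarrow> a * b \<in> Y"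
      "\<And>a b b'. a \<in> S \<Longrightarrow> b \<in> S \<Longrightarrow> b' \<in> S \<Longrightarrow> b * b' = 1 \<Longrightarrow> b * a \<in> Y \<Longrightarrow> b \<in> Y \<Longrightarrow> a \<in> Y" for Y
  proof (rule S_generated)
    show "t l \<in> Y" if "l \<noteq> i" for l
      using ijk[of l] that \<open>t j \<in> Y\<close> \<open>t k \<in> Y\<close> by auto
  qed (rule that; assumption)+
  show "\<exists>c\<in>S. r = c * g" if "r \<in> S" "\<exists>c\<in>S. r * D j g = c * g" "\<exists>c\<in>S. r * D k g = c * g" for r
    using that common_zero_divisor by (elim bexE)
qed (simp_all add: zero_S one_S add_S uminus_S mult_S \<kappa>_S D_S D_add D_mult D_\<kappa> t_S g_S)

lemma L_R_eq: "L.R = plane_local_ring P"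
  by (simp add: L.R_def plane_local_ring_def)

lemma L_I_eq: "L.I = curve_ideal u P"
proof (intro equalityI subsetI)
  fix x assume "x \<in> L.I"
  then obtain c where c: "c \<in> S" "x = c * g"
    by (auto simp: L.I_def)
  obtain n a b where r: "homogeneous3 n a" "homogeneous3 n b" "eval3 b w \<noteq> 0" "b \<noteq> 0" "c = Fract a b"
    using c(1) by (rule S_E)
  have h: "homogeneous3 (n + d) (u * a)" "homogeneous3 (n + d) (b * X ^ d)"
    using homogeneous3_mult[OF r(1) hom] homogeneous3_mult[OF r(2) homogeneous3_var_power[of d i]]
    by (simp_all add: mult.commute)
  have "x = Fract (u * a) (b * X ^ d)"
    by (simp add: c(2) r(5) g_def mult.commute)
  moreover have "\<forall>v\<in>P. eval3 (b * X ^ d) v \<noteq> 0"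
    using nonvanishing_iff[OF h(2)] r(3) by (simp add: w)
  ultimately show "x \<in> curve_ideal u P"
    unfolding curve_ideal_def mem_Collect_eq using h by (intro exI conjI)
next
  fix x assume "x \<in> curve_ideal u P"
  then obtain a b n where *: "x = Fract (u * a) b" "homogeneous3 n (u * a)" "homogeneous3 n b" "\<forall>v\<in>P. eval3 b v \<noteq> 0"
    unfolding curve_ideal_def mem_Collect_eq by (elim exE conjE)
  then have "eval3 b w \<noteq> 0"
    using nonvanishing_iff by blast
  then show "x \<in> L.I"
    using multiple_of_g[OF *(2,3)] unfolding L.I_def *(1) by blast
qed

lemma tjurina_at_eq: "tjurina_at u P = (SUP n \<in> {n. has_chain L.tjurina_ideals n}. enat n)"
proof -
  have A: "L.A = curve_local_ring u P"
    by (simp add: L.A_def curve_local_ring_def L_R_eq L_I_eq)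
  have "L.\<iota> = curve_structure_map u P"
    by (simp add: L.\<iota>_def L.\<pi>_def curve_structure_map_def L_R_eq L_I_eq \<kappa>_def fun_eq_iff)
  then show ?thesis
    using L.module_length_Ext1 by (simp add: tjurina_at_def Let_def A)
qed

end

section \<open>Tjurina numbers and filtrations\<close>

definition point_of :: "(3 \<Rightarrow> 'k::field) \<Rightarrow> (3 \<Rightarrow> 'k) set" where
  "point_of w = {\<lambda>j. c * w j | c. c \<noteq> 0}"

lemma mem_point_of: "w \<in> point_of w"
  unfolding point_of_def by (intro CollectI exI[of _ 1]) simp

context reduced_curve
begin

lemma u_in_jacobian: "u \<in> jacobian d"
proof -
  have "dot3 (\<lambda>l. const3 (inverse (of_nat d)) * var3 l) grad = u"
    using euler_const by (simp add: dot3_mult)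
  moreover have "homogeneous3 (d - (d - 1)) (const3 (inverse (of_nat d)) * var3 l :: 'k poly3)" for l
    using d_pos homogeneous3_const_mult[OF homogeneous3_var] by simp
  ultimately show ?thesis
    unfolding jacobian_def using d_pos
    by (intro CollectI exI[of _ "\<lambda>l. const3 (inverse (of_nat d)) * var3 l"]) auto
qed

end

context curve_point
begin

text \<open>The stalk at the point of the ideal sheaf defined by \<open>I\<close>: the degree 0 part
  of the homogeneous localisation.\<close>

definition loc :: "(nat \<Rightarrow> 'k poly3 set) \<Rightarrow> 'k poly3 fract set" where
  "loc I = {Fract p q | p q n. p \<in> I n \<and> homogeneous3 n q \<and> eval3 q w \<noteq> 0}"

lemma loc_I: "p \<in> I n \<Longrightarrow> homogeneous3 n q \<Longrightarrow> eval3 q w \<noteq> 0 \<Longrightarrow> Fract p q \<in> loc I"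
  unfolding loc_def mem_Collect_eq by (rule exI[of _ p], rule exI[of _ q], rule exI[of _ n]) simp

lemma loc_E:
  assumes "x \<in> loc I"
  obtains p q n where "x = Fract p q" "p \<in> I n" "homogeneous3 n q" "eval3 q w \<noteq> 0" "q \<noteq> 0"
proof -
  obtain p q n where *: "x = Fract p q" "p \<in> I n" "homogeneous3 n q" "eval3 q w \<noteq> 0"
    using assms unfolding loc_def mem_Collect_eq by (elim exE conjE)
  moreover have "q \<noteq> 0"
    using *(4) by auto
  ultimately show ?thesis
    by (rule that)
qed

lemma P_eq: "P = point_of w"
  by (simp add: P point_of_def)

lemma eval3_on_point:
  assumes "w' \<in> P" "homogeneous3 n b"
  shows "eval3 b w' = 0 \<longleftrightarrow> eval3 b w = 0"
  using assms(1) by (auto simp: P eval3_scale[OF assms(2)])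

lemma loc_is_ideal:
  assumes I: "graded_ideal I"
  shows "L.is_ideal (loc I)"
  unfolding L.is_ideal_def
proof (intro conjI ballI)
  show "loc I \<subseteq> S"
  proof
    fix x assume "x \<in> loc I"
    then obtain p q n where "x = Fract p q" "p \<in> I n" "homogeneous3 n q" "eval3 q w \<noteq> 0"
      by (rule loc_E)
    then show "x \<in> S"
      using S_I[OF graded_ideal_hom[OF I]] by simp
  qed
  show "0 \<in> loc I"
    using loc_I[of 0 I 0 1] graded_ideal_0[OF I] by (simp add: Zero_fract_def)
  fix x assume "x \<in> loc I"
  then obtain p q n where x: "x = Fract p q" "p \<in> I n" "homogeneous3 n q" "eval3 q w \<noteq> 0" "q \<noteq> 0"
    by (rule loc_E)
  show "x + y \<in> loc I" if yI: "y \<in> loc I" for y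
  proof -
    obtain p' q' n' where y: "y = Fract p' q'" "p' \<in> I n'" "homogeneous3 n' q'" "eval3 q' w \<noteq> 0" "q' \<noteq> 0"
      using yI by (rule loc_E)
    have "q' * p \<in> I (n' + n)" "q * p' \<in> I (n' + n)"
      using graded_ideal_mult[OF I y(3) x(2)] graded_ideal_mult[OF I x(3) y(2)] by (simp_all add: add.commute)
    then have "q' * p + q * p' \<in> I (n' + n)"
      by (rule graded_ideal_add[OF I])
    then have "Fract (q' * p + q * p') (q' * q) \<in> loc I"
      using homogeneous3_mult[OF y(3) x(3)] x(4) y(4) by (intro loc_I) simp_all
    then show ?thesis
      using x y by (simp add: add_fract ac_simps)
  qed
  show "s * x \<in> loc I" if "s \<in> S" for s
  proof -
    obtain m a b where s: "homogeneous3 m a" "homogeneous3 m b" "eval3 b w \<noteq> 0" "b \<noteq> 0" "s = Fract a b"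
      using \<open>s \<in> S\<close> by (rule S_E)
    have "Fract (a * p) (b * q) \<in> loc I"
      using graded_ideal_mult[OF I s(1) x(2)] homogeneous3_mult[OF s(2) x(3)] s(3) x(4)
      by (intro loc_I) simp_all
    then show ?thesis
      by (simp add: s(5) x(1))
  qed
qed

lemma loc_full:
  assumes "\<And>n. N \<le> n \<Longrightarrow> I n = hspace n"
  shows "S \<subseteq> loc I"
proof
  fix r assume "r \<in> S"
  then obtain n a b where r: "homogeneous3 n a" "homogeneous3 n b" "eval3 b w \<noteq> 0" "b \<noteq> 0" "r = Fract a b"
    by (rule S_E)
  have "homogeneous3 (N + n) (X ^ N * a)" "homogeneous3 (N + n) (X ^ N * b)"
    by (intro homogeneous3_mult homogeneous3_var_power r)+
  then have "Fract (X ^ N * a) (X ^ N * b) \<in> loc I"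
    using assms[of "N + n"] r(3) by (intro loc_I[of _ _ "N + n"]) (simp_all add: hspace_def w)
  moreover have "Fract (X ^ N * a) (X ^ N * b) = r"
    using r by (simp add: eq_fract)
  ultimately show "r \<in> loc I"
    by simp
qed

lemma grad_in_jacobian: "grad l \<in> jacobian (d - 1)"
proof -
  have "dot3 (\<lambda>j. if j = l then 1 else 0) grad = (\<Sum>j\<in>UNIV. if j = l then grad j else 0)"
    unfolding dot3_def by (rule sum.cong) auto
  then have "grad l = dot3 (\<lambda>j. if j = l then 1 else 0) grad"
    by simp
  then show ?thesis
    unfolding jacobian_def by (intro CollectI exI[of _ "\<lambda>j. if j = l then 1 else 0"]) simp
qed

text \<open>The partial derivative in the direction of the chart variable is not a derivative of
  \<open>g\<close> in the chart; the Euler identity recovers it.\<close>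

lemma grad_i: "\<exists>a b c. a \<in> S \<and> b \<in> S \<and> c \<in> S \<and> Fract (grad i) (X ^ (d - 1)) = a * g + b * D j g + c * D k g"
proof (intro exI conjI)
  show "\<kappa> (of_nat d) \<in> S" "- t j \<in> S" "- t k \<in> S"
    by (simp_all add: \<kappa>_S uminus_S t_S)
  have X: "X ^ d = X * X ^ (d - 1)"
    using d_pos by (cases d) simp_all
  have "(\<Sum>l\<in>UNIV. var3 l * grad l) = (\<Sum>l\<in>{i, j, k}. var3 l * grad l)"
    using ijk by (intro sum.mono_neutral_right) auto
  also have "\<dots> = X * grad i + (var3 j * grad j + var3 k * grad k)"
    using jk by simp
  finally have euler: "X * grad i = const3 (of_nat d) * u - var3 j * grad j - var3 k * grad k"
    using euler_identity[OF hom] by (simp add: const3_of_nat algebra_simps)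
  have 1: "Fract (grad i) (X ^ (d - 1)) = Fract (X * grad i) (X ^ d)"
    unfolding X by (simp add: eq_fract)
  have 2: "\<kappa> (of_nat d) * g = Fract (const3 (of_nat d) * u) (X ^ d)"
    by (simp add: \<kappa>_def g_def)
  have 3: "t l * Fract (grad l) (X ^ (d - 1)) = Fract (var3 l * grad l) (X ^ d)" for l
    unfolding X by (simp add: t_def)
  have fract_sub: "Fract (a - b) (X ^ d) = Fract a (X ^ d) - Fract b (X ^ d)" for a b :: "'k poly3"
    by (simp add: eq_fract algebra_simps)
  show "Fract (grad i) (X ^ (d - 1)) = \<kappa> (of_nat d) * g + (- t j) * D j g + (- t k) * D k g"
    unfolding 1 euler fract_sub D_g[OF jk(1)] D_g[OF jk(2)] 2 mult_minus_left 3 by simp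
qed

text \<open>The stalk of the Jacobian ideal is generated by \<open>g\<close>, \<open>D j g\<close>
  and \<open>D k g\<close>. It contains \<open>g\<close> because \<open>u\<close> lies in the
  Jacobian ideal.\<close>

lemma tjurina_ideals_iff: "Y \<in> L.tjurina_ideals \<longleftrightarrow> L.is_ideal Y \<and> loc jacobian \<subseteq> Y"
proof (cases "L.is_ideal Y")
  case Y: True
  have Yc: "\<And>x y. x \<in> Y \<Longrightarrow> y \<in> Y \<Longrightarrow> x + y \<in> Y" "\<And>s x. s \<in> S \<Longrightarrow> x \<in> Y \<Longrightarrow> s * x \<in> Y" "0 \<in> Y"
    using Y by (simp_all add: L.is_ideal_def)
  have "g \<in> loc jacobian"
    unfolding g_def using u_in_jacobian by (rule loc_I) (simp_all add: w)
  moreover have "D l g \<in> loc jacobian" if "l \<noteq> i" for l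
    unfolding D_g[OF that] using grad_in_jacobian by (rule loc_I) (simp_all only: homogeneous3_var_power eval3_simps w power_one one_neq_zero not_False_eq_True)
  moreover have "loc jacobian \<subseteq> Y" if gY: "g \<in> Y" "D j g \<in> Y" "D k g \<in> Y"
  proof
    fix x assume "x \<in> loc jacobian"
    then obtain p q n where x: "x = Fract p q" "p \<in> jacobian n" "homogeneous3 n q" "eval3 q w \<noteq> 0" "q \<noteq> 0"
      by (rule loc_E)
    obtain a where a: "p = dot3 a grad" "\<And>l. homogeneous3 (n - (d - 1)) (a l)" "n < d - 1 \<longrightarrow> a = (\<lambda>l. 0)"
      using x(2) by (auto simp: jacobian_def)
    have gr: "Fract (grad l) (X ^ (d - 1)) \<in> Y" for l
    proof (cases "l = i")
      case True
      then show ?thesis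
        using grad_i gY Yc by metis
    next
      case False
      then show ?thesis
        using ijk[of l] gY D_g by metis
    qed
    show "x \<in> Y"
    proof (cases "n < d - 1")
      case True
      then have "x = 0"
        using x a by (simp add: Zero_fract_def eq_fract)
      then show ?thesis
        using Yc by simp
    next
      case False
      have summand: "Fract (a l * grad l) q \<in> Y" for l
      proof -
        have "homogeneous3 n (a l * X ^ (d - 1))"
          using homogeneous3_mult[OF a(2)[of l] homogeneous3_var_power[of "d - 1" i]] False by simp
        then have "Fract (a l * X ^ (d - 1)) q \<in> S"
          using x by (intro S_I)
        then have "Fract (a l * X ^ (d - 1)) q * Fract (grad l) (X ^ (d - 1)) \<in> Y"
          using gr by (rule Yc)
        moreover have "Fract (a l * X ^ (d - 1)) q * Fract (grad l) (X ^ (d - 1)) = Fract (a l * grad l) q"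
          using x(5) by (simp add: eq_fract)
        ultimately show ?thesis
          by simp
      qed
      have "x = Fract (a 0 * grad 0) q + Fract (a 1 * grad 1) q + Fract (a 2 * grad 2) q"
        using x(5) by (simp add: x(1) a(1) dot3_eq eq_fract algebra_simps)
      then show ?thesis
        using summand Yc(1) by metis
    qed
  qed
  ultimately show ?thesis
    using Y jk unfolding L.tjurina_ideals_def mem_Collect_eq by (auto dest: subsetD)
qed (simp add: L.tjurina_ideals_def)

lemma loc_mono: "(\<And>n. I n \<subseteq> J n) \<Longrightarrow> loc I \<subseteq> loc J"
  by (rule subsetI, erule loc_E, simp only:, rule loc_I, rule subsetD)

text \<open>At any other point some linear form \<open>x_l - w'_l x_i'\<close> is a unit in the
  local ring up to degree, and it multiplies \<open>a\<close> into \<open>I\<close>; so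
  \<open>a\<close> is already in the stalk.\<close>

lemma loc_adjoin_other:
  assumes I: "graded_ideal I" and e: "eigen I a r i' w'" and P': "P \<noteq> point_of w'"
  shows "loc (adjoin I a r) = loc I"
proof (rule antisym)
  show "loc I \<subseteq> loc (adjoin I a r)"
    by (rule loc_mono) (rule adjoin_superset)
  \<comment> \<open>Otherwise \<open>w\<close> is \<open>w i'\<close> times \<open>w'\<close>, with
    \<open>w i'\<close> nonzero because \<open>w i = 1\<close>, and the two points coincide.\<close>
  have "\<exists>l. w l \<noteq> w' l * w i'"
  proof (rule ccontr)
    assume proportional: "\<not> (\<exists>l. w l \<noteq> w' l * w i')"
    have wl: "w l = w i' * w' l" for l
    proof (rule ccontr)
      assume "w l \<noteq> w i' * w' l"
      then have "w l \<noteq> w' l * w i'"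
        by (subst mult.commute)
      then have "\<exists>l. w l \<noteq> w' l * w i'"
        by (rule exI)
      with proportional show False
        by (rule notE)
    qed
    have "w i' \<noteq> 0"
      using wl[of i] by (auto simp only: w mult_zero_left one_neq_zero)
    have "\<exists>c'. (\<lambda>l. c * w l) = (\<lambda>l. c' * w' l) \<and> c' \<noteq> 0" if "c \<noteq> 0" for c
    proof (intro exI conjI)
      show "c * w i' \<noteq> 0"
        using that \<open>w i' \<noteq> 0\<close> by simp
      show "(\<lambda>l. c * w l) = (\<lambda>l. c * w i' * w' l)"
        by (rule ext) (subst wl, rule mult.assoc[symmetric])
    qed
    moreover have "\<exists>c'. (\<lambda>l. c * w' l) = (\<lambda>l. c' * w l) \<and> c' \<noteq> 0" if "c \<noteq> 0" for c
    proof (intro exI conjI)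
      show "c / w i' \<noteq> 0"
        using that \<open>w i' \<noteq> 0\<close> by simp
      show "(\<lambda>l. c * w' l) = (\<lambda>l. c / w i' * w l)"
      proof
        fix l
        have "c / w i' * w l = c / w i' * (w i' * w' l)"
          using wl[of l] by simp
        then show "c * w' l = c / w i' * w l"
          using \<open>w i' \<noteq> 0\<close> by simp
      qed
    qed
    ultimately have "P = point_of w'"
      unfolding P_eq point_of_def by (auto simp only: set_eq_iff mem_Collect_eq)
    then show False
      using P' by simp
  qed
  then obtain l where l: "w l \<noteq> w' l * w i'"
    by (elim exE)
  define b where "b = var3 l - const3 (w' l) * var3 i'"
  have b: "homogeneous3 1 b" "eval3 b w \<noteq> 0"
    unfolding b_def using l by (intro homogeneous3_diff homogeneous3_var homogeneous3_const_mult, simp)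
  have ba: "b * a \<in> I (Suc r)"
    using e by (simp add: eigen_def b_def)
  show "loc (adjoin I a r) \<subseteq> loc I"
  proof
    fix x assume "x \<in> loc (adjoin I a r)"
    then obtain p' q n where x: "x = Fract p' q" "p' \<in> adjoin I a r n" "homogeneous3 n q" "eval3 q w \<noteq> 0" "q \<noteq> 0"
      by (rule loc_E)
    obtain p c where p: "p' = p + c * a" "p \<in> I n" "homogeneous3 (n - r) c" "n < r \<longrightarrow> c = 0"
      using x(2) unfolding adjoin_def mem_Collect_eq by (elim exE conjE)
    have "c * (b * a) \<in> I (1 + n)"
    proof (cases "n < r")
      case True
      then show ?thesis
        using p(4) graded_ideal_0[OF I] by simp
    next
      case False
      then show ?thesis
        by (intro graded_ideal_mult'[OF I p(3) ba]) simp
    qed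
    then have "b * p + c * (b * a) \<in> I (1 + n)"
      using graded_ideal_mult[OF I b(1) p(2)] by (intro graded_ideal_add[OF I])
    then have "Fract (b * p + c * (b * a)) (b * q) \<in> loc I"
      using homogeneous3_mult[OF b(1) x(3)] b(2) x(4) by (intro loc_I) simp_all
    moreover have "b \<noteq> 0"
      using b(2) by auto
    then have "Fract (b * p + c * (b * a)) (b * q) = x"
      using x(5) by (simp add: x(1) p(1) eq_fract algebra_simps)
    ultimately show "x \<in> loc I"
      by simp
  qed
qed

text \<open>At the point itself the stalk grows by a simple quotient. It grows because a form
  \<open>q\<close> with \<open>q * a\<close> in \<open>I\<close> vanishes at the point. It is simple
  because a cofactor \<open>c'\<close> of \<open>a\<close> outside the old stalk does not vanish
  there and can be inverted.\<close>

lemma loc_adjoin_same: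
  assumes I: "graded_ideal I" and e: "eigen I a r i' w'" and P': "P = point_of w'"
  shows "\<exists>x\<in>loc (adjoin I a r). x \<notin> loc I"
    and "\<lbrakk>x \<in> loc (adjoin I a r); y \<in> loc (adjoin I a r); y \<notin> loc I\<rbrakk> \<Longrightarrow> \<exists>\<rho>\<in>S. x - \<rho> * y \<in> loc I"
proof -
  have w': "w' \<in> P"
    unfolding P' by (rule mem_point_of)
  have mem_iff: "b * a \<in> I (n + r) \<longleftrightarrow> eval3 b w = 0" if "homogeneous3 n b" for b n
    using eigen_mult_mem_iff[OF I e that] eval3_on_point[OF w' that] by simp
  have a: "homogeneous3 r a"
    using e by (simp add: eigen_def)
  show "\<exists>x\<in>loc (adjoin I a r). x \<notin> loc I"
  proof (rule bexI)
    have "a \<in> adjoin I a r r"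
      unfolding adjoin_def using graded_ideal_0[OF I, of r] by (intro CollectI exI[of _ 0] exI[of _ 1]) simp
    then show "Fract a (X ^ r) \<in> loc (adjoin I a r)"
      by (rule loc_I) (simp_all add: w)
    show "Fract a (X ^ r) \<notin> loc I"
    proof
      assume "Fract a (X ^ r) \<in> loc I"
      then obtain p q n where x: "Fract a (X ^ r) = Fract p q" "p \<in> I n" "homogeneous3 n q" "eval3 q w \<noteq> 0" "q \<noteq> 0"
        by (rule loc_E)
      then have "q * a = X ^ r * p"
        by (simp add: eq_fract mult.commute)
      moreover have "X ^ r * p \<in> I (n + r)"
        using x(2) by (intro graded_ideal_mult'[OF I homogeneous3_var_power]) simp_all
      ultimately show False
        using mem_iff[OF x(3)] x(4) by simp
    qed
  qed
  assume x: "x \<in> loc (adjoin I a r)" and y: "y \<in> loc (adjoin I a r)" "y \<notin> loc I"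
  show "\<exists>\<rho>\<in>S. x - \<rho> * y \<in> loc I"
  proof (cases "x \<in> loc I")
    case True
    then show ?thesis
      using zero_S by (intro bexI[of _ 0]) simp_all
  next
    case False
    obtain p0 q n where x: "x = Fract p0 q" "p0 \<in> adjoin I a r n" "homogeneous3 n q" "eval3 q w \<noteq> 0" "q \<noteq> 0"
      using x by (rule loc_E)
    obtain p c where p: "p0 = p + c * a" "p \<in> I n" "homogeneous3 (n - r) c" "n < r \<longrightarrow> c = 0"
      using x(2) unfolding adjoin_def mem_Collect_eq by (elim exE conjE)
    obtain p0' q' n' where y': "y = Fract p0' q'" "p0' \<in> adjoin I a r n'" "homogeneous3 n' q'" "eval3 q' w \<noteq> 0" "q' \<noteq> 0"
      using y(1) by (rule loc_E)
    obtain p' c' where p': "p0' = p' + c' * a" "p' \<in> I n'" "homogeneous3 (n' - r) c'" "n' < r \<longrightarrow> c' = 0"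
      using y'(2) unfolding adjoin_def mem_Collect_eq by (elim exE conjE)
    have n: "r \<le> n"
    proof (rule ccontr)
      assume "\<not> r \<le> n"
      then have "x = Fract p q"
        using p by (simp add: x(1))
      then show False
        using False loc_I[where I = I, OF p(2) x(3,4)] by simp
    qed
    have n': "r \<le> n'"
    proof (rule ccontr)
      assume "\<not> r \<le> n'"
      then have "y = Fract p' q'"
        using p' by (simp add: y'(1))
      then show False
        using y(2) loc_I[where I = I, OF p'(2) y'(3,4)] by simp
    qed
    have c': "eval3 c' w \<noteq> 0"
    proof
      assume "eval3 c' w = 0"
      then have "c' * a \<in> I n'"
        using mem_iff[OF p'(3)] n' by simp
      then have "p0' \<in> I n'"
        unfolding p'(1) by (rule graded_ideal_add[OF I p'(2)])
      then show False
        using y(2) loc_I[where I = I, OF _ y'(3,4)] y'(1) by simp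
    qed
    then have "c' \<noteq> 0"
      by auto
    \<comment> \<open>The common degree of \<open>c * q'\<close> and \<open>c' * q\<close>. The
      quotient of these two is the multiplier \<open>\<rho>\<close> for which the terms with
      \<open>a\<close> cancel in \<open>x - \<rho> * y\<close>.\<close>
    define N where "N = n + n' - r"
    have h: "homogeneous3 N (c * q')" "homogeneous3 N (c' * q)"
      using homogeneous3_mult[OF p(3) y'(3)] homogeneous3_mult[OF p'(3) x(3)] n n'
      by (auto simp: N_def elim!: homogeneous3_cast)
    have \<rho>: "Fract (c * q') (c' * q) \<in> S"
      using h c' x(4) by (intro S_I) simp_all
    have "c' * p \<in> I N" "c * p' \<in> I N"
      using n n' by (auto simp: N_def intro!: graded_ideal_mult'[OF I p'(3) p(2)] graded_ideal_mult'[OF I p(3) p'(2)])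
    then have "c' * p - c * p' \<in> I N"
      by (rule graded_ideal_diff[OF I])
    then have "Fract (c' * p - c * p') (c' * q) \<in> loc I"
      using h(2) c' x(4) by (intro loc_I) simp_all
    moreover have "x - Fract (c * q') (c' * q) * y = Fract (c' * p - c * p') (c' * q)"
    proof -
      have "x = Fract (c' * p0) (c' * q)"
        using x(5) \<open>c' \<noteq> 0\<close> by (simp add: x(1) eq_fract)
      moreover have "Fract (c * q') (c' * q) * y = Fract (c * p0') (c' * q)"
        using x(5) y'(5) \<open>c' \<noteq> 0\<close> by (simp add: y'(1) eq_fract)
      moreover have "Fract (c' * p0) (c' * q) - Fract (c * p0') (c' * q) = Fract (c' * p0 - c * p0') (c' * q)"
        using x(5) \<open>c' \<noteq> 0\<close> by (simp add: eq_fract algebra_simps)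
      moreover have "c' * p0 - c * p0' = c' * p - c * p'"
        by (simp add: p(1) p'(1) algebra_simps)
      ultimately show ?thesis
        by simp
    qed
    ultimately show ?thesis
      using \<rho> by (intro bexI) simp_all
  qed
qed

section \<open>Counting the filtration steps at one point\<close>

context
  fixes t I ip wp
  assumes F: "filtration jacobian t I ip wp"
begin

lemma filtration_graded: "s \<le> t \<Longrightarrow> graded_ideal (I s)"
  using F by (simp add: filtration_def)

lemma filtration_step:
  assumes "s < t"
  obtains a r where "eigen (I s) a r (ip s) (wp s)" "I (Suc s) = adjoin (I s) a r"
  using F assms unfolding filtration_def by blast

lemma filtration_loc_0: "loc (I 0) = loc jacobian"
  using F by (simp add: filtration_def)

lemma filtration_loc_full: "S \<subseteq> loc (I t)"
proof -
  obtain N where "\<forall>n\<ge>N. I t n = hspace n"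
    using F unfolding filtration_def by blast
  then show ?thesis
    by (intro loc_full[of N]) simp
qed

definition steps :: "nat \<Rightarrow> nat set" where
  "steps s = {s'. s' < s \<and> point_of (wp s') = P}"

lemma steps_Suc: "steps (Suc s) = (if point_of (wp s) = P then insert s (steps s) else steps s)"
  by (auto simp: steps_def less_Suc_eq)

lemma finite_steps: "finite (steps s)"
  unfolding steps_def by simp

text \<open>Lower bound for the local length: the stalks of the filtration grow strictly at the
  steps belonging to \<open>P\<close> and stay constant at all others, so repetitions are
  dropped.\<close>

lemma filtration_chain:
  assumes "s \<le> t"
  shows "\<exists>c. (\<forall>n\<le>card (steps s). c n \<in> L.tjurina_ideals) \<and> (\<forall>n<card (steps s). c n \<subset> c (Suc n)) \<and>
    c (card (steps s)) = loc (I s)"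
  using assms
proof (induction s)
  case 0
  have "loc (I 0) \<in> L.tjurina_ideals"
    unfolding tjurina_ideals_iff filtration_loc_0 using loc_is_ideal[OF jacobian_graded] by simp
  then show ?case
    by (intro exI[of _ "\<lambda>_. loc (I 0)"]) (simp add: steps_def)
next
  case (Suc s)
  then obtain c where c: "\<And>n. n \<le> card (steps s) \<Longrightarrow> c n \<in> L.tjurina_ideals"
    "\<And>n. n < card (steps s) \<Longrightarrow> c n \<subset> c (Suc n)" "c (card (steps s)) = loc (I s)"
    by auto
  have s: "s < t" "graded_ideal (I s)" "graded_ideal (I (Suc s))"
    using Suc.prems filtration_graded by simp_all
  obtain a r where ar: "eigen (I s) a r (ip s) (wp s)" "I (Suc s) = adjoin (I s) a r"
    using s(1) by (rule filtration_step)
  show ?case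
  proof (cases "point_of (wp s) = P")
    case False
    then have "loc (I (Suc s)) = loc (I s)"
      unfolding ar(2) by (intro loc_adjoin_other[OF s(2) ar(1)]) simp
    then show ?thesis
      using c False by (intro exI[of _ c]) (simp add: steps_Suc)
  next
    case True
    have sub: "loc (I s) \<subseteq> loc (I (Suc s))"
      unfolding ar(2) by (intro loc_mono adjoin_superset)
    moreover have "loc (I s) \<noteq> loc (I (Suc s))"
      using loc_adjoin_same(1)[OF s(2) ar(1) True[symmetric]] unfolding ar(2) by auto
    ultimately have strict: "loc (I s) \<subset> loc (I (Suc s))"
      by (rule psubsetI)
    have "loc jacobian \<subseteq> loc (I s)"
      using c(1)[of "card (steps s)"] c(3) by (simp add: tjurina_ideals_iff)
    then have mem: "loc (I (Suc s)) \<in> L.tjurina_ideals"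
      unfolding tjurina_ideals_iff using sub loc_is_ideal[OF s(3)] by (intro conjI) simp_all
    have "s \<notin> steps s"
      by (simp add: steps_def)
    then have card: "card (steps (Suc s)) = Suc (card (steps s))"
      using True by (simp add: steps_Suc finite_steps)
    define c' where "c' = c(Suc (card (steps s)) := loc (I (Suc s)))"
    have "c' n \<in> L.tjurina_ideals" if "n \<le> Suc (card (steps s))" for n
      using that c(1) mem by (auto simp: c'_def le_Suc_eq)
    moreover have "c' n \<subset> c' (Suc n)" if "n < Suc (card (steps s))" for n
      using that c(2)[of n] c(3) strict by (auto simp: c'_def less_Suc_eq)
    ultimately show ?thesis
      unfolding card by (intro exI[of _ c']) (simp add: c'_def)
  qed
qed

lemma has_chain_steps: "has_chain L.tjurina_ideals (card (steps t))"
  using filtration_chain[of t] unfolding has_chain_def by blast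

text \<open>The steps at which the trace of \<open>Y\<close> on the filtration grows. As every
  quotient of stalks is simple or zero, the number of jumps acts as the length of \<open>Y\<close>
  over the Jacobian stalk.\<close>

definition jumps :: "'k poly3 fract set \<Rightarrow> nat set" where
  "jumps Y = {s. s < t \<and> \<not> Y \<inter> loc (I (Suc s)) \<subseteq> loc (I s)}"

lemma jumps_subset: "jumps Y \<subseteq> steps t"
proof
  fix s assume s: "s \<in> jumps Y"
  then have "s < t"
    by (simp add: jumps_def)
  then obtain a r where ar: "eigen (I s) a r (ip s) (wp s)" "I (Suc s) = adjoin (I s) a r"
    by (rule filtration_step)
  have "point_of (wp s) = P"
  proof (rule ccontr)
    assume "point_of (wp s) \<noteq> P"
    then have "loc (I (Suc s)) = loc (I s)"
      unfolding ar(2) using \<open>s < t\<close> filtration_graded by (intro loc_adjoin_other[OF _ ar(1)]) auto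
    then show False
      using s by (simp add: jumps_def)
  qed
  then show "s \<in> steps t"
    using \<open>s < t\<close> by (simp add: steps_def)
qed

text \<open>With equal jumps, \<open>Y'\<close> is absorbed into \<open>Y\<close> along the
  filtration: at a jump some \<open>y\<close> in \<open>Y\<close> generates the simple quotient, so
  an element of \<open>Y'\<close> minus a multiple of \<open>y\<close> falls into the previous
  stalk.\<close>

lemma jumps_strict:
  assumes Y: "Y \<in> L.tjurina_ideals" "Y' \<in> L.tjurina_ideals" "Y \<subset> Y'"
  shows "jumps Y \<subset> jumps Y'"
proof
  show "jumps Y \<subseteq> jumps Y'"
    using Y(3) unfolding jumps_def by blast
  show "jumps Y \<noteq> jumps Y'"
  proof
    assume eq: "jumps Y = jumps Y'"
    have idl: "L.is_ideal Y" "L.is_ideal Y'" "loc jacobian \<subseteq> Y"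
      using Y tjurina_ideals_iff by simp_all
    have "Y' \<inter> loc (I s) \<subseteq> Y" if "s \<le> t" for s
      using that
    proof (induction s)
      case 0
      then show ?case
        using idl(3) unfolding filtration_loc_0 by blast
    next
      case (Suc s)
      then have "s < t" and IH: "Y' \<inter> loc (I s) \<subseteq> Y"
        by simp_all
      obtain a r where ar: "eigen (I s) a r (ip s) (wp s)" "I (Suc s) = adjoin (I s) a r"
        using \<open>s < t\<close> by (rule filtration_step)
      have Is: "graded_ideal (I s)"
        using filtration_graded \<open>s < t\<close> by simp
      show ?case
      proof
        fix x assume x: "x \<in> Y' \<inter> loc (I (Suc s))"
        show "x \<in> Y"
        proof (cases "x \<in> loc (I s)")
          case True
          then show ?thesis
            using x IH by blast
        next
          case False
          then have "s \<in> jumps Y'"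
            using x \<open>s < t\<close> unfolding jumps_def by blast
          then have s: "s \<in> jumps Y"
            using eq by simp
          then obtain y where y: "y \<in> Y" "y \<in> loc (I (Suc s))" "y \<notin> loc (I s)"
            unfolding jumps_def by blast
          have "point_of (wp s) = P"
            using s jumps_subset steps_def by blast
          then obtain \<rho> where \<rho>: "\<rho> \<in> S" "x - \<rho> * y \<in> loc (I s)"
            using loc_adjoin_same(2)[OF Is ar(1), of x y] x y unfolding ar(2) by auto
          have \<rho>y: "\<rho> * y \<in> Y"
            using idl(1) \<rho>(1) y(1) by (simp add: L.is_ideal_def)
          then have "x - \<rho> * y \<in> Y'"
            using L.is_ideal_diff[OF idl(2)] x Y(3) by blast
          then have "x - \<rho> * y \<in> Y"
            using IH \<rho>(2) by blast
          then have "x - \<rho> * y + \<rho> * y \<in> Y"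
            using idl(1) \<rho>y unfolding L.is_ideal_def by blast
          then show ?thesis
            by simp
        qed
      qed
    qed
    from this[of t] have "Y' \<subseteq> Y"
      using filtration_loc_full idl(2) unfolding L.is_ideal_def by blast
    then show False
      using Y(3) by blast
  qed
qed

lemma chain_le_steps:
  assumes "has_chain L.tjurina_ideals n"
  shows "n \<le> card (steps t)"
proof -
  obtain c where c: "\<And>m. m \<le> n \<Longrightarrow> c m \<in> L.tjurina_ideals" "\<And>m. m < n \<Longrightarrow> c m \<subset> c (Suc m)"
    using assms by (auto simp: has_chain_def)
  have fin: "finite (jumps Y)" for Y
    using finite_subset[OF jumps_subset finite_steps] .
  have "m \<le> card (jumps (c m))" if "m \<le> n" for m
    using that
  proof (induction m)
    case (Suc m)
    have "jumps (c m) \<subset> jumps (c (Suc m))"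
      using Suc.prems by (intro jumps_strict c) simp_all
    then have "card (jumps (c m)) < card (jumps (c (Suc m)))"
      by (rule psubset_card_mono[OF fin])
    then show ?case
      using Suc by simp
  qed simp
  from this[of n] have "n \<le> card (jumps (c n))"
    by simp
  also have "\<dots> \<le> card (steps t)"
    by (rule card_mono[OF finite_steps jumps_subset])
  finally show ?thesis .
qed

lemma tjurina_at_eq_steps: "tjurina_at u P = enat (card {s. s < t \<and> point_of (wp s) = P})"
proof -
  have "(SUP n \<in> {n. has_chain L.tjurina_ideals n}. enat n) = enat (card (steps t))"
  proof (rule antisym)
    show "(SUP n \<in> {n. has_chain L.tjurina_ideals n}. enat n) \<le> enat (card (steps t))"
      using chain_le_steps by (intro SUP_least) simp
    show "enat (card (steps t)) \<le> (SUP n \<in> {n. has_chain L.tjurina_ideals n}. enat n)"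
      using has_chain_steps by (intro SUP_upper) simp
  qed
  then show ?thesis
    by (simp add: tjurina_at_eq steps_def)
qed

end

end

section \<open>Summation over the points of the curve\<close>

context reduced_curve
begin

lemma tjurina_at_filtration:
  assumes F: "filtration jacobian t I ip wp" and P: "P \<in> proj_plane"
  shows "tjurina_at u P = enat (card {s. s < t \<and> point_of (wp s) = P})"
proof -
  obtain i w where w: "w i = 1" "P = {\<lambda>j. c * w j | c. c \<noteq> 0}"
    using P by (rule proj_plane_representative)
  have "(0::3) \<noteq> 1" "(0::3) \<noteq> 2" "(1::3) \<noteq> 2"
    by simp_all
  then have "\<exists>j k. j \<noteq> i \<and> k \<noteq> i \<and> j \<noteq> k"
    using exhaust_index3[of i] by metis
  then obtain j k where jk: "j \<noteq> i" "k \<noteq> i" "j \<noteq> k"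
    by (elim exE conjE)
  interpret curve_point u d i w P j k
    by unfold_locales (rule w jk)+
  show ?thesis
    using F by (rule tjurina_at_eq_steps)
qed

text \<open>All ideals of the filtration contain \<open>u\<close>, so \<open>u\<close> multiplies
  the eigenvector into the ideal, and by \<open>eigen_mult_mem_iff\<close> this means that
  \<open>u\<close> vanishes at the point.\<close>

lemma filtration_points_on_curve:
  assumes F: "filtration jacobian t I ip wp" and s: "s < t"
  shows "point_of (wp s) \<in> curve_points u"
proof -
  obtain a r where ar: "eigen (I s) a r (ip s) (wp s)"
    using F s unfolding filtration_def by blast
  have graded: "graded_ideal (I s')" if "s' \<le> t" for s'
    using F that by (simp add: filtration_def)
  have "jacobian n \<subseteq> I s' n" if "s' \<le> t" for s' n
    using that
  proof (induction s')
    case 0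
    then show ?case
      using F by (simp add: filtration_def)
  next
    case (Suc s')
    then have "s' < t"
      by simp
    then obtain a' r' where "I (Suc s') = adjoin (I s') a' r'"
      using F unfolding filtration_def by blast
    then have "I s' n \<subseteq> I (Suc s') n"
      by (simp add: adjoin_superset)
    then show ?case
      using Suc by simp
  qed
  then have sub: "jacobian n \<subseteq> I s n" for n
    using s by simp
  have wi: "wp s (ip s) = 1" and a: "homogeneous3 r a"
    using ar by (simp_all add: eigen_def)
  have "a * u \<in> I s (r + d)"
    using u_in_jacobian sub graded s by (intro graded_ideal_mult[OF _ a]) auto
  then have "u * a \<in> I s (d + r)"
    by (simp add: mult.commute add.commute)
  then have "eval3 u (wp s) = 0"
    using eigen_mult_mem_iff[OF graded ar hom] s by simp
  then have "eval3 u v = 0" if "v \<in> point_of (wp s)" for v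
    using that by (auto simp: point_of_def eval3_scale[OF hom])
  moreover have "point_of (wp s) \<in> proj_plane"
    unfolding proj_plane_def point_of_def using wi
    by (intro CollectI exI[of _ "wp s"]) auto
  ultimately show ?thesis
    by (simp add: curve_points_def)
qed

text \<open>Every step is counted at exactly one point. Finite partial sums therefore never exceed
  \<open>t\<close>, and the finite set of points that occur in the filtration attains it.\<close>

theorem tjurina_eq_filtration_length:
  assumes F: "filtration jacobian t I ip wp"
  shows "tjurina u = enat t"
proof -
  define pt where "pt s = point_of (wp s)" for s
  have sum_at: "(\<Sum>P\<in>A. tjurina_at u P) = enat (card {s. s < t \<and> pt s \<in> A})"
    if "finite A" "A \<subseteq> curve_points u" for A
    using that
  proof (induction A)
    case (insert P A)
    have "P \<in> proj_plane"
      using insert.prems by (simp add: curve_points_def)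
    then have "tjurina_at u P = enat (card {s. s < t \<and> pt s = P})"
      unfolding pt_def by (rule tjurina_at_filtration[OF F])
    moreover have "{s. s < t \<and> pt s \<in> insert P A} = {s. s < t \<and> pt s = P} \<union> {s. s < t \<and> pt s \<in> A}"
      by auto
    then have "card {s. s < t \<and> pt s \<in> insert P A} = card {s. s < t \<and> pt s = P} + card {s. s < t \<and> pt s \<in> A}"
      using insert.hyps by (simp only:) (rule card_Un_disjoint, auto)
    ultimately show ?case
      using insert by simp
  qed (simp add: zero_enat_def)
  show ?thesis
    unfolding tjurina_def
  proof (rule antisym)
    have "card {s. s < t \<and> pt s \<in> A} \<le> t" for A
      using card_mono[of "{..<t}" "{s. s < t \<and> pt s \<in> A}"] by auto
    then show "(SUP A \<in> {A. finite A \<and> A \<subseteq> curve_points u}. \<Sum>P\<in>A. tjurina_at u P) \<le> enat t"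
      using sum_at by (intro SUP_least) simp
    let ?A = "pt ` {..<t}"
    have A: "finite ?A" "?A \<subseteq> curve_points u"
      using filtration_points_on_curve[OF F] by (auto simp: pt_def)
    have "{s. s < t \<and> pt s \<in> ?A} = {..<t}"
      by auto
    then have "enat t = (\<Sum>P\<in>?A. tjurina_at u P)"
      using sum_at[OF A] by simp
    then show "enat t \<le> (SUP A \<in> {A. finite A \<and> A \<subseteq> curve_points u}. \<Sum>P\<in>A. tjurina_at u P)"
      using A by (intro SUP_upper2[of ?A]) simp_all
  qed
qed

end

theorem corollary6p4:
  fixes u :: "'k::alg_closed_field poly3" and d m :: nat
  assumes "homogeneous3 d u" and "squarefree u"
    and "\<not> CHAR('k) dvd d"
    and "m = (LEAST n. \<exists>\<phi>. annihilating_field u n \<phi>)"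
  shows "m \<le> d - 1
    \<and> enat ((d - 1) * (d - m - 1)) \<le> tjurina u
    \<and> (\<forall>\<phi>. annihilating_field u m \<phi>
          \<longrightarrow> finite (foliation_singularities m \<phi> \<inter> curve_points u)
          \<longrightarrow> tjurina u \<le> enat ((d - 1) * (d - m - 1) + m\<^sup>2))"
proof -
  interpret reduced_curve u d
    using assms by unfold_locales
  have "\<exists>\<phi>. annihilating_field u m \<phi>"
    unfolding assms(4) using exists_annihilating_field by (rule LeastI)
  then obtain \<phi> where \<phi>: "annihilating_field u m \<phi>"
    by (elim exE)
  interpret minimal_syzygy u d m \<phi>
  proof
    show "m \<le> n" if "annihilating_field u n v" for n v
      unfolding assms(4) using that by (intro Least_le exI)
  qed (rule \<phi>)
  \<comment> \<open>The upper codimension bound is what makes the filtration finite, with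
    \<open>2 * (d - 1) + m\<close> as the degree from which it holds.\<close>
  obtain t I ip wp where F: "filtration jacobian t I ip wp"
    using exists_filtration[OF jacobian_graded jacobian_codim_bounds(2)] by blast
  obtain N where N: "\<And>n. N \<le> n \<Longrightarrow> hdim n = p3.dim (jacobian n) + t"
    using filtration_dim[OF F] by blast
  \<comment> \<open>A degree in which the codimension has become \<open>t\<close> and the syzygy
    bounds are valid as well.\<close>
  define n where "n = max N (2 * (d - 1) + m)"
  have "(d - 1) * (d - m - 1) \<le> t" "t \<le> (d - 1) * (d - m - 1) + m\<^sup>2"
    using N[of n] jacobian_codim_bounds[of n] by (simp_all add: n_def)
  then show ?thesis
    using m_le tjurina_eq_filtration_length[OF F] by simp
qed

end
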